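(* Let $T$ be a context-free standard type theory. (1) If $\vdash_T t:A$ and $\vdash_T t:B$, then $\vdash_T A\equiv B\ \mathsf{by}\ \alpha$ for some assumption set $\alpha$. (2) If $\vdash_T s\equiv t:A\ \mathsf{by}\ \beta_1$ and $\vdash_T s\equiv t:B\ \mathsf{by}\ \beta_2$, where these judgements have well-typed annotations, then $\vdash_T A\equiv B\ \mathsf{by}\ \alpha$ for some assumption set $\alpha$. In both cases such an $\alpha$ with $\alpha\subseteq\mathrm{asm}(t)$ can be computed from the judgements involved, without recourse to their derivations.
   Context: Well-typed annotations: $X$ has well-typed annotations when $\vdash_T\mathcal B'$ for every $M^{\mathcal B'}\in\mathrm{asm}(X)$ and $\vdash_T A\ \mathsf{type}$ for every $a^A\in\mathrm{asm}(X)$. Standard context-free theories: a context-free rule-boundary is $M_1^{\mathcal B_1},\dots,M_n^{\mathcal B_n}\Longrightarrow\beta$ with $\mathcal B_i,\beta$ closed boundaries, $\mathrm{mv}(\mathcal B_i)\subseteq\{M_1^{\mathcal B_1},\dots,M_{i-1}^{\mathcal B_{i-1}}\}$, $\mathrm{mv}(\beta)\subseteq\{M_1^{\mathcal B_1},\dots,M_n^{\mathcal B_n}\}$. If $\beta$ is a type/term boundary of class $c$ and $S$ a symbol of arity $(c,[\mathrm{ar}(\mathcal B_1),\dots,\mathrm{ar}(\mathcal B_n)])$, the associated symbol rule is $M_1^{\mathcal B_1},\dots,M_n^{\mathcal B_n}\Longrightarrow\beta[S(\hat M_1,\dots,\hat M_n)]$ with $\hat M_i=\{x_1\}\cdots\{x_k\}M_i^{\mathcal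 B_i}(x_1,\dots,x_k)$ if $\mathrm{ar}(\mathcal B_i)=(c',k)$, $c'\in\{\mathrm{Ty},\mathrm{Tm}\}$, and $\hat M_i=\{x_1\}\cdots\{x_k\}\{M_i^{\mathcal B_i},x_1,\dots,x_k\}$ otherwise. A context-free raw rule $M_1^{\mathcal B_1},\dots\Longrightarrow\beta[e]$ is finitary over a context-free raw theory $T'$ if $\vdash_{T'}\mathcal B_i$ for all $i$ and $\vdash_{T'}\beta$; a context-free raw theory $(R_i)_{i\in I}$ is finitary if some well-founded order $\prec$ on $I$ makes each $R_i$ finitary over $(R_j)_{j\prec i}$; it is standard if its specific object rules are symbol rules and each symbol has precisely one associated rule. Context-free raw syntax. A signature $\Sigma$ assigns to each symbol $S$ an arity $(c,[(c_1,n_1),\dots,(c_k,n_k)])$, $c\in\{\mathrm{Ty},\mathrm{Tm}\}$, $c_i\in\{\mathrm{Ty},\mathrm{Tm},\mathrm{EqTy},\mathrm{EqTm}\}$ (the $i$-th argument has class $c_i$ and binds $n_i$ variables). Free variables are annotated with types, $a^A$ ($A$ a type expression with no unbound bound variables); $a^A$ and $b^B$ are equal iff $a=b$ and $A=B$ syntactically. Metavariables are annotated with closed boundaries, $M^{\mathcal B}$, equal iff names and boundaries coincide; $M^{\mathcal B}$ has arity $\mathrm{ar}(\mathcal B)=(c,m)$ where $\mathcal B=\{x_1{:}A_1\}\cdots\{x_m{:}A_m\}\beta$ and $c$ is the class of $\beta$ (Ty, Tm, EqTy, EqTm). Type expressions: $S(e_1,\dots,e_k)$, $M^{\mathcal B}(t_1,\dots,t_n)$.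 Term expressions: $a^A$, bound variables $x$, $S(e_1,\dots,e_k)$, $M^{\mathcal B}(t_1,\dots,t_n)$, and conversion terms $\mathrm{cv}(t,\alpha)$. Assumption sets $\alpha$ are finite sets of annotated free variables, bound variables and annotated metavariables; they are the arguments of class EqTy/EqTm. Arguments: types, terms, assumption sets, abstractions $\{x\}e$. Judgement theses: $A\ \mathsf{type}$, $t:A$, $A\equiv B\ \mathsf{by}\ \alpha$, $s\equiv t:A\ \mathsf{by}\ \alpha$; abstracted judgements $\mathcal J::=\text{thesis}\mid\{x{:}A\}\mathcal J$. Boundary theses $\Box\ \mathsf{type}$, $\Box:A$, $A\equiv B\ \mathsf{by}\ \Box$, $s\equiv t:A\ \mathsf{by}\ \Box$; abstracted boundaries $\mathcal B::=\text{thesis}\mid\{x{:}A\}\mathcal B$. Occurrences: $\mathrm{fv}(e)$ is the set of all annotated free variables occurring in $e$ (including in assumption sets and, recursively, in type annotations of occurring variables); $\mathrm{bv}(e)$ the bound variables occurring free in $e$ (including in assumption sets); $\mathrm{mv}(e)$ the annotated metavariables occurring in $e$ (including inside annotations, boundaries of metavariables and assumption sets); $\mathrm{asm}(e)=\mathrm{fv}(e)\cup\mathrm{bv}(e)\cup\mathrm{mv}(e)$, and $\mathrm{asm}(e_1,\dots,e_n)=\bigcup_i\mathrm{asm}(e_i)$, extended componentwise to judgements and boundaries. Substitution $e[s/x]$ replaces the bound variable $x$ by $s$ (capture-avoiding), and in an assumption set containing $x$ replaces $x$ by the elements of $\mathrm{asm}(s)$. $\mathcal J[a^A/x]$ replaces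 $x$ by the free variable $a^A$. Erasure $|e|$ removes all conversions ($|\mathrm{cv}(t,\alpha)|=|t|$) and replaces assumption sets by a fixed dummy, keeping annotations. Filling: $(\Box\ \mathsf{type})[A]=(A\ \mathsf{type})$, $(\Box:A)[t]=(t:A)$, $(A\equiv B\ \mathsf{by}\ \Box)[e]=(A\equiv B\ \mathsf{by}\ \mathrm{asm}(e))$, $(s\equiv t:A\ \mathsf{by}\ \Box)[e]=(s\equiv t:A\ \mathsf{by}\ \mathrm{asm}(e))$, $(\{x{:}A\}\mathcal B)[\{x\}e]=\{x{:}A\}(\mathcal B[e])$; with equations: $(\Box\ \mathsf{type})[A_1\equiv A_2\ \mathsf{by}\ \alpha]=(A_1\equiv A_2\ \mathsf{by}\ \alpha)$, $(\Box:A)[t_1\equiv t_2\ \mathsf{by}\ \alpha]=(t_1\equiv t_2:A\ \mathsf{by}\ \alpha)$, commuting with abstraction. An instantiation $I=\langle M_1^{\mathcal B_1}\mapsto e_1,\dots,M_n^{\mathcal B_n}\mapsto e_n\rangle$ requires $\mathrm{mv}(\mathcal B_i)\subseteq\{M_1^{\mathcal B_1},\dots,M_{i-1}^{\mathcal B_{i-1}}\}$ and matching arities; $I_*(M_i^{\mathcal B_i}(\vec t))=e_i'[I_*\vec t/\vec x]$ where $e_i=\{\vec x\}e_i'$, $I_*a^A=a^{I_*A}$, $I_*\mathrm{cv}(t,\alpha)=\mathrm{cv}(I_*t,I_*\alpha)$, $I_*\alpha=\bigcup\{\mathrm{asm}(e_i):M_i^{\mathcal B_i}\in\alpha\}\cup\{x: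 x\in\alpha\}\cup\{a^{I_*A}:a^A\in\alpha\}$, homomorphic elsewhere; $I_{(i)}$ is the restriction to the first $i-1$ metavariables. Rules. A context-free raw rule is $M_1^{\mathcal B_1},\dots,M_n^{\mathcal B_n}\Longrightarrow\mathcal J$ with $\mathcal B_i$ and $\mathcal J$ closed (no free variables), $\mathcal J$ non-abstracted, $\mathrm{mv}(\mathcal B_i)\subseteq\{M_1^{\mathcal B_1},\dots,M_{i-1}^{\mathcal B_{i-1}}\}$ and $\mathrm{mv}(\mathcal J)=\{M_1^{\mathcal B_1},\dots,M_n^{\mathcal B_n}\}$; object rule if $\mathcal J$ is a type/term judgement. In a closure rule with premises $p_1,\dots,p_k$ and equality conclusion $\beta[\alpha]$, "$\alpha$ suitable" means $\mathrm{asm}(p_1,\dots,p_k)=\mathrm{asm}(\beta[\alpha])$. A context-free raw type theory $T$ is a family of such rules; $\vdash_T$ denotes membership in the least set of judgements and boundaries closed under: (CF-Var) $\vdash a^A:A$; (CF-Abstr) from $\vdash A\ \mathsf{type}$ and $\vdash\mathcal J[a^A/x]$ with $a^A\notin\mathrm{fv}(\mathcal J)$ infer $\vdash\{x{:}A\}\mathcal J$; (CF-Meta) for $\mathcal B=\{x_1{:}A_1\}\cdots\{x_n{:}A_n\}\beta$: from $\vdash t_i:A_i[t_1,\dots,t_{i-1}/x_1,\dots,x_{i-1}]$ ($i=1..n$) and $\vdash\beta[\vec t/\vec x]$ infer $\vdash(\beta[\vec t/\vec x])[M^{\mathcal B}(\vec t)]$ (for equality $\beta$ the assumption set is $\mathrm{asm}(M^{\mathcal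 B}(\vec t))$); (CF-Meta-Congr) for $\mathcal B=\{x_1{:}A_1\}\cdots\{x_m{:}A_m\}\beta$ with $\beta$ a type or term boundary: from $\vdash s_j:A_j[\vec s_{<j}/\vec x_{<j}]$, $\vdash t_j:A_j[\vec t_{<j}/\vec x_{<j}]$, and $\vdash s_j\equiv t'_j:A_j[\vec s_{<j}/\vec x_{<j}]\ \mathsf{by}\ \alpha_j$ with $|t'_j|=|t_j|$ ($j=1..m$), infer $\vdash M^{\mathcal B}(\vec s)\equiv M^{\mathcal B}(\vec t)\ \mathsf{by}\ \gamma$ if $\beta=\Box\ \mathsf{type}$, and, if $\beta=(\Box:B)$, given also $\vdash v:B[\vec s/\vec x]$ with $|v|=|M^{\mathcal B}(\vec t)|$, infer $\vdash M^{\mathcal B}(\vec s)\equiv v:B[\vec s/\vec x]\ \mathsf{by}\ \gamma$ ($\gamma$ suitable); (equality) from $\vdash A_1\ \mathsf{type}$, $\vdash A_2\ \mathsf{type}$, $|A_1|=|A_2|$ infer $\vdash A_1\equiv A_2\ \mathsf{by}\ \emptyset$; from $\vdash t_1:A$, $\vdash t_2:A$, $|t_1|=|t_2|$ infer $\vdash t_1\equiv t_2:A\ \mathsf{by}\ \emptyset$; symmetry keeping the assumption set; transitivity: from $\vdash A\equiv B\ \mathsf{by}\ \alpha$ and $\vdash B'\equiv C\ \mathsf{by}\ \beta$ with $|B|=|B'|$ infer $\vdash A\equiv C\ \mathsf{by}\ \gamma$ ($\gamma$ suitable), likewise for terms at a common type $A$ with $|t|=|t'|$; (CF-Conv-Tm)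 from $\vdash t:A$ and $\vdash A\equiv B\ \mathsf{by}\ \alpha$ infer $\vdash\mathrm{cv}(t,\beta):B$ whenever $\mathrm{asm}(t,A,B,\alpha)=\mathrm{asm}(t,B,\beta)$; (CF-Conv-EqTm) from $\vdash s\equiv t:A\ \mathsf{by}\ \alpha$ and $\vdash A\equiv B\ \mathsf{by}\ \beta$ infer $\vdash\mathrm{cv}(s,\gamma)\equiv\mathrm{cv}(t,\delta):B\ \mathsf{by}\ \alpha$ whenever $\mathrm{asm}(s,A,B,\beta)=\mathrm{asm}(s,B,\gamma)$ and $\mathrm{asm}(t,A,B,\beta)=\mathrm{asm}(t,B,\delta)$; (boundaries) $\vdash\Box\ \mathsf{type}$; $\vdash\Box:A$ from $\vdash A\ \mathsf{type}$; $\vdash A\equiv B\ \mathsf{by}\ \Box$ from $\vdash A\ \mathsf{type}$, $\vdash B\ \mathsf{type}$; $\vdash s\equiv t:A\ \mathsf{by}\ \Box$ from $\vdash A\ \mathsf{type}$, $\vdash s:A$, $\vdash t:A$; $\vdash\{x{:}A\}\mathcal B$ from $\vdash A\ \mathsf{type}$ and $\vdash\mathcal B[a^A/x]$ with $a^A\notin\mathrm{fv}(\mathcal B)$; (specific rules) for a specific rule $M_1^{\mathcal B_1},\dots,M_n^{\mathcal B_n}\Longrightarrow\beta[e]$ and instantiation $I=\langle M_i^{\mathcal B_i}\mapsto e_i\rangle$: from $\vdash(I_{(i)*}\mathcal B_i)[e_i]$ ($i=1..n$) and $\vdash I_*\beta$ infer $\vdash I_*(\beta[e])$; (congruence) for a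 specific rule with conclusion $A\ \mathsf{type}$ (resp. $t:A$) and instantiations $I=\langle M_i\mapsto f_i\rangle$, $J=\langle M_i\mapsto g_i\rangle$: from $\vdash(I_{(i)*}\mathcal B_i)[f_i]$, $\vdash(J_{(i)*}\mathcal B_i)[g_i]$ for all $i$, and for each type/term boundary $\mathcal B_i$ some $g'_i$ with $|g'_i|=|g_i|$ and $\vdash(I_{(i)*}\mathcal B_i)[f_i\equiv g'_i\ \mathsf{by}\ \alpha_i]$, infer $\vdash I_*A\equiv J_*A\ \mathsf{by}\ \gamma$ (resp., given also $\vdash t':I_*A$ with $|t'|=|J_*t|$, infer $\vdash I_*t\equiv t':I_*A\ \mathsf{by}\ \gamma$), $\gamma$ suitable.
   Formalization: In (1), if t is a bare free variable a^C, it is also assumed that ⊢ C type (otherwise (1) fails, as ⊢ a^C : C holds for every raw type C); "can be computed" means partial recursive relative to the set of rules of T, for any injective numbering of the symbols. *)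

theory Defs
  imports Main "HOL-Library.FSet" "HOL-Library.Nat_Bijection"
begin

section \<open>Raw syntax\<close>

datatype cls = Ty | Tm | EqTy | EqTm

type_synonym arity = "cls \<times> nat"

text \<open>The domain of the map is the set of symbols of the signature.\<close>

type_synonym 's signature = "'s \<rightharpoonup> cls \<times> arity list"

abbreviation is_object_class :: "cls \<Rightarrow> bool" where
  "is_object_class c \<equiv> c = Ty \<or> c = Tm"

definition raw_signature :: "'s signature \<Rightarrow> bool" where
  "raw_signature \<Sigma> \<longleftrightarrow> (\<forall>S c ars. \<Sigma> S = Some (c, ars) \<longrightarrow> is_object_class c)"

text \<open>
  Bound variables are de Bruijn indices, so that equality is syntactic equality up to renaming
  of bound variables; index 0 is the innermost binder.  The annotation of a free variable has no
  loose indices and the annotation of a metavariable is a closed boundary (this is part of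
  well-formedness below), hence operations on indices never enter annotations.
  \<open>Asms \<alpha>\<close> is an assumption set in argument position, \<open>Abs e\<close> is \<open>{x}e\<close>, and
  \<open>Conv t \<alpha>\<close> is \<open>cv(t,\<alpha>)\<close>.
\<close>

datatype 's expr =
    FVar nat "'s expr"
  | BVar nat
  | Sym 's "'s expr list"
  | Meta nat "'s bdry" "'s expr list"
  | Conv "'s expr" "'s assm fset"
  | Asms "'s assm fset"
  | Abs "'s expr"
and 's assm =
    AFree nat "'s expr"
  | ABound nat
  | AMeta nat "'s bdry"
and 's bdry =
    BTy
  | BTm "'s expr"
  | BEqTy "'s expr" "'s expr"
  | BEqTm "'s expr" "'s expr" "'s expr"
  | BAbs "'s expr" "'s bdry"

text \<open>\<open>BEqTm s t A\<close> is \<open>s \<equiv> t : A by \<box>\<close>, and \<open>JEqTm s t A \<alpha>\<close> is \<open>s \<equiv> t : A by \<alpha>\<close>.\<close>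

datatype 's judgement =
    JTy "'s expr"
  | JTm "'s expr" "'s expr"
  | JEqTy "'s expr" "'s expr" "'s assm fset"
  | JEqTm "'s expr" "'s expr" "'s expr" "'s assm fset"
  | JAbs "'s expr" "'s judgement"

fun ar :: "'s bdry \<Rightarrow> arity" where
  "ar BTy = (Ty, 0)"
| "ar (BTm A) = (Tm, 0)"
| "ar (BEqTy A B) = (EqTy, 0)"
| "ar (BEqTm s t A) = (EqTm, 0)"
| "ar (BAbs A \<B>) = (fst (ar \<B>), Suc (snd (ar \<B>)))"


subsection \<open>Occurrences\<close>

definition unbind :: "'s assm fset \<Rightarrow> 's assm fset" where
  "unbind \<alpha> = (\<lambda>x. case x of ABound i \<Rightarrow> ABound (i - 1) | _ \<Rightarrow> x) |`| (\<alpha> |-| {|ABound 0|})"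

primrec asm :: "'s expr \<Rightarrow> 's assm fset"
  and asm_assm :: "'s assm \<Rightarrow> 's assm fset"
  and asm_bdry :: "'s bdry \<Rightarrow> 's assm fset" where
  "asm (FVar a A) = finsert (AFree a A) (asm A)"
| "asm (BVar i) = {|ABound i|}"
| "asm (Sym S es) = ffUnion (fset_of_list (map asm es))"
| "asm (Meta M \<B> ts) = finsert (AMeta M \<B>) (asm_bdry \<B> |\<union>| ffUnion (fset_of_list (map asm ts)))"
| "asm (Conv t \<alpha>) = asm t |\<union>| ffUnion (asm_assm |`| \<alpha>)"
| "asm (Asms \<alpha>) = ffUnion (asm_assm |`| \<alpha>)"
| "asm (Abs e) = unbind (asm e)"
| "asm_assm (AFree a A) = finsert (AFree a A) (asm A)"
| "asm_assm (ABound i) = {|ABound i|}"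
| "asm_assm (AMeta M \<B>) = finsert (AMeta M \<B>) (asm_bdry \<B>)"
| "asm_bdry BTy = {||}"
| "asm_bdry (BTm A) = asm A"
| "asm_bdry (BEqTy A B) = asm A |\<union>| asm B"
| "asm_bdry (BEqTm s t A) = asm s |\<union>| asm t |\<union>| asm A"
| "asm_bdry (BAbs A \<B>) = asm A |\<union>| unbind (asm_bdry \<B>)"

abbreviation asm_set :: "'s assm fset \<Rightarrow> 's assm fset" where
  "asm_set \<alpha> \<equiv> asm (Asms \<alpha>)"

primrec asm_jdg :: "'s judgement \<Rightarrow> 's assm fset" where
  "asm_jdg (JTy A) = asm A"
| "asm_jdg (JTm t A) = asm t |\<union>| asm A"
| "asm_jdg (JEqTy A B \<alpha>) = asm A |\<union>| asm B |\<union>| asm_set \<alpha>"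
| "asm_jdg (JEqTm s t A \<alpha>) = asm s |\<union>| asm t |\<union>| asm A |\<union>| asm_set \<alpha>"
| "asm_jdg (JAbs A J) = asm A |\<union>| unbind (asm_jdg J)"

definition asm_jdgs :: "'s judgement list \<Rightarrow> 's assm fset" where
  "asm_jdgs Js = ffUnion (fset_of_list (map asm_jdg Js))"

text \<open>The free variables and the metavariables among a set of occurring assumptions.\<close>

definition frees :: "'s assm fset \<Rightarrow> 's assm fset" where
  "frees \<alpha> = ffilter (\<lambda>x. \<exists>a A. x = AFree a A) \<alpha>"

definition metas :: "'s assm fset \<Rightarrow> 's assm fset" where
  "metas \<alpha> = ffilter (\<lambda>x. \<exists>M \<B>. x = AMeta M \<B>) \<alpha>"


subsection \<open>Well-formed raw syntax\<close>

text \<open>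
  \<open>wf_expr \<Sigma> k (c, n) e\<close>: in the scope of \<open>k\<close> bound variables, \<open>e\<close> is a raw argument
  of class \<open>c\<close> under \<open>n\<close> abstractions.  Type and term expressions are the case of arity
  \<open>(Ty, 0)\<close> and \<open>(Tm, 0)\<close>.
\<close>

inductive wf_expr :: "'s signature \<Rightarrow> nat \<Rightarrow> arity \<Rightarrow> 's expr \<Rightarrow> bool"
  and wf_assm :: "'s signature \<Rightarrow> nat \<Rightarrow> 's assm \<Rightarrow> bool"
  and wf_bdry :: "'s signature \<Rightarrow> nat \<Rightarrow> 's bdry \<Rightarrow> bool"
  for \<Sigma> :: "'s signature" where
  "wf_expr \<Sigma> 0 (Ty, 0) A \<Longrightarrow> wf_expr \<Sigma> k (Tm, 0) (FVar a A)"
| "i < k \<Longrightarrow> wf_expr \<Sigma> k (Tm, 0) (BVar i)"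
| "\<lbrakk>\<Sigma> S = Some (c, ars); length es = length ars;
    \<forall>i < length ars. wf_expr \<Sigma> k (ars ! i) (es ! i)\<rbrakk> \<Longrightarrow> wf_expr \<Sigma> k (c, 0) (Sym S es)"
| "\<lbrakk>wf_bdry \<Sigma> 0 \<B>; frees (asm_bdry \<B>) = {||}; ar \<B> = (c, length ts); is_object_class c;
    \<forall>t \<in> set ts. wf_expr \<Sigma> k (Tm, 0) t\<rbrakk> \<Longrightarrow> wf_expr \<Sigma> k (c, 0) (Meta M \<B> ts)"
| "\<lbrakk>wf_expr \<Sigma> k (Tm, 0) t; \<forall>x \<in> fset \<alpha>. wf_assm \<Sigma> k x\<rbrakk>
    \<Longrightarrow> wf_expr \<Sigma> k (Tm, 0) (Conv t \<alpha>)"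
| "\<lbrakk>\<not> is_object_class c; \<forall>x \<in> fset \<alpha>. wf_assm \<Sigma> k x\<rbrakk> \<Longrightarrow> wf_expr \<Sigma> k (c, 0) (Asms \<alpha>)"
| "wf_expr \<Sigma> (Suc k) (c, n) e \<Longrightarrow> wf_expr \<Sigma> k (c, Suc n) (Abs e)"
| "wf_expr \<Sigma> 0 (Ty, 0) A \<Longrightarrow> wf_assm \<Sigma> k (AFree a A)"
| "i < k \<Longrightarrow> wf_assm \<Sigma> k (ABound i)"
| "\<lbrakk>wf_bdry \<Sigma> 0 \<B>; frees (asm_bdry \<B>) = {||}\<rbrakk> \<Longrightarrow> wf_assm \<Sigma> k (AMeta M \<B>)"
| "wf_bdry \<Sigma> k BTy"
| "wf_expr \<Sigma> k (Ty, 0) A \<Longrightarrow> wf_bdry \<Sigma> k (BTm A)"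
| "\<lbrakk>wf_expr \<Sigma> k (Ty, 0) A; wf_expr \<Sigma> k (Ty, 0) B\<rbrakk> \<Longrightarrow> wf_bdry \<Sigma> k (BEqTy A B)"
| "\<lbrakk>wf_expr \<Sigma> k (Tm, 0) s; wf_expr \<Sigma> k (Tm, 0) t; wf_expr \<Sigma> k (Ty, 0) A\<rbrakk>
    \<Longrightarrow> wf_bdry \<Sigma> k (BEqTm s t A)"
| "\<lbrakk>wf_expr \<Sigma> k (Ty, 0) A; wf_bdry \<Sigma> (Suc k) \<B>\<rbrakk> \<Longrightarrow> wf_bdry \<Sigma> k (BAbs A \<B>)"

definition closed_bdry :: "'s signature \<Rightarrow> 's bdry \<Rightarrow> bool" where
  "closed_bdry \<Sigma> \<B> \<longleftrightarrow> wf_bdry \<Sigma> 0 \<B> \<and> frees (asm_bdry \<B>) = {||}"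

text \<open>Well-formed non-abstracted judgements.\<close>

fun wf_thesis :: "'s signature \<Rightarrow> 's judgement \<Rightarrow> bool" where
  "wf_thesis \<Sigma> (JTy A) \<longleftrightarrow> wf_expr \<Sigma> 0 (Ty, 0) A"
| "wf_thesis \<Sigma> (JTm t A) \<longleftrightarrow> wf_expr \<Sigma> 0 (Tm, 0) t \<and> wf_expr \<Sigma> 0 (Ty, 0) A"
| "wf_thesis \<Sigma> (JEqTy A B \<alpha>) \<longleftrightarrow>
     wf_expr \<Sigma> 0 (Ty, 0) A \<and> wf_expr \<Sigma> 0 (Ty, 0) B \<and> (\<forall>x \<in> fset \<alpha>. wf_assm \<Sigma> 0 x)"
| "wf_thesis \<Sigma> (JEqTm s t A \<alpha>) \<longleftrightarrow>
     wf_expr \<Sigma> 0 (Tm, 0) s \<and> wf_expr \<Sigma> 0 (Tm, 0) t \<and> wf_expr \<Sigma> 0 (Ty, 0) A \<and>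
     (\<forall>x \<in> fset \<alpha>. wf_assm \<Sigma> 0 x)"
| "wf_thesis \<Sigma> (JAbs A J) \<longleftrightarrow> False"


subsection \<open>Substitution for bound variables\<close>

fun lift_assm :: "nat \<Rightarrow> 's assm \<Rightarrow> 's assm" where
  "lift_assm k (ABound i) = ABound (if i < k then i else Suc i)"
| "lift_assm k x = x"

primrec lift :: "'s expr \<Rightarrow> nat \<Rightarrow> 's expr" where
  "lift (FVar a A) k = FVar a A"
| "lift (BVar i) k = BVar (if i < k then i else Suc i)"
| "lift (Sym S es) k = Sym S (map (\<lambda>e. lift e k) es)"
| "lift (Meta M \<B> ts) k = Meta M \<B> (map (\<lambda>t. lift t k) ts)"
| "lift (Conv t \<alpha>) k = Conv (lift t k) (lift_assm k |`| \<alpha>)"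
| "lift (Asms \<alpha>) k = Asms (lift_assm k |`| \<alpha>)"
| "lift (Abs e) k = Abs (lift e (Suc k))"

fun subst_assm :: "nat \<Rightarrow> 's expr \<Rightarrow> 's assm \<Rightarrow> 's assm fset" where
  "subst_assm k s (ABound i) =
     (if i < k then {|ABound i|} else if i = k then asm s else {|ABound (i - 1)|})"
| "subst_assm k s x = {|x|}"

definition subst_set :: "'s assm fset \<Rightarrow> nat \<Rightarrow> 's expr \<Rightarrow> 's assm fset" where
  "subst_set \<alpha> k s = ffUnion (subst_assm k s |`| \<alpha>)"

primrec subst :: "'s expr \<Rightarrow> nat \<Rightarrow> 's expr \<Rightarrow> 's expr" where
  "subst (FVar a A) k s = FVar a A"
| "subst (BVar i) k s = (if i < k then BVar i else if i = k then s else BVar (i - 1))"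
| "subst (Sym S es) k s = Sym S (map (\<lambda>e. subst e k s) es)"
| "subst (Meta M \<B> ts) k s = Meta M \<B> (map (\<lambda>t. subst t k s) ts)"
| "subst (Conv t \<alpha>) k s = Conv (subst t k s) (subst_set \<alpha> k s)"
| "subst (Asms \<alpha>) k s = Asms (subst_set \<alpha> k s)"
| "subst (Abs e) k s = Abs (subst e (Suc k) (lift s 0))"

primrec subst_bdry :: "'s bdry \<Rightarrow> nat \<Rightarrow> 's expr \<Rightarrow> 's bdry" where
  "subst_bdry BTy k s = BTy"
| "subst_bdry (BTm A) k s = BTm (subst A k s)"
| "subst_bdry (BEqTy A B) k s = BEqTy (subst A k s) (subst B k s)"
| "subst_bdry (BEqTm t u A) k s = BEqTm (subst t k s) (subst u k s) (subst A k s)"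
| "subst_bdry (BAbs A \<B>) k s = BAbs (subst A k s) (subst_bdry \<B> (Suc k) (lift s 0))"

primrec subst_jdg :: "'s judgement \<Rightarrow> nat \<Rightarrow> 's expr \<Rightarrow> 's judgement" where
  "subst_jdg (JTy A) k s = JTy (subst A k s)"
| "subst_jdg (JTm t A) k s = JTm (subst t k s) (subst A k s)"
| "subst_jdg (JEqTy A B \<alpha>) k s = JEqTy (subst A k s) (subst B k s) (subst_set \<alpha> k s)"
| "subst_jdg (JEqTm t u A \<alpha>) k s =
     JEqTm (subst t k s) (subst u k s) (subst A k s) (subst_set \<alpha> k s)"
| "subst_jdg (JAbs A J) k s = JAbs (subst A k s) (subst_jdg J (Suc k) (lift s 0))"

text \<open>
  \<open>apply_args ({x\<^sub>1}\<dots>{x\<^sub>n}e) [t\<^sub>1,\<dots>,t\<^sub>n]\<close> is \<open>e[t\<^sub>1,\<dots>,t\<^sub>n/x\<^sub>1,\<dots>,x\<^sub>n]\<close>,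
  and \<open>apply_bdry\<close> does the same for an abstracted boundary.
\<close>

fun apply_args :: "'s expr \<Rightarrow> 's expr list \<Rightarrow> 's expr" where
  "apply_args (Abs e) (t # ts) = apply_args (subst e 0 t) ts"
| "apply_args e ts = e"

fun apply_bdry :: "'s bdry \<Rightarrow> 's expr list \<Rightarrow> 's bdry" where
  "apply_bdry (BAbs A \<B>) (t # ts) = apply_bdry (subst_bdry \<B> 0 t) ts"
| "apply_bdry \<B> ts = \<B>"


subsection \<open>Erasure and filling\<close>

text \<open>The dummy assumption set is \<open>{||}\<close>; annotations are not erased.\<close>

primrec erase :: "'s expr \<Rightarrow> 's expr" where
  "erase (FVar a A) = FVar a A"
| "erase (BVar i) = BVar i"
| "erase (Sym S es) = Sym S (map erase es)"
| "erase (Meta M \<B> ts) = Meta M \<B> (map erase ts)"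
| "erase (Conv t \<alpha>) = erase t"
| "erase (Asms \<alpha>) = Asms {||}"
| "erase (Abs e) = Abs (erase e)"

text \<open>Only used when the arity of the boundary matches the number of abstractions of the head.\<close>

fun fill :: "'s bdry \<Rightarrow> 's expr \<Rightarrow> 's judgement" where
  "fill BTy A = JTy A"
| "fill (BTm A) t = JTm t A"
| "fill (BEqTy A B) e = JEqTy A B (asm e)"
| "fill (BEqTm s t A) e = JEqTm s t A (asm e)"
| "fill (BAbs A \<B>) (Abs e) = JAbs A (fill \<B> e)"

text \<open>The assumption set is understood in the scope of the abstractions of the boundary.\<close>

fun fill_eq :: "'s bdry \<Rightarrow> 's expr \<Rightarrow> 's expr \<Rightarrow> 's assm fset \<Rightarrow> 's judgement" where
  "fill_eq BTy A B \<alpha> = JEqTy A B \<alpha>"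
| "fill_eq (BTm A) s t \<alpha> = JEqTm s t A \<alpha>"
| "fill_eq (BAbs A \<B>) (Abs e) (Abs e') \<alpha> = JAbs A (fill_eq \<B> e e' \<alpha>)"

fun bdry_of :: "'s judgement \<Rightarrow> 's bdry" where
  "bdry_of (JTy A) = BTy"
| "bdry_of (JTm t A) = BTm A"
| "bdry_of (JEqTy A B \<alpha>) = BEqTy A B"
| "bdry_of (JEqTm s t A \<alpha>) = BEqTm s t A"
| "bdry_of (JAbs A J) = BAbs A (bdry_of J)"


subsection \<open>Instantiation of metavariables\<close>

type_synonym 's mvar = "nat \<times> 's bdry"
type_synonym 's inst = "('s mvar \<times> 's expr) list"

text \<open>
  The values of an instantiation have no loose indices, so they need no lifting under binders.
  In all uses below every metavariable occurring in the expression acted upon is instantiated.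
\<close>

primrec inst :: "'s expr \<Rightarrow> 's inst \<Rightarrow> 's expr"
  and inst_assm :: "'s assm \<Rightarrow> 's inst \<Rightarrow> 's assm fset"
  and inst_bdry :: "'s bdry \<Rightarrow> 's inst \<Rightarrow> 's bdry" where
  "inst (FVar a A) I = FVar a (inst A I)"
| "inst (BVar i) I = BVar i"
| "inst (Sym S es) I = Sym S (map (\<lambda>e. inst e I) es)"
| "inst (Meta M \<B> ts) I =
     (case map_of I (M, \<B>) of
        Some e \<Rightarrow> apply_args e (map (\<lambda>t. inst t I) ts)
      | None \<Rightarrow> Meta M \<B> (map (\<lambda>t. inst t I) ts))"
| "inst (Conv t \<alpha>) I = Conv (inst t I) (ffUnion ((\<lambda>x. inst_assm x I) |`| \<alpha>))"
| "inst (Asms \<alpha>) I = Asms (ffUnion ((\<lambda>x. inst_assm x I) |`| \<alpha>))"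
| "inst (Abs e) I = Abs (inst e I)"
| "inst_assm (AFree a A) I = {|AFree a (inst A I)|}"
| "inst_assm (ABound i) I = {|ABound i|}"
| "inst_assm (AMeta M \<B>) I = (case map_of I (M, \<B>) of Some e \<Rightarrow> asm e | None \<Rightarrow> {||})"
| "inst_bdry BTy I = BTy"
| "inst_bdry (BTm A) I = BTm (inst A I)"
| "inst_bdry (BEqTy A B) I = BEqTy (inst A I) (inst B I)"
| "inst_bdry (BEqTm s t A) I = BEqTm (inst s I) (inst t I) (inst A I)"
| "inst_bdry (BAbs A \<B>) I = BAbs (inst A I) (inst_bdry \<B> I)"

primrec inst_jdg :: "'s judgement \<Rightarrow> 's inst \<Rightarrow> 's judgement" where
  "inst_jdg (JTy A) I = JTy (inst A I)"
| "inst_jdg (JTm t A) I = JTm (inst t I) (inst A I)"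
| "inst_jdg (JEqTy A B \<alpha>) I =
     JEqTy (inst A I) (inst B I) (ffUnion ((\<lambda>x. inst_assm x I) |`| \<alpha>))"
| "inst_jdg (JEqTm s t A \<alpha>) I =
     JEqTm (inst s I) (inst t I) (inst A I) (ffUnion ((\<lambda>x. inst_assm x I) |`| \<alpha>))"
| "inst_jdg (JAbs A J) I = JAbs (inst A I) (inst_jdg J I)"

definition inst_values :: "'s signature \<Rightarrow> 's mvar list \<Rightarrow> 's expr list \<Rightarrow> bool" where
  "inst_values \<Sigma> ms es \<longleftrightarrow>
     length es = length ms \<and> (\<forall>i < length ms. wf_expr \<Sigma> 0 (ar (snd (ms ! i))) (es ! i))"


section \<open>Context-free raw type theories\<close>

text \<open>A rule \<open>M\<^sub>1,\<dots>,M\<^sub>n \<Longrightarrow> J\<close>.\<close>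

type_synonym 's rule = "'s mvar list \<times> 's judgement"

definition mvars :: "'s mvar list \<Rightarrow> 's assm fset" where
  "mvars ms = fset_of_list (map (\<lambda>(M, \<B>). AMeta M \<B>) ms)"

fun raw_rule :: "'s signature \<Rightarrow> 's rule \<Rightarrow> bool" where
  "raw_rule \<Sigma> (ms, J) \<longleftrightarrow>
     distinct ms \<and>
     (\<forall>i < length ms. closed_bdry \<Sigma> (snd (ms ! i)) \<and>
        metas (asm_bdry (snd (ms ! i))) |\<subseteq>| mvars (take i ms)) \<and>
     wf_thesis \<Sigma> J \<and> frees (asm_jdg J) = {||} \<and> metas (asm_jdg J) = mvars ms"

text \<open>The premise boundary \<open>I\<^sub>(\<^sub>i\<^sub>)\<^sub>*\<B>\<^sub>i\<close> for the instantiation \<open>I\<close> sending \<open>ms\<close> to \<open>es\<close>.\<close>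

definition premise_bdry :: "'s mvar list \<Rightarrow> 's expr list \<Rightarrow> nat \<Rightarrow> 's bdry" where
  "premise_bdry ms es i = inst_bdry (snd (ms ! i)) (zip (take i ms) (take i es))"

definition rule_premises :: "'s mvar list \<Rightarrow> 's expr list \<Rightarrow> 's judgement list" where
  "rule_premises ms es = map (\<lambda>i. fill (premise_bdry ms es i) (es ! i)) [0..<length ms]"

definition object_indices :: "'s mvar list \<Rightarrow> nat list" where
  "object_indices ms = filter (\<lambda>i. is_object_class (fst (ar (snd (ms ! i))))) [0..<length ms]"

definition congruence_premises ::
  "'s mvar list \<Rightarrow> 's expr list \<Rightarrow> 's expr list \<Rightarrow> 's expr list \<Rightarrow> 's assm fset list
    \<Rightarrow> 's judgement list" where
  "congruence_premises ms fs gs gs' \<alpha>s =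
     rule_premises ms fs @ rule_premises ms gs @
     map (\<lambda>i. fill_eq (premise_bdry ms fs i) (fs ! i) (gs' ! i) (\<alpha>s ! i)) (object_indices ms)"

text \<open>
  For \<open>\<B> = {x\<^sub>1:A\<^sub>1}\<dots>{x\<^sub>n:A\<^sub>n}\<beta>\<close>: the judgements \<open>t\<^sub>j : A\<^sub>j[t\<^sub>1,\<dots>/x\<^sub>1,\<dots>]\<close> and the equations
  \<open>s\<^sub>j \<equiv> t\<^sub>j : A\<^sub>j[s\<^sub>1,\<dots>/x\<^sub>1,\<dots>] by \<alpha>\<^sub>j\<close>.
\<close>

fun arg_judgements :: "'s bdry \<Rightarrow> 's expr list \<Rightarrow> 's judgement list" where
  "arg_judgements (BAbs A \<B>) (t # ts) = JTm t A # arg_judgements (subst_bdry \<B> 0 t) ts"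
| "arg_judgements _ _ = []"

fun arg_equations ::
  "'s bdry \<Rightarrow> 's expr list \<Rightarrow> 's expr list \<Rightarrow> 's assm fset list \<Rightarrow> 's judgement list" where
  "arg_equations (BAbs A \<B>) (s # ss) (t # ts) (\<alpha> # \<alpha>s) =
     JEqTm s t A \<alpha> # arg_equations (subst_bdry \<B> 0 s) ss ts \<alpha>s"
| "arg_equations _ _ _ _ = []"

text \<open>Derivability only depends on the set \<open>T\<close> of rules underlying a family of rules.\<close>

inductive derivable :: "'s signature \<Rightarrow> 's rule set \<Rightarrow> 's judgement \<Rightarrow> bool"
  and derivable_bdry :: "'s signature \<Rightarrow> 's rule set \<Rightarrow> 's bdry \<Rightarrow> bool"
  for \<Sigma> :: "'s signature" and T :: "'s rule set" where
  Var: "wf_expr \<Sigma> 0 (Ty, 0) A \<Longrightarrow> derivable \<Sigma> T (JTm (FVar a A) A)"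
| Abstr: "\<lbrakk>derivable \<Sigma> T (JTy A); derivable \<Sigma> T (subst_jdg J 0 (FVar a A));
    AFree a A |\<notin>| asm_jdg J\<rbrakk> \<Longrightarrow> derivable \<Sigma> T (JAbs A J)"
| Meta: "\<lbrakk>closed_bdry \<Sigma> \<B>; snd (ar \<B>) = length ts;
    \<forall>P \<in> set (arg_judgements \<B> ts). derivable \<Sigma> T P; derivable_bdry \<Sigma> T (apply_bdry \<B> ts)\<rbrakk>
    \<Longrightarrow> derivable \<Sigma> T (fill (apply_bdry \<B> ts) (Meta M \<B> ts))"
| Meta_Congr_Ty: "\<lbrakk>closed_bdry \<Sigma> \<B>; ar \<B> = (Ty, m);
    length ss = m; length ts = m; length ts' = m; length \<alpha>s = m;
    Ps = arg_judgements \<B> ss @ arg_judgements \<B> ts @ arg_equations \<B> ss ts' \<alpha>s;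
    \<forall>P \<in> set Ps. derivable \<Sigma> T P; map erase ts' = map erase ts;
    asm_jdgs Ps = asm_jdg (JEqTy (Meta M \<B> ss) (Meta M \<B> ts) \<gamma>)\<rbrakk>
    \<Longrightarrow> derivable \<Sigma> T (JEqTy (Meta M \<B> ss) (Meta M \<B> ts) \<gamma>)"
| Meta_Congr_Tm: "\<lbrakk>closed_bdry \<Sigma> \<B>; ar \<B> = (Tm, m);
    length ss = m; length ts = m; length ts' = m; length \<alpha>s = m;
    apply_bdry \<B> ss = BTm B;
    Ps = arg_judgements \<B> ss @ arg_judgements \<B> ts @ arg_equations \<B> ss ts' \<alpha>s @ [JTm v B];
    \<forall>P \<in> set Ps. derivable \<Sigma> T P; map erase ts' = map erase ts;
    erase v = erase (Meta M \<B> ts);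
    asm_jdgs Ps = asm_jdg (JEqTm (Meta M \<B> ss) v B \<gamma>)\<rbrakk>
    \<Longrightarrow> derivable \<Sigma> T (JEqTm (Meta M \<B> ss) v B \<gamma>)"
| EqTy_Refl: "\<lbrakk>derivable \<Sigma> T (JTy A); derivable \<Sigma> T (JTy B); erase A = erase B\<rbrakk>
    \<Longrightarrow> derivable \<Sigma> T (JEqTy A B {||})"
| EqTy_Sym: "derivable \<Sigma> T (JEqTy A B \<alpha>) \<Longrightarrow> derivable \<Sigma> T (JEqTy B A \<alpha>)"
| EqTy_Trans: "\<lbrakk>derivable \<Sigma> T (JEqTy A B \<alpha>); derivable \<Sigma> T (JEqTy B' C \<beta>);
    erase B = erase B'; asm_jdgs [JEqTy A B \<alpha>, JEqTy B' C \<beta>] = asm_jdg (JEqTy A C \<gamma>)\<rbrakk>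
    \<Longrightarrow> derivable \<Sigma> T (JEqTy A C \<gamma>)"
| EqTm_Refl: "\<lbrakk>derivable \<Sigma> T (JTm s A); derivable \<Sigma> T (JTm t A); erase s = erase t\<rbrakk>
    \<Longrightarrow> derivable \<Sigma> T (JEqTm s t A {||})"
| EqTm_Sym: "derivable \<Sigma> T (JEqTm s t A \<alpha>) \<Longrightarrow> derivable \<Sigma> T (JEqTm t s A \<alpha>)"
| EqTm_Trans: "\<lbrakk>derivable \<Sigma> T (JEqTm s t A \<alpha>); derivable \<Sigma> T (JEqTm t' u A \<beta>);
    erase t = erase t'; asm_jdgs [JEqTm s t A \<alpha>, JEqTm t' u A \<beta>] = asm_jdg (JEqTm s u A \<gamma>)\<rbrakk>
    \<Longrightarrow> derivable \<Sigma> T (JEqTm s u A \<gamma>)"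
| Conv_Tm: "\<lbrakk>derivable \<Sigma> T (JTm t A); derivable \<Sigma> T (JEqTy A B \<alpha>);
    asm t |\<union>| asm A |\<union>| asm B |\<union>| asm_set \<alpha> = asm t |\<union>| asm B |\<union>| asm_set \<beta>\<rbrakk>
    \<Longrightarrow> derivable \<Sigma> T (JTm (Conv t \<beta>) B)"
| Conv_EqTm: "\<lbrakk>derivable \<Sigma> T (JEqTm s t A \<alpha>); derivable \<Sigma> T (JEqTy A B \<beta>);
    asm s |\<union>| asm A |\<union>| asm B |\<union>| asm_set \<beta> = asm s |\<union>| asm B |\<union>| asm_set \<gamma>;
    asm t |\<union>| asm A |\<union>| asm B |\<union>| asm_set \<beta> = asm t |\<union>| asm B |\<union>| asm_set \<delta>\<rbrakk>
    \<Longrightarrow> derivable \<Sigma> T (JEqTm (Conv s \<gamma>) (Conv t \<delta>) B \<alpha>)"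
| Bdry_Ty: "derivable_bdry \<Sigma> T BTy"
| Bdry_Tm: "derivable \<Sigma> T (JTy A) \<Longrightarrow> derivable_bdry \<Sigma> T (BTm A)"
| Bdry_EqTy: "\<lbrakk>derivable \<Sigma> T (JTy A); derivable \<Sigma> T (JTy B)\<rbrakk> \<Longrightarrow> derivable_bdry \<Sigma> T (BEqTy A B)"
| Bdry_EqTm: "\<lbrakk>derivable \<Sigma> T (JTy A); derivable \<Sigma> T (JTm s A); derivable \<Sigma> T (JTm t A)\<rbrakk>
    \<Longrightarrow> derivable_bdry \<Sigma> T (BEqTm s t A)"
| Bdry_Abstr: "\<lbrakk>derivable \<Sigma> T (JTy A); derivable_bdry \<Sigma> T (subst_bdry \<B> 0 (FVar a A));
    AFree a A |\<notin>| asm_bdry \<B>\<rbrakk> \<Longrightarrow> derivable_bdry \<Sigma> T (BAbs A \<B>)"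
| Specific: "\<lbrakk>(ms, J) \<in> T; inst_values \<Sigma> ms es;
    \<forall>P \<in> set (rule_premises ms es). derivable \<Sigma> T P;
    derivable_bdry \<Sigma> T (inst_bdry (bdry_of J) (zip ms es))\<rbrakk>
    \<Longrightarrow> derivable \<Sigma> T (inst_jdg J (zip ms es))"
| Congr_Ty: "\<lbrakk>(ms, JTy A) \<in> T; inst_values \<Sigma> ms fs; inst_values \<Sigma> ms gs; inst_values \<Sigma> ms gs';
    length \<alpha>s = length ms; \<forall>i \<in> set (object_indices ms). erase (gs' ! i) = erase (gs ! i);
    Ps = congruence_premises ms fs gs gs' \<alpha>s; \<forall>P \<in> set Ps. derivable \<Sigma> T P;
    asm_jdgs Ps = asm_jdg (JEqTy (inst A (zip ms fs)) (inst A (zip ms gs)) \<gamma>)\<rbrakk>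
    \<Longrightarrow> derivable \<Sigma> T (JEqTy (inst A (zip ms fs)) (inst A (zip ms gs)) \<gamma>)"
| Congr_Tm: "\<lbrakk>(ms, JTm t A) \<in> T; inst_values \<Sigma> ms fs; inst_values \<Sigma> ms gs; inst_values \<Sigma> ms gs';
    length \<alpha>s = length ms; \<forall>i \<in> set (object_indices ms). erase (gs' ! i) = erase (gs ! i);
    Ps = congruence_premises ms fs gs gs' \<alpha>s @ [JTm t' (inst A (zip ms fs))];
    \<forall>P \<in> set Ps. derivable \<Sigma> T P; erase t' = erase (inst t (zip ms gs));
    asm_jdgs Ps = asm_jdg (JEqTm (inst t (zip ms fs)) t' (inst A (zip ms fs)) \<gamma>)\<rbrakk>
    \<Longrightarrow> derivable \<Sigma> T (JEqTm (inst t (zip ms fs)) t' (inst A (zip ms fs)) \<gamma>)"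

text \<open>
  Well-typed annotations, for an expression, judgement or boundary with \<open>asm\<close> equal to \<open>\<alpha>\<close>.
  Pitfall: \<open>Var\<close> has no premise, so \<open>a\<^sup>A : A\<close> is derivable for every raw type \<open>A\<close>, whereas both
  sides of a derivable type equation are derivable types.  Hence \<open>A \<equiv> A by \<alpha>\<close> is not derivable
  for any \<open>\<alpha>\<close> unless \<open>A type\<close> is, and uniqueness of typing for a bare variable \<open>a\<^sup>A\<close> needs the
  annotation \<open>A\<close> to be a derivable type.
\<close>

definition well_typed_annotations :: "'s signature \<Rightarrow> 's rule set \<Rightarrow> 's assm fset \<Rightarrow> bool" where
  "well_typed_annotations \<Sigma> T \<alpha> \<longleftrightarrow>
     (\<forall>M \<B>. AMeta M \<B> |\<in>| \<alpha> \<longrightarrow> derivable_bdry \<Sigma> T \<B>) \<and>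
     (\<forall>a A. AFree a A |\<in>| \<alpha> \<longrightarrow> derivable \<Sigma> T (JTy A))"


section \<open>Standard theories\<close>

definition generic_arg :: "'s mvar \<Rightarrow> 's expr" where
  "generic_arg = (\<lambda>(M, \<B>). case ar \<B> of (c, k) \<Rightarrow>
     (Abs ^^ k) (if is_object_class c then Meta M \<B> (map BVar (rev [0..<k]))
                 else Asms (finsert (AMeta M \<B>) (fset_of_list (map ABound [0..<k])))))"

definition symbol_rule :: "'s signature \<Rightarrow> 's \<Rightarrow> 's rule \<Rightarrow> bool" where
  "symbol_rule \<Sigma> S r \<longleftrightarrow>
     raw_rule \<Sigma> r \<and>
     (\<exists>ms \<beta> c. ar \<beta> = (c, 0) \<and> is_object_class c \<and>
        \<Sigma> S = Some (c, map (\<lambda>m. ar (snd m)) ms) \<and>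
        r = (ms, fill \<beta> (Sym S (map generic_arg ms))))"

fun object_rule :: "'s rule \<Rightarrow> bool" where
  "object_rule (ms, J) \<longleftrightarrow> (\<exists>A. J = JTy A) \<or> (\<exists>t A. J = JTm t A)"

fun finitary_rule :: "'s signature \<Rightarrow> 's rule set \<Rightarrow> 's rule \<Rightarrow> bool" where
  "finitary_rule \<Sigma> T (ms, J) \<longleftrightarrow>
     (\<forall>m \<in> set ms. derivable_bdry \<Sigma> T (snd m)) \<and> derivable_bdry \<Sigma> T (bdry_of J)"

text \<open>A theory is a family \<open>R\<close> of rules indexed by the set \<open>I\<close>.\<close>

definition raw_theory :: "'s signature \<Rightarrow> 'i set \<Rightarrow> ('i \<Rightarrow> 's rule) \<Rightarrow> bool" where
  "raw_theory \<Sigma> I R \<longleftrightarrow> raw_signature \<Sigma> \<and> (\<forall>i \<in> I. raw_rule \<Sigma> (R i))"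

definition finitary_theory :: "'s signature \<Rightarrow> 'i set \<Rightarrow> ('i \<Rightarrow> 's rule) \<Rightarrow> bool" where
  "finitary_theory \<Sigma> I R \<longleftrightarrow>
     raw_theory \<Sigma> I R \<and>
     (\<exists>r. r \<subseteq> I \<times> I \<and> trans r \<and> wf r \<and>
        (\<forall>i \<in> I. finitary_rule \<Sigma> (R ` {j. (j, i) \<in> r}) (R i)))"

definition standard_theory :: "'s signature \<Rightarrow> 'i set \<Rightarrow> ('i \<Rightarrow> 's rule) \<Rightarrow> bool" where
  "standard_theory \<Sigma> I R \<longleftrightarrow>
     finitary_theory \<Sigma> I R \<and>
     (\<forall>i \<in> I. object_rule (R i) \<longrightarrow> (\<exists>S. symbol_rule \<Sigma> S (R i))) \<and>
     (\<forall>S \<in> dom \<Sigma>. \<exists>!i. i \<in> I \<and> symbol_rule \<Sigma> S (R i))"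


section \<open>Computability\<close>

text \<open>
  Partial recursive functions relative to an oracle \<open>X\<close>, presented as unary functions on natural
  numbers with Cantor pairing; \<open>None\<close> means divergence.  As a type theory may be an arbitrary family
  of rules, computations with its judgements have the set of codes of its rules as oracle.
\<close>

inductive partial_recursive_in :: "nat set \<Rightarrow> (nat \<Rightarrow> nat option) \<Rightarrow> bool"
  for X :: "nat set" where
  "partial_recursive_in X (\<lambda>_. Some 0)"
| "partial_recursive_in X (\<lambda>n. Some (Suc n))"
| "partial_recursive_in X (\<lambda>n. Some (fst (prod_decode n)))"
| "partial_recursive_in X (\<lambda>n. Some (snd (prod_decode n)))"
| "partial_recursive_in X (\<lambda>n. Some (if n \<in> X then 1 else 0))"
| "\<lbrakk>partial_recursive_in X f; partial_recursive_in X g\<rbrakk>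
    \<Longrightarrow> partial_recursive_in X (\<lambda>n. Option.bind (f n) g)"
| "\<lbrakk>partial_recursive_in X f; partial_recursive_in X g\<rbrakk>
    \<Longrightarrow> partial_recursive_in X
         (\<lambda>n. Option.bind (f n) (\<lambda>a. Option.bind (g n) (\<lambda>b. Some (prod_encode (a, b)))))"
| "\<lbrakk>partial_recursive_in X f; partial_recursive_in X g\<rbrakk>
    \<Longrightarrow> partial_recursive_in X (\<lambda>n. case prod_decode n of (x, k) \<Rightarrow>
         rec_nat (f x)
           (\<lambda>i r. Option.bind r (\<lambda>v. g (prod_encode (x, prod_encode (i, v))))) k)"
| "partial_recursive_in X f
    \<Longrightarrow> partial_recursive_in X (\<lambda>x.
         if \<exists>k. f (prod_encode (x, k)) = Some 0 \<and> (\<forall>j < k. f (prod_encode (x, j)) \<noteq> None)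
         then Some (LEAST k. f (prod_encode (x, k)) = Some 0) else None)"

text \<open>Numbering of the raw syntax, given a numbering \<open>\<nu>\<close> of the symbols.\<close>

primrec code :: "'s expr \<Rightarrow> ('s \<Rightarrow> nat) \<Rightarrow> nat"
  and code_assm :: "'s assm \<Rightarrow> ('s \<Rightarrow> nat) \<Rightarrow> nat"
  and code_bdry :: "'s bdry \<Rightarrow> ('s \<Rightarrow> nat) \<Rightarrow> nat" where
  "code (FVar a A) \<nu> = list_encode [0, a, code A \<nu>]"
| "code (BVar i) \<nu> = list_encode [1, i]"
| "code (Sym S es) \<nu> = list_encode [2, \<nu> S, list_encode (map (\<lambda>e. code e \<nu>) es)]"
| "code (Meta M \<B> ts) \<nu> =
     list_encode [3, M, code_bdry \<B> \<nu>, list_encode (map (\<lambda>t. code t \<nu>) ts)]"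
| "code (Conv t \<alpha>) \<nu> =
     list_encode [4, code t \<nu>, set_encode (fset ((\<lambda>x. code_assm x \<nu>) |`| \<alpha>))]"
| "code (Asms \<alpha>) \<nu> = list_encode [5, set_encode (fset ((\<lambda>x. code_assm x \<nu>) |`| \<alpha>))]"
| "code (Abs e) \<nu> = list_encode [6, code e \<nu>]"
| "code_assm (AFree a A) \<nu> = list_encode [0, a, code A \<nu>]"
| "code_assm (ABound i) \<nu> = list_encode [1, i]"
| "code_assm (AMeta M \<B>) \<nu> = list_encode [2, M, code_bdry \<B> \<nu>]"
| "code_bdry BTy \<nu> = list_encode [0]"
| "code_bdry (BTm A) \<nu> = list_encode [1, code A \<nu>]"
| "code_bdry (BEqTy A B) \<nu> = list_encode [2, code A \<nu>, code B \<nu>]"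
| "code_bdry (BEqTm s t A) \<nu> = list_encode [3, code s \<nu>, code t \<nu>, code A \<nu>]"
| "code_bdry (BAbs A \<B>) \<nu> = list_encode [4, code A \<nu>, code_bdry \<B> \<nu>]"

definition code_set :: "'s assm fset \<Rightarrow> ('s \<Rightarrow> nat) \<Rightarrow> nat" where
  "code_set \<alpha> \<nu> = set_encode (fset ((\<lambda>x. code_assm x \<nu>) |`| \<alpha>))"

primrec code_jdg :: "'s judgement \<Rightarrow> ('s \<Rightarrow> nat) \<Rightarrow> nat" where
  "code_jdg (JTy A) \<nu> = list_encode [0, code A \<nu>]"
| "code_jdg (JTm t A) \<nu> = list_encode [1, code t \<nu>, code A \<nu>]"
| "code_jdg (JEqTy A B \<alpha>) \<nu> = list_encode [2, code A \<nu>, code B \<nu>, code_set \<alpha> \<nu>]"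
| "code_jdg (JEqTm s t A \<alpha>) \<nu> =
     list_encode [3, code s \<nu>, code t \<nu>, code A \<nu>, code_set \<alpha> \<nu>]"
| "code_jdg (JAbs A J) \<nu> = list_encode [4, code A \<nu>, code_jdg J \<nu>]"

fun code_rule :: "'s rule \<Rightarrow> ('s \<Rightarrow> nat) \<Rightarrow> nat" where
  "code_rule (ms, J) \<nu> =
     prod_encode (list_encode (map (\<lambda>(M, \<B>). prod_encode (M, code_bdry \<B> \<nu>)) ms), code_jdg J \<nu>)"

end

theory Submission
  imports Defs "HOL-Library.Countable_Set"
begin

text \<open>
  Every term other than a variable or a conversion determines its type up to erasure: a symbol has
  only one rule, and arguments that are assumption sets are the only ones that cannot be read off an
  instance of it.  Stripping the conversions off a term and chaining the type equations in them
  gives uniqueness of typing, and the side conditions on conversions keep the assumptions used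
  within those of the term.

  The set \<open>\<alpha>\<close> is not a function of the term and its types alone.  If a conversion of \<open>a\<^sup>C\<close> has
  both types \<open>D\<close> and \<open>E\<close>, it depends on the equality rules of the theory whether \<open>D \<equiv> E\<close> is
  derivable by the empty set or only by \<open>{a\<^sup>C}\<close>, and this need not be decidable.  But derivability
  is recursively enumerable relative to the set of rules, so \<open>\<alpha>\<close> can be found by searching for a
  derivable equation, and uniqueness of typing guarantees that the search succeeds.
\<close>

section \<open>Recursive functions and recursively enumerable sets\<close>

lemma prod_encode_0 [simp]: "prod_encode (0, 0) = 0"
  by (simp add: prod_encode_def)

lemma prod_decode_0 [simp]: "prod_decode 0 = (0, 0)"
  using prod_encode_inverse[of "(0, 0)"] by simp

section \<open>Total functions recursive relative to an oracle\<close>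

definition total_rec :: "nat set \<Rightarrow> (nat \<Rightarrow> nat) \<Rightarrow> bool" where
  "total_rec X f \<longleftrightarrow> partial_recursive_in X (\<lambda>n. Some (f n))"

abbreviation dec1 :: "nat \<Rightarrow> nat" where "dec1 n \<equiv> fst (prod_decode n)"
abbreviation dec2 :: "nat \<Rightarrow> nat" where "dec2 n \<equiv> snd (prod_decode n)"

lemma total_rec_comp: "total_rec X g \<Longrightarrow> total_rec X f \<Longrightarrow> total_rec X (\<lambda>n. g (f n))"
  unfolding total_rec_def
  by (drule (1) partial_recursive_in.intros(6)[rotated]) simp

lemma total_rec_pair: "total_rec X f \<Longrightarrow> total_rec X g \<Longrightarrow> total_rec X (\<lambda>n. prod_encode (f n, g n))"
  unfolding total_rec_def
  by (drule (1) partial_recursive_in.intros(7)) simp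

text \<open>The generators contain no identity. Pairing the two projections gives one, since every
  number is the code of a pair.\<close>

lemma total_rec_id: "total_rec X (\<lambda>n. n)"
  using total_rec_pair[of X dec1 dec2]
  by (simp add: total_rec_def partial_recursive_in.intros(3,4))

lemma total_rec_Suc: "total_rec X f \<Longrightarrow> total_rec X (\<lambda>n. Suc (f n))"
  by (rule total_rec_comp[of X Suc]) (simp add: total_rec_def partial_recursive_in.intros(2))

lemma total_rec_dec1: "total_rec X f \<Longrightarrow> total_rec X (\<lambda>n. dec1 (f n))"
  by (rule total_rec_comp[of X dec1]) (simp add: total_rec_def partial_recursive_in.intros(3))

lemma total_rec_dec2: "total_rec X f \<Longrightarrow> total_rec X (\<lambda>n. dec2 (f n))"
  by (rule total_rec_comp[of X dec2]) (simp add: total_rec_def partial_recursive_in.intros(4))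

lemma total_rec_mem: "total_rec X f \<Longrightarrow> total_rec X (\<lambda>n. if f n \<in> X then 1 else 0)"
  by (rule total_rec_comp[of X "\<lambda>n. if n \<in> X then 1 else 0"])
    (simp add: total_rec_def partial_recursive_in.intros(5))

lemma total_rec_const: "total_rec X (\<lambda>n. k)"
proof (induction k)
  case 0
  show ?case by (simp add: total_rec_def partial_recursive_in.intros(1))
qed (rule total_rec_Suc)

text \<open>The generator for recursion passes parameter, stage and previous value as one nested
  pair, which is why \<open>g\<close> is assumed recursive in decoded form. Composing with the
  pairing of \<open>n\<close> and \<open>k n\<close> turns the bound into an arbitrary recursive
  function of the parameter.\<close>

lemma total_rec_rec_nat:
  assumes f: "total_rec X f" and k: "total_rec X k"
    and g: "total_rec X (\<lambda>m. g (dec1 m) (dec1 (dec2 m)) (dec2 (dec2 m)))"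
  shows "total_rec X (\<lambda>n. rec_nat (f n) (g n) (k n))"
proof -
  have some: "rec_nat (Some a) (\<lambda>i r. Option.bind r (\<lambda>v. Some (h i v))) m = Some (rec_nat a h m)"
    for a h m by (induction m) auto
  have "total_rec X (\<lambda>n. rec_nat (f (dec1 n)) (g (dec1 n)) (dec2 n))"
    using partial_recursive_in.intros(8)[OF f[unfolded total_rec_def] g[unfolded total_rec_def]]
    by (simp add: total_rec_def some split_def)
  from total_rec_comp[OF this total_rec_pair[OF total_rec_id k]] show ?thesis by simp
qed

text \<open>Case distinction is a recursion whose step ignores the previous value and therefore
  returns \<open>g n\<close> as soon as it is taken once.\<close>

lemma total_rec_if_zero:
  assumes "total_rec X c" "total_rec X f" "total_rec X g"
  shows "total_rec X (\<lambda>n. if c n = 0 then f n else g n)"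
proof -
  have "total_rec X (\<lambda>n. rec_nat (f n) (\<lambda>i v. g n) (c n))"
    by (intro total_rec_rec_nat assms total_rec_comp[OF assms(3)] total_rec_dec1 total_rec_id)
  moreover have "rec_nat a (\<lambda>i v. b) m = (if m = 0 then a else b)" for a b m :: nat
    by (cases m) auto
  ultimately show ?thesis by simp
qed

lemma total_rec_pred: "total_rec X f \<Longrightarrow> total_rec X (\<lambda>n. f n - 1)"
proof -
  assume f: "total_rec X f"
  have "total_rec X (\<lambda>n. rec_nat 0 (\<lambda>i v. i) (f n))"
    by (intro total_rec_rec_nat total_rec_const f total_rec_dec1 total_rec_dec2 total_rec_id)
  moreover have "rec_nat 0 (\<lambda>i v. i) m = m - 1" for m :: nat by (cases m) auto
  ultimately show ?thesis by simp
qed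

lemma total_rec_add:
  assumes "total_rec X f" "total_rec X g" shows "total_rec X (\<lambda>n. f n + g n)"
proof -
  have "total_rec X (\<lambda>n. rec_nat (f n) (\<lambda>i v. Suc v) (g n))"
    by (intro total_rec_rec_nat assms total_rec_Suc total_rec_dec2 total_rec_id)
  moreover have "rec_nat a (\<lambda>i v. Suc v) m = a + m" for a m :: nat by (induction m) auto
  ultimately show ?thesis by simp
qed

lemma total_rec_diff:
  assumes "total_rec X f" "total_rec X g" shows "total_rec X (\<lambda>n. f n - g n)"
proof -
  have "total_rec X (\<lambda>n. rec_nat (f n) (\<lambda>i v. v - 1) (g n))"
    by (intro total_rec_rec_nat assms total_rec_pred total_rec_dec2 total_rec_id)
  moreover have "rec_nat a (\<lambda>i v. v - 1) m = a - m" for a m :: nat by (induction m) auto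
  ultimately show ?thesis by simp
qed

lemma total_rec_mult:
  assumes "total_rec X f" "total_rec X g" shows "total_rec X (\<lambda>n. f n * g n)"
proof -
  have "total_rec X (\<lambda>n. rec_nat 0 (\<lambda>i v. f n + v) (g n))"
    by (intro total_rec_rec_nat assms total_rec_add total_rec_const total_rec_comp[OF assms(1)] total_rec_dec1 total_rec_dec2 total_rec_id)
  moreover have "rec_nat 0 (\<lambda>i v. a + v) m = a * m" for a m :: nat by (induction m) auto
  ultimately show ?thesis by simp
qed

lemma total_rec_pow2:
  assumes "total_rec X f" shows "total_rec X (\<lambda>n. 2 ^ f n)"
proof -
  have "total_rec X (\<lambda>n. rec_nat 1 (\<lambda>i v. v + v) (f n))"
    by (intro total_rec_rec_nat assms total_rec_add total_rec_const total_rec_dec2 total_rec_id)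
  moreover have "rec_nat 1 (\<lambda>i v. v + v) m = (2::nat) ^ m" for m :: nat by (induction m) auto
  ultimately show ?thesis by simp
qed

text \<open>Serves to walk down a nested pair by a computed number of projections.\<close>

lemma total_rec_funpow:
  assumes "total_rec X g" "total_rec X f" "total_rec X k" shows "total_rec X (\<lambda>n. (g ^^ k n) (f n))"
proof -
  have "total_rec X (\<lambda>n. rec_nat (f n) (\<lambda>i v. g v) (k n))"
    by (intro total_rec_rec_nat assms(2,3) total_rec_comp[OF assms(1)] total_rec_dec2 total_rec_id)
  moreover have "rec_nat a (\<lambda>i v. g v) m = (g ^^ m) a" for a m by (induction m) auto
  ultimately show ?thesis by simp
qed

lemmas total_rec_intros = total_rec_pair total_rec_id total_rec_Suc total_rec_dec1 total_rec_dec2 total_rec_mem total_rec_const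
  total_rec_if_zero total_rec_pred total_rec_add total_rec_diff total_rec_mult total_rec_pow2

section \<open>Recursively enumerable sets\<close>

text \<open>Projections of zero sets of total functions, and not domains of partial ones:
  intersection becomes a sum of the two functions, union a product, and a search evaluates only
  total functions.\<close>

definition re_set :: "nat set \<Rightarrow> nat set \<Rightarrow> bool" where
  "re_set X S \<longleftrightarrow> (\<exists>f. total_rec X f \<and> S = {n. \<exists>k. f (prod_encode (n, k)) = 0})"

lemma re_set_zero: "total_rec X f \<Longrightarrow> re_set X {n. f n = 0}"
  unfolding re_set_def by (rule exI[of _ "\<lambda>n. f (dec1 n)"]) (simp add: total_rec_comp[of X f] total_rec_dec1 total_rec_id)

lemma re_set_eq:
  assumes "total_rec X f" "total_rec X g" shows "re_set X {n. f n = g n}"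
proof -
  have "re_set X {n. (f n - g n) + (g n - f n) = 0}"
    by (intro re_set_zero total_rec_add total_rec_diff assms)
  moreover have "{n. (f n - g n) + (g n - f n) = 0} = {n. f n = g n}" by auto
  ultimately show ?thesis by simp
qed

lemma re_set_less: "total_rec X f \<Longrightarrow> total_rec X g \<Longrightarrow> re_set X {n. f n < g n}"
  using re_set_zero[OF total_rec_diff[of X "\<lambda>n. Suc (f n)" g]] by (simp add: total_rec_Suc Suc_le_eq)

lemma re_set_self: "re_set X X"
proof -
  have "re_set X {n. 1 - (if n \<in> X then 1 else 0) = (0::nat)}"
    by (intro re_set_zero total_rec_diff total_rec_const total_rec_mem total_rec_id)
  moreover have "{n. 1 - (if n \<in> X then 1 else 0) = (0::nat)} = X" by (auto split: if_splits)
  ultimately show ?thesis by simp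
qed

lemma re_set_Int:
  assumes "re_set X S" "re_set X S'" shows "re_set X (S \<inter> S')"
proof -
  obtain f g where f: "total_rec X f" "S = {n. \<exists>k. f (prod_encode (n, k)) = 0}"
    and g: "total_rec X g" "S' = {n. \<exists>k. g (prod_encode (n, k)) = 0}"
    using assms unfolding re_set_def by blast
  let ?h = "\<lambda>m. f (prod_encode (dec1 m, dec1 (dec2 m))) + g (prod_encode (dec1 m, dec2 (dec2 m)))"
  have "total_rec X ?h"
    by (intro total_rec_add total_rec_comp[OF f(1)] total_rec_comp[OF g(1)] total_rec_intros)
  moreover have "S \<inter> S' = {n. \<exists>k. ?h (prod_encode (n, k)) = 0}"
  proof -
    have "\<exists>k. ?h (prod_encode (n, k)) = 0" if "n \<in> S" "n \<in> S'" for n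
    proof -
      from that obtain i j where "f (prod_encode (n, i)) = 0" "g (prod_encode (n, j)) = 0"
        using f g by auto
      then show ?thesis by (intro exI[of _ "prod_encode (i, j)"]) simp
    qed
    then show ?thesis unfolding f g by auto
  qed
  ultimately show ?thesis unfolding re_set_def by blast
qed

lemma re_set_Un:
  assumes "re_set X S" "re_set X S'" shows "re_set X (S \<union> S')"
proof -
  obtain f g where f: "total_rec X f" "S = {n. \<exists>k. f (prod_encode (n, k)) = 0}"
    and g: "total_rec X g" "S' = {n. \<exists>k. g (prod_encode (n, k)) = 0}"
    using assms unfolding re_set_def by blast
  have "total_rec X (\<lambda>m. f m * g m)"
    by (intro total_rec_mult f g)
  moreover have "S \<union> S' = {n. \<exists>k. f (prod_encode (n, k)) * g (prod_encode (n, k)) = 0}"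
    unfolding f g by auto
  ultimately show ?thesis unfolding re_set_def by blast
qed

lemma re_set_vimage:
  assumes "re_set X S" "total_rec X h" shows "re_set X {n. h n \<in> S}"
proof -
  obtain f where f: "total_rec X f" "S = {n. \<exists>k. f (prod_encode (n, k)) = 0}"
    using assms unfolding re_set_def by blast
  have "total_rec X (\<lambda>m. f (prod_encode (h (dec1 m), dec2 m)))"
    by (intro total_rec_comp[OF f(1)] total_rec_comp[OF assms(2)] total_rec_intros)
  moreover have "{n. h n \<in> S} = {n. \<exists>k. f (prod_encode (h (dec1 (prod_encode (n, k))), dec2 (prod_encode (n, k)))) = 0}"
    unfolding f by auto
  ultimately show ?thesis unfolding re_set_def by blast
qed

lemma re_set_ex:
  assumes "re_set X S" shows "re_set X {n. \<exists>m. prod_encode (n, m) \<in> S}"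
proof -
  obtain f where f: "total_rec X f" "S = {n. \<exists>k. f (prod_encode (n, k)) = 0}"
    using assms unfolding re_set_def by blast
  let ?h = "\<lambda>m. f (prod_encode (prod_encode (dec1 m, dec1 (dec2 m)), dec2 (dec2 m)))"
  have "total_rec X ?h" by (intro total_rec_comp[OF f(1)] total_rec_intros)
  moreover have "{n. \<exists>m. prod_encode (n, m) \<in> S} = {n. \<exists>k. ?h (prod_encode (n, k)) = 0}"
  proof -
    have "\<exists>k. ?h (prod_encode (n, k)) = 0" if "prod_encode (n, m) \<in> S" for n m
    proof -
      from that obtain j where "f (prod_encode (prod_encode (n, m), j)) = 0" using f by auto
      then show ?thesis by (intro exI[of _ "prod_encode (m, j)"]) simp
    qed
    then show ?thesis unfolding f by auto
  qed
  ultimately show ?thesis unfolding re_set_def by blast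
qed

lemma re_set_range: "total_rec X h \<Longrightarrow> re_set X (range h)"
  using re_set_ex[OF re_set_eq[of X dec1 "\<lambda>n. h (dec2 n)"]]
  by (simp add: total_rec_dec1 total_rec_comp[of X h] total_rec_dec2 total_rec_id full_SetCompr_eq)

text \<open>Uniformization of an enumerable relation. The minimization runs over coded pairs of a
  value and a witness for it, so that the condition tested at each number is decided by a total
  function; the value is projected out afterwards.\<close>

lemma re_set_select:
  assumes "re_set X S"
  obtains F where "partial_recursive_in X F"
    "\<And>n. \<exists>m. prod_encode (n, m) \<in> S \<Longrightarrow> \<exists>m. F n = Some m \<and> prod_encode (n, m) \<in> S"
proof -
  obtain f where f: "total_rec X f" "S = {n. \<exists>k. f (prod_encode (n, k)) = 0}"
    using assms unfolding re_set_def by blast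
  define h where "h m = f (prod_encode (prod_encode (dec1 m, dec1 (dec2 m)), dec2 (dec2 m)))" for m
  have "total_rec X h" unfolding h_def by (intro total_rec_comp[OF f(1)] total_rec_intros)
  note \<mu> = partial_recursive_in.intros(9)[OF this[unfolded total_rec_def]]
  let ?F = "\<lambda>n. Option.bind (if \<exists>k. h (prod_encode (n, k)) = 0
     then Some (LEAST k. h (prod_encode (n, k)) = 0) else None) (\<lambda>k. Some (dec1 k))"
  have "partial_recursive_in X ?F"
    by (rule partial_recursive_in.intros(6)[OF _ partial_recursive_in.intros(3)]) (use \<mu> in \<open>simp cong del: if_weak_cong\<close>)
  moreover have "\<exists>m. ?F n = Some m \<and> prod_encode (n, m) \<in> S" if "\<exists>m. prod_encode (n, m) \<in> S" for n
  proof -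
    from that obtain m k where "f (prod_encode (prod_encode (n, m), k)) = 0" using f by auto
    then have ex: "h (prod_encode (n, prod_encode (m, k))) = 0" by (simp add: h_def)
    then have "h (prod_encode (n, LEAST k. h (prod_encode (n, k)) = 0)) = 0" by (rule LeastI)
    then show ?thesis using ex f by (auto simp: h_def)
  qed
  ultimately show ?thesis using that by blast
qed

section \<open>Least fixed points of enumerable rule systems\<close>

text \<open>Every step has exactly two premises, so that one nested pair codes it; steps with fewer
  premises are padded with the base fact \<open>0\<close>.\<close>

inductive rule_closure :: "nat set \<Rightarrow> nat \<Rightarrow> bool" for St where
  base: "rule_closure St 0"
| step: "prod_encode (n, prod_encode (p, q)) \<in> St \<Longrightarrow> rule_closure St p \<Longrightarrow> rule_closure St q
    \<Longrightarrow> rule_closure St n"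

text \<open>
  The facts are enumerated in stages.  The history of the first \<open>k\<close> stages is a nested pair, so that
  \<open>0\<close>, which encodes \<open>(0, 0)\<close>, acts as an infinite list of the base fact.  Stage \<open>k\<close>
  decodes from \<open>k\<close> itself the conclusion, a witness and the stages at which the premises appeared.
\<close>

lemma re_set_rule_closure:
  assumes "re_set X St"
  shows "re_set X (Collect (rule_closure St))"
proof -
  obtain f where f: "total_rec X f" "St = {n. \<exists>k. f (prod_encode (n, k)) = 0}"
    using assms unfolding re_set_def by blast
  define get where "get l i = dec1 ((dec2 ^^ i) l)" for l i
  \<comment> \<open>\<open>get\<close> counts backwards from the newest fact, so position
    \<open>k - Suc i\<close> holds the fact of stage \<open>i\<close>. Stages are stored in
    \<open>k\<close> with a successor; a stored \<open>0\<close> then points past the end of the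
    history, which is the base fact. A number \<open>k\<close> that decodes to no valid step
    reproduces \<open>0\<close>.\<close>
  define new where "new k l =
    (if f (prod_encode (prod_encode (dec1 k, prod_encode (get l (k - dec1 (dec2 k)),
              get l (k - dec1 (dec2 (dec2 k))))), dec2 (dec2 (dec2 k)))) = 0
     then dec1 k else 0)" for k l
  define hist where "hist k = rec_nat 0 (\<lambda>k l. prod_encode (new k l, l)) k" for k
  define fact where "fact k = new k (hist k)" for k
  have get_rec: "total_rec X (\<lambda>n. get (a n) (b n))" if "total_rec X a" "total_rec X b" for a b
    unfolding get_def by (intro total_rec_dec1 total_rec_funpow that total_rec_dec2 total_rec_id)
  have new_rec: "total_rec X (\<lambda>n. new (a n) (b n))" if "total_rec X a" "total_rec X b" for a b
    unfolding new_def
    by (intro total_rec_if_zero total_rec_comp[OF f(1)] total_rec_pair get_rec total_rec_diff total_rec_dec1 total_rec_dec2 that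
        total_rec_const)
  have hist_rec: "total_rec X (\<lambda>k. hist k)"
    unfolding hist_def by (intro total_rec_rec_nat total_rec_pair new_rec total_rec_const total_rec_dec1 total_rec_dec2 total_rec_id)
  have fact_rec: "total_rec X (\<lambda>k. fact k)"
    unfolding fact_def by (intro new_rec hist_rec total_rec_id)
  have hist_Suc: "hist (Suc k) = prod_encode (fact k, hist k)" for k
    by (simp add: hist_def fact_def)
  have get_0: "get 0 i = 0" for i
  proof -
    have "(dec2 ^^ i) 0 = 0" by (induction i) auto
    then show ?thesis by (simp add: get_def)
  qed
  have get_hist: "get (hist k) i = (if i < k then fact (k - Suc i) else 0)" for k i
  proof (induction k arbitrary: i)
    case 0
    then show ?case by (simp add: hist_def get_0)
  next
    case (Suc k)
    show ?case
    proof (cases i)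
      case 0
      then show ?thesis by (simp add: hist_Suc get_def)
    next
      case (Suc j)
      then have "get (hist (Suc k)) i = get (hist k) j"
        by (simp add: hist_Suc get_def funpow_Suc_right del: funpow.simps)
      then show ?thesis using Suc.IH[of j] Suc by simp
    qed
  qed
  have sound: "rule_closure St (fact k)" for k
  proof (induction k rule: less_induct)
    case (less k)
    have "rule_closure St (get (hist k) i)" for i
      by (cases "i < k") (auto simp: get_hist less rule_closure.base)
    moreover have "fact k = 0 \<or> prod_encode (fact k, prod_encode (get (hist k) (k - dec1 (dec2 k)),
        get (hist k) (k - dec1 (dec2 (dec2 k))))) \<in> St"
      by (auto simp: fact_def new_def f)
    ultimately show ?case by (metis rule_closure.base rule_closure.step)
  qed
  have complete: "\<exists>k. fact k = n" if "rule_closure St n" for n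
    using that
  proof (induction rule: rule_closure.induct)
    case base
    show ?case by (intro exI[of _ 0]) (simp add: fact_def new_def)
  next
    case (step n p q)
    then obtain i j w where ij: "fact i = p" "fact j = q"
      and w: "f (prod_encode (prod_encode (n, prod_encode (p, q)), w)) = 0" using f by auto
    \<comment> \<open>A code is at least as large as its components, so both premises appear
      strictly before the stage \<open>k\<close> that is built from them.\<close>
    define k where "k = prod_encode (n, prod_encode (Suc i, prod_encode (Suc j, w)))"
    have "Suc i \<le> k" "Suc j \<le> k"
      unfolding k_def
      by (rule order_trans[OF le_prod_encode_1 le_prod_encode_2],
          rule order_trans[OF order_trans[OF le_prod_encode_1 le_prod_encode_2] le_prod_encode_2])
    then have "get (hist k) (k - Suc i) = p" "get (hist k) (k - Suc j) = q"
      using ij by (simp_all add: get_hist)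
    then have "new k (hist k) = n"
      using w by (simp add: new_def k_def)
    then show ?case unfolding fact_def by blast
  qed
  have "Collect (rule_closure St) = range fact" using sound complete by blast
  then show ?thesis using re_set_range[OF fact_rec] by simp
qed

inductive list_closure :: "nat set \<Rightarrow> nat \<Rightarrow> bool" for St where
  "prod_encode (n, list_encode ps) \<in> St \<Longrightarrow> \<forall>p \<in> set ps. list_closure St p \<Longrightarrow> list_closure St n"

text \<open>A step with a list of premises is split into binary ones. Tag 1 marks derivable facts
  and tag 2 codes of lists of derivable facts; the three parts of \<open>St'\<close> derive a fact
  from the list of its premises, the empty list with code \<open>0\<close>, and a list with code
  \<open>Suc (prod_encode (n, l))\<close> from its head and tail.\<close>

lemma re_set_list_closure:
  assumes "re_set X St"
  shows "re_set X (Collect (list_closure St))"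
proof -
  define St' where "St' =
     ({m. dec1 (dec1 m) = 1} \<inter> {m. dec1 (dec1 (dec2 m)) = 2} \<inter> {m. dec2 (dec2 m) = 0} \<inter>
      {m. prod_encode (dec2 (dec1 m), dec2 (dec1 (dec2 m))) \<in> St}) \<union>
     ({m. dec1 m = prod_encode (2, 0)} \<inter> {m. dec2 m = 0}) \<union>
     ({m. dec1 (dec1 m) = 2} \<inter> {m. dec1 (dec1 (dec2 m)) = 1} \<inter> {m. dec1 (dec2 (dec2 m)) = 2} \<inter>
      {m. dec2 (dec1 m) = Suc (prod_encode (dec2 (dec1 (dec2 m)), dec2 (dec2 (dec2 m))))})"
  have "re_set X St'"
    unfolding St'_def by (intro re_set_Un re_set_Int re_set_eq re_set_vimage[OF assms] total_rec_intros)
  note closure = re_set_rule_closure[OF this]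
  have sound: "case prod_decode m of (t, n) \<Rightarrow>
      (t = 1 \<longrightarrow> list_closure St n) \<and> (t = 2 \<longrightarrow> (\<forall>p \<in> set (list_decode n). list_closure St p))"
    if "rule_closure St' m" for m
    using that
  proof induction
    case base
    then show ?case by simp
  next
    case (step n p q)
    obtain tn nn where n: "n = prod_encode (tn, nn)" by (metis prod.collapse prod_decode_inverse)
    obtain tp np where p: "p = prod_encode (tp, np)" by (metis prod.collapse prod_decode_inverse)
    obtain tq nq where q: "q = prod_encode (tq, nq)" by (metis prod.collapse prod_decode_inverse)
    from step(1) consider
        "tn = 1" "tp = 2" "prod_encode (nn, np) \<in> St"
      | "tn = 2" "nn = 0"
      | "tn = 2" "tp = 1" "tq = 2" "nn = Suc (prod_encode (np, nq))"
      by (auto simp: St'_def n p q)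
    then show ?case
    proof cases
      case 1
      then show ?thesis
        using step(4) list_closure.intros[of nn "list_decode np" St] by (simp add: n p)
    qed (use step in \<open>auto simp: n p q\<close>)
  qed
  have lists: "rule_closure St' (prod_encode (2, list_encode ns))"
    if "\<forall>n \<in> set ns. rule_closure St' (prod_encode (1, n))" for ns
    using that
  proof (induction ns)
    case Nil
    have "prod_encode (prod_encode (2, 0), prod_encode (0, 0)) \<in> St'"
      unfolding St'_def by auto
    from rule_closure.step[OF this rule_closure.base rule_closure.base] show ?case by simp
  next
    case (Cons n ns)
    have "prod_encode (prod_encode (2, list_encode (n # ns)),
        prod_encode (prod_encode (1, n), prod_encode (2, list_encode ns))) \<in> St'"
      unfolding St'_def by auto
    from rule_closure.step[OF this] Cons show ?case by simp
  qed
  have complete: "rule_closure St' (prod_encode (1, n))" if "list_closure St n" for n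
    using that
  proof induction
    case (1 n ps)
    have "prod_encode (prod_encode (1, n), prod_encode (prod_encode (2, list_encode ps), 0)) \<in> St'"
      using 1(1) unfolding St'_def by auto
    from rule_closure.step[OF this lists rule_closure.base] 1 show ?case by simp
  qed
  have "Collect (list_closure St) = {n. prod_encode (1, n) \<in> Collect (rule_closure St')}"
    using sound complete by (fastforce split: prod.splits)
  then show ?thesis
    using re_set_vimage[OF closure, of "\<lambda>n. prod_encode (1, n)"] by (simp add: total_rec_intros)
qed

section \<open>Predicates and functions seen through codings\<close>

text \<open>Codings are explicit arguments and not fixed by the type, because the coding of syntax
  varies with the numbering of the symbols.\<close>

definition enc_nat :: "nat \<Rightarrow> nat" where "enc_nat n = n"

definition enc_pair :: "('a \<Rightarrow> nat) \<Rightarrow> ('b \<Rightarrow> nat) \<Rightarrow> 'a \<times> 'b \<Rightarrow> nat" (infixr "\<otimes>" 70) where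
  "(c \<otimes> d) p = prod_encode (c (fst p), d (snd p))"

definition enc_sum :: "('a \<Rightarrow> nat) \<Rightarrow> ('b \<Rightarrow> nat) \<Rightarrow> 'a + 'b \<Rightarrow> nat" (infixr "\<oplus>" 65) where
  "(c \<oplus> d) s = (case s of Inl x \<Rightarrow> prod_encode (0, c x) | Inr y \<Rightarrow> prod_encode (1, d y))"

definition enc_list :: "('a \<Rightarrow> nat) \<Rightarrow> 'a list \<Rightarrow> nat" where
  "enc_list c xs = list_encode (map c xs)"

definition enc_fset :: "('a \<Rightarrow> nat) \<Rightarrow> 'a fset \<Rightarrow> nat" where
  "enc_fset c \<alpha> = set_encode (c ` fset \<alpha>)"

text \<open>
  These rules are applied by \<open>rule\<close> and not by \<open>intro\<close>, because they leave schematic codings that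
  only later subgoals determine.
\<close>

named_theorems re_intros

locale relative_re =
  fixes X :: "nat set"
begin

text \<open>This is what an existential quantifier over the type needs: the numbers that are codes
  can be listed, although they need not be decidable.\<close>

definition enumerable :: "('a \<Rightarrow> nat) \<Rightarrow> bool" where
  "enumerable c \<longleftrightarrow> inj c \<and> re_set X (range c)"

text \<open>\<open>S\<close> is unconstrained outside the range of \<open>c\<close> and may contain
  junk there. Quantifiers, graphs and fixed points therefore intersect it with the range of an
  enumerable coding first.\<close>

definition re :: "('a \<Rightarrow> nat) \<Rightarrow> ('a \<Rightarrow> bool) \<Rightarrow> bool" where
  "re c P \<longleftrightarrow> (\<exists>S. re_set X S \<and> (\<forall>x. P x \<longleftrightarrow> c x \<in> S))"

text \<open>
  Computability is enumerability of the graph.  A total recursive function on codes would be too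
  much to ask for: the set of codes of objects need not be decidable.
\<close>

definition computable :: "('a \<Rightarrow> nat) \<Rightarrow> ('b \<Rightarrow> nat) \<Rightarrow> ('a \<Rightarrow> 'b) \<Rightarrow> bool" where
  "computable c d f \<longleftrightarrow> (\<exists>S. re_set X S \<and> (\<forall>x n. prod_encode (c x, n) \<in> S \<longleftrightarrow> n = d (f x)))"

lemma re_const [re_intros]: "re c (\<lambda>x. b)"
  unfolding re_def using re_set_eq[OF total_rec_const[of X 0] total_rec_const[of X "if b then 0 else 1"]]
  by (intro exI[of _ "{n. 0 = (if b then 0 else 1 :: nat)}"]) auto

lemma re_conj [re_intros]: "re c P \<Longrightarrow> re c Q \<Longrightarrow> re c (\<lambda>x. P x \<and> Q x)"
  unfolding re_def using re_set_Int by blast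

lemma re_disj [re_intros]: "re c P \<Longrightarrow> re c Q \<Longrightarrow> re c (\<lambda>x. P x \<or> Q x)"
  unfolding re_def using re_set_Un by blast

lemma re_cong: "re c Q \<Longrightarrow> (\<And>x. P x \<longleftrightarrow> Q x) \<Longrightarrow> re c P"
  by presburger

lemma re_ex [re_intros]:
  assumes "enumerable d" "re (c \<otimes> d) (\<lambda>p. P (fst p) (snd p))"
  shows "re c (\<lambda>x. \<exists>y. P x y)"
proof -
  obtain S where S: "re_set X S" "\<forall>p. P (fst p) (snd p) \<longleftrightarrow> (c \<otimes> d) p \<in> S"
    using assms(2) unfolding re_def by blast
  have "re_set X {n. \<exists>m. prod_encode (n, m) \<in> S \<inter> {k. dec2 k \<in> range d}}"
    using assms(1) unfolding enumerable_def
    by (intro re_set_ex re_set_Int S re_set_vimage total_rec_intros) auto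
  moreover have "(\<exists>y. P x y) \<longleftrightarrow> c x \<in> {n. \<exists>m. prod_encode (n, m) \<in> S \<inter> {k. dec2 k \<in> range d}}" for x
    using S(2) by (fastforce simp: enc_pair_def)
  ultimately show ?thesis unfolding re_def by blast
qed

lemma re_subst:
  assumes "re d P" "computable c d f" shows "re c (\<lambda>x. P (f x))"
proof -
  obtain S S' where S: "re_set X S" "\<forall>x. P x \<longleftrightarrow> d x \<in> S"
    and S': "re_set X S'" "\<forall>x n. prod_encode (c x, n) \<in> S' \<longleftrightarrow> n = d (f x)"
    using assms unfolding re_def computable_def by blast
  have "re_set X {n. \<exists>m. prod_encode (n, m) \<in> S' \<inter> {k. dec2 k \<in> S}}"
    by (intro re_set_ex re_set_Int S' re_set_vimage[OF S(1)] total_rec_intros)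
  then show ?thesis unfolding re_def using S S' by (intro exI conjI) auto
qed

lemma computable_comp:
  assumes "computable d e g" "computable c d f" shows "computable c e (\<lambda>x. g (f x))"
proof -
  obtain S S' where S: "re_set X S" "\<forall>x n. prod_encode (d x, n) \<in> S \<longleftrightarrow> n = e (g x)"
    and S': "re_set X S'" "\<forall>x n. prod_encode (c x, n) \<in> S' \<longleftrightarrow> n = d (f x)"
    using assms unfolding computable_def by blast
  have "re_set X {n. \<exists>m. prod_encode (n, m) \<in>
      {k. prod_encode (dec1 (dec1 k), dec2 k) \<in> S'} \<inter> {k. prod_encode (dec2 k, dec2 (dec1 k)) \<in> S}}"
    by (intro re_set_ex re_set_Int re_set_vimage[OF S(1)] re_set_vimage[OF S'(1)] total_rec_intros)
  then show ?thesis unfolding computable_def using S S' by (intro exI conjI) auto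
qed

lemma computable_Pair [re_intros]:
  assumes "computable c d f" "computable c e g" shows "computable c (d \<otimes> e) (\<lambda>x. (f x, g x))"
proof -
  obtain S S' where S: "re_set X S" "\<forall>x n. prod_encode (c x, n) \<in> S \<longleftrightarrow> n = d (f x)"
    and S': "re_set X S'" "\<forall>x n. prod_encode (c x, n) \<in> S' \<longleftrightarrow> n = e (g x)"
    using assms unfolding computable_def by blast
  have "re_set X ({k. prod_encode (dec1 k, dec1 (dec2 k)) \<in> S} \<inter>
      {k. prod_encode (dec1 k, dec2 (dec2 k)) \<in> S'})"
    by (intro re_set_Int re_set_vimage[OF S(1)] re_set_vimage[OF S'(1)] total_rec_intros)
  moreover have "n = prod_encode (u, v) \<longleftrightarrow> dec1 n = u \<and> dec2 n = v" for n u v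
    by (metis prod.collapse prod_decode_inverse prod_encode_inverse prod.inject)
  ultimately show ?thesis unfolding computable_def using S S' by (intro exI conjI) (auto simp: enc_pair_def)
qed

lemma computable_recf:
  assumes "total_rec X F" "\<And>x. d (f x) = F (c x)" shows "computable c d f"
  unfolding computable_def
  by (rule exI[of _ "{k. dec2 k = F (dec1 k)}"])
    (auto simp: assms(2) intro!: re_set_eq total_rec_comp[OF assms(1)] total_rec_intros)

lemma computable_id [re_intros]: "computable c c (\<lambda>x. x)"
  by (rule computable_recf[OF total_rec_id]) simp

lemma computable_const [re_intros]: "computable c d (\<lambda>x. k)"
  by (rule computable_recf[OF total_rec_const[of X "d k"]]) simp

lemma computable_fst [re_intros]: "computable c (d \<otimes> e) f \<Longrightarrow> computable c d (\<lambda>x. fst (f x))"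
  by (rule computable_comp[where g = fst, OF computable_recf[OF total_rec_dec1[OF total_rec_id]]])
    (simp_all add: enc_pair_def)

lemma computable_snd [re_intros]: "computable c (d \<otimes> e) f \<Longrightarrow> computable c e (\<lambda>x. snd (f x))"
  by (rule computable_comp[where g = snd, OF computable_recf[OF total_rec_dec2[OF total_rec_id]]])
    (simp_all add: enc_pair_def)

lemma computable_map_recf:
  assumes "total_rec X F" "\<And>y. e (g y) = F (d y)" "computable c d f" shows "computable c e (\<lambda>x. g (f x))"
  by (rule computable_comp[OF computable_recf assms(3)]) (use assms in auto)

lemma computable_map2_recf:
  assumes "total_rec X F" "\<And>y z. e (g y z) = F (prod_encode (d1 y, d2 z))" "computable c d1 f1" "computable c d2 f2"
  shows "computable c e (\<lambda>x. g (f1 x) (f2 x))"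
  using computable_map_recf[OF assms(1), of e "\<lambda>p. g (fst p) (snd p)" "d1 \<otimes> d2" c "\<lambda>x. (f1 x, f2 x)"]
    assms(2-4) by (simp add: enc_pair_def computable_Pair)

text \<open>Functions of several arguments are shown computable as functions of one nested pair;
  these rules apply the result to separately computed arguments.\<close>

lemma computable_app2:
  assumes "computable (a \<otimes> b) d (\<lambda>p. f (fst p) (snd p))" "computable c a g" "computable c b h"
  shows "computable c d (\<lambda>x. f (g x) (h x))"
  using computable_comp[OF assms(1) computable_Pair[OF assms(2,3)]] by simp

lemma computable_app3:
  assumes "computable (a \<otimes> b \<otimes> b') d (\<lambda>p. f (fst p) (fst (snd p)) (snd (snd p)))"
    "computable c a g" "computable c b h" "computable c b' h'"
  shows "computable c d (\<lambda>x. f (g x) (h x) (h' x))"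
  using computable_comp[OF assms(1) computable_Pair[OF assms(2) computable_Pair[OF assms(3,4)]]] by simp

lemma computable_app4:
  assumes "computable (a \<otimes> b \<otimes> b' \<otimes> b'') d (\<lambda>p. f (fst p) (fst (snd p)) (fst (snd (snd p))) (snd (snd (snd p))))"
    "computable c a g" "computable c b h" "computable c b' h'" "computable c b'' h''"
  shows "computable c d (\<lambda>x. f (g x) (h x) (h' x) (h'' x))"
  using computable_comp[OF assms(1) computable_Pair[OF assms(2) computable_Pair[OF assms(3) computable_Pair[OF assms(4,5)]]]]
  by simp

lemma re_app2:
  assumes "re (a \<otimes> b) (\<lambda>p. P (fst p) (snd p))" "computable c a g" "computable c b h"
  shows "re c (\<lambda>x. P (g x) (h x))"
  using re_subst[OF assms(1) computable_Pair[OF assms(2,3)]] by simp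

lemma re_app3:
  assumes "re (a \<otimes> b \<otimes> b') (\<lambda>p. P (fst p) (fst (snd p)) (snd (snd p)))"
    "computable c a g" "computable c b h" "computable c b' h'"
  shows "re c (\<lambda>x. P (g x) (h x) (h' x))"
  using re_subst[OF assms(1) computable_Pair[OF assms(2) computable_Pair[OF assms(3,4)]]] by simp

lemma re_recf_reset:
  assumes "re_set X S" "computable c enc_nat f" shows "re c (\<lambda>x. f x \<in> S)"
  by (rule re_subst[OF _ assms(2)]) (use assms(1) in \<open>auto simp: re_def enc_nat_def\<close>)

lemma re_less [re_intros]:
  assumes "computable c enc_nat f" "computable c enc_nat g" shows "re c (\<lambda>x. f x < g x)"
proof -
  have "re_set X {n. dec1 n < dec2 n}" by (intro re_set_less total_rec_intros)
  then have "re (enc_nat \<otimes> enc_nat) (\<lambda>p. fst p < snd p)"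
    unfolding re_def by (intro exI[of _ "{n. dec1 n < dec2 n}"]) (auto simp: enc_nat_def enc_pair_def)
  from re_subst[OF this computable_Pair[OF assms]] show ?thesis by simp
qed

lemma re_eq [re_intros]:
  assumes "enumerable d" "computable c d f" "computable c d g" shows "re c (\<lambda>x. f x = g x)"
proof -
  have "re_set X {n. dec1 n = dec2 n}" by (intro re_set_eq total_rec_intros)
  then have "re (d \<otimes> d) (\<lambda>p. fst p = snd p)"
    using assms(1) unfolding re_def enumerable_def
    by (intro exI[of _ "{n. dec1 n = dec2 n}"]) (auto simp: inj_eq enc_pair_def)
  from re_subst[OF this computable_Pair[OF assms(2,3)]] show ?thesis by simp
qed

text \<open>Codes are compared as numbers, so inequality is enumerable even where the set of all
  codes is not decidable.\<close>

lemma re_neq [re_intros]: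
  assumes "enumerable d" "computable c d f" "computable c d g" shows "re c (\<lambda>x. f x \<noteq> g x)"
proof -
  have "re_set X ({n. dec1 n < dec2 n} \<union> {n. dec2 n < dec1 n})"
    by (intro re_set_Un re_set_less total_rec_intros)
  then have "re (d \<otimes> d) (\<lambda>p. fst p \<noteq> snd p)"
    using assms(1) unfolding re_def enumerable_def
    by (intro exI[of _ "{n. dec1 n < dec2 n} \<union> {n. dec2 n < dec1 n}"])
      (auto simp: inj_eq enc_pair_def neq_iff[symmetric])
  from re_subst[OF this computable_Pair[OF assms(2,3)]] show ?thesis by simp
qed

text \<open>The usual way to a computable function. Intersecting with the range of \<open>d\<close>
  is essential, since \<open>computable\<close> forbids that any number other than the code of the
  value be related to the argument.\<close>

lemma computable_graph:
  assumes "enumerable d" "re (c \<otimes> d) (\<lambda>p. snd p = f (fst p))"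
  shows "computable c d f"
proof -
  obtain S where S: "re_set X S" "\<forall>p. snd p = f (fst p) \<longleftrightarrow> (c \<otimes> d) p \<in> S"
    using assms(2) unfolding re_def by blast
  have "re_set X (S \<inter> {k. dec2 k \<in> range d})"
    using assms(1) unfolding enumerable_def by (intro re_set_Int S re_set_vimage total_rec_intros) auto
  moreover have "prod_encode (c x, n) \<in> S \<inter> {k. dec2 k \<in> range d} \<longleftrightarrow> n = d (f x)" for x n
  proof -
    have "prod_encode (c x, d y) \<in> S \<longleftrightarrow> y = f x" for y
      using S(2)[rule_format, of "(x, y)"] by (simp add: enc_pair_def)
    then show ?thesis by auto
  qed
  ultimately show ?thesis unfolding computable_def by blast
qed

text \<open>The graph is a disjunction of two guarded branches, so the negation of the test must be
  enumerable as well.\<close>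

lemma computable_if [re_intros]:
  assumes "enumerable d" "re c P" "re c (\<lambda>x. \<not> P x)" "computable c d f" "computable c d g"
  shows "computable c d (\<lambda>x. if P x then f x else g x)"
proof (rule computable_graph[OF assms(1)])
  have "re (c \<otimes> d) (\<lambda>p. (P (fst p) \<and> snd p = f (fst p)) \<or> (\<not> P (fst p) \<and> snd p = g (fst p)))"
    by (rule re_conj re_disj re_eq[OF assms(1)] re_subst[OF assms(2)] re_subst[OF assms(3)]
        computable_comp[OF assms(4)] computable_comp[OF assms(5)] computable_fst computable_snd computable_id)+
  then show "re (c \<otimes> d) (\<lambda>p. snd p = (if P (fst p) then f (fst p) else g (fst p)))"
    by (rule re_cong) auto
qed

lemma re_not_less [re_intros]:
  assumes "computable c enc_nat f" "computable c enc_nat g" shows "re c (\<lambda>x. \<not> f x < g x)"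
proof -
  have "re_set X {n. dec2 n < Suc (dec1 n)}" by (intro re_set_less total_rec_intros)
  then have "re (enc_nat \<otimes> enc_nat) (\<lambda>p. \<not> fst p < snd p)"
    unfolding re_def
    by (intro exI[of _ "{n. dec2 n < Suc (dec1 n)}"]) (auto simp: enc_nat_def enc_pair_def)
  from re_subst[OF this computable_Pair[OF assms]] show ?thesis by simp
qed

lemma computable_Suc [re_intros]: "computable c enc_nat f \<Longrightarrow> computable c enc_nat (\<lambda>x. Suc (f x))"
  by (rule computable_map_recf[OF total_rec_Suc[OF total_rec_id], where g = Suc]) (simp_all add: enc_nat_def)

lemma computable_pred [re_intros]: "computable c enc_nat f \<Longrightarrow> computable c enc_nat (\<lambda>x. f x - 1)"
  by (rule computable_map_recf[OF total_rec_pred[OF total_rec_id], where g = "\<lambda>n. n - 1"]) (simp_all add: enc_nat_def)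

lemma computable_add [re_intros]:
  "computable c enc_nat f \<Longrightarrow> computable c enc_nat g \<Longrightarrow> computable c enc_nat (\<lambda>x. f x + g x)"
  by (rule computable_map2_recf[OF total_rec_add[OF total_rec_dec1[OF total_rec_id] total_rec_dec2[OF total_rec_id]], where g = "(+)"])
    (simp_all add: enc_nat_def)

lemma computable_mult [re_intros]:
  "computable c enc_nat f \<Longrightarrow> computable c enc_nat g \<Longrightarrow> computable c enc_nat (\<lambda>x. f x * g x)"
  by (rule computable_map2_recf[OF total_rec_mult[OF total_rec_dec1[OF total_rec_id] total_rec_dec2[OF total_rec_id]], where g = "(*)"])
    (simp_all add: enc_nat_def)

lemma computable_pow2 [re_intros]: "computable c enc_nat f \<Longrightarrow> computable c enc_nat (\<lambda>x. 2 ^ f x)"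
  by (rule computable_map_recf[OF total_rec_pow2[OF total_rec_id], where g = "\<lambda>n. 2 ^ n"]) (simp_all add: enc_nat_def)

lemma computable_Cons [re_intros]:
  "computable c d f \<Longrightarrow> computable c (enc_list d) g \<Longrightarrow> computable c (enc_list d) (\<lambda>x. f x # g x)"
  by (rule computable_map2_recf[OF total_rec_Suc[OF total_rec_id], where g = "(#)"]) (simp_all add: enc_list_def)

lemma computable_Inl [re_intros]: "computable c d f \<Longrightarrow> computable c (d \<oplus> e) (\<lambda>x. Inl (f x))"
  by (rule computable_map_recf[OF total_rec_pair[OF total_rec_const[of X 0] total_rec_id], where g = Inl])
    (simp_all add: enc_sum_def)

lemma computable_Inr [re_intros]: "computable c e f \<Longrightarrow> computable c (d \<oplus> e) (\<lambda>x. Inr (f x))"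
  by (rule computable_map_recf[OF total_rec_pair[OF total_rec_const[of X 1] total_rec_id], where g = Inr])
    (simp_all add: enc_sum_def)

lemma enumerable_nat [re_intros]: "enumerable enc_nat"
proof -
  have "range enc_nat = UNIV" by (auto simp: enc_nat_def)
  then show ?thesis
    unfolding enumerable_def using re_set_eq[OF total_rec_id total_rec_id, of X] by (simp add: inj_def enc_nat_def)
qed

lemma enumerable_pair [re_intros]:
  assumes "enumerable c" "enumerable d" shows "enumerable (c \<otimes> d)"
proof -
  have "range (c \<otimes> d) = {k. dec1 k \<in> range c} \<inter> {k. dec2 k \<in> range d}"
  proof (intro equalityI subsetI)
    fix k assume "k \<in> {k. dec1 k \<in> range c} \<inter> {k. dec2 k \<in> range d}"
    then obtain x y where "dec1 k = c x" "dec2 k = d y" by auto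
    then have "k = (c \<otimes> d) (x, y)"
      unfolding enc_pair_def by (metis fst_conv snd_conv prod.collapse prod_decode_inverse)
    then show "k \<in> range (c \<otimes> d)" by blast
  qed (auto simp: enc_pair_def)
  moreover have "re_set X ({k. dec1 k \<in> range c} \<inter> {k. dec2 k \<in> range d})"
    using assms unfolding enumerable_def by (intro re_set_Int re_set_vimage total_rec_intros) auto
  ultimately show ?thesis
    using assms unfolding enumerable_def by (auto simp: inj_def enc_pair_def)
qed

lemma enumerable_sum [re_intros]:
  assumes "enumerable c" "enumerable d" shows "enumerable (c \<oplus> d)"
proof -
  have "range (c \<oplus> d) = ({k. dec1 k = 0} \<inter> {k. dec2 k \<in> range c}) \<union>
      ({k. dec1 k = 1} \<inter> {k. dec2 k \<in> range d})" (is "_ = ?S")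
  proof (intro equalityI subsetI)
    fix k assume "k \<in> ?S"
    then obtain x y where "dec1 k = 0 \<and> dec2 k = c x \<or> dec1 k = 1 \<and> dec2 k = d y" by auto
    then have "k = (c \<oplus> d) (Inl x) \<or> k = (c \<oplus> d) (Inr y)"
      unfolding enc_sum_def by (metis sum.case prod.collapse prod_decode_inverse)
    then show "k \<in> range (c \<oplus> d)" by blast
  qed (auto simp: enc_sum_def split: sum.splits)
  moreover have "re_set X ?S"
    using assms unfolding enumerable_def
    by (intro re_set_Int re_set_Un re_set_eq re_set_vimage total_rec_intros) auto
  ultimately show ?thesis
    using assms unfolding enumerable_def by (auto simp: inj_def enc_sum_def split: sum.splits)
qed

text \<open>The codes of lists are generated by rules of their own, with tag 0 for codes of elements
  and tag 1 for codes of lists. \<open>list_closure\<close> is used directly here because the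
  general principle \<open>re_lfp\<close> already presupposes that premise lists can be
  enumerated.\<close>

lemma enumerable_list [re_intros]:
  assumes "enumerable c" shows "enumerable (enc_list c)"
proof -
  have inj: "inj c" and ran: "re_set X (range c)" using assms unfolding enumerable_def by auto
  \<comment> \<open>The third set is the rule for \<open>x # l\<close>: the nested successors spell
    out \<open>list_encode [prod_encode (0, x), prod_encode (1, l)]\<close>, the premise list, with
    \<open>x\<close> and \<open>l\<close> taken from one quantified pair.\<close>
  define St where "St =
     ({m. dec1 (dec1 m) = 0} \<inter> {m. dec2 m = 0} \<inter> {m. dec2 (dec1 m) \<in> range c}) \<union>
     ({m. dec1 m = prod_encode (1, 0)} \<inter> {m. dec2 m = 0}) \<union>
     {m. \<exists>k. prod_encode (m, k) \<in> {j. dec1 j = prod_encode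
       (prod_encode (1, Suc (prod_encode (dec1 (dec2 j), dec2 (dec2 j)))),
        Suc (prod_encode (prod_encode (0, dec1 (dec2 j)), Suc (prod_encode (prod_encode (1, dec2 (dec2 j)), 0)))))}}"
  have "re_set X St"
    unfolding St_def by (intro re_set_Un re_set_Int re_set_ex re_set_eq re_set_vimage[OF ran] total_rec_intros)
  note closure = re_set_list_closure[OF this]
  have sound: "case prod_decode m of (t, n) \<Rightarrow>
      (t = 0 \<longrightarrow> n \<in> range c) \<and> (t = 1 \<longrightarrow> n \<in> range (enc_list c))"
    if "list_closure St m" for m
    using that
  proof induction
    case (1 n ps)
    obtain t k where n: "n = prod_encode (t, k)" by (metis prod.collapse prod_decode_inverse)
    from 1(1) consider
        "t = 0" "k \<in> range c"
      | "t = 1" "k = 0"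
      | x l where "t = 1" "k = Suc (prod_encode (x, l))"
          "list_encode ps = list_encode [prod_encode (0, x), prod_encode (1, l)]"
    proof -
      assume cases: "t = 0 \<Longrightarrow> k \<in> range c \<Longrightarrow> thesis" "t = 1 \<Longrightarrow> k = 0 \<Longrightarrow> thesis"
        "\<And>x l. t = 1 \<Longrightarrow> k = Suc (prod_encode (x, l)) \<Longrightarrow>
          list_encode ps = list_encode [prod_encode (0, x), prod_encode (1, l)] \<Longrightarrow> thesis"
      show thesis
        using 1(1) cases(1,2) cases(3)[of "dec1 j" "dec2 j" for j] by (auto simp: St_def n)
    qed
    then show ?case
    proof cases
      case 2
      then show ?thesis by (auto simp: n enc_list_def intro!: image_eqI[of _ _ "[]"])
    next
      case 3
      have ps: "ps = [prod_encode (0, x), prod_encode (1, l)]" using 3(3) unfolding list_encode_eq .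
      with 1(2) obtain y ys where "x = c y" "l = enc_list c ys" by auto
      then have "k = enc_list c (y # ys)" using 3 by (simp add: enc_list_def)
      then show ?thesis using 3 by (auto simp: n)
    qed (simp add: n)
  qed
  have "list_closure St (prod_encode (0, c x))" for x
    by (rule list_closure.intros[of _ "[]"]) (auto simp: St_def)
  then have complete: "list_closure St (prod_encode (1, enc_list c xs))" for xs
  proof (induction xs)
    case Nil
    show ?case by (rule list_closure.intros[of _ "[]"]) (auto simp: St_def enc_list_def)
  next
    case (Cons x xs)
    have "dec1 (prod_encode (c x, enc_list c xs)) = c x" "dec2 (prod_encode (c x, enc_list c xs)) = enc_list c xs"
      by simp_all
    show ?case
      by (rule list_closure.intros[of _ "[prod_encode (0, c x), prod_encode (1, enc_list c xs)]"])
        (use Cons in \<open>auto simp: St_def enc_list_def intro!: exI[of _ "prod_encode (c x, list_encode (map c xs))"]\<close>)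
  qed
  have "range (enc_list c) = {n. prod_encode (1, n) \<in> Collect (list_closure St)}"
    using sound complete by (fastforce split: prod.splits)
  moreover have "re_set X {n. prod_encode (1, n) \<in> Collect (list_closure St)}"
    by (intro re_set_vimage[OF closure] total_rec_intros)
  moreover have "inj (enc_list c)"
    using inj by (auto simp: inj_def enc_list_def list_encode_eq intro: list.inj_map_strong)
  ultimately show ?thesis unfolding enumerable_def by simp
qed

text \<open>\<open>closed\<close> and \<open>least\<close> express that \<open>P\<close> is the
  least predicate closed under \<open>Step\<close>. Stating them in place of an inductive definition
  lets graphs of recursive functions and membership in the range of a coding be treated in the same
  way as derivability.\<close>

lemma re_lfp:
  assumes "enumerable c" "re (c \<otimes> enc_list c) (\<lambda>p. Step (fst p) (snd p))"
    and closed: "\<And>x ps. Step x ps \<Longrightarrow> (\<And>p. p \<in> set ps \<Longrightarrow> P p) \<Longrightarrow> P x"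
    and least: "\<And>x Q. P x \<Longrightarrow> (\<And>x ps. Step x ps \<Longrightarrow> (\<And>p. p \<in> set ps \<Longrightarrow> Q p) \<Longrightarrow> Q x) \<Longrightarrow> Q x"
  shows "re c P"
proof -
  have gen: "enumerable (c \<otimes> enc_list c)" by (intro enumerable_pair enumerable_list assms(1))
  obtain S where S: "re_set X S" "\<And>p. Step (fst p) (snd p) \<longleftrightarrow> (c \<otimes> enc_list c) p \<in> S"
    using assms(2) unfolding re_def by blast
  \<comment> \<open>Only numbers that really code a conclusion with a premise list are kept, so that
    every step on codes can be decoded to a step of \<open>Step\<close>.\<close>
  define St where "St = S \<inter> range (c \<otimes> enc_list c)"
  have "re_set X St" using S(1) gen unfolding St_def enumerable_def by (intro re_set_Int) auto
  note closure = re_set_list_closure[OF this]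
  have inj: "inj c" "inj (c \<otimes> enc_list c)" using assms(1) gen unfolding enumerable_def by auto
  have St: "prod_encode (n, list_encode ns) \<in> St \<longleftrightarrow> (\<exists>x ps. n = c x \<and> ns = map c ps \<and> Step x ps)"
    for n ns
  proof
    assume "prod_encode (n, list_encode ns) \<in> St"
    then obtain x ps where "n = c x" "list_encode ns = enc_list c ps" "prod_encode (n, list_encode ns) \<in> S"
      by (auto simp: St_def enc_pair_def)
    then show "\<exists>x ps. n = c x \<and> ns = map c ps \<and> Step x ps"
      using S(2)[of "(x, ps)"] by (auto simp: enc_pair_def enc_list_def list_encode_eq)
  next
    assume "\<exists>x ps. n = c x \<and> ns = map c ps \<and> Step x ps"
    then obtain x ps where *: "n = c x" "ns = map c ps" "Step x ps" by blast
    then have "prod_encode (n, list_encode ns) = (c \<otimes> enc_list c) (x, ps)"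
      by (simp add: enc_pair_def enc_list_def)
    then show "prod_encode (n, list_encode ns) \<in> St" using S(2)[of "(x, ps)"] * by (simp add: St_def)
  qed
  have "\<exists>x. n = c x \<and> P x" if "list_closure St n" for n
    using that
  proof induction
    case (1 n ns)
    then obtain x ps where x: "n = c x" "ns = map c ps" "Step x ps" using St by blast
    have "P p" if "p \<in> set ps" for p using 1(2) that x(2) inj(1) by (auto simp: inj_eq)
    then show ?case using x closed by blast
  qed
  moreover have "list_closure St (c x)" if "P x" for x
    using that
  proof (rule least)
    fix x ps assume "Step x ps" "\<And>p. p \<in> set ps \<Longrightarrow> list_closure St (c p)"
    then show "list_closure St (c x)"
      by (intro list_closure.intros[of _ "map c ps"]) (auto simp: St)
  qed
  ultimately show ?thesis
    unfolding re_def using closure inj(1)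
    by (intro exI[of _ "Collect (list_closure St)"]) (auto dest: injD)
qed



section \<open>Lists, folds and well-founded recursion\<close>

lemma re_list_all [re_intros]:
  assumes "enumerable c" "enumerable d" "re (c \<otimes> d) (\<lambda>p. P (fst p) (snd p))" "computable c (enc_list d) xs"
  shows "re c (\<lambda>e. \<forall>x \<in> set (xs e). P e x)"
proof -
  have "re (c \<otimes> enc_list d) (\<lambda>p. \<forall>x \<in> set (snd p). P (fst p) x)"
  proof (rule re_lfp)
    show "re ((c \<otimes> enc_list d) \<otimes> enc_list (c \<otimes> enc_list d)) (\<lambda>q.
        (\<lambda>p ps. snd p = [] \<and> ps = [] \<or>
          (\<exists>y ys. snd p = y # ys \<and> P (fst p) y \<and> ps = [(fst p, ys)])) (fst q) (snd q))"
      by (rule re_app2[OF assms(3)] assms(1,2) re_intros)+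
  next
    fix x Q
    assume x: "\<forall>y \<in> set (snd x). P (fst x) y"
      and Q: "\<And>p ps. snd p = [] \<and> ps = [] \<or>
          (\<exists>y ys. snd p = y # ys \<and> P (fst p) y \<and> ps = [(fst p, ys)]) \<Longrightarrow> (\<And>p. p \<in> set ps \<Longrightarrow> Q p) \<Longrightarrow> Q p"
    have "Q (e, ys)" if "\<forall>y \<in> set ys. P e y" for e ys
      using that
    proof (induction ys)
      case Nil
      show ?case by (rule Q[of _ "[]"]) simp_all
    next
      case (Cons y ys)
      then have "Q (e, ys)" by simp
      with Cons.prems show ?case by - (rule Q[of _ "[(e, ys)]"], simp_all)
    qed
    from this[OF x] show "Q x" by simp
  qed (rule enumerable_pair enumerable_list assms(1-3) | auto)+
  from re_app2[OF this computable_id assms(4)] show ?thesis .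
qed

text \<open>The graph, with the parameter \<open>e\<close> carried along, is the least relation
  closed under the two recursion equations of \<open>foldr\<close>. Other operations on lists are
  then written as folds.\<close>

lemma computable_foldr:
  assumes "enumerable c" "enumerable a" "enumerable b"
    and g: "computable (c \<otimes> a \<otimes> b) b (\<lambda>p. g (fst p) (fst (snd p)) (snd (snd p)))"
    and xs: "computable c (enc_list a) xs" and z: "computable c b z"
  shows "computable c b (\<lambda>e. foldr (g e) (xs e) (z e))"
proof -
  have "re (c \<otimes> enc_list a \<otimes> b) (\<lambda>p. snd (snd p) = foldr (g (fst p)) (fst (snd p)) (z (fst p)))"
  proof (rule re_lfp)
    show "re ((c \<otimes> enc_list a \<otimes> b) \<otimes> enc_list (c \<otimes> enc_list a \<otimes> b)) (\<lambda>q.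
        (\<lambda>p ps. fst (snd p) = [] \<and> snd (snd p) = z (fst p) \<and> ps = [] \<or>
          (\<exists>y ys r. fst (snd p) = y # ys \<and> snd (snd p) = g (fst p) y r \<and> ps = [(fst p, ys, r)]))
        (fst q) (snd q))"
      by (rule computable_comp[OF z] computable_app3[OF g] assms(1-3) re_intros)+
  next
    fix x Q
    assume x: "snd (snd x) = foldr (g (fst x)) (fst (snd x)) (z (fst x))"
      and Q: "\<And>p ps. fst (snd p) = [] \<and> snd (snd p) = z (fst p) \<and> ps = [] \<or>
          (\<exists>y ys r. fst (snd p) = y # ys \<and> snd (snd p) = g (fst p) y r \<and> ps = [(fst p, ys, r)]) \<Longrightarrow>
          (\<And>p. p \<in> set ps \<Longrightarrow> Q p) \<Longrightarrow> Q p"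
    have "Q (e, ys, foldr (g e) ys (z e))" for e ys
    proof (induction ys)
      case Nil
      show ?case by (rule Q[of _ "[]"]) simp_all
    next
      case (Cons y ys)
      then show ?case by - (rule Q[of _ "[(e, ys, foldr (g e) ys (z e))]"], simp_all)
    qed
    from this[of "fst x" "fst (snd x)"] show "Q x" unfolding x[symmetric] by simp
  qed (rule enumerable_pair enumerable_list assms(1-3) | auto)+
  then have "re ((c \<otimes> enc_list a) \<otimes> b) (\<lambda>q. snd q = foldr (g (fst (fst q))) (snd (fst q)) (z (fst (fst q))))"
    by (rule re_app3[where P = "\<lambda>e ys r. r = foldr (g e) ys (z e)"]) (rule re_intros)+
  then have "computable (c \<otimes> enc_list a) b (\<lambda>p. foldr (g (fst p)) (snd p) (z (fst p)))"
    by (rule computable_graph[OF assms(3)])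
  from computable_app2[OF this computable_id xs] show ?thesis .
qed

lemma computable_map [re_intros]:
  assumes "enumerable c" "enumerable a" "enumerable b"
    and f: "computable (c \<otimes> a) b (\<lambda>p. f (fst p) (snd p))" and xs: "computable c (enc_list a) xs"
  shows "computable c (enc_list b) (\<lambda>e. map (f e) (xs e))"
proof -
  have "computable c (enc_list b) (\<lambda>e. foldr ((\<lambda>e y r. f e y # r) e) (xs e) [])"
    by (rule computable_foldr computable_app2[OF f] xs assms(1-3) re_intros)+
  moreover have "foldr (\<lambda>y r. f e y # r) ys [] = map (f e) ys" for e ys by (induction ys) auto
  ultimately show ?thesis by simp
qed

lemma computable_append [re_intros]:
  fixes xs :: "'e \<Rightarrow> 'a list"
  assumes "enumerable c" "enumerable a" "computable c (enc_list a) xs" "computable c (enc_list a) ys"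
  shows "computable c (enc_list a) (\<lambda>e. xs e @ ys e)"
proof -
  have "computable c (enc_list a) (\<lambda>e. foldr ((\<lambda>_. (#)) e) (xs e) (ys e))"
    by (rule computable_foldr[where g = "\<lambda>_. (#)"] assms re_intros)+
  moreover have "foldr (#) us vs = us @ vs" for us vs :: "'a list" by (induction us) auto
  ultimately show ?thesis by simp
qed

lemma computable_length [re_intros]:
  fixes xs :: "'e \<Rightarrow> 'a list"
  assumes "enumerable c" "enumerable a" "computable c (enc_list a) xs"
  shows "computable c enc_nat (\<lambda>e. length (xs e))"
proof -
  have "computable c enc_nat (\<lambda>e. foldr ((\<lambda>_ _. Suc) e) (xs e) 0)"
    by (rule computable_foldr[where g = "\<lambda>_ _. Suc"] assms re_intros)+
  moreover have "foldr (\<lambda>_. Suc) us 0 = length us" for us :: "'a list" by (induction us) auto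
  ultimately show ?thesis by simp
qed

lemma computable_case_list [re_intros]:
  assumes "enumerable d" "enumerable a" "computable c (enc_list a) xs" "computable c d f"
    "computable (c \<otimes> a \<otimes> enc_list a) d (\<lambda>p. g (fst p) (fst (snd p)) (snd (snd p)))"
  shows "computable c d (\<lambda>e. case xs e of [] \<Rightarrow> f e | y # ys \<Rightarrow> g e y ys)"
proof (rule computable_graph[OF assms(1)])
  have "re (c \<otimes> d) (\<lambda>p. xs (fst p) = [] \<and> snd p = f (fst p) \<or>
      (\<exists>y ys. xs (fst p) = y # ys \<and> snd p = g (fst p) y ys))"
    by (rule computable_app3[OF assms(5)] computable_comp[OF assms(3)] computable_comp[OF assms(4)] assms(1,2) re_intros)+
  then show "re (c \<otimes> d) (\<lambda>p. snd p = (case xs (fst p) of [] \<Rightarrow> f (fst p) | y # ys \<Rightarrow> g (fst p) y ys))"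
    by (rule re_cong) (auto split: list.splits)
qed

lemma computable_case_sum [re_intros]:
  assumes "enumerable d" "enumerable a" "enumerable b" "computable c (a \<oplus> b) s"
    "computable (c \<otimes> a) d (\<lambda>p. f (fst p) (snd p))" "computable (c \<otimes> b) d (\<lambda>p. g (fst p) (snd p))"
  shows "computable c d (\<lambda>e. case s e of Inl x \<Rightarrow> f e x | Inr y \<Rightarrow> g e y)"
proof (rule computable_graph[OF assms(1)])
  have "re (c \<otimes> d) (\<lambda>p. (\<exists>x. s (fst p) = Inl x \<and> snd p = f (fst p) x) \<or>
      (\<exists>y. s (fst p) = Inr y \<and> snd p = g (fst p) y))"
    by (rule computable_app2[OF assms(5)] computable_app2[OF assms(6)] computable_comp[OF assms(4)] assms(1-3) re_intros)+
  then show "re (c \<otimes> d) (\<lambda>p. snd p = (case s (fst p) of Inl x \<Rightarrow> f (fst p) x | Inr y \<Rightarrow> g (fst p) y))"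
    by (rule re_cong) (auto split: sum.splits)
qed

text \<open>The arguments of the recursive calls are given by a relation and not by a function,
  because the elements of a finite set may be listed in many ways; the recursion equation has to
  hold for every admissible listing, and at least one must exist.\<close>

lemma computable_rec:
  fixes m :: "'a \<Rightarrow> nat"
  assumes "enumerable c" "enumerable d"
    and deps: "re (c \<otimes> enc_list c) (\<lambda>p. deps (fst p) (snd p))"
    and h: "computable (c \<otimes> enc_list d) d (\<lambda>p. h (fst p) (snd p))"
    and ex: "\<And>x. \<exists>ys. deps x ys"
    and f: "\<And>x ys. deps x ys \<Longrightarrow> f x = h x (map f ys)"
    and m: "\<And>x ys y. deps x ys \<Longrightarrow> y \<in> set ys \<Longrightarrow> m y < m x"
  shows "computable c d f"
proof (rule computable_graph[OF assms(2)], rule re_lfp)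
  show "re ((c \<otimes> d) \<otimes> enc_list (c \<otimes> d)) (\<lambda>q.
      (\<lambda>p ps. deps (fst p) (map fst ps) \<and> snd p = h (fst p) (map snd ps)) (fst q) (snd q))"
    by (rule re_app2[OF deps] computable_app2[OF h] assms(1,2) re_intros)+
next
  fix x ps
  assume ps: "deps (fst x) (map fst ps) \<and> snd x = h (fst x) (map snd ps)"
    and "\<And>p. p \<in> set ps \<Longrightarrow> snd p = f (fst p)"
  from this(2) have "map snd ps = map f (map fst ps)" by simp
  then show "snd x = f (fst x)" using f[of "fst x" "map fst ps"] ps by (simp del: map_map map_eq_conv)
next
  fix x Q
  assume x: "snd x = f (fst x)"
    and Q: "\<And>x ps. deps (fst x) (map fst ps) \<and> snd x = h (fst x) (map snd ps) \<Longrightarrow>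
        (\<And>p. p \<in> set ps \<Longrightarrow> Q p) \<Longrightarrow> Q x"
  \<comment> \<open>The measure enters here: well-foundedness puts every point of the graph of
    \<open>f\<close> into the least fixed point.\<close>
  have "Q (y, f y)" for y
  proof (induction "m y" arbitrary: y rule: less_induct)
    case less
    obtain ys where ys: "deps y ys" using ex by blast
    show ?case
    proof (rule Q[of _ "map (\<lambda>z. (z, f z)) ys"])
      show "deps (fst (y, f y)) (map fst (map (\<lambda>z. (z, f z)) ys)) \<and>
          snd (y, f y) = h (fst (y, f y)) (map snd (map (\<lambda>z. (z, f z)) ys))"
        using ys f[OF ys] by (simp add: comp_def)
    qed (use m[OF ys] less in auto)
  qed
  from this[of "fst x"] show "Q x" unfolding x[symmetric] by simp
qed (rule enumerable_pair assms(1,2))+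

lemma computable_rec_fun:
  fixes m :: "'a \<Rightarrow> nat"
  assumes "enumerable c" "enumerable d" "computable c (enc_list c) deps"
    and h: "computable (c \<otimes> enc_list d) d (\<lambda>p. h (fst p) (snd p))"
    and f: "\<And>x. f x = h x (map f (deps x))"
    and m: "\<And>x y. y \<in> set (deps x) \<Longrightarrow> m y < m x"
  shows "computable c d f"
proof (rule computable_rec[where deps = "\<lambda>x ys. ys = deps x" and m = m and h = h])
  show "re (c \<otimes> enc_list c) (\<lambda>p. snd p = deps (fst p))"
    by (rule re_intros computable_comp[OF assms(3)] assms(1,2))+
  show "f x = h x (map f ys)" if "ys = deps x" for x ys using f[of x] that by simp
qed (auto intro: assms(1,2) h m)

section \<open>Finite sets as binary numbers\<close>

text \<open>Membership of \<open>n\<close> in \<open>set_decode k\<close> is oddness of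
  \<open>k div 2 ^ n\<close>. It and its negation are restated with sums, products and powers, for
  which closure rules are at hand.\<close>

lemma odd_div_pow2_iff:
  "odd (k div 2 ^ n) \<longleftrightarrow> (\<exists>q r. r < 2 ^ n \<and> k = (2 * q + 1) * 2 ^ n + r)" for k n :: nat
proof
  assume "odd (k div 2 ^ n)"
  then obtain q where "k div 2 ^ n = 2 * q + 1" by (rule oddE)
  then show "\<exists>q r. r < 2 ^ n \<and> k = (2 * q + 1) * 2 ^ n + r"
    by (intro exI[of _ q] exI[of _ "k mod 2 ^ n"])
      (use div_mult_mod_eq[of k "2 ^ n"] in simp)
next
  assume "\<exists>q r. r < 2 ^ n \<and> k = (2 * q + 1) * 2 ^ n + r"
  then obtain q r where "r < 2 ^ n" "k = r + (2 * q + 1) * 2 ^ n" by (metis add.commute)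
  then have "k div 2 ^ n = 2 * q + 1" by (simp only: div_mult_self1) simp
  then show "odd (k div 2 ^ n)" by simp
qed

lemma even_div_pow2_iff:
  "even (k div 2 ^ n) \<longleftrightarrow> (\<exists>q r. r < 2 ^ n \<and> k = (2 * q) * 2 ^ n + r)" for k n :: nat
proof
  assume "even (k div 2 ^ n)"
  then obtain q where "k div 2 ^ n = 2 * q" by (rule evenE)
  then show "\<exists>q r. r < 2 ^ n \<and> k = (2 * q) * 2 ^ n + r"
    by (intro exI[of _ q] exI[of _ "k mod 2 ^ n"])
      (use div_mult_mod_eq[of k "2 ^ n"] in simp)
qed auto

lemma re_in_set_decode:
  assumes "computable c enc_nat f" "computable c enc_nat g"
  shows "re c (\<lambda>x. f x \<in> set_decode (g x))" "re c (\<lambda>x. f x \<notin> set_decode (g x))"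
proof -
  show "re c (\<lambda>x. f x \<in> set_decode (g x))"
    unfolding set_decode_def mem_Collect_eq odd_div_pow2_iff
    by (rule re_intros computable_comp[OF assms(1)] computable_comp[OF assms(2)])+
  show "re c (\<lambda>x. f x \<notin> set_decode (g x))"
    unfolding set_decode_def mem_Collect_eq not_not even_div_pow2_iff
    by (rule re_intros computable_comp[OF assms(1)] computable_comp[OF assms(2)])+
qed

lemma computable_set_encode_insert:
  assumes "computable c enc_nat f" "computable c enc_nat g"
  shows "computable c enc_nat (\<lambda>x. set_encode (insert (f x) (set_decode (g x))))"
proof -
  have "computable c enc_nat (\<lambda>x. if f x \<in> set_decode (g x) then g x else g x + 2 ^ f x)"
    by (rule re_intros re_in_set_decode assms)+
  moreover have "set_encode (insert n (set_decode k)) = (if n \<in> set_decode k then k else k + 2 ^ n)" for n k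
    by (auto simp: insert_absorb)
  ultimately show ?thesis by simp
qed

lemma computable_set_encode_set: "computable (enc_list enc_nat) enc_nat (\<lambda>ns. set_encode (set ns))"
proof -
  have "computable (enc_list enc_nat) enc_nat (\<lambda>ns. foldr ((\<lambda>_ n k. set_encode (insert n (set_decode k))) ns) ns 0)"
    by (rule computable_foldr computable_set_encode_insert re_intros)+
  moreover have "foldr (\<lambda>n k. set_encode (insert n (set_decode k))) ns 0 = set_encode (set ns)" for ns
    by (induction ns) auto
  ultimately show ?thesis by simp
qed

lemma re_enc_nat: "re enc_nat P \<Longrightarrow> re_set X (Collect P)"
  unfolding re_def enc_nat_def by (metis Collect_cong Collect_mem_eq)

lemma enc_list_enc_nat: "enc_list enc_nat ns = list_encode ns"
  by (simp add: enc_list_def enc_nat_def map_idI)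

lemma enumerable_fset [re_intros]:
  assumes "enumerable c" shows "enumerable (enc_fset c)"
proof -
  have l: "re_set X (range (enc_list c))" and inj: "inj c"
    using enumerable_list[OF assms] assms unfolding enumerable_def by auto
  have "computable (enc_list enc_nat) enc_nat list_encode"
    by (rule computable_recf[OF total_rec_id]) (simp add: enc_list_enc_nat enc_nat_def)
  note le = computable_comp[OF this]
  have "re enc_nat (\<lambda>k. \<exists>ns. list_encode ns \<in> range (enc_list c) \<and> k = set_encode (set ns))"
    by (rule re_recf_reset[OF l] le computable_comp[OF computable_set_encode_set] re_intros)+
  moreover have "(\<exists>ns. list_encode ns \<in> range (enc_list c) \<and> k = set_encode (set ns)) \<longleftrightarrow>
      k \<in> range (enc_fset c)" for k
  proof
    assume "\<exists>ns. list_encode ns \<in> range (enc_list c) \<and> k = set_encode (set ns)"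
    then obtain xs where "k = set_encode (set (map c xs))"
      by (auto simp: enc_list_def list_encode_eq)
    then have "k = enc_fset c (fset_of_list xs)" by (simp add: enc_fset_def fset_of_list.rep_eq)
    then show "k \<in> range (enc_fset c)" by blast
  next
    assume "k \<in> range (enc_fset c)"
    then obtain \<alpha> where k: "k = set_encode (c ` fset \<alpha>)" by (auto simp: enc_fset_def)
    obtain xs where "fset_of_list xs = \<alpha>" by (metis exists_fset_of_list)
    then have "k = set_encode (set (map c xs))" using k by (auto simp: fset_of_list.rep_eq)
    then show "\<exists>ns. list_encode ns \<in> range (enc_list c) \<and> k = set_encode (set ns)"
      by (intro exI[of _ "map c xs"]) (auto simp: enc_list_def)
  qed
  ultimately have "re_set X {k. k \<in> range (enc_fset c)}" by (intro re_enc_nat) simp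
  moreover have "inj (enc_fset c)"
    using inj by (auto simp: inj_def enc_fset_def set_encode_eq inj_image_eq_iff fset_inject)
  ultimately show ?thesis unfolding enumerable_def by simp
qed

lemma computable_fset_of_list [re_intros]:
  "computable c (enc_list d) xs \<Longrightarrow> computable c (enc_fset d) (\<lambda>x. fset_of_list (xs x))"
proof (rule computable_comp[where g = fset_of_list])
  obtain S where S: "re_set X S" "\<forall>ns n. prod_encode (enc_list enc_nat ns, n) \<in> S \<longleftrightarrow>
      n = enc_nat (set_encode (set ns))"
    using computable_set_encode_set unfolding computable_def by blast
  have "prod_encode (enc_list d xs, n) \<in> S \<longleftrightarrow> n = enc_fset d (fset_of_list xs)" for xs n
    using S(2)[rule_format, of "map d xs" n]
    unfolding enc_list_enc_nat by (simp add: enc_list_def enc_nat_def enc_fset_def fset_of_list.rep_eq)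
  then show "computable (enc_list d) (enc_fset d) fset_of_list" unfolding computable_def using S(1) by blast
qed

lemma computable_finsert [re_intros]:
  assumes "computable c d f" "computable c (enc_fset d) g"
  shows "computable c (enc_fset d) (\<lambda>x. finsert (f x) (g x))"
proof (rule computable_app2[OF _ assms])
  have "computable (enc_nat \<otimes> enc_nat) enc_nat (\<lambda>p. set_encode (insert (fst p) (set_decode (snd p))))"
    by (rule computable_set_encode_insert re_intros)+
  then obtain S where S: "re_set X S" "\<forall>p n. prod_encode ((enc_nat \<otimes> enc_nat) p, n) \<in> S \<longleftrightarrow>
      n = enc_nat (set_encode (insert (fst p) (set_decode (snd p))))"
    unfolding computable_def by blast
  have "prod_encode ((d \<otimes> enc_fset d) p, n) \<in> S \<longleftrightarrow> n = enc_fset d (finsert (fst p) (snd p))" for p n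
    using S(2)[rule_format, of "(d (fst p), enc_fset d (snd p))" n]
    by (simp add: enc_pair_def enc_nat_def enc_fset_def)
  then show "computable (d \<otimes> enc_fset d) (enc_fset d) (\<lambda>p. finsert (fst p) (snd p))"
    unfolding computable_def using S(1) by blast
qed

text \<open>A function on finite sets is computed by folding over any list of the elements. The last
  assumption holds for all lists, so the result depends neither on order nor on repetitions.\<close>

lemma computable_fset_foldr:
  assumes "enumerable c" "enumerable a" "enumerable b"
    and g: "computable (c \<otimes> a \<otimes> b) b (\<lambda>p. g (fst p) (fst (snd p)) (snd (snd p)))"
    and \<alpha>: "computable c (enc_fset a) \<alpha>" and z: "computable c b z"
    and f: "\<And>e xs. f e (fset_of_list xs) = foldr (g e) xs (z e)"
  shows "computable c b (\<lambda>e. f e (\<alpha> e))"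
proof (rule computable_graph[OF assms(3)])
  have "computable (c \<otimes> enc_list a) b (\<lambda>p. foldr ((\<lambda>q. g (fst q)) p) (snd p) ((\<lambda>q. z (fst q)) p))"
    by (rule computable_foldr computable_app3[OF g] computable_comp[OF z] assms(1-3) re_intros)+
  note fold = computable_app2[OF this[simplified]]
  have "re (c \<otimes> b) (\<lambda>p. \<exists>xs. \<alpha> (fst p) = fset_of_list xs \<and>
      snd p = foldr (g (fst p)) xs (z (fst p)))"
    by (rule fold computable_comp[OF \<alpha>] assms(1-3) re_intros)+
  moreover have "snd p = f (fst p) (\<alpha> (fst p)) \<longleftrightarrow> (\<exists>xs. \<alpha> (fst p) = fset_of_list xs \<and>
      snd p = foldr (g (fst p)) xs (z (fst p)))" for p
    using exists_fset_of_list[of "\<alpha> (fst p)"] f by metis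
  ultimately show "re (c \<otimes> b) (\<lambda>p. snd p = f (fst p) (\<alpha> (fst p)))" by (rule re_cong)
qed

lemma computable_funion [re_intros]:
  assumes "enumerable c" "enumerable a" "computable c (enc_fset a) \<alpha>" "computable c (enc_fset a) \<beta>"
  shows "computable c (enc_fset a) (\<lambda>e. \<alpha> e |\<union>| \<beta> e)"
proof (rule computable_fset_foldr[where g = "\<lambda>_. finsert" and z = \<beta> and f = "\<lambda>e \<alpha>. \<alpha> |\<union>| \<beta> e"])
  show "fset_of_list xs |\<union>| \<beta> e = foldr finsert xs (\<beta> e)" for e xs by (induction xs) auto
qed (rule assms re_intros)+

lemma computable_ffUnion_image [re_intros]:
  assumes "enumerable c" "enumerable a" "enumerable b" "computable (c \<otimes> a) (enc_fset b) (\<lambda>p. f (fst p) (snd p))"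
    "computable c (enc_fset a) \<alpha>"
  shows "computable c (enc_fset b) (\<lambda>e. ffUnion ((\<lambda>x. f e x) |`| \<alpha> e))"
proof (rule computable_fset_foldr[where g = "\<lambda>e x r. f e x |\<union>| r" and z = "\<lambda>_. {||}"
      and f = "\<lambda>e \<alpha>. ffUnion (f e |`| \<alpha>)"])
  show "ffUnion (f e |`| fset_of_list xs) = foldr (\<lambda>x. (|\<union>|) (f e x)) xs {||}" for e xs
    by (induction xs) auto
qed (rule assms re_intros computable_app2[OF assms(4)])+

text \<open>Provides the freshness conditions of the abstraction rules, which are negative.\<close>

lemma re_not_fmember [re_intros]:
  assumes "enumerable d" "computable c d f" "computable c (enc_fset d) g"
  shows "re c (\<lambda>x. f x |\<notin>| g x)"
proof (rule re_app2[OF _ assms(2,3)])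
  have "re (enc_nat \<otimes> enc_nat) (\<lambda>p. fst p \<notin> set_decode (snd p))"
    by (rule re_in_set_decode re_intros)+
  then obtain S where S: "re_set X S" "\<forall>p. (fst p \<notin> set_decode (snd p)) \<longleftrightarrow> (enc_nat \<otimes> enc_nat) p \<in> S"
    unfolding re_def by blast
  have "fst p |\<notin>| snd p \<longleftrightarrow> (d \<otimes> enc_fset d) p \<in> S" for p
    using S(2)[rule_format, of "(d (fst p), enc_fset d (snd p))"] assms(1)
    by (simp add: enc_pair_def enc_nat_def enc_fset_def enumerable_def inj_image_mem_iff)
  then show "re (d \<otimes> enc_fset d) (\<lambda>p. fst p |\<notin>| snd p)" unfolding re_def using S(1) by blast
qed

lemma re_fsubset [re_intros]:
  assumes "enumerable c" "enumerable d" "computable c (enc_fset d) f" "computable c (enc_fset d) g"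
  shows "re c (\<lambda>x. f x |\<subseteq>| g x)"
proof -
  have "re c (\<lambda>x. f x |\<union>| g x = g x)" by (rule re_intros assms)+
  then show ?thesis by (rule re_cong) auto
qed

lemma re_fBall [re_intros]:
  assumes "enumerable c" "enumerable d" "re (c \<otimes> d) (\<lambda>p. P (fst p) (snd p))" "computable c (enc_fset d) \<alpha>"
  shows "re c (\<lambda>e. \<forall>x \<in> fset (\<alpha> e). P e x)"
proof -
  have "re c (\<lambda>e. \<exists>xs. \<alpha> e = fset_of_list xs \<and> (\<forall>x \<in> set xs. P e x))"
    by (rule re_intros computable_comp[OF assms(4)] re_app2[OF assms(3)] assms)+
  moreover have "(\<forall>x \<in> fset (\<alpha> e). P e x) \<longleftrightarrow> (\<exists>xs. \<alpha> e = fset_of_list xs \<and> (\<forall>x \<in> set xs. P e x))" for e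
    using exists_fset_of_list[of "\<alpha> e"] by (metis fset_of_list.rep_eq)
  ultimately show ?thesis by (rule re_cong)
qed

end

section \<open>Numbering of the raw syntax\<close>

definition enc_cls :: "cls \<Rightarrow> nat" where
  "enc_cls c = (case c of Ty \<Rightarrow> 0 | Tm \<Rightarrow> 1 | EqTy \<Rightarrow> 2 | EqTm \<Rightarrow> 3)"

lemma code_inject:
  fixes \<nu> :: "'s \<Rightarrow> nat"
  assumes "inj \<nu>"
  shows "code e \<nu> = code e' \<nu> \<longleftrightarrow> e = e'"
    and "code_assm x \<nu> = code_assm x' \<nu> \<longleftrightarrow> x = x'"
    and "code_bdry \<B> \<nu> = code_bdry \<B>' \<nu> \<longleftrightarrow> \<B> = \<B>'"
proof -
  have maps: "map (\<lambda>e. code e \<nu>) es = map (\<lambda>e. code e \<nu>) es' \<longleftrightarrow> es = es'"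
    if "\<And>e e'. e \<in> set es \<Longrightarrow> code e \<nu> = code e' \<nu> \<longleftrightarrow> e = e'" for es es'
    using that by (metis (no_types, lifting) list.inj_map_strong)
  \<comment> \<open>The induction on syntax gives injectivity for the elements of one set against
    arbitrary partners; that already makes the image under the coding determine the set.\<close>
  have sets: "(\<lambda>x. code_assm x \<nu>) ` fset \<alpha> = (\<lambda>x. code_assm x \<nu>) ` fset \<beta> \<longleftrightarrow> \<alpha> = \<beta>"
    if *: "\<And>x x'. x \<in> fset \<alpha> \<Longrightarrow> code_assm x \<nu> = code_assm x' \<nu> \<longleftrightarrow> x = x'" for \<alpha> \<beta>
  proof
    assume eq: "(\<lambda>x. code_assm x \<nu>) ` fset \<alpha> = (\<lambda>x. code_assm x \<nu>) ` fset \<beta>"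
    have "x \<in> fset \<alpha> \<longleftrightarrow> x \<in> fset \<beta>" for x
      using eq * by (smt (verit, best) image_iff)
    then show "\<alpha> = \<beta>" by (simp add: fset_eq_iff)
  qed simp
  show "code e \<nu> = code e' \<nu> \<longleftrightarrow> e = e'"
    and "code_assm x \<nu> = code_assm x' \<nu> \<longleftrightarrow> x = x'"
    and "code_bdry \<B> \<nu> = code_bdry \<B>' \<nu> \<longleftrightarrow> \<B> = \<B>'"
  proof (induction e and x and \<B> arbitrary: e' and x' and \<B>')
    case (FVar a A)
    then show ?case by (cases e') (auto simp: list_encode_eq simp del: list_encode.simps)
  next
    case (BVar i)
    then show ?case by (cases e') (auto simp: list_encode_eq simp del: list_encode.simps)
  next
    case (Sym S es)
    then show ?case using assms maps[of es] by (cases e') (auto simp: list_encode_eq inj_eq)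
  next
    case (Meta M \<B> ts)
    then show ?case using maps[of ts] by (cases e') (auto simp: list_encode_eq simp del: list_encode.simps)
  next
    case (Conv t \<alpha>)
    then show ?case using sets[of \<alpha>] by (cases e') (auto simp: list_encode_eq set_encode_eq)
  next
    case (Asms \<alpha>)
    then show ?case using sets[of \<alpha>] by (cases e') (auto simp: list_encode_eq set_encode_eq)
  next
    case (Abs e)
    then show ?case by (cases e') (auto simp: list_encode_eq simp del: list_encode.simps)
  next
    case (AFree a A)
    then show ?case by (cases x') (auto simp: list_encode_eq simp del: list_encode.simps)
  next
    case (ABound i)
    then show ?case by (cases x') (auto simp: list_encode_eq simp del: list_encode.simps)
  next
    case (AMeta M \<B>)
    then show ?case by (cases x') (auto simp: list_encode_eq simp del: list_encode.simps)
  next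
    case BTy
    then show ?case by (cases \<B>') (auto simp: list_encode_eq simp del: list_encode.simps)
  next
    case (BTm A)
    then show ?case by (cases \<B>') (auto simp: list_encode_eq simp del: list_encode.simps)
  next
    case (BEqTy A B)
    then show ?case by (cases \<B>') (auto simp: list_encode_eq simp del: list_encode.simps)
  next
    case (BEqTm s t A)
    then show ?case by (cases \<B>') (auto simp: list_encode_eq simp del: list_encode.simps)
  next
    case (BAbs A \<B>)
    then show ?case by (cases \<B>') (auto simp: list_encode_eq simp del: list_encode.simps)
  qed
qed

lemma code_set_inject:
  assumes "inj \<nu>" shows "code_set \<alpha> \<nu> = code_set \<beta> \<nu> \<longleftrightarrow> \<alpha> = \<beta>"
proof -
  have "inj (\<lambda>x. code_assm x \<nu>)" using code_inject(2)[OF assms] by (auto simp: inj_def)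
  then show ?thesis by (simp add: code_set_def set_encode_eq inj_image_eq_iff fset_inject)
qed

lemma code_jdg_inject:
  assumes "inj \<nu>" shows "code_jdg J \<nu> = code_jdg J' \<nu> \<longleftrightarrow> J = J'"
proof (induction J arbitrary: J')
qed (case_tac J'; auto simp: list_encode_eq code_inject[OF assms] code_set_inject[OF assms]
    simp del: list_encode.simps)+

lemma code_rule_inject:
  assumes "inj \<nu>" shows "code_rule r \<nu> = code_rule r' \<nu> \<longleftrightarrow> r = r'"
proof -
  have "inj (\<lambda>(M, \<B>). prod_encode (M, code_bdry \<B> \<nu>))"
    by (auto simp: inj_def code_inject[OF assms])
  then show ?thesis
    by (cases r; cases r') (simp add: list_encode_eq code_jdg_inject[OF assms] inj_map_eq_map)
qed

context relative_re begin

lemma computable_encI: "computable c enc_nat (\<lambda>x. d (f x)) \<Longrightarrow> computable c d f"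
  unfolding computable_def enc_nat_def by simp

lemma computable_encD: "computable c d f \<Longrightarrow> computable c enc_nat (\<lambda>x. d (f x))"
  unfolding computable_def enc_nat_def by simp

lemma computable_list_encode: "computable c (enc_list enc_nat) f \<Longrightarrow> computable c enc_nat (\<lambda>x. list_encode (f x))"
  by (drule computable_encD) (simp add: enc_list_enc_nat)

end

locale syntax_coding = relative_re X for X :: "nat set" +
  fixes cs :: "'s \<Rightarrow> nat"
  assumes enumerable_sym [re_intros]: "enumerable cs"
begin

definition enc_expr :: "'s expr \<Rightarrow> nat" where "enc_expr e = code e cs"
definition enc_assm :: "'s assm \<Rightarrow> nat" where "enc_assm x = code_assm x cs"
definition enc_bdry :: "'s bdry \<Rightarrow> nat" where "enc_bdry \<B> = code_bdry \<B> cs"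
definition enc_jdg :: "'s judgement \<Rightarrow> nat" where "enc_jdg J = code_jdg J cs"

lemma inj_cs: "inj cs"
  using enumerable_sym unfolding enumerable_def by simp

text \<open>Rewrites the fixed numbering in terms of the generic codings, so that a constructor acts
  on codes as a list of codes of its arguments.\<close>

lemma enc_expr_simps:
  "enc_expr (FVar a A) = list_encode [0, enc_nat a, enc_expr A]"
  "enc_expr (BVar i) = list_encode [1, enc_nat i]"
  "enc_expr (Sym S es) = list_encode [2, cs S, enc_list enc_expr es]"
  "enc_expr (Meta M \<B> es) = list_encode [3, enc_nat M, enc_bdry \<B>, enc_list enc_expr es]"
  "enc_expr (Conv t \<alpha>) = list_encode [4, enc_expr t, enc_fset enc_assm \<alpha>]"
  "enc_expr (Asms \<alpha>) = list_encode [5, enc_fset enc_assm \<alpha>]"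
  "enc_expr (Abs e) = list_encode [6, enc_expr e]"
  "enc_assm (AFree a A) = list_encode [0, enc_nat a, enc_expr A]"
  "enc_assm (ABound i) = list_encode [1, enc_nat i]"
  "enc_assm (AMeta M \<B>) = list_encode [2, enc_nat M, enc_bdry \<B>]"
  "enc_bdry BTy = list_encode [0]"
  "enc_bdry (BTm A) = list_encode [1, enc_expr A]"
  "enc_bdry (BEqTy A B) = list_encode [2, enc_expr A, enc_expr B]"
  "enc_bdry (BEqTm s t A) = list_encode [3, enc_expr s, enc_expr t, enc_expr A]"
  "enc_bdry (BAbs A \<B>) = list_encode [4, enc_expr A, enc_bdry \<B>]"
  "enc_jdg (JTy A) = list_encode [0, enc_expr A]"
  "enc_jdg (JTm t A) = list_encode [1, enc_expr t, enc_expr A]"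
  "enc_jdg (JEqTy A B \<alpha>) = list_encode [2, enc_expr A, enc_expr B, enc_fset enc_assm \<alpha>]"
  "enc_jdg (JEqTm s t A \<alpha>) =
     list_encode [3, enc_expr s, enc_expr t, enc_expr A, enc_fset enc_assm \<alpha>]"
  "enc_jdg (JAbs A J) = list_encode [4, enc_expr A, enc_jdg J]"
  by (simp_all add: enc_expr_def enc_assm_def enc_bdry_def enc_jdg_def enc_nat_def enc_list_def
      enc_fset_def code_set_def cong: map_cong image_cong)

lemma ranges_cases:
  "\<forall>x \<in> set xs. x \<in> range f \<Longrightarrow> \<exists>ys. xs = map f ys"
  unfolding ex_map_conv by auto

text \<open>The three mutually recursive types are generated together, with tags 0, 1 and 2 for
  expressions, assumptions and boundaries. The steps speak of bare numbers, since quantifying over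
  syntax would presuppose the claim; an assumption set enters as the code of the set of a list of
  numbers.\<close>

lemma
  shows enumerable_expr [re_intros]: "enumerable enc_expr"
    and enumerable_assm [re_intros]: "enumerable enc_assm"
    and enumerable_bdry [re_intros]: "enumerable enc_bdry"
proof -
  define P where "P p \<longleftrightarrow> (fst p = 0 \<and> snd p \<in> range enc_expr) \<or> (fst p = 1 \<and> snd p \<in> range enc_assm) \<or>
      (fst p = 2 \<and> snd p \<in> range enc_bdry)" for p :: "nat \<times> nat"
  define Step where "Step p ps \<longleftrightarrow>
   (fst p = 0 \<and> (
     (\<exists>a A. snd p = list_encode [0, a, A] \<and> ps = [(0, A)]) \<or>
     (\<exists>i. snd p = list_encode [1, i] \<and> ps = []) \<or>
     (\<exists>S es. snd p = list_encode [2, S, list_encode es] \<and> S \<in> range cs \<and> ps = map (\<lambda>e. (0, e)) es) \<or>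
     (\<exists>M B es. snd p = list_encode [3, M, B, list_encode es] \<and> ps = (2, B) # map (\<lambda>e. (0, e)) es) \<or>
     (\<exists>t xs. snd p = list_encode [4, t, set_encode (set xs)] \<and> ps = (0, t) # map (\<lambda>e. (1, e)) xs) \<or>
     (\<exists>xs. snd p = list_encode [5, set_encode (set xs)] \<and> ps = map (\<lambda>e. (1, e)) xs) \<or>
     (\<exists>e. snd p = list_encode [6, e] \<and> ps = [(0, e)]))) \<or>
   (fst p = 1 \<and> (
     (\<exists>a A. snd p = list_encode [0, a, A] \<and> ps = [(0, A)]) \<or>
     (\<exists>i. snd p = list_encode [1, i] \<and> ps = []) \<or>
     (\<exists>M B. snd p = list_encode [2, M, B] \<and> ps = [(2, B)]))) \<or>
   (fst p = 2 \<and> (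
     (snd p = list_encode [0] \<and> ps = []) \<or>
     (\<exists>A. snd p = list_encode [1, A] \<and> ps = [(0, A)]) \<or>
     (\<exists>A B. snd p = list_encode [2, A, B] \<and> ps = [(0, A), (0, B)]) \<or>
     (\<exists>s t A. snd p = list_encode [3, s, t, A] \<and> ps = [(0, s), (0, t), (0, A)]) \<or>
     (\<exists>A B. snd p = list_encode [4, A, B] \<and> ps = [(0, A), (2, B)])))"
    for p :: "nat \<times> nat" and ps :: "(nat \<times> nat) list"
  have "re (enc_nat \<otimes> enc_nat) P"
  proof (rule re_lfp[where Step = Step])
    have "re_set X (range cs)" using enumerable_sym unfolding enumerable_def by simp
    note cs = re_recf_reset[OF this]
    show "re ((enc_nat \<otimes> enc_nat) \<otimes> enc_list (enc_nat \<otimes> enc_nat)) (\<lambda>q. Step (fst q) (snd q))"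
      unfolding Step_def
      by (rule cs computable_list_encode computable_comp[OF computable_set_encode_set] re_intros)+
    show "enumerable (enc_nat \<otimes> enc_nat)" by (rule re_intros)+
  next
    fix p ps assume st: "Step p ps" and ps: "\<And>p. p \<in> set ps \<Longrightarrow> P p"
    have exprs: "\<exists>es'. es = map enc_expr es'" if "set (map (\<lambda>e. (0, e)) es) \<subseteq> set ps" for es
      by (rule ranges_cases) (use ps that in \<open>fastforce simp: P_def\<close>)
    have assms: "\<exists>\<alpha>. set_encode (set xs) = enc_fset enc_assm \<alpha>"
      if "set (map (\<lambda>e. (1, e)) xs) \<subseteq> set ps" for xs
    proof -
      have "\<exists>ys. xs = map enc_assm ys"
        by (rule ranges_cases) (use ps that in \<open>fastforce simp: P_def\<close>)
      then obtain ys where "xs = map enc_assm ys" by blast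
      then have "set_encode (set xs) = enc_fset enc_assm (fset_of_list ys)"
        by (simp add: enc_fset_def fset_of_list.rep_eq)
      then show ?thesis by blast
    qed
    have r: "(0, A) \<in> set ps \<Longrightarrow> \<exists>e. A = enc_expr e" "(1, A) \<in> set ps \<Longrightarrow> \<exists>x. A = enc_assm x"
      "(2, A) \<in> set ps \<Longrightarrow> \<exists>B. A = enc_bdry B" for A
      using ps by (fastforce simp: P_def)+
    obtain t n where p: "p = (t, n)" by (cases p)
    have rI: "enc_expr e = n \<Longrightarrow> n \<in> range enc_expr" "enc_assm x = n \<Longrightarrow> n \<in> range enc_assm"
      "enc_bdry B = n \<Longrightarrow> n \<in> range enc_bdry" for n e x B by blast+
    note nI = rI[unfolded enc_nat_def]
    have simps: "enc_list enc_expr es = list_encode (map enc_expr es)" for es by (simp add: enc_list_def)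
    from st show "P p"
      unfolding Step_def p fst_conv snd_conv
    proof (elim disjE conjE exE)
      fix a A assume "t = 0" "n = list_encode [0, a, A]" "ps = [(0, A)]"
      with r(1)[of A] obtain e where "A = enc_expr e" by auto
      then have "enc_expr (FVar a e) = n" using \<open>n = _\<close> by (simp add: enc_expr_simps enc_nat_def)
      then show "P (t, n)" using \<open>t = 0\<close> by (auto simp: P_def)
    next
      fix i assume "t = 0" "n = list_encode [1, i]"
      then have "enc_expr (BVar i) = n" by (simp add: enc_expr_simps enc_nat_def)
      then show "P (t, n)" using \<open>t = 0\<close> by (auto simp: P_def)
    next
      fix S es assume *: "t = 0" "n = list_encode [2, S, list_encode es]" "S \<in> range cs" "ps = map (\<lambda>e. (0, e)) es"
      with exprs[of es] obtain es' S' where "es = map enc_expr es'" "S = cs S'" by auto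
      then have "enc_expr (Sym S' es') = n" using * by (simp add: enc_expr_simps simps)
      then show "P (t, n)" using \<open>t = 0\<close> by (auto simp: P_def)
    next
      fix M B es assume *: "t = 0" "n = list_encode [3, M, B, list_encode es]" "ps = (2, B) # map (\<lambda>e. (0, e)) es"
      with exprs[of es] r(3)[of B] obtain es' B' where "es = map enc_expr es'" "B = enc_bdry B'" by auto
      then have "enc_expr (Meta M B' es') = n" using * by (simp add: enc_expr_simps simps enc_nat_def)
      then show "P (t, n)" using \<open>t = 0\<close> by (auto simp: P_def)
    next
      fix u xs assume *: "t = 0" "n = list_encode [4, u, set_encode (set xs)]" "ps = (0, u) # map (\<lambda>e. (1, e)) xs"
      with assms[of xs] r(1)[of u] obtain \<alpha> e where "set_encode (set xs) = enc_fset enc_assm \<alpha>" "u = enc_expr e" by auto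
      then have "enc_expr (Conv e \<alpha>) = n" using * by (simp add: enc_expr_simps)
      then show "P (t, n)" using \<open>t = 0\<close> by (auto simp: P_def)
    next
      fix xs assume *: "t = 0" "n = list_encode [5, set_encode (set xs)]" "ps = map (\<lambda>e. (1, e)) xs"
      with assms[of xs] obtain \<alpha> where "set_encode (set xs) = enc_fset enc_assm \<alpha>" by auto
      then have "enc_expr (Asms \<alpha>) = n" using * by (simp add: enc_expr_simps)
      then show "P (t, n)" using \<open>t = 0\<close> by (auto simp: P_def)
    next
      fix u assume *: "t = 0" "n = list_encode [6, u]" "ps = [(0, u)]"
      with r(1)[of u] obtain e where "u = enc_expr e" by auto
      then have "enc_expr (Abs e) = n" using * by (simp add: enc_expr_simps)
      then show "P (t, n)" using \<open>t = 0\<close> by (auto simp: P_def)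
    next
      fix a A assume *: "t = 1" "n = list_encode [0, a, A]" "ps = [(0, A)]"
      with r(1)[of A] obtain e where "A = enc_expr e" by auto
      then have "enc_assm (AFree a e) = n" using * by (simp add: enc_expr_simps enc_nat_def)
      then show "P (t, n)" using \<open>t = 1\<close> by (auto simp: P_def)
    next
      fix i assume "t = 1" "n = list_encode [1, i]"
      then have "enc_assm (ABound i) = n" by (simp add: enc_expr_simps enc_nat_def)
      then show "P (t, n)" using \<open>t = 1\<close> by (auto simp: P_def)
    next
      fix M B assume *: "t = 1" "n = list_encode [2, M, B]" "ps = [(2, B)]"
      with r(3)[of B] obtain B' where "B = enc_bdry B'" by auto
      then have "enc_assm (AMeta M B') = n" using * by (simp add: enc_expr_simps enc_nat_def)
      then show "P (t, n)" using \<open>t = 1\<close> by (auto simp: P_def)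
    next
      assume "t = 2" "n = list_encode [0]"
      then have "enc_bdry BTy = n" by (simp add: enc_expr_simps)
      then show "P (t, n)" using \<open>t = 2\<close> by (auto simp: P_def)
    next
      fix A assume *: "t = 2" "n = list_encode [1, A]" "ps = [(0, A)]"
      with r(1)[of A] obtain e where "A = enc_expr e" by auto
      then have "enc_bdry (BTm e) = n" using * by (simp add: enc_expr_simps)
      then show "P (t, n)" using \<open>t = 2\<close> by (auto simp: P_def)
    next
      fix A B assume *: "t = 2" "n = list_encode [2, A, B]" "ps = [(0, A), (0, B)]"
      with r(1)[of A] r(1)[of B] obtain e e' where "A = enc_expr e" "B = enc_expr e'" by auto
      then have "enc_bdry (BEqTy e e') = n" using * by (simp add: enc_expr_simps)
      then show "P (t, n)" using \<open>t = 2\<close> by (auto simp: P_def)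
    next
      fix u v A assume *: "t = 2" "n = list_encode [3, u, v, A]" "ps = [(0, u), (0, v), (0, A)]"
      with r(1)[of A] r(1)[of u] r(1)[of v] obtain e e' e''
        where "A = enc_expr e" "u = enc_expr e'" "v = enc_expr e''" by auto
      then have "enc_bdry (BEqTm e' e'' e) = n" using * by (simp add: enc_expr_simps)
      then show "P (t, n)" using \<open>t = 2\<close> by (auto simp: P_def)
    next
      fix A B assume *: "t = 2" "n = list_encode [4, A, B]" "ps = [(0, A), (2, B)]"
      with r(1)[of A] r(3)[of B] obtain e e' where "A = enc_expr e" "B = enc_bdry e'" by auto
      then have "enc_bdry (BAbs e e') = n" using * by (simp add: enc_expr_simps)
      then show "P (t, n)" using \<open>t = 2\<close> by (auto simp: P_def)
    qed
  next
    fix p Q assume p: "P p"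
      and Q: "\<And>p ps. Step p ps \<Longrightarrow> (\<And>q. q \<in> set ps \<Longrightarrow> Q q) \<Longrightarrow> Q p"
    have set: "\<exists>xs. enc_fset enc_assm \<alpha> = set_encode (set (map enc_assm xs)) \<and> set xs = fset \<alpha>" for \<alpha>
      using exists_fset_of_list[of \<alpha>] by (auto simp: enc_fset_def fset_of_list.rep_eq)
    have "Q (0, enc_expr e)" "Q (1, enc_assm x)" "Q (2, enc_bdry B)" for e x B
    proof (induction e and x and B)
      case (FVar a A)
      then show ?case by - (rule Q[of _ "[(0, enc_expr A)]"], auto simp: Step_def enc_expr_simps)
    next
      case (BVar i)
      then show ?case by - (rule Q[of _ "[]"], auto simp: Step_def enc_expr_simps)
    next
      case (Sym S es)
      then show ?case
        by - (rule Q[of _ "map (\<lambda>e. (0, e)) (map enc_expr es)"],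
          auto simp: Step_def enc_expr_simps enc_list_def list_encode_eq inj_eq[OF inj_cs] simp del: list_encode.simps)
    next
      case (Meta M B ts)
      then show ?case
        by - (rule Q[of _ "(2, enc_bdry B) # map (\<lambda>e. (0, e)) (map enc_expr ts)"],
          auto simp: Step_def enc_expr_simps enc_list_def list_encode_eq simp del: list_encode.simps)
    next
      case (Conv t \<alpha>)
      obtain xs where xs: "enc_fset enc_assm \<alpha> = set_encode (set (map enc_assm xs))" "set xs = fset \<alpha>"
        using set by blast
      have "Step (0, enc_expr (Conv t \<alpha>)) ((0, enc_expr t) # map (\<lambda>e. (1, e)) (map enc_assm xs))"
        unfolding Step_def enc_expr_simps fst_conv snd_conv xs(1) by blast
      from Q[OF this] Conv xs(2) show ?case by auto
    next
      case (Asms \<alpha>)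
      obtain xs where xs: "enc_fset enc_assm \<alpha> = set_encode (set (map enc_assm xs))" "set xs = fset \<alpha>"
        using set by blast
      have "Step (0, enc_expr (Asms \<alpha>)) (map (\<lambda>e. (1, e)) (map enc_assm xs))"
        unfolding Step_def enc_expr_simps fst_conv snd_conv xs(1) by blast
      from Q[OF this] Asms xs(2) show ?case by auto
    next
      case (Abs e)
      then show ?case by - (rule Q[of _ "[(0, enc_expr e)]"], auto simp: Step_def enc_expr_simps)
    next
      case (AFree a A)
      then show ?case by - (rule Q[of _ "[(0, enc_expr A)]"], auto simp: Step_def enc_expr_simps)
    next
      case (ABound i)
      then show ?case by - (rule Q[of _ "[]"], auto simp: Step_def enc_expr_simps)
    next
      case (AMeta M B)
      then show ?case by - (rule Q[of _ "[(2, enc_bdry B)]"], auto simp: Step_def enc_expr_simps)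
    next
      case BTy
      then show ?case by - (rule Q[of _ "[]"], auto simp: Step_def enc_expr_simps)
    next
      case (BTm A)
      then show ?case by - (rule Q[of _ "[(0, enc_expr A)]"], auto simp: Step_def enc_expr_simps)
    next
      case (BEqTy A B)
      then show ?case
        by - (rule Q[of _ "[(0, enc_expr A), (0, enc_expr B)]"], auto simp: Step_def enc_expr_simps)
    next
      case (BEqTm s t A)
      then show ?case
        by - (rule Q[of _ "[(0, enc_expr s), (0, enc_expr t), (0, enc_expr A)]"], auto simp: Step_def enc_expr_simps)
    next
      case (BAbs A B)
      then show ?case
        by - (rule Q[of _ "[(0, enc_expr A), (2, enc_bdry B)]"], auto simp: Step_def enc_expr_simps)
    qed
    then show "Q p" using p by (cases p) (auto simp: P_def)
  qed
  note P = re_subst[OF this]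
  have "re enc_nat (\<lambda>n. P (0, n))" "re enc_nat (\<lambda>n. P (1, n))" "re enc_nat (\<lambda>n. P (2, n))"
    by (rule P re_intros)+
  then have "re_set X (range enc_expr)" "re_set X (range enc_assm)" "re_set X (range enc_bdry)"
    by (auto dest!: re_enc_nat simp: P_def)
  then show "enumerable enc_expr" "enumerable enc_assm" "enumerable enc_bdry"
    unfolding enumerable_def by (auto simp: inj_def enc_expr_def enc_assm_def enc_bdry_def code_inject[OF inj_cs])
qed

end

context relative_re begin

lemma computable_app5:
  assumes "computable (a \<otimes> b1 \<otimes> b2 \<otimes> b3 \<otimes> b4) d (\<lambda>p. f (fst p) (fst (snd p)) (fst (snd (snd p)))
      (fst (snd (snd (snd p)))) (snd (snd (snd (snd p)))))"
    "computable c a g" "computable c b1 h1" "computable c b2 h2" "computable c b3 h3" "computable c b4 h4"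
  shows "computable c d (\<lambda>x. f (g x) (h1 x) (h2 x) (h3 x) (h4 x))"
  using computable_comp[OF assms(1) computable_Pair[OF assms(2) computable_Pair[OF assms(3) computable_Pair[OF assms(4)
    computable_Pair[OF assms(5,6)]]]]]
  by simp

lemma enumerable_cls [re_intros]: "enumerable enc_cls"
proof -
  have "range enc_cls = {n. n < 4}"
  proof (intro equalityI subsetI)
    fix n assume "n \<in> {n. n < (4::nat)}"
    then consider "n = 0" | "n = 1" | "n = 2" | "n = 3" by force
    then show "n \<in> range enc_cls"
      by cases (auto simp: enc_cls_def intro: range_eqI[of _ _ Ty] range_eqI[of _ _ Tm]
          range_eqI[of _ _ EqTy] range_eqI[of _ _ EqTm])
  qed (auto simp: enc_cls_def split: cls.splits)
  moreover have "re_set X {n. n < 4}" by (intro re_set_less total_rec_intros)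
  moreover have "inj enc_cls" by (auto simp: inj_def enc_cls_def split: cls.splits)
  ultimately show ?thesis unfolding enumerable_def by simp
qed

end

context syntax_coding begin

text \<open>Expressions and assumption sets are enumerable by now and may be quantified over; only
  the body of a \<open>JAbs\<close> is a recursive premise.\<close>

lemma enumerable_jdg [re_intros]: "enumerable enc_jdg"
proof -
  define Step where "Step n ps \<longleftrightarrow>
    (\<exists>A. n = list_encode [0, enc_expr A] \<and> ps = []) \<or>
    (\<exists>t A. n = list_encode [1, enc_expr t, enc_expr A] \<and> ps = []) \<or>
    (\<exists>A B \<alpha>. n = list_encode [2, enc_expr A, enc_expr B, enc_fset enc_assm \<alpha>] \<and> ps = []) \<or>
    (\<exists>s t A \<alpha>. n = list_encode [3, enc_expr s, enc_expr t, enc_expr A, enc_fset enc_assm \<alpha>] \<and> ps = []) \<or>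
    (\<exists>A m. n = list_encode [4, enc_expr A, m] \<and> ps = [m])" for n and ps :: "nat list"
  have encode: "computable c enc_expr f \<Longrightarrow> computable c enc_nat (\<lambda>x. enc_expr (f x))"
    "computable c (enc_fset enc_assm) g \<Longrightarrow> computable c enc_nat (\<lambda>x. enc_fset enc_assm (g x))"
    for c :: "'b \<Rightarrow> nat" and f g by (rule computable_encD, assumption)+
  have "re enc_nat (\<lambda>n. n \<in> range enc_jdg)"
  proof (rule re_lfp[where Step = Step])
    show "re (enc_nat \<otimes> enc_list enc_nat) (\<lambda>q. Step (fst q) (snd q))"
      unfolding Step_def by (rule encode computable_list_encode re_intros)+
    show "enumerable enc_nat" by (rule re_intros)
  next
    fix n ps assume "Step n ps" "\<And>p. p \<in> set ps \<Longrightarrow> p \<in> range enc_jdg"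
    then show "n \<in> range enc_jdg"
      unfolding Step_def enc_expr_simps(16-19)[symmetric]
      by (auto simp: enc_expr_simps(20)[symmetric] simp del: list_encode.simps)
  next
    fix n Q assume n: "n \<in> range enc_jdg"
      and Q: "\<And>n ps. Step n ps \<Longrightarrow> (\<And>q. q \<in> set ps \<Longrightarrow> Q q) \<Longrightarrow> Q n"
    have "Q (enc_jdg J)" for J
    proof (induction J)
      case (JAbs A J)
      have "Step (enc_jdg (JAbs A J)) [enc_jdg J]"
        unfolding Step_def enc_expr_simps by blast
      from Q[OF this] JAbs show ?case by simp
    qed (rule Q[of _ "[]"], unfold Step_def enc_expr_simps, blast, simp)+
    then show "Q n" using n by blast
  qed
  from re_enc_nat[OF this] have "re_set X (range enc_jdg)" by simp
  then show ?thesis unfolding enumerable_def by (simp add: inj_def enc_jdg_def code_jdg_inject[OF inj_cs])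
qed

section \<open>Constructors and case distinctions of the raw syntax\<close>

lemma computable_FVar [re_intros]:
  assumes "computable c enc_nat f1" "computable c enc_expr f2"
  shows "computable c enc_expr (\<lambda>x. FVar (f1 x) (f2 x))"
  by (rule computable_encI, unfold enc_expr_simps) (rule computable_list_encode re_intros assms(1)[THEN computable_encD] assms(2)[THEN computable_encD])+

lemma computable_BVar [re_intros]:
  assumes "computable c enc_nat f1"
  shows "computable c enc_expr (\<lambda>x. BVar (f1 x))"
  by (rule computable_encI, unfold enc_expr_simps) (rule computable_list_encode re_intros assms[THEN computable_encD])+

lemma computable_Sym [re_intros]:
  assumes "computable c cs f1" "computable c (enc_list enc_expr) f2"
  shows "computable c enc_expr (\<lambda>x. Sym (f1 x) (f2 x))"
  by (rule computable_encI, unfold enc_expr_simps) (rule computable_list_encode re_intros assms(1)[THEN computable_encD] assms(2)[THEN computable_encD])+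

lemma computable_Meta [re_intros]:
  assumes "computable c enc_nat f1" "computable c enc_bdry f2" "computable c (enc_list enc_expr) f3"
  shows "computable c enc_expr (\<lambda>x. Meta (f1 x) (f2 x) (f3 x))"
  by (rule computable_encI, unfold enc_expr_simps) (rule computable_list_encode re_intros assms(1)[THEN computable_encD] assms(2)[THEN computable_encD] assms(3)[THEN computable_encD])+

lemma computable_Conv [re_intros]:
  assumes "computable c enc_expr f1" "computable c (enc_fset enc_assm) f2"
  shows "computable c enc_expr (\<lambda>x. Conv (f1 x) (f2 x))"
  by (rule computable_encI, unfold enc_expr_simps) (rule computable_list_encode re_intros assms(1)[THEN computable_encD] assms(2)[THEN computable_encD])+

lemma computable_Asms [re_intros]:
  assumes "computable c (enc_fset enc_assm) f1"
  shows "computable c enc_expr (\<lambda>x. Asms (f1 x))"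
  by (rule computable_encI, unfold enc_expr_simps) (rule computable_list_encode re_intros assms[THEN computable_encD])+

lemma computable_Abs [re_intros]:
  assumes "computable c enc_expr f1"
  shows "computable c enc_expr (\<lambda>x. Abs (f1 x))"
  by (rule computable_encI, unfold enc_expr_simps) (rule computable_list_encode re_intros assms[THEN computable_encD])+

lemma computable_AFree [re_intros]:
  assumes "computable c enc_nat f1" "computable c enc_expr f2"
  shows "computable c enc_assm (\<lambda>x. AFree (f1 x) (f2 x))"
  by (rule computable_encI, unfold enc_expr_simps) (rule computable_list_encode re_intros assms(1)[THEN computable_encD] assms(2)[THEN computable_encD])+

lemma computable_ABound [re_intros]:
  assumes "computable c enc_nat f1"
  shows "computable c enc_assm (\<lambda>x. ABound (f1 x))"
  by (rule computable_encI, unfold enc_expr_simps) (rule computable_list_encode re_intros assms[THEN computable_encD])+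

lemma computable_AMeta [re_intros]:
  assumes "computable c enc_nat f1" "computable c enc_bdry f2"
  shows "computable c enc_assm (\<lambda>x. AMeta (f1 x) (f2 x))"
  by (rule computable_encI, unfold enc_expr_simps) (rule computable_list_encode re_intros assms(1)[THEN computable_encD] assms(2)[THEN computable_encD])+

lemma computable_BTm [re_intros]:
  assumes "computable c enc_expr f1"
  shows "computable c enc_bdry (\<lambda>x. BTm (f1 x))"
  by (rule computable_encI, unfold enc_expr_simps) (rule computable_list_encode re_intros assms[THEN computable_encD])+

lemma computable_BEqTy [re_intros]:
  assumes "computable c enc_expr f1" "computable c enc_expr f2"
  shows "computable c enc_bdry (\<lambda>x. BEqTy (f1 x) (f2 x))"
  by (rule computable_encI, unfold enc_expr_simps) (rule computable_list_encode re_intros assms(1)[THEN computable_encD] assms(2)[THEN computable_encD])+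

lemma computable_BEqTm [re_intros]:
  assumes "computable c enc_expr f1" "computable c enc_expr f2" "computable c enc_expr f3"
  shows "computable c enc_bdry (\<lambda>x. BEqTm (f1 x) (f2 x) (f3 x))"
  by (rule computable_encI, unfold enc_expr_simps) (rule computable_list_encode re_intros assms(1)[THEN computable_encD] assms(2)[THEN computable_encD] assms(3)[THEN computable_encD])+

lemma computable_BAbs [re_intros]:
  assumes "computable c enc_expr f1" "computable c enc_bdry f2"
  shows "computable c enc_bdry (\<lambda>x. BAbs (f1 x) (f2 x))"
  by (rule computable_encI, unfold enc_expr_simps) (rule computable_list_encode re_intros assms(1)[THEN computable_encD] assms(2)[THEN computable_encD])+

lemma computable_JTy [re_intros]:
  assumes "computable c enc_expr f1"
  shows "computable c enc_jdg (\<lambda>x. JTy (f1 x))"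
  by (rule computable_encI, unfold enc_expr_simps) (rule computable_list_encode re_intros assms[THEN computable_encD])+

lemma computable_JTm [re_intros]:
  assumes "computable c enc_expr f1" "computable c enc_expr f2"
  shows "computable c enc_jdg (\<lambda>x. JTm (f1 x) (f2 x))"
  by (rule computable_encI, unfold enc_expr_simps) (rule computable_list_encode re_intros assms(1)[THEN computable_encD] assms(2)[THEN computable_encD])+

lemma computable_JEqTy [re_intros]:
  assumes "computable c enc_expr f1" "computable c enc_expr f2" "computable c (enc_fset enc_assm) f3"
  shows "computable c enc_jdg (\<lambda>x. JEqTy (f1 x) (f2 x) (f3 x))"
  by (rule computable_encI, unfold enc_expr_simps) (rule computable_list_encode re_intros assms(1)[THEN computable_encD] assms(2)[THEN computable_encD] assms(3)[THEN computable_encD])+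

lemma computable_JEqTm [re_intros]:
  assumes "computable c enc_expr f1" "computable c enc_expr f2" "computable c enc_expr f3" "computable c (enc_fset enc_assm) f4"
  shows "computable c enc_jdg (\<lambda>x. JEqTm (f1 x) (f2 x) (f3 x) (f4 x))"
  by (rule computable_encI, unfold enc_expr_simps) (rule computable_list_encode re_intros assms(1)[THEN computable_encD] assms(2)[THEN computable_encD] assms(3)[THEN computable_encD] assms(4)[THEN computable_encD])+

lemma computable_JAbs [re_intros]:
  assumes "computable c enc_expr f1" "computable c enc_jdg f2"
  shows "computable c enc_jdg (\<lambda>x. JAbs (f1 x) (f2 x))"
  by (rule computable_encI, unfold enc_expr_simps) (rule computable_list_encode re_intros assms(1)[THEN computable_encD] assms(2)[THEN computable_encD])+

text \<open>The graph of a case distinction is the disjunction of its branches, each with the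
  arguments of the constructor quantified existentially.\<close>

lemma computable_case_expr [re_intros]:
  assumes "enumerable d" "computable c enc_expr s"
    "computable (c \<otimes> enc_nat \<otimes> enc_expr) d (\<lambda>p. g1 (fst p) (fst (snd p)) (snd (snd p)))"
    "computable (c \<otimes> enc_nat) d (\<lambda>p. g2 (fst p) (snd p))"
    "computable (c \<otimes> cs \<otimes> (enc_list enc_expr)) d (\<lambda>p. g3 (fst p) (fst (snd p)) (snd (snd p)))"
    "computable (c \<otimes> enc_nat \<otimes> enc_bdry \<otimes> (enc_list enc_expr)) d (\<lambda>p. g4 (fst p) (fst (snd p)) (fst (snd (snd p))) (snd (snd (snd p))))"
    "computable (c \<otimes> enc_expr \<otimes> (enc_fset enc_assm)) d (\<lambda>p. g5 (fst p) (fst (snd p)) (snd (snd p)))"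
    "computable (c \<otimes> (enc_fset enc_assm)) d (\<lambda>p. g6 (fst p) (snd p))"
    "computable (c \<otimes> enc_expr) d (\<lambda>p. g7 (fst p) (snd p))"
  shows "computable c d (\<lambda>e. case s e of FVar y1 y2 \<Rightarrow> g1 e y1 y2
      | BVar y1 \<Rightarrow> g2 e y1
      | Sym y1 y2 \<Rightarrow> g3 e y1 y2
      | Meta y1 y2 y3 \<Rightarrow> g4 e y1 y2 y3
      | Conv y1 y2 \<Rightarrow> g5 e y1 y2
      | Asms y1 \<Rightarrow> g6 e y1
      | Abs y1 \<Rightarrow> g7 e y1)"
proof (rule computable_graph[OF assms(1)])
  have "re (c \<otimes> d) (\<lambda>p. (\<exists>y1 y2. s (fst p) = FVar y1 y2 \<and> snd p = g1 (fst p) y1 y2) \<or>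
      (\<exists>y1. s (fst p) = BVar y1 \<and> snd p = g2 (fst p) y1) \<or>
      (\<exists>y1 y2. s (fst p) = Sym y1 y2 \<and> snd p = g3 (fst p) y1 y2) \<or>
      (\<exists>y1 y2 y3. s (fst p) = Meta y1 y2 y3 \<and> snd p = g4 (fst p) y1 y2 y3) \<or>
      (\<exists>y1 y2. s (fst p) = Conv y1 y2 \<and> snd p = g5 (fst p) y1 y2) \<or>
      (\<exists>y1. s (fst p) = Asms y1 \<and> snd p = g6 (fst p) y1) \<or>
      (\<exists>y1. s (fst p) = Abs y1 \<and> snd p = g7 (fst p) y1))"
    by (rule computable_app3[OF assms(3)] computable_app2[OF assms(4)] computable_app3[OF assms(5)] computable_app4[OF assms(6)] computable_app3[OF assms(7)] computable_app2[OF assms(8)] computable_app2[OF assms(9)] computable_comp[OF assms(2)] assms(1) re_intros)+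
  then show "re (c \<otimes> d) (\<lambda>p. snd p = (case s (fst p) of FVar y1 y2 \<Rightarrow> g1 (fst p) y1 y2
      | BVar y1 \<Rightarrow> g2 (fst p) y1
      | Sym y1 y2 \<Rightarrow> g3 (fst p) y1 y2
      | Meta y1 y2 y3 \<Rightarrow> g4 (fst p) y1 y2 y3
      | Conv y1 y2 \<Rightarrow> g5 (fst p) y1 y2
      | Asms y1 \<Rightarrow> g6 (fst p) y1
      | Abs y1 \<Rightarrow> g7 (fst p) y1))"
    by (rule re_cong) (auto split: expr.splits)
qed

lemma computable_case_assm [re_intros]:
  assumes "enumerable d" "computable c enc_assm s"
    "computable (c \<otimes> enc_nat \<otimes> enc_expr) d (\<lambda>p. g1 (fst p) (fst (snd p)) (snd (snd p)))"
    "computable (c \<otimes> enc_nat) d (\<lambda>p. g2 (fst p) (snd p))"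
    "computable (c \<otimes> enc_nat \<otimes> enc_bdry) d (\<lambda>p. g3 (fst p) (fst (snd p)) (snd (snd p)))"
  shows "computable c d (\<lambda>e. case s e of AFree y1 y2 \<Rightarrow> g1 e y1 y2
      | ABound y1 \<Rightarrow> g2 e y1
      | AMeta y1 y2 \<Rightarrow> g3 e y1 y2)"
proof (rule computable_graph[OF assms(1)])
  have "re (c \<otimes> d) (\<lambda>p. (\<exists>y1 y2. s (fst p) = AFree y1 y2 \<and> snd p = g1 (fst p) y1 y2) \<or>
      (\<exists>y1. s (fst p) = ABound y1 \<and> snd p = g2 (fst p) y1) \<or>
      (\<exists>y1 y2. s (fst p) = AMeta y1 y2 \<and> snd p = g3 (fst p) y1 y2))"
    by (rule computable_app3[OF assms(3)] computable_app2[OF assms(4)] computable_app3[OF assms(5)] computable_comp[OF assms(2)] assms(1) re_intros)+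
  then show "re (c \<otimes> d) (\<lambda>p. snd p = (case s (fst p) of AFree y1 y2 \<Rightarrow> g1 (fst p) y1 y2
      | ABound y1 \<Rightarrow> g2 (fst p) y1
      | AMeta y1 y2 \<Rightarrow> g3 (fst p) y1 y2))"
    by (rule re_cong) (auto split: assm.splits)
qed

lemma computable_case_bdry [re_intros]:
  assumes "enumerable d" "computable c enc_bdry s"
    "computable c d g1"
    "computable (c \<otimes> enc_expr) d (\<lambda>p. g2 (fst p) (snd p))"
    "computable (c \<otimes> enc_expr \<otimes> enc_expr) d (\<lambda>p. g3 (fst p) (fst (snd p)) (snd (snd p)))"
    "computable (c \<otimes> enc_expr \<otimes> enc_expr \<otimes> enc_expr) d (\<lambda>p. g4 (fst p) (fst (snd p)) (fst (snd (snd p))) (snd (snd (snd p))))"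
    "computable (c \<otimes> enc_expr \<otimes> enc_bdry) d (\<lambda>p. g5 (fst p) (fst (snd p)) (snd (snd p)))"
  shows "computable c d (\<lambda>e. case s e of BTy \<Rightarrow> g1 e
      | BTm y1 \<Rightarrow> g2 e y1
      | BEqTy y1 y2 \<Rightarrow> g3 e y1 y2
      | BEqTm y1 y2 y3 \<Rightarrow> g4 e y1 y2 y3
      | BAbs y1 y2 \<Rightarrow> g5 e y1 y2)"
proof (rule computable_graph[OF assms(1)])
  have "re (c \<otimes> d) (\<lambda>p. (s (fst p) = BTy \<and> snd p = g1 (fst p)) \<or>
      (\<exists>y1. s (fst p) = BTm y1 \<and> snd p = g2 (fst p) y1) \<or>
      (\<exists>y1 y2. s (fst p) = BEqTy y1 y2 \<and> snd p = g3 (fst p) y1 y2) \<or>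
      (\<exists>y1 y2 y3. s (fst p) = BEqTm y1 y2 y3 \<and> snd p = g4 (fst p) y1 y2 y3) \<or>
      (\<exists>y1 y2. s (fst p) = BAbs y1 y2 \<and> snd p = g5 (fst p) y1 y2))"
    by (rule computable_comp[OF assms(3)] computable_app2[OF assms(4)] computable_app3[OF assms(5)] computable_app4[OF assms(6)] computable_app3[OF assms(7)] computable_comp[OF assms(2)] assms(1) re_intros)+
  then show "re (c \<otimes> d) (\<lambda>p. snd p = (case s (fst p) of BTy \<Rightarrow> g1 (fst p)
      | BTm y1 \<Rightarrow> g2 (fst p) y1
      | BEqTy y1 y2 \<Rightarrow> g3 (fst p) y1 y2
      | BEqTm y1 y2 y3 \<Rightarrow> g4 (fst p) y1 y2 y3
      | BAbs y1 y2 \<Rightarrow> g5 (fst p) y1 y2))"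
    by (rule re_cong) (auto split: bdry.splits)
qed

lemma computable_case_judgement [re_intros]:
  assumes "enumerable d" "computable c enc_jdg s"
    "computable (c \<otimes> enc_expr) d (\<lambda>p. g1 (fst p) (snd p))"
    "computable (c \<otimes> enc_expr \<otimes> enc_expr) d (\<lambda>p. g2 (fst p) (fst (snd p)) (snd (snd p)))"
    "computable (c \<otimes> enc_expr \<otimes> enc_expr \<otimes> (enc_fset enc_assm)) d (\<lambda>p. g3 (fst p) (fst (snd p)) (fst (snd (snd p))) (snd (snd (snd p))))"
    "computable (c \<otimes> enc_expr \<otimes> enc_expr \<otimes> enc_expr \<otimes> (enc_fset enc_assm)) d (\<lambda>p. g4 (fst p) (fst (snd p)) (fst (snd (snd p))) (fst (snd (snd (snd p)))) (snd (snd (snd (snd p)))))"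
    "computable (c \<otimes> enc_expr \<otimes> enc_jdg) d (\<lambda>p. g5 (fst p) (fst (snd p)) (snd (snd p)))"
  shows "computable c d (\<lambda>e. case s e of JTy y1 \<Rightarrow> g1 e y1
      | JTm y1 y2 \<Rightarrow> g2 e y1 y2
      | JEqTy y1 y2 y3 \<Rightarrow> g3 e y1 y2 y3
      | JEqTm y1 y2 y3 y4 \<Rightarrow> g4 e y1 y2 y3 y4
      | JAbs y1 y2 \<Rightarrow> g5 e y1 y2)"
proof (rule computable_graph[OF assms(1)])
  have "re (c \<otimes> d) (\<lambda>p. (\<exists>y1. s (fst p) = JTy y1 \<and> snd p = g1 (fst p) y1) \<or>
      (\<exists>y1 y2. s (fst p) = JTm y1 y2 \<and> snd p = g2 (fst p) y1 y2) \<or>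
      (\<exists>y1 y2 y3. s (fst p) = JEqTy y1 y2 y3 \<and> snd p = g3 (fst p) y1 y2 y3) \<or>
      (\<exists>y1 y2 y3 y4. s (fst p) = JEqTm y1 y2 y3 y4 \<and> snd p = g4 (fst p) y1 y2 y3 y4) \<or>
      (\<exists>y1 y2. s (fst p) = JAbs y1 y2 \<and> snd p = g5 (fst p) y1 y2))"
    by (rule computable_app2[OF assms(3)] computable_app3[OF assms(4)] computable_app4[OF assms(5)] computable_app5[OF assms(6)] computable_app3[OF assms(7)] computable_comp[OF assms(2)] assms(1) re_intros)+
  then show "re (c \<otimes> d) (\<lambda>p. snd p = (case s (fst p) of JTy y1 \<Rightarrow> g1 (fst p) y1
      | JTm y1 y2 \<Rightarrow> g2 (fst p) y1 y2
      | JEqTy y1 y2 y3 \<Rightarrow> g3 (fst p) y1 y2 y3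
      | JEqTm y1 y2 y3 y4 \<Rightarrow> g4 (fst p) y1 y2 y3 y4
      | JAbs y1 y2 \<Rightarrow> g5 (fst p) y1 y2))"
    by (rule re_cong) (auto split: judgement.splits)
qed

end

section \<open>Computability of the syntactic operations\<close>

context relative_re begin

lemma computable_fimage [re_intros]:
  assumes "enumerable c" "enumerable a" "enumerable b" "computable (c \<otimes> a) b (\<lambda>p. f (fst p) (snd p))"
    "computable c (enc_fset a) \<alpha>"
  shows "computable c (enc_fset b) (\<lambda>e. f e |`| \<alpha> e)"
proof -
  have "computable c (enc_fset b) (\<lambda>e. ffUnion ((\<lambda>x. {|f e x|}) |`| \<alpha> e))"
    by (rule re_intros assms computable_app2[OF assms(4)])+
  moreover have "ffUnion ((\<lambda>x. {|f e x|}) |`| \<beta>) = f e |`| \<beta>" for e \<beta> by (induction \<beta>) auto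
  ultimately show ?thesis by simp
qed

lemma computable_ffUnion_list [re_intros]:
  fixes xs :: "'e \<Rightarrow> 'b fset list"
  assumes "enumerable c" "enumerable b" "computable c (enc_list (enc_fset b)) xs"
  shows "computable c (enc_fset b) (\<lambda>e. ffUnion (fset_of_list (xs e)))"
proof -
  have "computable c (enc_fset b) (\<lambda>e. foldr ((\<lambda>_. (|\<union>|)) e) (xs e) {||})"
    by (rule computable_foldr[where g = "\<lambda>_. (|\<union>|)"] re_intros assms)+
  moreover have "foldr (|\<union>|) ys {||} = ffUnion (fset_of_list ys)" for ys :: "'b fset list"
    by (induction ys) auto
  ultimately show ?thesis by simp
qed

lemma computable_rev [re_intros]:
  fixes xs :: "'e \<Rightarrow> 'a list"
  assumes "enumerable c" "enumerable a" "computable c (enc_list a) xs"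
  shows "computable c (enc_list a) (\<lambda>e. rev (xs e))"
proof -
  have "computable c (enc_list a) (\<lambda>e. foldr ((\<lambda>_ x r. r @ [x]) e) (xs e) [])"
    by (rule computable_foldr[where g = "\<lambda>_ x r. r @ [x]"] re_intros assms)+
  moreover have "(\<lambda>e. foldr ((\<lambda>_ x r. r @ [x]) e) (xs e) []) = (\<lambda>e. rev (xs e))"
  proof
    have "foldr (\<lambda>x r. r @ [x]) ys [] = rev ys" for ys :: "'a list" by (induction ys) auto
    then show "foldr (\<lambda>x r. r @ [x]) (xs e) [] = rev (xs e)" for e .
  qed
  ultimately show ?thesis by simp
qed

end

text \<open>A sum of the three types turns mutual recursion into recursion on one type.\<close>

type_synonym 's node = "'s expr + 's assm + 's bdry"

abbreviation "NE \<equiv> Inl"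
abbreviation "NA x \<equiv> Inr (Inl x)"
abbreviation "NB \<B> \<equiv> Inr (Inr \<B>)"

text \<open>The immediate constituents, annotations and elements of assumption sets included. It is
  a relation because an assumption set may be listed in any order and with repetitions.\<close>

definition children :: "'s node \<Rightarrow> 's node list \<Rightarrow> bool" where
  "children x ys \<longleftrightarrow>
     (\<exists>a A. x = NE (FVar a A) \<and> ys = [NE A]) \<or>
     (\<exists>i. x = NE (BVar i) \<and> ys = []) \<or>
     (\<exists>S es. x = NE (Sym S es) \<and> ys = map NE es) \<or>
     (\<exists>M \<B> ts. x = NE (Meta M \<B> ts) \<and> ys = NB \<B> # map NE ts) \<or>
     (\<exists>t xs. x = NE (Conv t (fset_of_list xs)) \<and> ys = NE t # map (\<lambda>x. NA x) xs) \<or>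
     (\<exists>xs. x = NE (Asms (fset_of_list xs)) \<and> ys = map (\<lambda>x. NA x) xs) \<or>
     (\<exists>e. x = NE (Abs e) \<and> ys = [NE e]) \<or>
     (\<exists>a A. x = NA (AFree a A) \<and> ys = [NE A]) \<or>
     (\<exists>i. x = NA (ABound i) \<and> ys = []) \<or>
     (\<exists>M \<B>. x = NA (AMeta M \<B>) \<and> ys = [NB \<B>]) \<or>
     (x = NB BTy \<and> ys = []) \<or>
     (\<exists>A. x = NB (BTm A) \<and> ys = [NE A]) \<or>
     (\<exists>A B. x = NB (BEqTy A B) \<and> ys = [NE A, NE B]) \<or>
     (\<exists>s t A. x = NB (BEqTm s t A) \<and> ys = [NE s, NE t, NE A]) \<or>
     (\<exists>A \<B>. x = NB (BAbs A \<B>) \<and> ys = [NE A, NB \<B>])"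

lemma children_total: "\<exists>ys. children x ys"
proof -
  have set: "\<exists>xs. \<alpha> = fset_of_list xs" for \<alpha> :: "'a assm fset"
    using exists_fset_of_list[of \<alpha>] by metis
  show ?thesis
  proof (cases x)
    case (Inl e)
    then show ?thesis
      unfolding children_def by (cases e) (use set in \<open>simp_all add: ex_disj_distrib\<close>)
  next
    case (Inr y)
    then show ?thesis
    proof (cases y)
      case (Inl z)
      then show ?thesis using Inr unfolding children_def by (cases z) (simp_all add: ex_disj_distrib)
    next
      case (Inr z)
      then show ?thesis using \<open>x = Inr y\<close> unfolding children_def by (cases z) (simp_all add: ex_disj_distrib)
    qed
  qed
qed

definition node_size :: "'s node \<Rightarrow> nat" where
  "node_size x = (case x of NE e \<Rightarrow> size e | Inr y \<Rightarrow> (case y of Inl z \<Rightarrow> size z | Inr \<B> \<Rightarrow> size \<B>))"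

lemma children_size: "children x ys \<Longrightarrow> y \<in> set ys \<Longrightarrow> node_size y < node_size x"
proof -
  have list: "e \<in> set es \<Longrightarrow> size e \<le> size_list size es" for e :: "'a expr" and es
    by (simp add: size_list_estimation')
  \<comment> \<open>The size of a finite set sums \<open>Suc (size x)\<close> over its elements, so
    that elements are strictly smaller than the set even if there is only one.\<close>
  have set: "x \<in> set xs \<Longrightarrow> size x < (\<Sum>x \<in> set xs. Suc (size x))" for x :: "'a assm" and xs
    by (meson List.finite_set member_le_sum less_le_trans lessI zero_le)
  assume "children x ys" "y \<in> set ys"
  then show ?thesis
    unfolding children_def
    by (elim disjE exE conjE)
      (auto simp: node_size_def fset_of_list.rep_eq dest!: list set)
qed

text \<open>An option as a list of length at most one, so that the coding and the case rule of lists
  apply.\<close>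

definition lookup :: "'s inst \<Rightarrow> 's mvar \<Rightarrow> 's expr list" where
  "lookup I m = (case map_of I m of None \<Rightarrow> [] | Some e \<Rightarrow> [e])"

lemma lookup_foldr: "lookup I m = foldr (\<lambda>z r. if fst z = m then [snd z] else r) I []"
  unfolding lookup_def by (induction I) auto

context syntax_coding begin

abbreviation "enc_node \<equiv> enc_expr \<oplus> enc_assm \<oplus> enc_bdry"
abbreviation "enc_inst \<equiv> enc_list ((enc_nat \<otimes> enc_bdry) \<otimes> enc_expr)"
abbreviation "enc_ar \<equiv> enc_cls \<otimes> enc_nat"

lemma re_children [re_intros]:
  assumes "computable c enc_node f" "computable c (enc_list enc_node) g"
  shows "re c (\<lambda>x. children (f x) (g x))"
proof (rule re_app2[OF _ assms])
  show "re (enc_node \<otimes> enc_list enc_node) (\<lambda>p. children (fst p) (snd p))"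
    unfolding children_def by (rule re_intros)+
qed

lemma computable_unbind [re_intros]:
  assumes "enumerable c" "computable c (enc_fset enc_assm) f" shows "computable c (enc_fset enc_assm) (\<lambda>x. unbind (f x))"
proof -
  have "computable c (enc_fset enc_assm) (\<lambda>e. ffUnion ((\<lambda>x. if x = ABound 0 then {||} else
      {|case x of ABound i \<Rightarrow> ABound (i - 1) | _ \<Rightarrow> x|}) |`| f e))"
    by (rule re_intros assms)+
  moreover have "ffUnion ((\<lambda>x. if x = ABound 0 then {||} else
      {|case x of ABound i \<Rightarrow> ABound (i - 1) | _ \<Rightarrow> x|}) |`| \<alpha>) = unbind \<alpha>" for \<alpha> :: "'s assm fset"
    unfolding unbind_def by (induction \<alpha>) (auto simp: finsert_fminus_if)
  ultimately show ?thesis by simp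
qed

lemma computable_asm_node:
  "computable enc_node (enc_fset enc_assm) (\<lambda>x. case x of NE e \<Rightarrow> asm e | Inr y \<Rightarrow>
     (case y of Inl z \<Rightarrow> asm_assm z | Inr \<B> \<Rightarrow> asm_bdry \<B>))" (is "computable _ _ ?f")
proof -
  \<comment> \<open>Elsewhere the union of all results suffices, but in \<open>BAbs\<close> the type
    lies outside the binder, so the first result must be kept apart from those that are
    unbound.\<close>
  define h where "h x rs = (case x of
      Inl e \<Rightarrow> (case e of
          FVar a A \<Rightarrow> finsert (AFree a A) (ffUnion (fset_of_list rs))
        | BVar i \<Rightarrow> {|ABound i|}
        | Sym S es \<Rightarrow> ffUnion (fset_of_list rs)
        | Meta M \<B> ts \<Rightarrow> finsert (AMeta M \<B>) (ffUnion (fset_of_list rs))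
        | Conv t \<alpha> \<Rightarrow> ffUnion (fset_of_list rs)
        | Asms \<alpha> \<Rightarrow> ffUnion (fset_of_list rs)
        | Abs e \<Rightarrow> unbind (ffUnion (fset_of_list rs)))
    | Inr y \<Rightarrow> (case y of
          Inl z \<Rightarrow> finsert z (ffUnion (fset_of_list rs))
        | Inr \<B> \<Rightarrow> (case \<B> of
            BTy \<Rightarrow> ffUnion (fset_of_list rs)
          | BTm A \<Rightarrow> ffUnion (fset_of_list rs)
          | BEqTy A B \<Rightarrow> ffUnion (fset_of_list rs)
          | BEqTm s t A \<Rightarrow> ffUnion (fset_of_list rs)
          | BAbs A \<B> \<Rightarrow> (case rs of [] \<Rightarrow> {||} | r # rs \<Rightarrow> r |\<union>| unbind (ffUnion (fset_of_list rs))))))"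
    for x :: "'s node" and rs
  show ?thesis
  proof (rule computable_rec[where deps = children and h = h and m = node_size])
    show "computable (enc_node \<otimes> enc_list (enc_fset enc_assm)) (enc_fset enc_assm) (\<lambda>p. h (fst p) (snd p))"
      unfolding h_def by (rule re_intros)+
    show "re (enc_node \<otimes> enc_list enc_node) (\<lambda>p. children (fst p) (snd p))"
      by (rule re_intros)+
    fix x and ys :: "'s node list" assume "children x ys"
    then show "?f x = h x (map ?f ys)"
      unfolding children_def
      by (elim disjE exE conjE) (auto simp: h_def comp_def fset_of_list_map)
  qed (rule re_intros children_total children_size; assumption?)+
qed

lemma computable_asm [re_intros]: "computable c enc_expr f \<Longrightarrow> computable c (enc_fset enc_assm) (\<lambda>x. asm (f x))"
  using computable_comp[OF computable_asm_node computable_Inl, of c f] by simp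

lemma computable_asm_bdry [re_intros]: "computable c enc_bdry f \<Longrightarrow> computable c (enc_fset enc_assm) (\<lambda>x. asm_bdry (f x))"
  using computable_comp[OF computable_asm_node computable_Inr[OF computable_Inr], of c f] by simp

lemma computable_lift_assm [re_intros]:
  assumes "enumerable c" "computable c enc_nat k" "computable c enc_assm f"
  shows "computable c enc_assm (\<lambda>x. lift_assm (k x) (f x))"
proof (rule computable_app2[OF _ assms(2,3)])
  have "computable (enc_nat \<otimes> enc_assm) enc_assm (\<lambda>p. case snd p of
      AFree a A \<Rightarrow> AFree a A | ABound i \<Rightarrow> ABound (if i < fst p then i else Suc i) | AMeta M \<B> \<Rightarrow> AMeta M \<B>)"
    by (rule re_intros)+
  moreover have "(case x of
      AFree a A \<Rightarrow> AFree a A | ABound i \<Rightarrow> ABound (if i < k then i else Suc i) | AMeta M \<B> \<Rightarrow> AMeta M \<B>) = lift_assm k x"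
    for k and x :: "'s assm" by (cases x) auto
  ultimately show "computable (enc_nat \<otimes> enc_assm) enc_assm (\<lambda>p. lift_assm (fst p) (snd p))" by simp
qed

text \<open>Lifting acts on assumption sets elementwise and never enters annotations. The recursive
  calls are therefore a function of the argument, with the level \<open>k\<close> as part of it
  since it grows under binders.\<close>

lemma computable_lift [re_intros]:
  assumes "computable c enc_expr f" "computable c enc_nat k"
  shows "computable c enc_expr (\<lambda>x. lift (f x) (k x))"
proof (rule computable_app2[OF _ assms])
  define deps where "deps p = (case fst p of
      FVar a A \<Rightarrow> [] | BVar i \<Rightarrow> [] | Sym S es \<Rightarrow> map (\<lambda>e. (e, snd p)) es
    | Meta M \<B> ts \<Rightarrow> map (\<lambda>e. (e, snd p)) ts | Conv t \<alpha> \<Rightarrow> [(t, snd p)] | Asms \<alpha> \<Rightarrow> []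
    | Abs e \<Rightarrow> [(e, Suc (snd p))])" for p :: "'s expr \<times> nat"
  \<comment> \<open>\<open>rs\<close> has one entry for each recursive call, so the branches for an
    empty list are never reached.\<close>
  define h where "h p rs = (case fst p of
      FVar a A \<Rightarrow> FVar a A | BVar i \<Rightarrow> BVar (if i < snd p then i else Suc i) | Sym S es \<Rightarrow> Sym S rs
    | Meta M \<B> ts \<Rightarrow> Meta M \<B> rs
    | Conv t \<alpha> \<Rightarrow> (case rs of [] \<Rightarrow> t | r # _ \<Rightarrow> Conv r (lift_assm (snd p) |`| \<alpha>))
    | Asms \<alpha> \<Rightarrow> Asms (lift_assm (snd p) |`| \<alpha>)
    | Abs e \<Rightarrow> (case rs of [] \<Rightarrow> e | r # _ \<Rightarrow> Abs r))" for p :: "'s expr \<times> nat" and rs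
  show "computable (enc_expr \<otimes> enc_nat) enc_expr (\<lambda>p. lift (fst p) (snd p))"
  proof (rule computable_rec_fun[where deps = deps and h = h and m = "\<lambda>p. size (fst p)"])
    show "computable (enc_expr \<otimes> enc_nat) (enc_list (enc_expr \<otimes> enc_nat)) deps"
      unfolding deps_def by (rule re_intros)+
    show "computable ((enc_expr \<otimes> enc_nat) \<otimes> enc_list enc_expr) enc_expr (\<lambda>p. h (fst p) (snd p))"
      unfolding h_def by (rule re_intros)+
    show "lift (fst x) (snd x) = h x (map (\<lambda>p. lift (fst p) (snd p)) (deps x))" for x
      by (cases x; cases "fst x") (auto simp: h_def deps_def)
    show "size (fst y) < size (fst x)" if "y \<in> set (deps x)" for x y
      using that by (cases x; cases "fst x") (auto simp: deps_def less_Suc_eq_le size_list_estimation' trans_le_add1)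
  qed (rule re_intros)+
qed

lemma computable_subst_set [re_intros]:
  assumes "enumerable c" "computable c (enc_fset enc_assm) \<alpha>" "computable c enc_nat k" "computable c enc_expr s"
  shows "computable c (enc_fset enc_assm) (\<lambda>x. subst_set (\<alpha> x) (k x) (s x))"
proof (rule computable_app3[OF _ assms(2-4)])
  have "computable (enc_fset enc_assm \<otimes> enc_nat \<otimes> enc_expr) (enc_fset enc_assm) (\<lambda>p. ffUnion ((\<lambda>x. case x of
      AFree a A \<Rightarrow> {|AFree a A|} | AMeta M \<B> \<Rightarrow> {|AMeta M \<B>|}
    | ABound i \<Rightarrow> if i < fst (snd p) then {|ABound i|} else if i = fst (snd p) then asm (snd (snd p))
        else {|ABound (i - 1)|}) |`| fst p))"
    by (rule re_intros)+
  moreover have "(case x of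
      AFree a A \<Rightarrow> {|AFree a A|} | AMeta M \<B> \<Rightarrow> {|AMeta M \<B>|}
    | ABound i \<Rightarrow> if i < k then {|ABound i|} else if i = k then asm s else {|ABound (i - 1)|}) = subst_assm k s x"
    for k s and x :: "'s assm" by (cases x) auto
  ultimately show "computable (enc_fset enc_assm \<otimes> enc_nat \<otimes> enc_expr) (enc_fset enc_assm)
      (\<lambda>p. subst_set (fst p) (fst (snd p)) (snd (snd p)))"
    unfolding subst_set_def by simp
qed

lemma computable_subst [re_intros]:
  assumes "computable c enc_expr f" "computable c enc_nat k" "computable c enc_expr s"
  shows "computable c enc_expr (\<lambda>x. subst (f x) (k x) (s x))"
proof (rule computable_app3[OF _ assms])
  define deps where "deps p = (case fst p of
      FVar a A \<Rightarrow> [] | BVar i \<Rightarrow> [] | Sym S es \<Rightarrow> map (\<lambda>e. (e, snd p)) es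
    | Meta M \<B> ts \<Rightarrow> map (\<lambda>e. (e, snd p)) ts | Conv t \<alpha> \<Rightarrow> [(t, snd p)] | Asms \<alpha> \<Rightarrow> []
    | Abs e \<Rightarrow> [(e, Suc (fst (snd p)), lift (snd (snd p)) 0)])" for p :: "'s expr \<times> nat \<times> 's expr"
  define h where "h p rs = (case fst p of
      FVar a A \<Rightarrow> FVar a A
    | BVar i \<Rightarrow> if i < fst (snd p) then BVar i else if i = fst (snd p) then snd (snd p) else BVar (i - 1)
    | Sym S es \<Rightarrow> Sym S rs | Meta M \<B> ts \<Rightarrow> Meta M \<B> rs
    | Conv t \<alpha> \<Rightarrow> (case rs of [] \<Rightarrow> t | r # _ \<Rightarrow> Conv r (subst_set \<alpha> (fst (snd p)) (snd (snd p))))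
    | Asms \<alpha> \<Rightarrow> Asms (subst_set \<alpha> (fst (snd p)) (snd (snd p)))
    | Abs e \<Rightarrow> (case rs of [] \<Rightarrow> e | r # _ \<Rightarrow> Abs r))" for p :: "'s expr \<times> nat \<times> 's expr" and rs
  show "computable (enc_expr \<otimes> enc_nat \<otimes> enc_expr) enc_expr (\<lambda>p. subst (fst p) (fst (snd p)) (snd (snd p)))"
  proof (rule computable_rec_fun[where deps = deps and h = h and m = "\<lambda>p. size (fst p)"])
    show "computable (enc_expr \<otimes> enc_nat \<otimes> enc_expr) (enc_list (enc_expr \<otimes> enc_nat \<otimes> enc_expr)) deps"
      unfolding deps_def by (rule re_intros)+
    show "computable ((enc_expr \<otimes> enc_nat \<otimes> enc_expr) \<otimes> enc_list enc_expr) enc_expr (\<lambda>p. h (fst p) (snd p))"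
      unfolding h_def by (rule re_intros)+
    show "subst (fst x) (fst (snd x)) (snd (snd x)) =
        h x (map (\<lambda>p. subst (fst p) (fst (snd p)) (snd (snd p))) (deps x))" for x
      by (cases x; cases "fst x") (auto simp: h_def deps_def)
    show "size (fst y) < size (fst x)" if "y \<in> set (deps x)" for x y
      using that by (cases x; cases "fst x") (auto simp: deps_def less_Suc_eq_le size_list_estimation' trans_le_add1)
  qed (rule re_intros)+
qed

lemma computable_erase [re_intros]:
  assumes "computable c enc_expr f" shows "computable c enc_expr (\<lambda>x. erase (f x))"
proof (rule computable_comp[OF _ assms])
  define deps where "deps p = (case p of
      FVar a A \<Rightarrow> [] | BVar i \<Rightarrow> [] | Sym S es \<Rightarrow> es
    | Meta M \<B> ts \<Rightarrow> ts | Conv t \<alpha> \<Rightarrow> [t] | Asms \<alpha> \<Rightarrow> [] | Abs e \<Rightarrow> [e])" for p :: "'s expr"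
  define h where "h p rs = (case p of
      FVar a A \<Rightarrow> p | BVar i \<Rightarrow> p | Sym S es \<Rightarrow> Sym S rs | Meta M \<B> ts \<Rightarrow> Meta M \<B> rs
    | Conv t \<alpha> \<Rightarrow> (case rs of [] \<Rightarrow> t | r # _ \<Rightarrow> r) | Asms \<alpha> \<Rightarrow> Asms {||}
    | Abs e \<Rightarrow> (case rs of [] \<Rightarrow> e | r # _ \<Rightarrow> Abs r))" for p :: "'s expr" and rs
  show "computable enc_expr enc_expr erase"
  proof (rule computable_rec_fun[where deps = deps and h = h and m = size])
    show "computable enc_expr (enc_list enc_expr) deps"
      unfolding deps_def by (rule re_intros)+
    show "computable (enc_expr \<otimes> enc_list enc_expr) enc_expr (\<lambda>p. h (fst p) (snd p))"
      unfolding h_def by (rule re_intros)+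
    show "erase x = h x (map erase (deps x))" for x
      by (cases x) (auto simp: h_def deps_def)
    show "size y < size x" if "y \<in> set (deps x)" for x y
      using that by (cases x) (auto simp: deps_def less_Suc_eq_le size_list_estimation' trans_le_add1)
  qed (rule re_intros)+
qed


lemma computable_apply_args [re_intros]:
  assumes "computable c enc_expr f" "computable c (enc_list enc_expr) ts"
  shows "computable c enc_expr (\<lambda>x. apply_args (f x) (ts x))"
proof (rule computable_app2[OF _ assms])
  define deps where "deps p = (case fst p of
      Abs e \<Rightarrow> (case snd p of [] \<Rightarrow> [] | t # ts \<Rightarrow> [(subst e 0 t, ts)]) | _ \<Rightarrow> [])"
    for p :: "'s expr \<times> 's expr list"
  define h where "h p rs = (case rs of [] \<Rightarrow> fst p | r # _ \<Rightarrow> r)"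
    for p :: "'s expr \<times> 's expr list" and rs
  show "computable (enc_expr \<otimes> enc_list enc_expr) enc_expr (\<lambda>p. apply_args (fst p) (snd p))"
  proof (rule computable_rec_fun[where deps = deps and h = h and m = "\<lambda>p. length (snd p)"])
    show "computable (enc_expr \<otimes> enc_list enc_expr) (enc_list (enc_expr \<otimes> enc_list enc_expr)) deps"
      unfolding deps_def by (rule re_intros)+
    show "computable ((enc_expr \<otimes> enc_list enc_expr) \<otimes> enc_list enc_expr) enc_expr (\<lambda>p. h (fst p) (snd p))"
      unfolding h_def by (rule re_intros)+
    show "apply_args (fst x) (snd x) = h x (map (\<lambda>p. apply_args (fst p) (snd p)) (deps x))" for x
      by (cases x; cases "fst x"; cases "snd x") (auto simp: h_def deps_def)
    show "length (snd y) < length (snd x)" if "y \<in> set (deps x)" for x y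
      using that by (cases x; cases "fst x"; cases "snd x") (auto simp: deps_def)
  qed (rule re_intros)+
qed

lemma computable_lookup [re_intros]:
  assumes "enumerable c" "computable c enc_inst I" "computable c (enc_nat \<otimes> enc_bdry) m"
  shows "computable c (enc_list enc_expr) (\<lambda>x. lookup (I x) (m x))"
proof -
  have "computable c (enc_list enc_expr)
      (\<lambda>x. foldr ((\<lambda>x z r. if fst z = m x then [snd z] else r) x) (I x) [])"
    by (rule computable_foldr[where g = "\<lambda>x z r. if fst z = m x then [snd z] else r"]
        computable_comp[OF assms(3)] assms(1,2) re_intros)+
  then show ?thesis by (simp add: lookup_foldr)
qed

abbreviation "enc_result \<equiv> enc_expr \<oplus> enc_fset enc_assm \<oplus> enc_bdry"

lemma computable_inst_node:
  "computable (enc_inst \<otimes> enc_node) enc_result (\<lambda>p. case snd p of Inl e \<Rightarrow> Inl (inst e (fst p)) | Inr y \<Rightarrow>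
     (case y of Inl z \<Rightarrow> Inr (Inl (inst_assm z (fst p))) | Inr \<B> \<Rightarrow> Inr (Inr (inst_bdry \<B> (fst p)))))"
    (is "computable _ _ ?f")
proof -
  \<comment> \<open>The three mutually recursive instantiation functions return their results in one
    list over a sum type; these folds sort them by kind and unite the assumption sets.\<close>
  define exprs where "exprs rs = foldr (\<lambda>r acc. case r of Inl e \<Rightarrow> e # acc | Inr y \<Rightarrow> acc) rs []"
    for rs :: "('s expr + 's assm fset + 's bdry) list"
  define sets where "sets rs = foldr (\<lambda>r acc. case r of Inl e \<Rightarrow> acc | Inr y \<Rightarrow>
      (case y of Inl \<alpha> \<Rightarrow> \<alpha> |\<union>| acc | Inr \<B> \<Rightarrow> acc)) rs {||}"
    for rs :: "('s expr + 's assm fset + 's bdry) list"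
  define bdrys where "bdrys rs = foldr (\<lambda>r acc. case r of Inl e \<Rightarrow> acc | Inr y \<Rightarrow>
      (case y of Inl \<alpha> \<Rightarrow> acc | Inr \<B> \<Rightarrow> \<B> # acc)) rs []"
    for rs :: "('s expr + 's assm fset + 's bdry) list"
  have computable_exprs: "computable c (enc_list enc_expr) (\<lambda>x. exprs (rs x))"
    if "enumerable c" "computable c (enc_list enc_result) rs" for c :: "'b \<Rightarrow> nat" and rs
    unfolding exprs_def
    by (rule computable_foldr[where g = "\<lambda>_ r acc. case r of Inl e \<Rightarrow> e # acc | Inr y \<Rightarrow> acc"] that re_intros)+
  have computable_sets: "computable c (enc_fset enc_assm) (\<lambda>x. sets (rs x))"
    if "enumerable c" "computable c (enc_list enc_result) rs" for c :: "'b \<Rightarrow> nat" and rs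
    unfolding sets_def
    by (rule computable_foldr[where g = "\<lambda>_ r acc. case r of Inl e \<Rightarrow> acc | Inr y \<Rightarrow>
      (case y of Inl \<alpha> \<Rightarrow> \<alpha> |\<union>| acc | Inr \<B> \<Rightarrow> acc)"] that re_intros)+
  have computable_bdrys: "computable c (enc_list enc_bdry) (\<lambda>x. bdrys (rs x))"
    if "enumerable c" "computable c (enc_list enc_result) rs" for c :: "'b \<Rightarrow> nat" and rs
    unfolding bdrys_def
    by (rule computable_foldr[where g = "\<lambda>_ r acc. case r of Inl e \<Rightarrow> acc | Inr y \<Rightarrow>
      (case y of Inl \<alpha> \<Rightarrow> acc | Inr \<B> \<Rightarrow> \<B> # acc)"] that re_intros)+
  define h where "h p rs = (case snd p of
      Inl e \<Rightarrow> Inl (case e of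
          FVar a A \<Rightarrow> (case exprs rs of [] \<Rightarrow> A | A # _ \<Rightarrow> FVar a A)
        | BVar i \<Rightarrow> BVar i
        | Sym S es \<Rightarrow> Sym S (exprs rs)
        | Meta M \<B> ts \<Rightarrow> (case lookup (fst p) (M, \<B>) of
            [] \<Rightarrow> Meta M \<B> (exprs rs) | e # _ \<Rightarrow> apply_args e (exprs rs))
        | Conv t \<alpha> \<Rightarrow> (case exprs rs of [] \<Rightarrow> t | t # _ \<Rightarrow> Conv t (sets rs))
        | Asms \<alpha> \<Rightarrow> Asms (sets rs)
        | Abs e \<Rightarrow> (case exprs rs of [] \<Rightarrow> e | e # _ \<Rightarrow> Abs e))
    | Inr y \<Rightarrow> Inr (case y of
          Inl z \<Rightarrow> Inl (case z of
            AFree a A \<Rightarrow> (case exprs rs of [] \<Rightarrow> {||} | A # _ \<Rightarrow> {|AFree a A|})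
          | ABound i \<Rightarrow> {|ABound i|}
          | AMeta M \<B> \<Rightarrow> (case lookup (fst p) (M, \<B>) of [] \<Rightarrow> {||} | e # _ \<Rightarrow> asm e))
        | Inr \<B> \<Rightarrow> Inr (case \<B> of
            BTy \<Rightarrow> BTy
          | BTm A \<Rightarrow> (case exprs rs of [] \<Rightarrow> BTy | A # _ \<Rightarrow> BTm A)
          | BEqTy A B \<Rightarrow> (case exprs rs of [] \<Rightarrow> BTy | A # es \<Rightarrow> (case es of [] \<Rightarrow> BTy | B # _ \<Rightarrow> BEqTy A B))
          | BEqTm s t A \<Rightarrow> (case exprs rs of [] \<Rightarrow> BTy | s # es \<Rightarrow> (case es of [] \<Rightarrow> BTy | t # es \<Rightarrow>
              (case es of [] \<Rightarrow> BTy | A # _ \<Rightarrow> BEqTm s t A)))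
          | BAbs A \<B> \<Rightarrow> (case exprs rs of [] \<Rightarrow> BTy | A # _ \<Rightarrow>
              (case bdrys rs of [] \<Rightarrow> BTy | \<B> # _ \<Rightarrow> BAbs A \<B>)))))"
    for p :: "'s inst \<times> 's node" and rs
  define deps where "deps p ys \<longleftrightarrow> (\<exists>zs. children (snd p) zs \<and> ys = map (Pair (fst p)) zs)"
    for p :: "'s inst \<times> 's node" and ys
  have ex_list: "exprs (map f xs) = map g xs" if "\<And>x. f x = Inl (g x)" for f g and xs :: "'c list"
    using that by (induction xs) (auto simp: exprs_def)
  have set_list: "sets (map f xs) = ffUnion (g |`| fset_of_list xs)" "exprs (map f xs) = []"
    if "\<And>x. f x = Inr (Inl (g x))" for f g and xs :: "'c list"
    using that by (induction xs) (auto simp: sets_def exprs_def)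
  show ?thesis
  proof (rule computable_rec[where deps = deps and h = h and m = "\<lambda>p. node_size (snd p)"])
    show "computable ((enc_inst \<otimes> enc_node) \<otimes> enc_list enc_result) enc_result (\<lambda>p. h (fst p) (snd p))"
      unfolding h_def by (rule computable_exprs computable_sets computable_bdrys re_intros)+
    show "re ((enc_inst \<otimes> enc_node) \<otimes> enc_list (enc_inst \<otimes> enc_node)) (\<lambda>p. deps (fst p) (snd p))"
      unfolding deps_def by (rule re_intros)+
    show "\<exists>ys. deps x ys" for x using children_total by (fastforce simp: deps_def)
    show "node_size (snd y) < node_size (snd x)" if "deps x ys" "y \<in> set ys" for x y ys
      using that children_size by (force simp: deps_def)
  next
    fix x ys assume "deps x ys"
    then obtain zs where zs: "children (snd x) zs" "ys = map (Pair (fst x)) zs" unfolding deps_def by blast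
    obtain I n where x: "x = (I, n)" by (cases x)
    have Cons: "exprs (Inl e # rs) = e # exprs rs" "exprs (Inr y # rs) = exprs rs"
      "sets (Inl e # rs) = sets rs" "bdrys (Inl e # rs) = bdrys rs"
      "bdrys (Inr (Inr \<B>) # rs) = \<B> # bdrys rs" "exprs [] = []" for e rs y \<B>
      by (simp_all add: exprs_def sets_def bdrys_def)
    have m1: "exprs (map (\<lambda>x. Inl (inst x I)) ts) = map (\<lambda>e. inst e I) ts" for ts
      by (rule ex_list) simp
    have m2: "sets (map (\<lambda>x. Inr (Inl (inst_assm x I))) xs) = ffUnion ((\<lambda>x. inst_assm x I) |`| fset_of_list xs)"
      "exprs (map (\<lambda>x. Inr (Inl (inst_assm x I))) xs) = []" for xs
      by (rule set_list; simp)+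
    show "?f x = h x (map ?f ys)"
      using zs(1) unfolding children_def zs(2) x snd_conv
      by (elim disjE exE conjE)
        (auto simp: h_def comp_def Cons m1 m2 lookup_def split: option.splits)
  qed (rule re_intros)+
qed

lemma computable_inst [re_intros]:
  assumes "computable c enc_expr f" "computable c enc_inst I" shows "computable c enc_expr (\<lambda>x. inst (f x) (I x))"
proof -
  have "computable c enc_result (\<lambda>x. Inl (inst (f x) (I x)))"
    using computable_comp[OF computable_inst_node computable_Pair[OF assms(2) computable_Inl[OF assms(1)]]] by simp
  note this[re_intros]
  have "computable c enc_expr (\<lambda>x. case Inl (inst (f x) (I x)) of Inl e \<Rightarrow> e | Inr (y :: 's assm fset + 's bdry) \<Rightarrow> BVar 0)"
    by (rule re_intros)+
  then show ?thesis by simp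
qed

lemma computable_inst_assm [re_intros]:
  assumes "computable c enc_assm f" "computable c enc_inst I"
  shows "computable c (enc_fset enc_assm) (\<lambda>x. inst_assm (f x) (I x))"
proof -
  have "computable c enc_result (\<lambda>x. Inr (Inl (inst_assm (f x) (I x))))"
    using computable_comp[OF computable_inst_node computable_Pair[OF assms(2) computable_Inr[OF computable_Inl[OF assms(1)]]]] by simp
  note this[re_intros]
  have "computable c (enc_fset enc_assm) (\<lambda>x. case Inr (Inl (inst_assm (f x) (I x))) of
      Inl (e :: 's expr) \<Rightarrow> {||} | Inr y \<Rightarrow> (case y of Inl \<alpha> \<Rightarrow> \<alpha> | Inr (\<B> :: 's bdry) \<Rightarrow> {||}))"
    by (rule re_intros)+
  then show ?thesis by simp
qed

lemma computable_inst_bdry [re_intros]: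
  assumes "computable c enc_bdry f" "computable c enc_inst I"
  shows "computable c enc_bdry (\<lambda>x. inst_bdry (f x) (I x))"
proof -
  have "computable c enc_result (\<lambda>x. Inr (Inr (inst_bdry (f x) (I x))))"
    using computable_comp[OF computable_inst_node computable_Pair[OF assms(2) computable_Inr[OF computable_Inr[OF assms(1)]]]] by simp
  note this[re_intros]
  have "computable c enc_bdry (\<lambda>x. case Inr (Inr (inst_bdry (f x) (I x))) of
      Inl (e :: 's expr) \<Rightarrow> BTy | Inr y \<Rightarrow> (case y of Inl (\<alpha> :: 's assm fset) \<Rightarrow> BTy | Inr \<B> \<Rightarrow> \<B>))"
    by (rule re_intros)+
  then show ?thesis by simp
qed

end

text \<open>Computable extensions of \<open>fill\<close> and \<open>fill_eq\<close>, with junk values where those are unspecified.\<close>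

fun fill_total :: "'s bdry \<Rightarrow> 's expr \<Rightarrow> 's judgement" where
  "fill_total BTy A = JTy A"
| "fill_total (BTm A) t = JTm t A"
| "fill_total (BEqTy A B) e = JEqTy A B (asm e)"
| "fill_total (BEqTm s t A) e = JEqTm s t A (asm e)"
| "fill_total (BAbs A \<B>) (Abs e) = JAbs A (fill_total \<B> e)"
| "fill_total (BAbs A \<B>) e = JTy e"

fun fill_eq_total :: "'s bdry \<Rightarrow> 's expr \<Rightarrow> 's expr \<Rightarrow> 's assm fset \<Rightarrow> 's judgement" where
  "fill_eq_total BTy A B \<alpha> = JEqTy A B \<alpha>"
| "fill_eq_total (BTm A) s t \<alpha> = JEqTm s t A \<alpha>"
| "fill_eq_total (BAbs A \<B>) (Abs e) (Abs e') \<alpha> = JAbs A (fill_eq_total \<B> e e' \<alpha>)"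
| "fill_eq_total \<B> e e' \<alpha> = JTy e"

section \<open>Boundaries, judgements and lists of premises\<close>

context syntax_coding begin

lemma computable_ar [re_intros]:
  assumes "computable c enc_bdry f1"
  shows "computable c enc_ar (\<lambda>x. ar (f1 x))"
proof (rule computable_comp[OF _ assms])
  define deps where "deps p = (case p of BAbs A \<B> \<Rightarrow> [\<B>] | _ \<Rightarrow> [])" for p :: "'s bdry"
  define h where "h p rs = (case p of BTy \<Rightarrow> (Ty, 0) | BTm A \<Rightarrow> (Tm, 0) | BEqTy A B \<Rightarrow> (EqTy, 0) | BEqTm s t A \<Rightarrow> (EqTm, 0)
    | BAbs A \<B> \<Rightarrow> (case rs of [] \<Rightarrow> (Ty, 0) | r # _ \<Rightarrow> (fst r, Suc (snd r))))" for p :: "'s bdry" and rs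
  show "computable enc_bdry enc_ar ar"
  proof (rule computable_rec_fun[where deps = deps and h = h and m = "\<lambda>p. size p"])
    show "computable enc_bdry (enc_list enc_bdry) deps"
      unfolding deps_def by (rule re_intros)+
    show "computable (enc_bdry \<otimes> enc_list enc_ar) enc_ar (\<lambda>p. h (fst p) (snd p))"
      unfolding h_def by (rule re_intros)+
    show "ar x = h x (map ar (deps x))" for x
      by (cases x) (auto simp: h_def deps_def)
    show "(\<lambda>p. size p) y < (\<lambda>p. size p) x" if "y \<in> set (deps x)" for x y
      using that by (cases x) (auto simp: deps_def)
  qed (rule re_intros)+
qed

lemma computable_subst_bdry [re_intros]:
  assumes "computable c enc_bdry f1" "computable c enc_nat f2" "computable c enc_expr f3"
  shows "computable c enc_bdry (\<lambda>x. subst_bdry (f1 x) (f2 x) (f3 x))"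
proof (rule computable_app3[OF _ assms])
  define deps where "deps p = (case (fst p) of BAbs A \<B> \<Rightarrow> [(\<B>, Suc (fst (snd p)), lift (snd (snd p)) 0)] | _ \<Rightarrow> [])" for p :: "'s bdry \<times> nat \<times> 's expr"
  define h where "h p rs = (case (fst p) of BTy \<Rightarrow> BTy | BTm A \<Rightarrow> BTm (subst A (fst (snd p)) (snd (snd p))) | BEqTy A B \<Rightarrow> BEqTy (subst A (fst (snd p)) (snd (snd p))) (subst B (fst (snd p)) (snd (snd p)))
    | BEqTm s t A \<Rightarrow> BEqTm (subst s (fst (snd p)) (snd (snd p))) (subst t (fst (snd p)) (snd (snd p))) (subst A (fst (snd p)) (snd (snd p)))
    | BAbs A \<B> \<Rightarrow> (case rs of [] \<Rightarrow> BTy | r # _ \<Rightarrow> BAbs (subst A (fst (snd p)) (snd (snd p))) r))" for p :: "'s bdry \<times> nat \<times> 's expr" and rs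
  show "computable (enc_bdry \<otimes> enc_nat \<otimes> enc_expr) enc_bdry (\<lambda>p. subst_bdry (fst p) (fst (snd p)) (snd (snd p)))"
  proof (rule computable_rec_fun[where deps = deps and h = h and m = "\<lambda>p. size (fst p)"])
    show "computable (enc_bdry \<otimes> enc_nat \<otimes> enc_expr) (enc_list (enc_bdry \<otimes> enc_nat \<otimes> enc_expr)) deps"
      unfolding deps_def by (rule re_intros)+
    show "computable ((enc_bdry \<otimes> enc_nat \<otimes> enc_expr) \<otimes> enc_list enc_bdry) enc_bdry (\<lambda>p. h (fst p) (snd p))"
      unfolding h_def by (rule re_intros)+
    show "(\<lambda>p. subst_bdry (fst p) (fst (snd p)) (snd (snd p))) x = h x (map (\<lambda>p. subst_bdry (fst p) (fst (snd p)) (snd (snd p))) (deps x))" for x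
      by (cases x; cases "(fst x)") (auto simp: h_def deps_def)
    show "(\<lambda>p. size (fst p)) y < (\<lambda>p. size (fst p)) x" if "y \<in> set (deps x)" for x y
      using that by (cases x; cases "(fst x)") (auto simp: deps_def)
  qed (rule re_intros)+
qed

lemma computable_apply_bdry [re_intros]:
  assumes "computable c enc_bdry f1" "computable c (enc_list enc_expr) f2"
  shows "computable c enc_bdry (\<lambda>x. apply_bdry (f1 x) (f2 x))"
proof (rule computable_app2[OF _ assms])
  define deps where "deps p = (case (fst p) of BAbs A \<B> \<Rightarrow> (case (snd p) of [] \<Rightarrow> [] | t # ts \<Rightarrow> [(subst_bdry \<B> 0 t, ts)]) | _ \<Rightarrow> [])" for p :: "'s bdry \<times> 's expr list"
  define h where "h p rs = (case rs of [] \<Rightarrow> (fst p) | r # _ \<Rightarrow> r)" for p :: "'s bdry \<times> 's expr list" and rs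
  show "computable (enc_bdry \<otimes> enc_list enc_expr) enc_bdry (\<lambda>p. apply_bdry (fst p) (snd p))"
  proof (rule computable_rec_fun[where deps = deps and h = h and m = "\<lambda>p. length (snd p)"])
    show "computable (enc_bdry \<otimes> enc_list enc_expr) (enc_list (enc_bdry \<otimes> enc_list enc_expr)) deps"
      unfolding deps_def by (rule re_intros)+
    show "computable ((enc_bdry \<otimes> enc_list enc_expr) \<otimes> enc_list enc_bdry) enc_bdry (\<lambda>p. h (fst p) (snd p))"
      unfolding h_def by (rule re_intros)+
    show "(\<lambda>p. apply_bdry (fst p) (snd p)) x = h x (map (\<lambda>p. apply_bdry (fst p) (snd p)) (deps x))" for x
      by (cases x; cases "(fst x)"; cases "(snd x)") (auto simp: h_def deps_def)
    show "(\<lambda>p. length (snd p)) y < (\<lambda>p. length (snd p)) x" if "y \<in> set (deps x)" for x y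
      using that by (cases x; cases "(fst x)"; cases "(snd x)") (auto simp: deps_def)
  qed (rule re_intros)+
qed

lemma computable_bdry_of [re_intros]:
  assumes "computable c enc_jdg f1"
  shows "computable c enc_bdry (\<lambda>x. bdry_of (f1 x))"
proof (rule computable_comp[OF _ assms])
  define deps where "deps p = (case p of JAbs A J \<Rightarrow> [J] | _ \<Rightarrow> [])" for p :: "'s judgement"
  define h where "h p rs = (case p of JTy A \<Rightarrow> BTy | JTm t A \<Rightarrow> BTm A | JEqTy A B \<alpha> \<Rightarrow> BEqTy A B | JEqTm s t A \<alpha> \<Rightarrow> BEqTm s t A
    | JAbs A J \<Rightarrow> (case rs of [] \<Rightarrow> BTy | r # _ \<Rightarrow> BAbs A r))" for p :: "'s judgement" and rs
  show "computable enc_jdg enc_bdry bdry_of"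
  proof (rule computable_rec_fun[where deps = deps and h = h and m = "\<lambda>p. size p"])
    show "computable enc_jdg (enc_list enc_jdg) deps"
      unfolding deps_def by (rule re_intros)+
    show "computable (enc_jdg \<otimes> enc_list enc_bdry) enc_bdry (\<lambda>p. h (fst p) (snd p))"
      unfolding h_def by (rule re_intros)+
    show "bdry_of x = h x (map bdry_of (deps x))" for x
      by (cases x) (auto simp: h_def deps_def)
    show "(\<lambda>p. size p) y < (\<lambda>p. size p) x" if "y \<in> set (deps x)" for x y
      using that by (cases x) (auto simp: deps_def)
  qed (rule re_intros)+
qed

lemma computable_subst_jdg [re_intros]:
  assumes "computable c enc_jdg f1" "computable c enc_nat f2" "computable c enc_expr f3"
  shows "computable c enc_jdg (\<lambda>x. subst_jdg (f1 x) (f2 x) (f3 x))"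
proof (rule computable_app3[OF _ assms])
  define deps where "deps p = (case (fst p) of JAbs A J \<Rightarrow> [(J, Suc (fst (snd p)), lift (snd (snd p)) 0)] | _ \<Rightarrow> [])" for p :: "'s judgement \<times> nat \<times> 's expr"
  define h where "h p rs = (case (fst p) of JTy A \<Rightarrow> JTy (subst A (fst (snd p)) (snd (snd p))) | JTm t A \<Rightarrow> JTm (subst t (fst (snd p)) (snd (snd p))) (subst A (fst (snd p)) (snd (snd p)))
    | JEqTy A B \<alpha> \<Rightarrow> JEqTy (subst A (fst (snd p)) (snd (snd p))) (subst B (fst (snd p)) (snd (snd p))) (subst_set \<alpha> (fst (snd p)) (snd (snd p)))
    | JEqTm s t A \<alpha> \<Rightarrow> JEqTm (subst s (fst (snd p)) (snd (snd p))) (subst t (fst (snd p)) (snd (snd p))) (subst A (fst (snd p)) (snd (snd p))) (subst_set \<alpha> (fst (snd p)) (snd (snd p)))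
    | JAbs A J \<Rightarrow> (case rs of [] \<Rightarrow> J | r # _ \<Rightarrow> JAbs (subst A (fst (snd p)) (snd (snd p))) r))" for p :: "'s judgement \<times> nat \<times> 's expr" and rs
  show "computable (enc_jdg \<otimes> enc_nat \<otimes> enc_expr) enc_jdg (\<lambda>p. subst_jdg (fst p) (fst (snd p)) (snd (snd p)))"
  proof (rule computable_rec_fun[where deps = deps and h = h and m = "\<lambda>p. size (fst p)"])
    show "computable (enc_jdg \<otimes> enc_nat \<otimes> enc_expr) (enc_list (enc_jdg \<otimes> enc_nat \<otimes> enc_expr)) deps"
      unfolding deps_def by (rule re_intros)+
    show "computable ((enc_jdg \<otimes> enc_nat \<otimes> enc_expr) \<otimes> enc_list enc_jdg) enc_jdg (\<lambda>p. h (fst p) (snd p))"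
      unfolding h_def by (rule re_intros)+
    show "(\<lambda>p. subst_jdg (fst p) (fst (snd p)) (snd (snd p))) x = h x (map (\<lambda>p. subst_jdg (fst p) (fst (snd p)) (snd (snd p))) (deps x))" for x
      by (cases x; cases "(fst x)") (auto simp: h_def deps_def)
    show "(\<lambda>p. size (fst p)) y < (\<lambda>p. size (fst p)) x" if "y \<in> set (deps x)" for x y
      using that by (cases x; cases "(fst x)") (auto simp: deps_def)
  qed (rule re_intros)+
qed

lemma computable_inst_jdg [re_intros]:
  assumes "computable c enc_jdg f1" "computable c enc_inst f2"
  shows "computable c enc_jdg (\<lambda>x. inst_jdg (f1 x) (f2 x))"
proof (rule computable_app2[OF _ assms])
  define deps where "deps p = (case (fst p) of JAbs A J \<Rightarrow> [(J, (snd p))] | _ \<Rightarrow> [])" for p :: "'s judgement \<times> 's inst"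
  define h where "h p rs = (case (fst p) of JTy A \<Rightarrow> JTy (inst A (snd p)) | JTm t A \<Rightarrow> JTm (inst t (snd p)) (inst A (snd p))
    | JEqTy A B \<alpha> \<Rightarrow> JEqTy (inst A (snd p)) (inst B (snd p)) (ffUnion ((\<lambda>x. inst_assm x (snd p)) |`| \<alpha>))
    | JEqTm s t A \<alpha> \<Rightarrow> JEqTm (inst s (snd p)) (inst t (snd p)) (inst A (snd p)) (ffUnion ((\<lambda>x. inst_assm x (snd p)) |`| \<alpha>))
    | JAbs A J \<Rightarrow> (case rs of [] \<Rightarrow> J | r # _ \<Rightarrow> JAbs (inst A (snd p)) r))" for p :: "'s judgement \<times> 's inst" and rs
  show "computable (enc_jdg \<otimes> enc_inst) enc_jdg (\<lambda>p. inst_jdg (fst p) (snd p))"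
  proof (rule computable_rec_fun[where deps = deps and h = h and m = "\<lambda>p. size (fst p)"])
    show "computable (enc_jdg \<otimes> enc_inst) (enc_list (enc_jdg \<otimes> enc_inst)) deps"
      unfolding deps_def by (rule re_intros)+
    show "computable ((enc_jdg \<otimes> enc_inst) \<otimes> enc_list enc_jdg) enc_jdg (\<lambda>p. h (fst p) (snd p))"
      unfolding h_def by (rule re_intros)+
    show "(\<lambda>p. inst_jdg (fst p) (snd p)) x = h x (map (\<lambda>p. inst_jdg (fst p) (snd p)) (deps x))" for x
      by (cases x; cases "(fst x)") (auto simp: h_def deps_def)
    show "(\<lambda>p. size (fst p)) y < (\<lambda>p. size (fst p)) x" if "y \<in> set (deps x)" for x y
      using that by (cases x; cases "(fst x)") (auto simp: deps_def)
  qed (rule re_intros)+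
qed

lemma computable_asm_jdg [re_intros]:
  assumes "computable c enc_jdg f1"
  shows "computable c (enc_fset enc_assm) (\<lambda>x. asm_jdg (f1 x))"
proof (rule computable_comp[OF _ assms])
  define deps where "deps p = (case p of JAbs A J \<Rightarrow> [J] | _ \<Rightarrow> [])" for p :: "'s judgement"
  define h where "h p rs = (case p of JTy A \<Rightarrow> asm A | JTm t A \<Rightarrow> asm t |\<union>| asm A | JEqTy A B \<alpha> \<Rightarrow> asm A |\<union>| asm B |\<union>| asm_set \<alpha>
    | JEqTm s t A \<alpha> \<Rightarrow> asm s |\<union>| asm t |\<union>| asm A |\<union>| asm_set \<alpha>
    | JAbs A J \<Rightarrow> (case rs of [] \<Rightarrow> {||} | r # _ \<Rightarrow> asm A |\<union>| unbind r))" for p :: "'s judgement" and rs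
  show "computable enc_jdg (enc_fset enc_assm) asm_jdg"
  proof (rule computable_rec_fun[where deps = deps and h = h and m = "\<lambda>p. size p"])
    show "computable enc_jdg (enc_list enc_jdg) deps"
      unfolding deps_def by (rule re_intros)+
    show "computable (enc_jdg \<otimes> enc_list (enc_fset enc_assm)) (enc_fset enc_assm) (\<lambda>p. h (fst p) (snd p))"
      unfolding h_def by (rule re_intros)+
    show "asm_jdg x = h x (map asm_jdg (deps x))" for x
      by (cases x) (auto simp: h_def deps_def)
    show "(\<lambda>p. size p) y < (\<lambda>p. size p) x" if "y \<in> set (deps x)" for x y
      using that by (cases x) (auto simp: deps_def)
  qed (rule re_intros)+
qed

lemma computable_fill_total [re_intros]:
  assumes "computable c enc_bdry f1" "computable c enc_expr f2"
  shows "computable c enc_jdg (\<lambda>x. fill_total (f1 x) (f2 x))"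
proof (rule computable_app2[OF _ assms])
  define deps where "deps p = (case (fst p) of BAbs A \<B> \<Rightarrow> (case (snd p) of Abs e \<Rightarrow> [(\<B>, e)] | _ \<Rightarrow> []) | _ \<Rightarrow> [])" for p :: "'s bdry \<times> 's expr"
  \<comment> \<open>Here an empty \<open>rs\<close> under \<open>BAbs\<close> does occur: it means
    that the head is no abstraction, and the value is the junk value of
    \<open>fill_total\<close>.\<close>
  define h where "h p rs = (case (fst p) of BTy \<Rightarrow> JTy (snd p) | BTm A \<Rightarrow> JTm (snd p) A | BEqTy A B \<Rightarrow> JEqTy A B (asm (snd p)) | BEqTm s t A \<Rightarrow> JEqTm s t A (asm (snd p))
    | BAbs A \<B> \<Rightarrow> (case rs of [] \<Rightarrow> JTy (snd p) | r # _ \<Rightarrow> JAbs A r))" for p :: "'s bdry \<times> 's expr" and rs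
  show "computable (enc_bdry \<otimes> enc_expr) enc_jdg (\<lambda>p. fill_total (fst p) (snd p))"
  proof (rule computable_rec_fun[where deps = deps and h = h and m = "\<lambda>p. size (fst p)"])
    show "computable (enc_bdry \<otimes> enc_expr) (enc_list (enc_bdry \<otimes> enc_expr)) deps"
      unfolding deps_def by (rule re_intros)+
    show "computable ((enc_bdry \<otimes> enc_expr) \<otimes> enc_list enc_jdg) enc_jdg (\<lambda>p. h (fst p) (snd p))"
      unfolding h_def by (rule re_intros)+
    show "(\<lambda>p. fill_total (fst p) (snd p)) x = h x (map (\<lambda>p. fill_total (fst p) (snd p)) (deps x))" for x
      by (cases x; cases "(fst x)"; cases "(snd x)") (auto simp: h_def deps_def)
    show "(\<lambda>p. size (fst p)) y < (\<lambda>p. size (fst p)) x" if "y \<in> set (deps x)" for x y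
      using that by (cases x; cases "(fst x)"; cases "(snd x)") (auto simp: deps_def)
  qed (rule re_intros)+
qed

lemma computable_fill_eq_total [re_intros]:
  assumes "computable c enc_bdry f1" "computable c enc_expr f2" "computable c enc_expr f3" "computable c (enc_fset enc_assm) f4"
  shows "computable c enc_jdg (\<lambda>x. fill_eq_total (f1 x) (f2 x) (f3 x) (f4 x))"
proof (rule computable_app4[OF _ assms])
  define deps where "deps p = (case (fst p) of BAbs A \<B> \<Rightarrow> (case (fst (snd p)) of Abs e \<Rightarrow> (case (fst (snd (snd p))) of Abs e' \<Rightarrow> [(\<B>, e, e', (snd (snd (snd p))))] | _ \<Rightarrow> []) | _ \<Rightarrow> []) | _ \<Rightarrow> [])" for p :: "'s bdry \<times> 's expr \<times> 's expr \<times> 's assm fset"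
  define h where "h p rs = (case (fst p) of BTy \<Rightarrow> JEqTy (fst (snd p)) (fst (snd (snd p))) (snd (snd (snd p))) | BTm A \<Rightarrow> JEqTm (fst (snd p)) (fst (snd (snd p))) A (snd (snd (snd p))) | BEqTy A B \<Rightarrow> JTy (fst (snd p)) | BEqTm s t A \<Rightarrow> JTy (fst (snd p))
    | BAbs A \<B> \<Rightarrow> (case rs of [] \<Rightarrow> JTy (fst (snd p)) | r # _ \<Rightarrow> JAbs A r))" for p :: "'s bdry \<times> 's expr \<times> 's expr \<times> 's assm fset" and rs
  show "computable (enc_bdry \<otimes> enc_expr \<otimes> enc_expr \<otimes> enc_fset enc_assm) enc_jdg (\<lambda>p. fill_eq_total (fst p) (fst (snd p)) (fst (snd (snd p))) (snd (snd (snd p))))"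
  proof (rule computable_rec_fun[where deps = deps and h = h and m = "\<lambda>p. size (fst p)"])
    show "computable (enc_bdry \<otimes> enc_expr \<otimes> enc_expr \<otimes> enc_fset enc_assm) (enc_list (enc_bdry \<otimes> enc_expr \<otimes> enc_expr \<otimes> enc_fset enc_assm)) deps"
      unfolding deps_def by (rule re_intros)+
    show "computable ((enc_bdry \<otimes> enc_expr \<otimes> enc_expr \<otimes> enc_fset enc_assm) \<otimes> enc_list enc_jdg) enc_jdg (\<lambda>p. h (fst p) (snd p))"
      unfolding h_def by (rule re_intros)+
    show "(\<lambda>p. fill_eq_total (fst p) (fst (snd p)) (fst (snd (snd p))) (snd (snd (snd p)))) x = h x (map (\<lambda>p. fill_eq_total (fst p) (fst (snd p)) (fst (snd (snd p))) (snd (snd (snd p)))) (deps x))" for x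
      by (cases x; cases "(fst x)"; cases "(fst (snd x))"; cases "(fst (snd (snd x)))") (auto simp: h_def deps_def)
    show "(\<lambda>p. size (fst p)) y < (\<lambda>p. size (fst p)) x" if "y \<in> set (deps x)" for x y
      using that by (cases x; cases "(fst x)"; cases "(fst (snd x))"; cases "(fst (snd (snd x)))") (auto simp: deps_def)
  qed (rule re_intros)+
qed

lemma computable_arg_judgements [re_intros]:
  assumes "computable c enc_bdry f1" "computable c (enc_list enc_expr) f2"
  shows "computable c (enc_list enc_jdg) (\<lambda>x. arg_judgements (f1 x) (f2 x))"
proof (rule computable_app2[OF _ assms])
  define deps where "deps p = (case (fst p) of BAbs A \<B> \<Rightarrow> (case (snd p) of [] \<Rightarrow> [] | t # ts \<Rightarrow> [(subst_bdry \<B> 0 t, ts)]) | _ \<Rightarrow> [])" for p :: "'s bdry \<times> 's expr list"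
  define h where "h p rs = (case (fst p) of BAbs A \<B> \<Rightarrow> (case (snd p) of [] \<Rightarrow> [] | t # ts \<Rightarrow> (case rs of [] \<Rightarrow> [] | r # _ \<Rightarrow> JTm t A # r)) | _ \<Rightarrow> [])" for p :: "'s bdry \<times> 's expr list" and rs
  show "computable (enc_bdry \<otimes> enc_list enc_expr) (enc_list enc_jdg) (\<lambda>p. arg_judgements (fst p) (snd p))"
  proof (rule computable_rec_fun[where deps = deps and h = h and m = "\<lambda>p. length (snd p)"])
    show "computable (enc_bdry \<otimes> enc_list enc_expr) (enc_list (enc_bdry \<otimes> enc_list enc_expr)) deps"
      unfolding deps_def by (rule re_intros)+
    show "computable ((enc_bdry \<otimes> enc_list enc_expr) \<otimes> enc_list (enc_list enc_jdg)) (enc_list enc_jdg) (\<lambda>p. h (fst p) (snd p))"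
      unfolding h_def by (rule re_intros)+
    show "(\<lambda>p. arg_judgements (fst p) (snd p)) x = h x (map (\<lambda>p. arg_judgements (fst p) (snd p)) (deps x))" for x
      by (cases x; cases "(fst x)"; cases "(snd x)") (auto simp: h_def deps_def)
    show "(\<lambda>p. length (snd p)) y < (\<lambda>p. length (snd p)) x" if "y \<in> set (deps x)" for x y
      using that by (cases x; cases "(fst x)"; cases "(snd x)") (auto simp: deps_def)
  qed (rule re_intros)+
qed

lemma computable_arg_equations [re_intros]:
  assumes "computable c enc_bdry f1" "computable c (enc_list enc_expr) f2" "computable c (enc_list enc_expr) f3" "computable c (enc_list (enc_fset enc_assm)) f4"
  shows "computable c (enc_list enc_jdg) (\<lambda>x. arg_equations (f1 x) (f2 x) (f3 x) (f4 x))"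
proof (rule computable_app4[OF _ assms])
  define deps where "deps p = (case (fst p) of BAbs A \<B> \<Rightarrow> (case (fst (snd p)) of [] \<Rightarrow> [] | s # ss \<Rightarrow> (case (fst (snd (snd p))) of [] \<Rightarrow> [] | t # ts \<Rightarrow>
      (case (snd (snd (snd p))) of [] \<Rightarrow> [] | \<alpha> # \<alpha>s \<Rightarrow> [(subst_bdry \<B> 0 s, ss, ts, \<alpha>s)]))) | _ \<Rightarrow> [])" for p :: "'s bdry \<times> 's expr list \<times> 's expr list \<times> 's assm fset list"
  define h where "h p rs = (case (fst p) of BAbs A \<B> \<Rightarrow> (case (fst (snd p)) of [] \<Rightarrow> [] | s # _ \<Rightarrow> (case (fst (snd (snd p))) of [] \<Rightarrow> [] | t # _ \<Rightarrow>
      (case (snd (snd (snd p))) of [] \<Rightarrow> [] | \<alpha> # _ \<Rightarrow> (case rs of [] \<Rightarrow> [] | r # _ \<Rightarrow> JEqTm s t A \<alpha> # r)))) | _ \<Rightarrow> [])" for p :: "'s bdry \<times> 's expr list \<times> 's expr list \<times> 's assm fset list" and rs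
  show "computable (enc_bdry \<otimes> enc_list enc_expr \<otimes> enc_list enc_expr \<otimes> enc_list (enc_fset enc_assm)) (enc_list enc_jdg) (\<lambda>p. arg_equations (fst p) (fst (snd p)) (fst (snd (snd p))) (snd (snd (snd p))))"
  proof (rule computable_rec_fun[where deps = deps and h = h and m = "\<lambda>p. length (fst (snd p))"])
    show "computable (enc_bdry \<otimes> enc_list enc_expr \<otimes> enc_list enc_expr \<otimes> enc_list (enc_fset enc_assm)) (enc_list (enc_bdry \<otimes> enc_list enc_expr \<otimes> enc_list enc_expr \<otimes> enc_list (enc_fset enc_assm))) deps"
      unfolding deps_def by (rule re_intros)+
    show "computable ((enc_bdry \<otimes> enc_list enc_expr \<otimes> enc_list enc_expr \<otimes> enc_list (enc_fset enc_assm)) \<otimes> enc_list (enc_list enc_jdg)) (enc_list enc_jdg) (\<lambda>p. h (fst p) (snd p))"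
      unfolding h_def by (rule re_intros)+
    show "(\<lambda>p. arg_equations (fst p) (fst (snd p)) (fst (snd (snd p))) (snd (snd (snd p)))) x = h x (map (\<lambda>p. arg_equations (fst p) (fst (snd p)) (fst (snd (snd p))) (snd (snd (snd p)))) (deps x))" for x
      by (cases x; cases "(fst x)"; cases "(fst (snd x))"; cases "(fst (snd (snd x)))"; cases "(snd (snd (snd x)))") (auto simp: h_def deps_def)
    show "(\<lambda>p. length (fst (snd p))) y < (\<lambda>p. length (fst (snd p))) x" if "y \<in> set (deps x)" for x y
      using that by (cases x; cases "(fst x)"; cases "(fst (snd x))"; cases "(fst (snd (snd x)))"; cases "(snd (snd (snd x)))") (auto simp: deps_def)
  qed (rule re_intros)+
qed

end

section \<open>Derivability is recursively enumerable\<close>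

context relative_re begin

text \<open>For the condition \<open>\<not> is_object_class c\<close>, which abbreviates the
  negation of a disjunction of two equations.\<close>

lemma re_not_disj [re_intros]:
  "re c (\<lambda>x. \<not> P x) \<Longrightarrow> re c (\<lambda>x. \<not> Q x) \<Longrightarrow> re c (\<lambda>x. \<not> (P x \<or> Q x))"
  unfolding de_Morgan_disj by (rule re_conj)

end

inductive_cases wf_AbsE: "wf_expr \<Sigma> k (c, Suc n) e"

lemma ar_inst_bdry [simp]: "ar (inst_bdry \<B> I) = ar \<B>"
  by (induction \<B> rule: ar.induct) auto

lemma fill_total: "wf_expr \<Sigma> k (ar \<B>) e \<Longrightarrow> fill \<B> e = fill_total \<B> e"
  by (induction \<B> e arbitrary: k rule: fill_total.induct) (auto elim: wf_AbsE)

lemma fill_eq_total: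
  "wf_expr \<Sigma> k (ar \<B>) e \<Longrightarrow> wf_expr \<Sigma> k (ar \<B>) e' \<Longrightarrow> is_object_class (fst (ar \<B>)) \<Longrightarrow>
    fill_eq \<B> e e' \<alpha> = fill_eq_total \<B> e e' \<alpha>"
proof (induction \<B> arbitrary: k e e' rule: ar.induct)
  case (5 A \<B>)
  from "5.prems"(1) obtain f where "e = Abs f" "wf_expr \<Sigma> (Suc k) (ar \<B>) f" by (auto elim: wf_AbsE)
  moreover from "5.prems"(2) obtain f' where "e' = Abs f'" "wf_expr \<Sigma> (Suc k) (ar \<B>) f'" by (auto elim: wf_AbsE)
  ultimately show ?case using "5.IH"(1) "5.prems"(3) by simp
qed auto

section \<open>Premises of the rules as folds\<close>

text \<open>\<open>rule_premises\<close> picks prefixes by index. The fold carries the instantiation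
  of the earlier metavariables along and thereby builds the same boundaries. It is run over the
  reversed list, since \<open>foldr\<close> starts at the right end.\<close>

definition premise_step ::
  "'s mvar \<times> 's expr \<Rightarrow> 's inst \<times> 's judgement list \<Rightarrow> 's inst \<times> 's judgement list" where
  "premise_step z acc =
     (fst acc @ [z], snd acc @ [fill_total (inst_bdry (snd (fst z)) (fst acc)) (snd z)])"

definition inst_premises :: "'s inst \<Rightarrow> 's judgement list" where
  "inst_premises zs = snd (foldr premise_step (rev zs) ([], []))"

lemma inst_premises_snoc:
  "inst_premises (zs @ [z]) = inst_premises zs @ [fill_total (inst_bdry (snd (fst z)) zs) (snd z)]"
proof -
  have "fst (foldr premise_step (rev zs) ([], [])) = zs"
    by (induction zs rule: rev_induct) (auto simp: premise_step_def)
  then show ?thesis by (simp add: inst_premises_def premise_step_def)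
qed

definition values_wf :: "'s signature \<Rightarrow> 's inst \<Rightarrow> bool" where
  "values_wf \<Sigma> zs \<longleftrightarrow> (\<forall>z \<in> set zs. wf_expr \<Sigma> 0 (ar (snd (fst z))) (snd z))"

lemma inst_values_iff: "inst_values \<Sigma> (map fst zs) (map snd zs) \<longleftrightarrow> values_wf \<Sigma> zs"
  unfolding inst_values_def values_wf_def by (simp add: all_set_conv_all_nth)

lemma rule_premises_eq:
  assumes "values_wf \<Sigma> zs" shows "rule_premises (map fst zs) (map snd zs) = inst_premises zs"
  using assms
proof (induction zs rule: rev_induct)
  case Nil
  then show ?case by (simp add: rule_premises_def inst_premises_def)
next
  case (snoc z zs)
  have "premise_bdry (map fst zs @ [fst z]) (map snd zs @ [snd z]) i =
      premise_bdry (map fst zs) (map snd zs) i" if "i < length zs" for i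
    using that by (simp add: premise_bdry_def nth_append)
  then have "rule_premises (map fst (zs @ [z])) (map snd (zs @ [z])) =
      rule_premises (map fst zs) (map snd zs) @ [fill (inst_bdry (snd (fst z)) zs) (snd z)]"
    by (simp add: rule_premises_def nth_append)
      (simp add: premise_bdry_def nth_append zip_map_fst_snd)
  moreover have "fill (inst_bdry (snd (fst z)) zs) (snd z) = fill_total (inst_bdry (snd (fst z)) zs) (snd z)"
    by (rule fill_total[of \<Sigma> 0]) (use snoc(2) in \<open>simp add: values_wf_def\<close>)
  ultimately show ?case using snoc by (simp add: inst_premises_snoc values_wf_def)
qed

text \<open>The data of a congruence rule for one metavariable: \<open>((M, \<B>), f, g, g', \<alpha>)\<close>.\<close>

type_synonym 's congr_arg = "'s mvar \<times> 's expr \<times> 's expr \<times> 's expr \<times> 's assm fset"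

abbreviation arg_f :: "'s congr_arg \<Rightarrow> 's expr" where "arg_f q \<equiv> fst (snd q)"
abbreviation arg_g :: "'s congr_arg \<Rightarrow> 's expr" where "arg_g q \<equiv> fst (snd (snd q))"
abbreviation arg_g' :: "'s congr_arg \<Rightarrow> 's expr" where "arg_g' q \<equiv> fst (snd (snd (snd q)))"
abbreviation arg_asm :: "'s congr_arg \<Rightarrow> 's assm fset" where "arg_asm q \<equiv> snd (snd (snd (snd q)))"
abbreviation inst_f :: "'s congr_arg list \<Rightarrow> 's inst" where "inst_f qs \<equiv> map (\<lambda>q. (fst q, arg_f q)) qs"
abbreviation inst_g :: "'s congr_arg list \<Rightarrow> 's inst" where "inst_g qs \<equiv> map (\<lambda>q. (fst q, arg_g q)) qs"
abbreviation inst_g' :: "'s congr_arg list \<Rightarrow> 's inst" where "inst_g' qs \<equiv> map (\<lambda>q. (fst q, arg_g' q)) qs"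

text \<open>The same fold for the equations of a congruence rule; the selection by
  \<open>object_indices\<close> becomes a test at each metavariable.\<close>

definition equation_step ::
  "'s congr_arg \<Rightarrow> 's inst \<times> 's judgement list \<Rightarrow> 's inst \<times> 's judgement list" where
  "equation_step q acc =
     (fst acc @ [(fst q, arg_f q)],
      snd acc @ (if is_object_class (fst (ar (snd (fst q))))
        then [fill_eq_total (inst_bdry (snd (fst q)) (fst acc)) (arg_f q) (arg_g' q) (arg_asm q)] else []))"

definition congr_equations :: "'s congr_arg list \<Rightarrow> 's judgement list" where
  "congr_equations qs = snd (foldr equation_step (rev qs) ([], []))"

lemma congr_equations_snoc:
  "congr_equations (qs @ [q]) = congr_equations qs @ (if is_object_class (fst (ar (snd (fst q))))
     then [fill_eq_total (inst_bdry (snd (fst q)) (inst_f qs)) (arg_f q) (arg_g' q) (arg_asm q)] else [])"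
proof -
  have "fst (foldr equation_step (rev qs) ([], [])) = inst_f qs"
    by (induction qs rule: rev_induct) (auto simp: equation_step_def)
  then show ?thesis by (simp add: congr_equations_def equation_step_def)
qed

lemma object_indices_snoc:
  "object_indices (ms @ [m]) = object_indices ms @
    (if is_object_class (fst (ar (snd m))) then [length ms] else [])"
proof -
  have "filter (\<lambda>i. is_object_class (fst (ar (snd ((ms @ [m]) ! i))))) [0..<length ms] = object_indices ms"
    unfolding object_indices_def by (rule filter_cong) (auto simp: nth_append)
  then show ?thesis by (simp add: object_indices_def)
qed

lemma object_indices_less: "i \<in> set (object_indices ms) \<Longrightarrow> i < length ms"
  by (auto simp: object_indices_def)

lemma zip_inst_f: "zip (map fst qs) (map (\<lambda>q. arg_f q) qs) = inst_f qs"
  by (induction qs) auto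

lemma congr_equations_eq:
  assumes "values_wf \<Sigma> (inst_f qs)" "values_wf \<Sigma> (inst_g' qs)"
  shows "map (\<lambda>i. fill_eq (premise_bdry (map fst qs) (map (\<lambda>q. arg_f q) qs) i) (map (\<lambda>q. arg_f q) qs ! i)
    (map (\<lambda>q. arg_g' q) qs ! i) (map (\<lambda>q. arg_asm q) qs ! i)) (object_indices (map fst qs)) = congr_equations qs"
  using assms
proof (induction qs rule: rev_induct)
  case Nil
  then show ?case by (simp add: congr_equations_def object_indices_def)
next
  case (snoc q qs)
  let ?F = "\<lambda>qs i. fill_eq (premise_bdry (map fst qs) (map (\<lambda>q. arg_f q) qs) i) (map (\<lambda>q. arg_f q) qs ! i)
    (map (\<lambda>q. arg_g' q) qs ! i) (map (\<lambda>q. arg_asm q) qs ! i)"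
  have "?F (qs @ [q]) i = ?F qs i" if "i \<in> set (object_indices (map fst qs))" for i
    using object_indices_less[OF that] by (simp add: premise_bdry_def nth_append)
  then have "map (?F (qs @ [q])) (object_indices (map fst qs)) = map (?F qs) (object_indices (map fst qs))"
    by simp
  moreover have "map (?F qs) (object_indices (map fst qs)) = congr_equations qs"
    using snoc by (auto simp: values_wf_def)
  moreover have "?F (qs @ [q]) (length qs) =
      fill_eq_total (inst_bdry (snd (fst q)) (inst_f qs)) (arg_f q) (arg_g' q) (arg_asm q)"
    if "is_object_class (fst (ar (snd (fst q))))"
  proof -
    have "?F (qs @ [q]) (length qs) =
        fill_eq (inst_bdry (snd (fst q)) (inst_f qs)) (arg_f q) (arg_g' q) (arg_asm q)"
      by (simp add: nth_append premise_bdry_def zip_inst_f)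
    also have "\<dots> = fill_eq_total (inst_bdry (snd (fst q)) (inst_f qs)) (arg_f q) (arg_g' q) (arg_asm q)"
      by (rule fill_eq_total[of \<Sigma> 0]) (use snoc(2,3) that in \<open>auto simp: values_wf_def\<close>)
    finally show ?thesis .
  qed
  ultimately show ?case by (auto simp: object_indices_snoc congr_equations_snoc)
qed

section \<open>Well-formedness as a least fixed point\<close>

text \<open>The rules of well-formed syntax as a relation between a conclusion and the list of its
  recursive premises. Quantification over argument positions becomes a map over one list
  \<open>zs\<close> of pairs of an arity and an argument.\<close>

inductive wf_step :: "'s signature \<Rightarrow> (nat \<times> arity \<times> 's expr) + (nat \<times> 's assm) + (nat \<times> 's bdry) \<Rightarrow>
    ((nat \<times> arity \<times> 's expr) + (nat \<times> 's assm) + (nat \<times> 's bdry)) list \<Rightarrow> bool" for \<Sigma> where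
  "wf_step \<Sigma> (Inl (k, (Tm, 0), FVar a A)) [Inl (0, (Ty, 0), A)]"
| "i < k \<Longrightarrow> wf_step \<Sigma> (Inl (k, (Tm, 0), BVar i)) []"
| "\<Sigma> S = Some (c, map fst zs) \<Longrightarrow>
    wf_step \<Sigma> (Inl (k, (c, 0), Sym S (map snd zs))) (map (\<lambda>z. Inl (k, fst z, snd z)) zs)"
| "\<lbrakk>frees (asm_bdry \<B>) = {||}; ar \<B> = (c, length ts); is_object_class c\<rbrakk> \<Longrightarrow>
    wf_step \<Sigma> (Inl (k, (c, 0), Meta M \<B> ts)) (NB (0, \<B>) # map (\<lambda>t. Inl (k, (Tm, 0), t)) ts)"
| "wf_step \<Sigma> (Inl (k, (Tm, 0), Conv t (fset_of_list xs)))
    (Inl (k, (Tm, 0), t) # map (\<lambda>x. NA (k, x)) xs)"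
| "\<not> is_object_class c \<Longrightarrow> wf_step \<Sigma> (Inl (k, (c, 0), Asms (fset_of_list xs))) (map (\<lambda>x. NA (k, x)) xs)"
| "wf_step \<Sigma> (Inl (k, (c, Suc n), Abs e)) [Inl (Suc k, (c, n), e)]"
| "wf_step \<Sigma> (NA (k, AFree a A)) [Inl (0, (Ty, 0), A)]"
| "i < k \<Longrightarrow> wf_step \<Sigma> (NA (k, ABound i)) []"
| "frees (asm_bdry \<B>) = {||} \<Longrightarrow> wf_step \<Sigma> (NA (k, AMeta M \<B>)) [NB (0, \<B>)]"
| "wf_step \<Sigma> (NB (k, BTy)) []"
| "wf_step \<Sigma> (NB (k, BTm A)) [Inl (k, (Ty, 0), A)]"
| "wf_step \<Sigma> (NB (k, BEqTy A B)) [Inl (k, (Ty, 0), A), Inl (k, (Ty, 0), B)]"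
| "wf_step \<Sigma> (NB (k, BEqTm s t A)) [Inl (k, (Tm, 0), s), Inl (k, (Tm, 0), t), Inl (k, (Ty, 0), A)]"
| "wf_step \<Sigma> (NB (k, BAbs A \<B>)) [Inl (k, (Ty, 0), A), NB (Suc k, \<B>)]"

definition wf_node :: "'s signature \<Rightarrow> (nat \<times> arity \<times> 's expr) + (nat \<times> 's assm) + (nat \<times> 's bdry) \<Rightarrow> bool" where
  "wf_node \<Sigma> w = (case w of Inl (k, a, e) \<Rightarrow> wf_expr \<Sigma> k a e
     | Inr y \<Rightarrow> (case y of Inl (k, x) \<Rightarrow> wf_assm \<Sigma> k x | Inr (k, \<B>) \<Rightarrow> wf_bdry \<Sigma> k \<B>))"

lemma wf_node_simps [simp]:
  "wf_node \<Sigma> (Inl (k, a, e)) = wf_expr \<Sigma> k a e"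
  "wf_node \<Sigma> (NA (k, x)) = wf_assm \<Sigma> k x"
  "wf_node \<Sigma> (NB (k, \<B>)) = wf_bdry \<Sigma> k \<B>"
  by (simp_all add: wf_node_def)

text \<open>This and \<open>wf_step_least\<close> are the two hypotheses that \<open>re_lfp\<close>
  makes about the fixed point.\<close>

lemma wf_step_closed:
  assumes "wf_step \<Sigma> w ws" "\<And>v. v \<in> set ws \<Longrightarrow> wf_node \<Sigma> v" shows "wf_node \<Sigma> w"
proof -
  have ws: "\<forall>v \<in> set ws. wf_node \<Sigma> v" using assms(2) by blast
  from assms(1) show ?thesis
  proof cases
  case (3 S c zs k)
  have "wf_expr \<Sigma> k (fst z) (snd z)" if "z \<in> set zs" for z
    using assms(2)[of "Inl (k, z)"] that 3 by (cases z) auto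
  then have "wf_expr \<Sigma> k (map fst zs ! i) (map snd zs ! i)" if "i < length (map fst zs)" for i
    using that by simp
  then have "wf_expr \<Sigma> k (c, 0) (Sym S (map snd zs))"
    by (intro wf_expr_wf_assm_wf_bdry.intros(3)[where ars = "map fst zs"]) (use 3 in auto)
  then show ?thesis using 3 by simp
  qed (use ws in \<open>auto intro!: wf_expr_wf_assm_wf_bdry.intros simp: fset_of_list.rep_eq\<close>)
qed

lemma wf_step_least:
  assumes Q: "\<And>w ws. wf_step \<Sigma> w ws \<Longrightarrow> (\<And>v. v \<in> set ws \<Longrightarrow> Q v) \<Longrightarrow> Q w"
  shows "wf_node \<Sigma> w \<Longrightarrow> Q w"
proof -
  have set: "\<exists>xs. \<alpha> = fset_of_list xs" for \<alpha> :: "'a assm fset"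
    using exists_fset_of_list[of \<alpha>] by metis
  have "wf_expr \<Sigma> k a e \<Longrightarrow> Q (Inl (k, a, e))" "wf_assm \<Sigma> k x \<Longrightarrow> Q (NA (k, x))"
    "wf_bdry \<Sigma> k \<B> \<Longrightarrow> Q (NB (k, \<B>))" for k a e x \<B>
  proof (induction rule: wf_expr_wf_assm_wf_bdry.inducts)
    case (3 S c ars es k)
    have "map fst (zip ars es) = ars" "map snd (zip ars es) = es" using 3 by auto
    then have "wf_step \<Sigma> (Inl (k, (c, 0), Sym S es)) (map (\<lambda>z. Inl (k, fst z, snd z)) (zip ars es))"
      using wf_step.intros(3)[of \<Sigma> S c "zip ars es" k] 3(1) by simp
    then show ?case by (rule Q) (use 3 in \<open>auto simp: set_zip\<close>)
  next
    case (5 k t \<alpha>)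
    obtain xs where xs: "\<alpha> = fset_of_list xs" using set by blast
    show ?case unfolding xs
      by (rule Q[OF wf_step.intros(5)]) (use 5 xs in \<open>auto simp: fset_of_list.rep_eq\<close>)
  next
    case (6 c \<alpha> k)
    obtain xs where xs: "\<alpha> = fset_of_list xs" using set by blast
    show ?case unfolding xs
      by (rule Q[OF wf_step.intros(6)]) (use 6 xs in \<open>auto simp: fset_of_list.rep_eq\<close>)
  next
    case (4 \<B> c ts k M)
    show ?case by (rule Q[OF wf_step.intros(4)]) (use 4 in auto)
  qed (rule Q, rule wf_step.intros; force)+
  then show "wf_node \<Sigma> w \<Longrightarrow> Q w"
    by (auto simp: wf_node_def split: sum.splits)
qed

definition congr_args_ok :: "'s signature \<Rightarrow> 's congr_arg list \<Rightarrow> bool" where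
  "congr_args_ok \<Sigma> qs \<longleftrightarrow> (\<forall>q \<in> set qs. wf_expr \<Sigma> 0 (ar (snd (fst q))) (arg_f q) \<and>
     wf_expr \<Sigma> 0 (ar (snd (fst q))) (arg_g q) \<and> wf_expr \<Sigma> 0 (ar (snd (fst q))) (arg_g' q) \<and>
     (\<not> is_object_class (fst (ar (snd (fst q)))) \<or> erase (arg_g' q) = erase (arg_g q)))"

definition congr_premises :: "'s congr_arg list \<Rightarrow> 's judgement list" where
  "congr_premises qs = inst_premises (inst_f qs) @ inst_premises (inst_g qs) @ congr_equations qs"

section \<open>Derivability as a least fixed point\<close>

text \<open>The rules of derivability as a relation with a finite premise list. Partial operations
  are replaced by total ones, and parallel lists are zipped into \<open>zs\<close> and
  \<open>qs\<close>, so that all side conditions are covered by the closure rules for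
  enumerability.\<close>

inductive drv_step :: "'s signature \<Rightarrow> 's rule set \<Rightarrow> 's judgement + 's bdry \<Rightarrow>
    ('s judgement + 's bdry) list \<Rightarrow> bool" for \<Sigma> T where
  Var: "wf_expr \<Sigma> 0 (Ty, 0) A \<Longrightarrow> drv_step \<Sigma> T (Inl (JTm (FVar a A) A)) []"
| Abstr: "AFree a A |\<notin>| asm_jdg J \<Longrightarrow>
    drv_step \<Sigma> T (Inl (JAbs A J)) [Inl (JTy A), Inl (subst_jdg J 0 (FVar a A))]"
| Meta: "\<lbrakk>closed_bdry \<Sigma> \<B>; snd (ar \<B>) = length ts\<rbrakk> \<Longrightarrow>
    drv_step \<Sigma> T (Inl (fill_total (apply_bdry \<B> ts) (expr.Meta M \<B> ts)))
      (Inr (apply_bdry \<B> ts) # map Inl (arg_judgements \<B> ts))"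
| Meta_Congr_Ty: "\<lbrakk>closed_bdry \<Sigma> \<B>; ar \<B> = (Ty, length ss);
    length ts = length ss; length ts' = length ss; length \<alpha>s = length ss;
    Ps = arg_judgements \<B> ss @ arg_judgements \<B> ts @ arg_equations \<B> ss ts' \<alpha>s;
    map erase ts' = map erase ts;
    asm_jdgs Ps = asm_jdg (JEqTy (expr.Meta M \<B> ss) (expr.Meta M \<B> ts) \<gamma>)\<rbrakk> \<Longrightarrow>
    drv_step \<Sigma> T (Inl (JEqTy (expr.Meta M \<B> ss) (expr.Meta M \<B> ts) \<gamma>)) (map Inl Ps)"
| Meta_Congr_Tm: "\<lbrakk>closed_bdry \<Sigma> \<B>; ar \<B> = (Tm, length ss);
    length ts = length ss; length ts' = length ss; length \<alpha>s = length ss;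
    apply_bdry \<B> ss = BTm B;
    Ps = arg_judgements \<B> ss @ arg_judgements \<B> ts @ arg_equations \<B> ss ts' \<alpha>s @ [JTm v B];
    map erase ts' = map erase ts; erase v = erase (expr.Meta M \<B> ts);
    asm_jdgs Ps = asm_jdg (JEqTm (expr.Meta M \<B> ss) v B \<gamma>)\<rbrakk> \<Longrightarrow>
    drv_step \<Sigma> T (Inl (JEqTm (expr.Meta M \<B> ss) v B \<gamma>)) (map Inl Ps)"
| EqTy_Refl: "erase A = erase B \<Longrightarrow> drv_step \<Sigma> T (Inl (JEqTy A B {||})) [Inl (JTy A), Inl (JTy B)]"
| EqTy_Sym: "drv_step \<Sigma> T (Inl (JEqTy B A \<alpha>)) [Inl (JEqTy A B \<alpha>)]"
| EqTy_Trans: "\<lbrakk>erase B = erase B'; asm_jdgs [JEqTy A B \<alpha>, JEqTy B' C \<beta>] = asm_jdg (JEqTy A C \<gamma>)\<rbrakk> \<Longrightarrow>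
    drv_step \<Sigma> T (Inl (JEqTy A C \<gamma>)) [Inl (JEqTy A B \<alpha>), Inl (JEqTy B' C \<beta>)]"
| EqTm_Refl: "erase s = erase t \<Longrightarrow> drv_step \<Sigma> T (Inl (JEqTm s t A {||})) [Inl (JTm s A), Inl (JTm t A)]"
| EqTm_Sym: "drv_step \<Sigma> T (Inl (JEqTm t s A \<alpha>)) [Inl (JEqTm s t A \<alpha>)]"
| EqTm_Trans: "\<lbrakk>erase t = erase t'; asm_jdgs [JEqTm s t A \<alpha>, JEqTm t' u A \<beta>] = asm_jdg (JEqTm s u A \<gamma>)\<rbrakk> \<Longrightarrow>
    drv_step \<Sigma> T (Inl (JEqTm s u A \<gamma>)) [Inl (JEqTm s t A \<alpha>), Inl (JEqTm t' u A \<beta>)]"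
| Conv_Tm: "asm t |\<union>| asm A |\<union>| asm B |\<union>| asm_set \<alpha> = asm t |\<union>| asm B |\<union>| asm_set \<beta> \<Longrightarrow>
    drv_step \<Sigma> T (Inl (JTm (Conv t \<beta>) B)) [Inl (JTm t A), Inl (JEqTy A B \<alpha>)]"
| Conv_EqTm: "\<lbrakk>asm s |\<union>| asm A |\<union>| asm B |\<union>| asm_set \<beta> = asm s |\<union>| asm B |\<union>| asm_set \<gamma>;
    asm t |\<union>| asm A |\<union>| asm B |\<union>| asm_set \<beta> = asm t |\<union>| asm B |\<union>| asm_set \<delta>\<rbrakk> \<Longrightarrow>
    drv_step \<Sigma> T (Inl (JEqTm (Conv s \<gamma>) (Conv t \<delta>) B \<alpha>)) [Inl (JEqTm s t A \<alpha>), Inl (JEqTy A B \<beta>)]"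
| Bdry_Ty: "drv_step \<Sigma> T (Inr BTy) []"
| Bdry_Tm: "drv_step \<Sigma> T (Inr (BTm A)) [Inl (JTy A)]"
| Bdry_EqTy: "drv_step \<Sigma> T (Inr (BEqTy A B)) [Inl (JTy A), Inl (JTy B)]"
| Bdry_EqTm: "drv_step \<Sigma> T (Inr (BEqTm s t A)) [Inl (JTy A), Inl (JTm s A), Inl (JTm t A)]"
| Bdry_Abstr: "AFree a A |\<notin>| asm_bdry \<B> \<Longrightarrow>
    drv_step \<Sigma> T (Inr (BAbs A \<B>)) [Inl (JTy A), Inr (subst_bdry \<B> 0 (FVar a A))]"
| Specific: "\<lbrakk>(map fst zs, J) \<in> T; values_wf \<Sigma> zs\<rbrakk> \<Longrightarrow>
    drv_step \<Sigma> T (Inl (inst_jdg J zs)) (Inr (inst_bdry (bdry_of J) zs) # map Inl (inst_premises zs))"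
| Congr_Ty: "\<lbrakk>(map fst qs, JTy A) \<in> T; congr_args_ok \<Sigma> qs; Ps = congr_premises qs;
    asm_jdgs Ps = asm_jdg (JEqTy (inst A (inst_f qs)) (inst A (inst_g qs)) \<gamma>)\<rbrakk> \<Longrightarrow>
    drv_step \<Sigma> T (Inl (JEqTy (inst A (inst_f qs)) (inst A (inst_g qs)) \<gamma>)) (map Inl Ps)"
| Congr_Tm: "\<lbrakk>(map fst qs, JTm t A) \<in> T; congr_args_ok \<Sigma> qs;
    Ps = congr_premises qs @ [JTm t' (inst A (inst_f qs))]; erase t' = erase (inst t (inst_g qs));
    asm_jdgs Ps = asm_jdg (JEqTm (inst t (inst_f qs)) t' (inst A (inst_f qs)) \<gamma>)\<rbrakk> \<Longrightarrow>
    drv_step \<Sigma> T (Inl (JEqTm (inst t (inst_f qs)) t' (inst A (inst_f qs)) \<gamma>)) (map Inl Ps)"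

text \<open>
  The arity of a symbol is read off its rule, so nothing but the set of rules is needed to search
  for derivations.
\<close>

locale theory_coding = syntax_coding X cs for X and cs :: "'s \<Rightarrow> nat" +
  fixes \<Sigma> :: "'s signature" and T :: "'s rule set"
  assumes re_theory: "re (enc_list (enc_nat \<otimes> enc_bdry) \<otimes> enc_jdg) (\<lambda>r. r \<in> T)"
    and signature_iff: "\<Sigma> S = Some (k, ars) \<longleftrightarrow> (\<exists>ms es A. ars = map (\<lambda>m. ar (snd m)) ms \<and>
      (k = Ty \<and> (ms, JTy (Sym S es)) \<in> T \<or> k = Tm \<and> (ms, JTm (Sym S es) A) \<in> T))"
begin

lemma re_in_theory [re_intros]:
  assumes "computable c (enc_list (enc_nat \<otimes> enc_bdry)) f" "computable c enc_jdg g"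
  shows "re c (\<lambda>x. (f x, g x) \<in> T)"
  using re_subst[OF re_theory computable_Pair[OF assms]] .

lemma re_signature [re_intros]:
  assumes "computable c cs S" "computable c enc_cls k" "computable c (enc_list enc_ar) ars"
  shows "re c (\<lambda>x. \<Sigma> (S x) = Some (k x, ars x))"
proof (rule re_app3[OF _ assms, where P = "\<lambda>S k ars. \<Sigma> S = Some (k, ars)"])
  show "re (cs \<otimes> enc_cls \<otimes> enc_list enc_ar) (\<lambda>p. \<Sigma> (fst p) = Some (fst (snd p), snd (snd p)))"
    unfolding signature_iff by (rule re_intros)+
qed

lemma re_no_frees [re_intros]:
  assumes "enumerable c" "computable c (enc_fset enc_assm) f" shows "re c (\<lambda>x. frees (f x) = {||})"
proof -
  have "re c (\<lambda>e. \<forall>x \<in> fset (f e). (\<exists>i. x = ABound i) \<or> (\<exists>M \<B>. x = AMeta M \<B>))"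
    by (rule re_intros assms)+
  moreover have "frees \<alpha> = {||} \<longleftrightarrow> (\<forall>x \<in> fset \<alpha>. (\<exists>i. x = ABound i) \<or> (\<exists>M \<B>. x = AMeta M \<B>))"
    for \<alpha> :: "'s assm fset"
    unfolding frees_def by (auto simp: fset_eq_iff) (metis assm.exhaust)
  ultimately show ?thesis by simp
qed

lemma re_wf_node:
  "re ((enc_nat \<otimes> enc_ar \<otimes> enc_expr) \<oplus> (enc_nat \<otimes> enc_assm) \<oplus> (enc_nat \<otimes> enc_bdry)) (wf_node \<Sigma>)"
proof (rule re_lfp[where Step = "wf_step \<Sigma>"])
  let ?c = "(enc_nat \<otimes> enc_ar \<otimes> enc_expr) \<oplus> (enc_nat \<otimes> enc_assm) \<oplus> (enc_nat \<otimes> enc_bdry)"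
  show "enumerable ?c" by (rule re_intros)+
  show "re (?c \<otimes> enc_list ?c) (\<lambda>p. wf_step \<Sigma> (fst p) (snd p))"
    unfolding wf_step.simps by (rule re_intros)+
qed (use wf_step_closed wf_step_least in blast)+

lemma re_wf_expr [re_intros]:
  assumes "computable c enc_nat k" "computable c enc_ar a" "computable c enc_expr e"
  shows "re c (\<lambda>x. wf_expr \<Sigma> (k x) (a x) (e x))"
proof -
  have "re c (\<lambda>x. wf_node \<Sigma> (Inl (k x, a x, e x)))"
    by (rule re_subst[OF re_wf_node] re_intros assms)+
  then show ?thesis by simp
qed

lemma re_wf_bdry [re_intros]:
  assumes "computable c enc_nat k" "computable c enc_bdry e"
  shows "re c (\<lambda>x. wf_bdry \<Sigma> (k x) (e x))"
proof -
  have "re c (\<lambda>x. wf_node \<Sigma> (NB (k x, e x)))"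
    by (rule re_subst[OF re_wf_node] re_intros assms)+
  then show ?thesis by simp
qed

lemma re_closed_bdry [re_intros]:
  assumes "enumerable c" "computable c enc_bdry e"
  shows "re c (\<lambda>x. closed_bdry \<Sigma> (e x))"
  unfolding closed_bdry_def by (rule re_intros assms)+

lemma re_values_wf [re_intros]:
  assumes "enumerable c" "computable c enc_inst e"
  shows "re c (\<lambda>x. values_wf \<Sigma> (e x))"
  unfolding values_wf_def by (rule re_intros assms)+

abbreviation "enc_congr_arg \<equiv>
  (enc_nat \<otimes> enc_bdry) \<otimes> enc_expr \<otimes> enc_expr \<otimes> enc_expr \<otimes> enc_fset enc_assm"

lemma re_congr_args_ok [re_intros]:
  assumes "enumerable c" "computable c (enc_list enc_congr_arg) e"
  shows "re c (\<lambda>x. congr_args_ok \<Sigma> (e x))"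
  unfolding congr_args_ok_def by (rule re_intros assms)+

lemma computable_inst_premises [re_intros]:
  assumes "enumerable c" "computable c enc_inst e"
  shows "computable c (enc_list enc_jdg) (\<lambda>x. inst_premises (e x))"
proof -
  have "computable c (enc_inst \<otimes> enc_list enc_jdg) (\<lambda>x. foldr ((\<lambda>_. premise_step) x) (rev (e x)) ([], []))"
    unfolding premise_step_def by (rule computable_foldr assms re_intros)+
  then show ?thesis unfolding inst_premises_def by (rule computable_snd)
qed

lemma computable_congr_equations [re_intros]:
  assumes "enumerable c" "computable c (enc_list enc_congr_arg) e"
  shows "computable c (enc_list enc_jdg) (\<lambda>x. congr_equations (e x))"
proof -
  have "computable c (enc_inst \<otimes> enc_list enc_jdg) (\<lambda>x. foldr ((\<lambda>_. equation_step) x) (rev (e x)) ([], []))"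
    unfolding equation_step_def by (rule computable_foldr assms re_intros)+
  then show ?thesis unfolding congr_equations_def by (rule computable_snd)
qed

lemma computable_congr_premises [re_intros]:
  assumes "enumerable c" "computable c (enc_list enc_congr_arg) e"
  shows "computable c (enc_list enc_jdg) (\<lambda>x. congr_premises (e x))"
  unfolding congr_premises_def by (rule assms re_intros)+

lemma computable_asm_jdgs [re_intros]:
  assumes "enumerable c" "computable c (enc_list enc_jdg) e"
  shows "computable c (enc_fset enc_assm) (\<lambda>x. asm_jdgs (e x))"
  unfolding asm_jdgs_def by (rule assms re_intros)+

lemma re_drv_step:
  "re ((enc_jdg \<oplus> enc_bdry) \<otimes> enc_list (enc_jdg \<oplus> enc_bdry)) (\<lambda>p. drv_step \<Sigma> T (fst p) (snd p))"
  unfolding drv_step.simps by (rule re_intros)+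

end

lemma ar_subst_bdry [simp]: "ar (subst_bdry \<B> k s) = ar \<B>"
  by (induction \<B> arbitrary: k s rule: ar.induct) auto

lemma snd_ar_apply_bdry: "snd (ar (apply_bdry \<B> ts)) = snd (ar \<B>) - length ts"
  by (induction \<B> ts rule: apply_bdry.induct) auto

lemma fst_ar_apply_bdry: "fst (ar (apply_bdry \<B> ts)) = fst (ar \<B>)"
  by (induction \<B> ts rule: apply_bdry.induct) auto

lemma fill_total_thesis: "snd (ar \<B>) = 0 \<Longrightarrow> fill_total \<B> e = fill \<B> e"
  by (cases \<B>) auto

definition drv_node :: "'s signature \<Rightarrow> 's rule set \<Rightarrow> 's judgement + 's bdry \<Rightarrow> bool" where
  "drv_node \<Sigma> T w = (case w of Inl J \<Rightarrow> derivable \<Sigma> T J | Inr \<B> \<Rightarrow> derivable_bdry \<Sigma> T \<B>)"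

lemma drv_node_simps [simp]:
  "drv_node \<Sigma> T (Inl J) = derivable \<Sigma> T J" "drv_node \<Sigma> T (Inr \<B>) = derivable_bdry \<Sigma> T \<B>"
  by (simp_all add: drv_node_def)

lemma congr_premises_eq:
  assumes "congr_args_ok \<Sigma> qs"
  shows "congruence_premises (map fst qs) (map (\<lambda>q. arg_f q) qs) (map (\<lambda>q. arg_g q) qs)
      (map (\<lambda>q. arg_g' q) qs) (map (\<lambda>q. arg_asm q) qs) = congr_premises qs"
proof -
  have wf: "values_wf \<Sigma> (inst_f qs)" "values_wf \<Sigma> (inst_g qs)" "values_wf \<Sigma> (inst_g' qs)"
    using assms by (auto simp: congr_args_ok_def values_wf_def)
  show ?thesis
    using rule_premises_eq[OF wf(1)] rule_premises_eq[OF wf(2)] congr_equations_eq[OF wf(1,3)]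
    by (simp add: congruence_premises_def congr_premises_def comp_def)
qed

lemma congr_args_ok_iff:
  "congr_args_ok \<Sigma> qs \<longleftrightarrow> inst_values \<Sigma> (map fst qs) (map (\<lambda>q. arg_f q) qs) \<and>
     inst_values \<Sigma> (map fst qs) (map (\<lambda>q. arg_g q) qs) \<and> inst_values \<Sigma> (map fst qs) (map (\<lambda>q. arg_g' q) qs) \<and>
     (\<forall>i \<in> set (object_indices (map fst qs)).
        erase (map (\<lambda>q. arg_g' q) qs ! i) = erase (map (\<lambda>q. arg_g q) qs ! i))"
  unfolding congr_args_ok_def inst_values_def object_indices_def all_set_conv_all_nth[of qs]
  by auto

lemma zip_congr_args:
  "zip (map fst qs) (map (\<lambda>q. arg_f q) qs) = inst_f qs" "zip (map fst qs) (map (\<lambda>q. arg_g q) qs) = inst_g qs"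
  by (induction qs) auto

text \<open>The parallel lists of a congruence rule have equal length and can be zipped into the
  single list over which the search quantifies.\<close>

lemma ex_congr_args:
  assumes "length fs = length ms" "length gs = length ms" "length gs' = length ms" "length \<alpha>s = length ms"
  obtains qs where "map fst qs = ms" "map (\<lambda>q. arg_f q) qs = fs" "map (\<lambda>q. arg_g q) qs = gs"
    "map (\<lambda>q. arg_g' q) qs = gs'" "map (\<lambda>q. arg_asm q) qs = \<alpha>s"
proof (rule that)
  let ?qs = "zip ms (zip fs (zip gs (zip gs' \<alpha>s)))"
  show "map fst ?qs = ms" "map (\<lambda>q. arg_f q) ?qs = fs" "map (\<lambda>q. arg_g q) ?qs = gs"
    "map (\<lambda>q. arg_g' q) ?qs = gs'" "map (\<lambda>q. arg_asm q) ?qs = \<alpha>s"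
    using assms by (auto intro!: nth_equalityI)
qed

lemma drv_step_closed:
  assumes "drv_step \<Sigma> T w ws" "\<And>v. v \<in> set ws \<Longrightarrow> drv_node \<Sigma> T v" shows "drv_node \<Sigma> T w"
proof -
  have ws: "\<forall>v \<in> set ws. drv_node \<Sigma> T v" using assms(2) by blast
  note I = derivable_derivable_bdry.intros
  from assms(1) show ?thesis
  proof cases
    case (Abstr a A J)
    then show ?thesis using ws by (auto intro: I(2))
  next
    case (Meta \<B> ts M)
    then have "fill_total (apply_bdry \<B> ts) (expr.Meta M \<B> ts) = fill (apply_bdry \<B> ts) (expr.Meta M \<B> ts)"
      by (intro fill_total_thesis) (simp add: snd_ar_apply_bdry)
    then show ?thesis using Meta ws by (auto intro: I(3))
  next
    case (Meta_Congr_Ty \<B> ss ts ts' \<alpha>s Ps M \<gamma>)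
    have "derivable \<Sigma> T (JEqTy (expr.Meta M \<B> ss) (expr.Meta M \<B> ts) \<gamma>)"
      by (rule I(4)[OF Meta_Congr_Ty(3,4) refl Meta_Congr_Ty(5-8) _ Meta_Congr_Ty(9,10)])
        (use ws Meta_Congr_Ty(2) in auto)
    then show ?thesis using Meta_Congr_Ty by simp
  next
    case (Meta_Congr_Tm \<B> ss ts ts' \<alpha>s B Ps v M \<gamma>)
    have "derivable \<Sigma> T (JEqTm (expr.Meta M \<B> ss) v B \<gamma>)"
      by (rule I(5)[OF Meta_Congr_Tm(3,4) refl Meta_Congr_Tm(5-9) _ Meta_Congr_Tm(10-12)])
        (use ws Meta_Congr_Tm(2) in auto)
    then show ?thesis using Meta_Congr_Tm by simp
  next
    case (EqTy_Trans B B' A \<alpha> C \<beta> \<gamma>)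
    then show ?thesis using ws by (auto intro: I(8))
  next
    case (EqTm_Trans t t' s A \<alpha> u \<beta> \<gamma>)
    then show ?thesis using ws by (auto intro: I(11))
  next
    case (Conv_Tm t A B \<alpha> \<beta>)
    then show ?thesis using ws I(12)[of \<Sigma> T t A B \<alpha> \<beta>] by simp
  next
    case (Conv_EqTm s A B \<beta> \<gamma> t \<delta> \<alpha>)
    then show ?thesis using ws I(13)[of \<Sigma> T s t A \<alpha> B \<beta> \<gamma> \<delta>] by simp
  next
    case (Bdry_Abstr a A \<B>)
    then show ?thesis using ws by (auto intro: I(18))
  next
    case (Specific zs J)
    have "derivable \<Sigma> T (inst_jdg J (zip (map fst zs) (map snd zs)))"
      by (rule I(19)[OF Specific(3)])
        (use Specific ws in \<open>auto simp: inst_values_iff rule_premises_eq zip_map_fst_snd\<close>)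
    then show ?thesis using Specific by (simp add: zip_map_fst_snd)
  next
    case (Congr_Ty qs A Ps \<gamma>)
    have "derivable \<Sigma> T (JEqTy (inst A (zip (map fst qs) (map (\<lambda>q. arg_f q) qs)))
        (inst A (zip (map fst qs) (map (\<lambda>q. arg_g q) qs))) \<gamma>)"
      by (rule I(20)[OF Congr_Ty(3), where gs' = "map (\<lambda>q. arg_g' q) qs" and \<alpha>s = "map (\<lambda>q. arg_asm q) qs" and Ps = Ps])
        (use Congr_Ty ws congr_args_ok_iff[of \<Sigma> qs] congr_premises_eq[of \<Sigma> qs] in \<open>auto simp: zip_congr_args\<close>)
    then show ?thesis using Congr_Ty by (simp add: zip_congr_args)
  next
    case (Congr_Tm qs t A Ps t' \<gamma>)
    have "derivable \<Sigma> T (JEqTm (inst t (zip (map fst qs) (map (\<lambda>q. arg_f q) qs))) t'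
        (inst A (zip (map fst qs) (map (\<lambda>q. arg_f q) qs))) \<gamma>)"
      by (rule I(21)[OF Congr_Tm(3), where gs = "map (\<lambda>q. arg_g q) qs" and gs' = "map (\<lambda>q. arg_g' q) qs"
            and \<alpha>s = "map (\<lambda>q. arg_asm q) qs" and Ps = Ps])
        (use Congr_Tm ws congr_args_ok_iff[of \<Sigma> qs] congr_premises_eq[of \<Sigma> qs] in \<open>auto simp: zip_congr_args\<close>)
    then show ?thesis using Congr_Tm by (simp add: zip_congr_args)
  qed (use ws in \<open>auto intro: I(1,6,7,9,10,14-17)\<close>)
qed

lemma drv_step_least:
  assumes Q: "\<And>w ws. drv_step \<Sigma> T w ws \<Longrightarrow> (\<And>v. v \<in> set ws \<Longrightarrow> Q v) \<Longrightarrow> Q w"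
  shows "drv_node \<Sigma> T w \<Longrightarrow> Q w"
proof -
  note I = drv_step.intros
  have "derivable \<Sigma> T J \<Longrightarrow> Q (Inl J)" "derivable_bdry \<Sigma> T \<B> \<Longrightarrow> Q (Inr \<B>)" for J \<B>
  proof (induction rule: derivable_derivable_bdry.inducts)
    case (Meta \<B> ts M)
    then have eq: "fill (apply_bdry \<B> ts) (expr.Meta M \<B> ts) = fill_total (apply_bdry \<B> ts) (expr.Meta M \<B> ts)"
      by (intro fill_total_thesis[symmetric]) (simp add: snd_ar_apply_bdry)
    show ?case unfolding eq by (rule Q[OF I(3)]) (use Meta in auto)
  next
    case (Meta_Congr_Ty \<B> m ss ts ts' \<alpha>s Ps M \<gamma>)
    show ?case by (rule Q[OF I(4)[where ss = ss and ts = ts and ts' = ts' and \<alpha>s = \<alpha>s and Ps = Ps]]) (use Meta_Congr_Ty in auto)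
  next
    case (Meta_Congr_Tm \<B> m ss ts ts' \<alpha>s B Ps v M \<gamma>)
    show ?case by (rule Q[OF I(5)[where ss = ss and ts = ts and ts' = ts' and \<alpha>s = \<alpha>s and Ps = Ps]]) (use Meta_Congr_Tm in auto)
  next
    case (EqTy_Trans A B \<alpha> B' C \<beta> \<gamma>)
    show ?case by (rule Q[OF I(8)[OF EqTy_Trans.hyps]]) (use EqTy_Trans in auto)
  next
    case (EqTm_Trans s t A \<alpha> t' u \<beta> \<gamma>)
    show ?case by (rule Q[OF I(11)[OF EqTm_Trans.hyps]]) (use EqTm_Trans in auto)
  next
    case (Conv_Tm t A B \<alpha> \<beta>)
    show ?case by (rule Q[OF I(12)[OF Conv_Tm.hyps]]) (use Conv_Tm in auto)
  next
    case (Conv_EqTm s t A \<alpha> B \<beta> \<gamma> \<delta>)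
    show ?case by (rule Q[OF I(13)[OF Conv_EqTm.hyps]]) (use Conv_EqTm in auto)
  next
    case (Specific ms J es)
    have ms: "map fst (zip ms es) = ms" "map snd (zip ms es) = es"
      using Specific(2) by (auto simp: inst_values_def)
    have wf: "values_wf \<Sigma> (zip ms es)" using Specific(2) inst_values_iff[of \<Sigma> "zip ms es"] ms by simp
    have prem: "rule_premises ms es = inst_premises (zip ms es)" using rule_premises_eq[OF wf] ms by simp
    show ?case by (rule Q[OF I(19)]) (use Specific wf ms prem in auto)
  next
    case (Congr_Ty ms A fs gs gs' \<alpha>s Ps \<gamma>)
    obtain qs where qs: "map fst qs = ms" "map (\<lambda>q. arg_f q) qs = fs" "map (\<lambda>q. arg_g q) qs = gs"
      "map (\<lambda>q. arg_g' q) qs = gs'" "map (\<lambda>q. arg_asm q) qs = \<alpha>s"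
      by (rule ex_congr_args[of fs ms gs gs' \<alpha>s]) (use Congr_Ty in \<open>auto simp: inst_values_def\<close>)
    have ok: "congr_args_ok \<Sigma> qs"
      unfolding congr_args_ok_iff qs using Congr_Ty by simp
    have prem: "Ps = congr_premises qs"
      using congr_premises_eq[OF ok] Congr_Ty(8) unfolding qs by simp
    have z: "zip ms fs = inst_f qs" "zip ms gs = inst_g qs"
      using zip_congr_args[of qs] unfolding qs by simp_all
    show ?case unfolding z
      by (rule Q[OF I(20)[of qs, OF _ ok prem]]) (use Congr_Ty qs z in auto)
  next
    case (Congr_Tm ms t A fs gs gs' \<alpha>s Ps t' \<gamma>)
    obtain qs where qs: "map fst qs = ms" "map (\<lambda>q. arg_f q) qs = fs" "map (\<lambda>q. arg_g q) qs = gs"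
      "map (\<lambda>q. arg_g' q) qs = gs'" "map (\<lambda>q. arg_asm q) qs = \<alpha>s"
      by (rule ex_congr_args[of fs ms gs gs' \<alpha>s]) (use Congr_Tm in \<open>auto simp: inst_values_def\<close>)
    have ok: "congr_args_ok \<Sigma> qs"
      unfolding congr_args_ok_iff qs using Congr_Tm by simp
    have z: "zip ms fs = inst_f qs" "zip ms gs = inst_g qs"
      using zip_congr_args[of qs] unfolding qs by simp_all
    have prem: "Ps = congr_premises qs @ [JTm t' (inst A (inst_f qs))]"
      using congr_premises_eq[OF ok] Congr_Tm(8) unfolding qs z by simp
    show ?case unfolding z
      by (rule Q[OF I(21)[of qs, OF _ ok prem]]) (use Congr_Tm qs z in auto)
  qed (rule Q, rule I; force)+
  then show "drv_node \<Sigma> T w \<Longrightarrow> Q w"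
    by (auto simp: drv_node_def split: sum.splits)
qed

context theory_coding begin

lemma re_derivable [re_intros]:
  assumes "computable c enc_jdg f" shows "re c (\<lambda>x. derivable \<Sigma> T (f x))"
proof -
  have "re (enc_jdg \<oplus> enc_bdry) (drv_node \<Sigma> T)"
  proof (rule re_lfp[where Step = "drv_step \<Sigma> T"])
    show "enumerable (enc_jdg \<oplus> enc_bdry)" by (rule re_intros)+
  qed (use drv_step_closed drv_step_least re_drv_step in blast)+
  from re_subst[OF this computable_Inl[OF assms]] show ?thesis by simp
qed

end

section \<open>Well-formedness and renaming of bound variables\<close>

lemma fmember_ffUnion [simp]: "x |\<in>| ffUnion A \<longleftrightarrow> (\<exists>B. B |\<in>| A \<and> x |\<in>| B)"
  by (auto simp: ffUnion.rep_eq)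

section \<open>Assumptions of well-formed syntax\<close>

lemma fmember_unbind:
  "x |\<in>| unbind \<alpha> \<longleftrightarrow> (\<exists>i. x = ABound i \<and> ABound (Suc i) |\<in>| \<alpha>) \<or> (x |\<in>| \<alpha> \<and> (\<forall>i. x \<noteq> ABound i))"
proof
  assume "x |\<in>| unbind \<alpha>"
  then obtain y where "y |\<in>| \<alpha>" "y \<noteq> ABound 0" "x = (case y of ABound i \<Rightarrow> ABound (i - 1) | _ \<Rightarrow> y)"
    unfolding unbind_def by auto
  then show "(\<exists>i. x = ABound i \<and> ABound (Suc i) |\<in>| \<alpha>) \<or> (x |\<in>| \<alpha> \<and> (\<forall>i. x \<noteq> ABound i))"
    by (cases y) (auto simp: gr0_conv_Suc)
next
  assume "(\<exists>i. x = ABound i \<and> ABound (Suc i) |\<in>| \<alpha>) \<or> (x |\<in>| \<alpha> \<and> (\<forall>i. x \<noteq> ABound i))"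
  then show "x |\<in>| unbind \<alpha>"
  proof (elim disjE exE conjE)
    fix i assume "x = ABound i" "ABound (Suc i) |\<in>| \<alpha>"
    then show ?thesis unfolding unbind_def by (intro rev_fimage_eqI[of "ABound (Suc i)"]) auto
  next
    assume "x |\<in>| \<alpha>" "\<forall>i. x \<noteq> ABound i"
    then show ?thesis unfolding unbind_def by (intro rev_fimage_eqI[of x]) (auto split: assm.splits)
  qed
qed

inductive_cases wf_FVarE: "wf_expr \<Sigma> k a (FVar b A)"
inductive_cases wf_BVarE: "wf_expr \<Sigma> k a (BVar i)"
inductive_cases wf_SymE: "wf_expr \<Sigma> k a (Sym S es)"
inductive_cases wf_MetaE: "wf_expr \<Sigma> k a (Meta M \<B> ts)"
inductive_cases wf_ConvE: "wf_expr \<Sigma> k a (Conv t \<alpha>)"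
inductive_cases wf_AsmsE: "wf_expr \<Sigma> k a (Asms \<alpha>)"
inductive_cases wf_Abs'E: "wf_expr \<Sigma> k a (Abs e)"
inductive_cases wf_AFreeE: "wf_assm \<Sigma> k (AFree b A)"
inductive_cases wf_ABoundE: "wf_assm \<Sigma> k (ABound i)"
inductive_cases wf_AMetaE: "wf_assm \<Sigma> k (AMeta M \<B>)"
inductive_cases wf_BTmE: "wf_bdry \<Sigma> k (BTm A)"
inductive_cases wf_BEqTyE: "wf_bdry \<Sigma> k (BEqTy A B)"
inductive_cases wf_BEqTmE: "wf_bdry \<Sigma> k (BEqTm s t A)"
inductive_cases wf_BAbsE: "wf_bdry \<Sigma> k (BAbs A \<B>)"

lemmas wf_intros = wf_expr_wf_assm_wf_bdry.intros

lemma wf_assm_closed: "wf_assm \<Sigma> 0 x \<Longrightarrow> wf_assm \<Sigma> k x"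
  by (cases x) (auto elim: wf_AFreeE wf_ABoundE wf_AMetaE intro: wf_intros)

text \<open>Suitability conditions describe an assumption set only through \<open>asm\<close> of the
  premises. The well-formedness of such a set is therefore read off the assumptions that occur in
  well-formed syntax.\<close>

lemma wf_asm:
  shows "wf_expr \<Sigma> k a e \<Longrightarrow> \<forall>x. x |\<in>| asm e \<longrightarrow> wf_assm \<Sigma> k x"
    and "wf_assm \<Sigma> k y \<Longrightarrow> \<forall>x. x |\<in>| asm_assm y \<longrightarrow> wf_assm \<Sigma> k x"
    and "wf_bdry \<Sigma> k \<B> \<Longrightarrow> \<forall>x. x |\<in>| asm_bdry \<B> \<longrightarrow> wf_assm \<Sigma> k x"
proof (induction rule: wf_expr_wf_assm_wf_bdry.inducts)
  case (3 S c ars es k)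
  then show ?case by (auto simp: fset_of_list.rep_eq in_set_conv_nth)
next
  case (7 k c n e)
  show ?case
  proof (intro allI impI)
    fix x assume "x |\<in>| asm (Abs e)"
    then consider i where "x = ABound i" "ABound (Suc i) |\<in>| asm e" | "x |\<in>| asm e" "\<forall>i. x \<noteq> ABound i"
      by (auto simp: fmember_unbind)
    then show "wf_assm \<Sigma> k x"
    proof cases
      case (1 i)
      then show ?thesis using 7 by (auto elim: wf_ABoundE intro: wf_intros)
    next
      case 2
      then show ?thesis using 7 by (cases x) (auto elim!: wf_AFreeE wf_AMetaE intro: wf_intros)
    qed
  qed
next
  case (15 k A \<B>)
  show ?case
  proof (intro allI impI)
    fix x assume "x |\<in>| asm_bdry (BAbs A \<B>)"
    then consider "x |\<in>| asm A" | i where "x = ABound i" "ABound (Suc i) |\<in>| asm_bdry \<B>"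
      | "x |\<in>| asm_bdry \<B>" "\<forall>i. x \<noteq> ABound i"
      by (auto simp: fmember_unbind)
    then show "wf_assm \<Sigma> k x"
    proof cases
      case (2 i)
      then show ?thesis using 15 by (auto elim: wf_ABoundE intro: wf_intros)
    next
      case 3
      then show ?thesis using 15 by (cases x) (auto elim!: wf_AFreeE wf_AMetaE intro: wf_intros)
    qed (use 15 in auto)
  qed
qed (auto intro: wf_intros wf_assm_closed simp: fset_of_list.rep_eq)

text \<open>Annotations are closed, so what they contribute passes unchanged through
  \<open>unbind\<close>.\<close>

lemma asm_assm_annotation:
  "wf_assm \<Sigma> k x \<Longrightarrow> \<forall>i. x \<noteq> ABound i \<Longrightarrow> y |\<in>| asm_assm x \<Longrightarrow> y \<noteq> ABound i"
  using wf_asm(2)[of \<Sigma> 0 x]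
  by (cases x) (auto elim!: wf_AFreeE wf_AMetaE intro: wf_intros elim: wf_ABoundE)

lemma asm_assm_refl: "x |\<in>| asm_assm x"
  by (cases x) auto

text \<open>An occurring assumption brings the assumptions of its annotation along. Hence passing
  from a subset of \<open>asm e\<close> to its \<open>asm_set\<close> does not leave
  \<open>asm e\<close>.\<close>

lemma asm_closed:
  shows "wf_expr \<Sigma> k a e \<Longrightarrow> \<forall>x. x |\<in>| asm e \<longrightarrow> asm_assm x |\<subseteq>| asm e"
    and "wf_assm \<Sigma> k y \<Longrightarrow> \<forall>x. x |\<in>| asm_assm y \<longrightarrow> asm_assm x |\<subseteq>| asm_assm y"
    and "wf_bdry \<Sigma> k \<B> \<Longrightarrow> \<forall>x. x |\<in>| asm_bdry \<B> \<longrightarrow> asm_assm x |\<subseteq>| asm_bdry \<B>"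
proof (induction rule: wf_expr_wf_assm_wf_bdry.inducts)
  case (3 S c ars es k)
  then show ?case by (fastforce simp: fset_of_list.rep_eq in_set_conv_nth)
next
  case (4 \<B> c ts k M)
  then show ?case by (fastforce simp: fset_of_list.rep_eq)
next
  case (5 k t \<alpha>)
  then show ?case by fastforce
next
  case (6 c \<alpha> k)
  then show ?case by fastforce
next
  case (7 k c n e)
  show ?case
  proof (intro allI impI)
    fix x assume x: "x |\<in>| asm (Abs e)"
    show "asm_assm x |\<subseteq>| asm (Abs e)"
    proof (cases "\<exists>i. x = ABound i")
      case True
      then show ?thesis using x by auto
    next
      case False
      then have "x |\<in>| asm e" using x by (auto simp: fmember_unbind)
      moreover from this have "wf_assm \<Sigma> (Suc k) x" using wf_asm(1) 7(1) by blast
      ultimately show ?thesis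
        using 7 asm_assm_annotation False by (fastforce simp: fmember_unbind)
    qed
  qed
next
  case (15 k A \<B>)
  show ?case
  proof (intro allI impI)
    fix x assume x: "x |\<in>| asm_bdry (BAbs A \<B>)"
    show "asm_assm x |\<subseteq>| asm_bdry (BAbs A \<B>)"
    proof (cases "x |\<in>| asm A \<or> (\<exists>i. x = ABound i)")
      case True
      then show ?thesis using x 15 by auto
    next
      case False
      then have "x |\<in>| asm_bdry \<B>" using x by (auto simp: fmember_unbind)
      moreover from this have "wf_assm \<Sigma> (Suc k) x" using wf_asm(3) 15(3) by blast
      ultimately show ?thesis
        using 15 asm_assm_annotation False by (fastforce simp: fmember_unbind)
    qed
  qed
qed auto

text \<open>Unlike \<open>wf_thesis\<close> it covers abstracted judgements and the scope below
  their binders, as induction over derivations requires.\<close>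

fun wf_jdg :: "'s signature \<Rightarrow> nat \<Rightarrow> 's judgement \<Rightarrow> bool" where
  "wf_jdg \<Sigma> k (JTy A) \<longleftrightarrow> wf_expr \<Sigma> k (Ty, 0) A"
| "wf_jdg \<Sigma> k (JTm t A) \<longleftrightarrow> wf_expr \<Sigma> k (Tm, 0) t \<and> wf_expr \<Sigma> k (Ty, 0) A"
| "wf_jdg \<Sigma> k (JEqTy A B \<alpha>) \<longleftrightarrow>
     wf_expr \<Sigma> k (Ty, 0) A \<and> wf_expr \<Sigma> k (Ty, 0) B \<and> (\<forall>x \<in> fset \<alpha>. wf_assm \<Sigma> k x)"
| "wf_jdg \<Sigma> k (JEqTm s t A \<alpha>) \<longleftrightarrow>
     wf_expr \<Sigma> k (Tm, 0) s \<and> wf_expr \<Sigma> k (Tm, 0) t \<and> wf_expr \<Sigma> k (Ty, 0) A \<and>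
     (\<forall>x \<in> fset \<alpha>. wf_assm \<Sigma> k x)"
| "wf_jdg \<Sigma> k (JAbs A J) \<longleftrightarrow> wf_expr \<Sigma> k (Ty, 0) A \<and> wf_jdg \<Sigma> (Suc k) J"

lemma wf_asm_jdg: "wf_jdg \<Sigma> k J \<Longrightarrow> x |\<in>| asm_jdg J \<Longrightarrow> wf_assm \<Sigma> k x"
proof (induction J arbitrary: k x)
  case (JAbs A J)
  from JAbs(3) consider "x |\<in>| asm A" | i where "x = ABound i" "ABound (Suc i) |\<in>| asm_jdg J"
    | "x |\<in>| asm_jdg J" "\<forall>i. x \<noteq> ABound i"
    by (auto simp: fmember_unbind)
  then show ?case
  proof cases
    case 1
    then show ?thesis using JAbs wf_asm(1) by fastforce
  next
    case (2 i)
    then show ?thesis using JAbs by (fastforce elim: wf_ABoundE intro: wf_intros)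
  next
    case 3
    with JAbs have "wf_assm \<Sigma> (Suc k) x" by auto
    then show ?thesis using 3 by (cases x) (auto elim!: wf_AFreeE wf_AMetaE intro: wf_intros)
  qed
qed (use wf_asm(1,2) in fastforce)+

lemma wf_asm_jdgs:
  "\<forall>P \<in> set Ps. wf_jdg \<Sigma> k P \<Longrightarrow> x |\<in>| asm_jdgs Ps \<Longrightarrow> wf_assm \<Sigma> k x"
  unfolding asm_jdgs_def by (auto simp: fset_of_list.rep_eq intro: wf_asm_jdg)

lemma fsubset_asm_set: "x |\<in>| \<gamma> \<Longrightarrow> x |\<in>| asm_set \<gamma>"
  using asm_assm_refl by fastforce

lemma wf_subst_set_FVarD:
  assumes "\<forall>x \<in> fset (subst_set \<alpha> j (FVar a A)). wf_assm \<Sigma> k x" "j \<le> k"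
  shows "\<forall>x \<in> fset \<alpha>. wf_assm \<Sigma> (Suc k) x"
proof
  fix x assume x: "x \<in> fset \<alpha>"
  then have wf: "wf_assm \<Sigma> k y" if "y |\<in>| subst_assm j (FVar a A) x" for y
    using assms(1) that by (auto simp: subst_set_def)
  show "wf_assm \<Sigma> (Suc k) x"
  proof (cases x)
    case (ABound i)
    show ?thesis
    proof (cases "i \<le> j")
      case True
      then show ?thesis using assms(2) ABound by (auto intro: wf_intros)
    next
      case False
      then show ?thesis using wf[of "ABound (i - 1)"] ABound by (auto elim!: wf_ABoundE intro: wf_intros)
    qed
  qed (use wf[of x] in \<open>auto elim!: wf_AFreeE wf_AMetaE intro: wf_intros\<close>)
qed

text \<open>The abstraction rule knows its body only with a free variable put in, so well-formedness
  has to be reflected back. This works because free and bound variables are terms of the same arity,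
  and removing index \<open>j\<close> costs at most one level of scope.\<close>

lemma wf_subst_FVarD:
  "wf_expr \<Sigma> k r (subst e j (FVar a A)) \<Longrightarrow> j \<le> k \<Longrightarrow> wf_expr \<Sigma> (Suc k) r e"
proof (induction e arbitrary: j k r rule: expr.induct[where ?P2.0 = "\<lambda>_. True" and ?P3.0 = "\<lambda>_. True"])
  case (BVar i)
  then show ?case by (auto elim!: wf_BVarE wf_FVarE intro!: wf_intros split: if_splits)
next
  case (Sym S es)
  from Sym.prems(1) obtain c ars where *: "\<Sigma> S = Some (c, ars)" "length es = length ars" "r = (c, 0)"
    "\<forall>i < length ars. wf_expr \<Sigma> k (ars ! i) (subst (es ! i) j (FVar a A))"
    by (auto elim!: wf_SymE)
  have "wf_expr \<Sigma> (Suc k) (ars ! i) (es ! i)" if "i < length ars" for i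
    by (rule Sym.IH[OF _ _ Sym.prems(2)]) (use * that in auto)
  then show ?case using * by (auto intro!: wf_intros)
next
  case (Conv t \<alpha>)
  then show ?case by (auto elim!: wf_ConvE intro!: wf_intros dest: wf_subst_set_FVarD)
next
  case (Asms \<alpha>)
  then show ?case by (auto elim!: wf_AsmsE intro!: wf_intros dest: wf_subst_set_FVarD)
next
  case (Meta M \<B> ts)
  have "wf_expr \<Sigma> (Suc k) (Tm, 0) t" if "t \<in> set ts" for t
    by (rule Meta.IH[OF that _ Meta.prems(2)]) (use Meta.prems(1) that in \<open>auto elim!: wf_MetaE\<close>)
  then show ?case using Meta.prems(1) by (auto elim!: wf_MetaE intro!: wf_intros)
qed (auto elim!: wf_FVarE wf_Abs'E intro!: wf_intros)

lemma wf_subst_bdry_FVarD: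
  "wf_bdry \<Sigma> k (subst_bdry \<B> j (FVar a A)) \<Longrightarrow> j \<le> k \<Longrightarrow> wf_bdry \<Sigma> (Suc k) \<B>"
  by (induction \<B> arbitrary: j k rule: ar.induct)
    (auto elim!: wf_BTmE wf_BEqTyE wf_BEqTmE wf_BAbsE intro!: wf_intros dest: wf_subst_FVarD)

lemma wf_subst_jdg_FVarD:
  "wf_jdg \<Sigma> k (subst_jdg J j (FVar a A)) \<Longrightarrow> j \<le> k \<Longrightarrow> wf_jdg \<Sigma> (Suc k) J"
  by (induction J arbitrary: j k) (auto dest: wf_subst_FVarD wf_subst_set_FVarD)

lemma wf_expr_Abs_funpow:
  "wf_expr \<Sigma> j (c, k) e \<Longrightarrow> \<exists>f. e = (Abs ^^ k) f \<and> wf_expr \<Sigma> (j + k) (c, 0) f"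
proof (induction k arbitrary: e j)
  case (Suc k)
  from Suc.prems obtain f where f: "e = Abs f" "wf_expr \<Sigma> (Suc j) (c, k) f" by (auto elim: wf_AbsE)
  from Suc.IH[OF f(2)] show ?case using f by auto
qed auto

lemma wf_expr_funpow_Abs: "wf_expr \<Sigma> (j + k) (c, 0) f \<Longrightarrow> wf_expr \<Sigma> j (c, k) ((Abs ^^ k) f)"
proof (induction k arbitrary: j)
  case (Suc k)
  then have "wf_expr \<Sigma> (Suc j) (c, k) ((Abs ^^ k) f)" by simp
  then show ?case by (auto intro: wf_intros)
qed auto

section \<open>Substitution of bound variables as renaming\<close>

fun up :: "(nat \<Rightarrow> nat) \<Rightarrow> nat \<Rightarrow> nat" where
  "up f 0 = 0"
| "up f (Suc i) = Suc (f i)"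

fun ren_assm :: "(nat \<Rightarrow> nat) \<Rightarrow> 's assm \<Rightarrow> 's assm" where
  "ren_assm f (ABound i) = ABound (f i)"
| "ren_assm f x = x"

text \<open>Generic arguments apply a metavariable to its own bound variables. Substituting
  variables for variables is a renaming of indices, and successive renamings compose into
  one.\<close>

primrec ren :: "'s expr \<Rightarrow> (nat \<Rightarrow> nat) \<Rightarrow> 's expr" where
  "ren (FVar a A) f = FVar a A"
| "ren (BVar i) f = BVar (f i)"
| "ren (Sym S es) f = Sym S (map (\<lambda>e. ren e f) es)"
| "ren (Meta M \<B> ts) f = Meta M \<B> (map (\<lambda>e. ren e f) ts)"
| "ren (Conv t \<alpha>) f = Conv (ren t f) (ren_assm f |`| \<alpha>)"
| "ren (Asms \<alpha>) f = Asms (ren_assm f |`| \<alpha>)"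
| "ren (Abs e) f = Abs (ren e (up f))"

lemma up_subst_index:
  "up (\<lambda>i. if i < k then i else if i = k then j else i - 1) =
   (\<lambda>i. if i < Suc k then i else if i = Suc k then Suc j else i - 1)"
proof
  fix i show "up (\<lambda>i. if i < k then i else if i = k then j else i - 1) i =
    (if i < Suc k then i else if i = Suc k then Suc j else i - 1)"
    by (cases i) auto
qed

lemma subst_set_BVar:
  "subst_set \<alpha> k (BVar j) = ren_assm (\<lambda>i. if i < k then i else if i = k then j else i - 1) |`| \<alpha>"
proof -
  have "subst_assm k (BVar j) x = {|ren_assm (\<lambda>i. if i < k then i else if i = k then j else i - 1) x|}"
    for x :: "'a assm" by (cases x) auto
  then show ?thesis unfolding subst_set_def by (induction \<alpha>) auto
qed

lemma subst_BVar:
  "subst e k (BVar j) = ren e (\<lambda>i. if i < k then i else if i = k then j else i - 1)"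
  by (induction e arbitrary: k j rule: expr.induct[where ?P2.0 = "\<lambda>_. True" and ?P3.0 = "\<lambda>_. True"])
    (auto simp: subst_set_BVar up_subst_index)

lemma up_comp: "up g \<circ> up f = up (g \<circ> f)"
proof
  fix i show "(up g \<circ> up f) i = up (g \<circ> f) i" by (cases i) auto
qed

lemma ren_assm_comp: "ren_assm g (ren_assm f x) = ren_assm (g \<circ> f) x"
  by (cases x) auto

lemma ren_ren: "ren (ren e f) g = ren e (g \<circ> f)"
  by (induction e arbitrary: f g rule: expr.induct[where ?P2.0 = "\<lambda>_. True" and ?P3.0 = "\<lambda>_. True"])
    (auto simp: ren_assm_comp up_comp)

lemma ren_assm_id:
  assumes "\<forall>x \<in> fset \<alpha>. wf_assm \<Sigma> k x" "\<forall>i < k. f i = i" shows "ren_assm f |`| \<alpha> = \<alpha>"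
proof -
  have "ren_assm f x = x" if "x \<in> fset \<alpha>" for x
    using assms that by (cases x) (auto elim: wf_ABoundE)
  then show ?thesis by (auto simp: fset.map_ident_strong)
qed

lemma ren_id: "wf_expr \<Sigma> k r e \<Longrightarrow> \<forall>i < k. f i = i \<Longrightarrow> ren e f = e"
proof (induction e arbitrary: k r f rule: expr.induct[where ?P2.0 = "\<lambda>_. True" and ?P3.0 = "\<lambda>_. True"])
  case (Sym S es)
  have "ren e f = e" if "e \<in> set es" for e
  proof -
    from Sym.prems(1) obtain c ars where *: "length es = length ars"
      "\<forall>i < length ars. wf_expr \<Sigma> k (ars ! i) (es ! i)" by (auto elim!: wf_SymE)
    from that obtain i where "i < length es" "e = es ! i" by (auto simp: in_set_conv_nth)
    with * have "wf_expr \<Sigma> k (ars ! i) e" by simp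
    then show ?thesis using Sym.IH[OF that] Sym.prems(2) by blast
  qed
  then show ?case by (simp add: map_idI)
next
  case (Meta M \<B> ts)
  have "ren e f = e" if "e \<in> set ts" for e
    using Meta that by (auto elim!: wf_MetaE)
  then show ?case by (simp add: map_idI)
next
  case (Conv t \<alpha>)
  have "ren_assm f |`| \<alpha> = \<alpha>"
    by (rule ren_assm_id[OF _ Conv.prems(2)]) (use Conv.prems(1) in \<open>auto elim!: wf_ConvE\<close>)
  moreover have "ren t f = t"
    by (rule Conv.IH(1)[OF _ Conv.prems(2)]) (use Conv.prems(1) in \<open>auto elim!: wf_ConvE\<close>)
  ultimately show ?case by simp
next
  case (Asms \<alpha>)
  have "ren_assm f |`| \<alpha> = \<alpha>"
    by (rule ren_assm_id[OF _ Asms.prems(2)]) (use Asms.prems(1) in \<open>auto elim!: wf_AsmsE\<close>)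
  then show ?case by simp
next
  case (Abs e)
  have "\<forall>i < Suc k. up f i = i" using Abs.prems(2) by (auto simp: less_Suc_eq_0_disj)
  then show ?case using Abs by (auto elim!: wf_Abs'E)
qed (auto elim: wf_BVarE)

lemma up_funpow: "(up ^^ n) h i = (if i < n then i else n + h (i - n))"
proof (induction n arbitrary: i)
  case (Suc n)
  then show ?case by (cases i) auto
qed auto

lemma ren_Abs_funpow: "ren ((Abs ^^ n) e) h = (Abs ^^ n) (ren e ((up ^^ n) h))"
  by (induction n arbitrary: h) (auto simp: funpow_swap1[where f = up])

text \<open>The first argument replaces the outermost variable, hence the reversed list. Each of the
  \<open>n\<close> abstracted variables is replaced by itself, and indices pointing further out drop
  by the \<open>n\<close> binders removed.\<close>

lemma apply_args_BVar:
  "apply_args ((Abs ^^ n) e) (map BVar (rev [0..<n])) = ren e (\<lambda>i. if i < n then i else i - n)"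
proof (induction n arbitrary: e)
  case 0
  have "ren e (\<lambda>i. i) = e" for e :: "'a expr"
  proof (induction e rule: expr.induct[where ?P2.0 = "\<lambda>_. True" and ?P3.0 = "\<lambda>_. True"])
    case (Abs e)
    have "up (\<lambda>i. i) = (\<lambda>i. i)" by (rule ext) (metis up.elims)
    then show ?case using Abs by simp
  next
    have id: "ren_assm (\<lambda>i. i) x = x" for x :: "'a assm" by (cases x) auto
    {
      case (Conv t \<alpha>)
      then show ?case by (simp add: fset.map_ident_strong id)
    next
      case (Asms \<alpha>)
      then show ?case by (simp add: fset.map_ident_strong id)
    }
  qed (auto simp: map_idI)
  then show ?case by simp
next
  case (Suc n)
  \<comment> \<open>Substituting \<open>BVar n\<close> for the outermost variable, as a renaming; it
    acts on \<open>e\<close> below the remaining \<open>n\<close> binders, hence as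
    \<open>(up ^^ n) ?h\<close>.\<close>
  let ?h = "\<lambda>i. if i < 0 then i else if i = 0 then n else i - 1"
  have "(\<lambda>i. if i < n then i else i - n) \<circ> (up ^^ n) ?h = (\<lambda>i. if i < Suc n then i else i - Suc n)"
    by (rule ext) (auto simp: up_funpow)
  then show ?case
    by (simp add: subst_BVar ren_Abs_funpow Suc ren_ren)
qed

lemma inst_Abs_funpow [simp]: "inst ((Abs ^^ n) e) I = (Abs ^^ n) (inst e I)"
  by (induction n) auto

text \<open>An eta law: a value applied to its own bound variables and abstracted again is the
  value. So the object arguments of an instantiated symbol are the values of its
  metavariables.\<close>

lemma inst_generic_arg_object:
  assumes "map_of I (M, \<B>) = Some e" "wf_expr \<Sigma> 0 (ar \<B>) e" "is_object_class (fst (ar \<B>))"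
  shows "inst (generic_arg (M, \<B>)) I = e"
proof -
  obtain c k where ar: "ar \<B> = (c, k)" by fastforce
  with assms(2) obtain f where f: "e = (Abs ^^ k) f" "wf_expr \<Sigma> k (c, 0) f"
    using wf_expr_Abs_funpow by fastforce
  have "(\<lambda>t. inst t I) \<circ> BVar = BVar" by (rule ext) simp
  then have "inst (generic_arg (M, \<B>)) I = (Abs ^^ k) (apply_args e (map BVar (rev [0..<k])))"
    using assms(1,3) ar by (auto simp: generic_arg_def)
  also have "\<dots> = (Abs ^^ k) (ren f (\<lambda>i. if i < k then i else i - k))"
    unfolding f(1) apply_args_BVar ..
  also have "ren f (\<lambda>i. if i < k then i else i - k) = f" by (rule ren_id[OF f(2)]) simp
  finally show ?thesis using f by simp
qed

lemma wf_inst_generic_arg: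
  assumes "map_of I (M, \<B>) = Some e" "wf_expr \<Sigma> 0 (ar \<B>) e"
  shows "wf_expr \<Sigma> 0 (ar \<B>) (inst (generic_arg (M, \<B>)) I)"
proof (cases "is_object_class (fst (ar \<B>))")
  case True
  then show ?thesis using inst_generic_arg_object assms by metis
next
  case False
  obtain c k where ar: "ar \<B> = (c, k)" by fastforce
  let ?\<alpha> = "finsert (AMeta M \<B>) (fset_of_list (map ABound [0..<k]))"
  have "inst (generic_arg (M, \<B>)) I = (Abs ^^ k) (Asms (ffUnion ((\<lambda>x. inst_assm x I) |`| ?\<alpha>)))"
    using False ar by (simp add: generic_arg_def)
  moreover have "wf_assm \<Sigma> k x" if "x |\<in>| ffUnion ((\<lambda>x. inst_assm x I) |`| ?\<alpha>)" for x
  proof -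
    from that consider "x |\<in>| asm e" | i where "i < k" "x = ABound i"
      using assms(1) by (auto simp: fset_of_list.rep_eq)
    then show ?thesis
    proof cases
      case 1
      then show ?thesis using wf_asm(1)[OF assms(2)] wf_assm_closed by blast
    qed (auto intro: wf_intros)
  qed
  ultimately show ?thesis
    unfolding ar using False ar by (auto intro!: wf_expr_funpow_Abs wf_intros)
qed

section \<open>Uniqueness of typing\<close>

lemma erase_lift: "erase (lift e k) = lift (erase e) k"
  by (induction e arbitrary: k rule: expr.induct[where ?P2.0 = "\<lambda>_. True" and ?P3.0 = "\<lambda>_. True"]) auto

lemma erase_subst: "erase (subst e k s) = subst (erase e) k (erase s)"
  by (induction e arbitrary: k s rule: expr.induct[where ?P2.0 = "\<lambda>_. True" and ?P3.0 = "\<lambda>_. True"])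
    (auto simp: erase_lift subst_set_def)

lemma erase_Abs_funpow: "erase ((Abs ^^ n) e) = (Abs ^^ n) (erase e)"
  by (induction n) auto

lemma subst_Abs_funpow:
  "subst ((Abs ^^ n) e) k s = (Abs ^^ n) (subst e (k + n) (((\<lambda>s. lift s 0) ^^ n) s))"
  by (induction n arbitrary: k s) (auto simp: funpow_swap1[where f = "\<lambda>s. lift s 0"])

text \<open>The number of abstractions is fixed to that of the arguments: otherwise erasing a
  conversion could expose an abstraction that \<open>apply_args\<close> would then consume.\<close>

lemma erase_apply_args:
  "erase (apply_args ((Abs ^^ length ts) e) ts) = apply_args (erase ((Abs ^^ length ts) e)) (map erase ts)"
proof (induction ts arbitrary: e)
  case (Cons t ts)
  then show ?case by (simp add: subst_Abs_funpow) (simp add: erase_subst[symmetric] subst_Abs_funpow)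
qed simp

definition values_agree :: "'s signature \<Rightarrow> 's inst \<Rightarrow> 's inst \<Rightarrow> 's mvar \<Rightarrow> bool" where
  "values_agree \<Sigma> I I' m \<longleftrightarrow> (\<exists>e e'. map_of I m = Some e \<and> map_of I' m = Some e' \<and>
     wf_expr \<Sigma> 0 (ar (snd m)) e \<and> wf_expr \<Sigma> 0 (ar (snd m)) e' \<and> erase e = erase e')"

text \<open>Values enter through substitution, which commutes with erasure, and assumption sets
  erase to the dummy. Free variables are excluded because erasure keeps annotations, so their
  instantiated annotations would have to agree exactly.\<close>

lemma erase_inst_cong:
  assumes "wf_expr \<Sigma> k r A" "\<forall>a C. AFree a C |\<notin>| asm A"
    and "\<forall>M \<B>. AMeta M \<B> |\<in>| asm A \<longrightarrow> values_agree \<Sigma> I I' (M, \<B>)"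
  shows "erase (inst A I) = erase (inst A I')"
  using assms
proof (induction A arbitrary: k r rule: expr.induct[where ?P2.0 = "\<lambda>_. True" and ?P3.0 = "\<lambda>_. True"])
  case (Sym S es)
  have "erase (inst e I) = erase (inst e I')" if "e \<in> set es" for e
  proof -
    from Sym.prems(1) obtain c ars where *: "length es = length ars"
      "\<forall>i < length ars. wf_expr \<Sigma> k (ars ! i) (es ! i)" by (auto elim!: wf_SymE)
    from that obtain i where "i < length es" "e = es ! i" by (auto simp: in_set_conv_nth)
    with * have wf: "wf_expr \<Sigma> k (ars ! i) e" by simp
    show ?thesis
    proof (rule Sym.IH[OF that wf])
      have "asm e |\<subseteq>| asm (Sym S es)" using that by (auto simp: fset_of_list.rep_eq)
      then show "\<forall>a C. AFree a C |\<notin>| asm e"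
        "\<forall>M \<B>. AMeta M \<B> |\<in>| asm e \<longrightarrow> values_agree \<Sigma> I I' (M, \<B>)"
        using Sym.prems(2,3) by blast+
    qed
  qed
  then show ?case by simp
next
  case (Meta M \<B> ts)
  from Meta.prems(1) obtain c where c: "ar \<B> = (c, length ts)" "\<forall>t \<in> set ts. wf_expr \<Sigma> k (Tm, 0) t"
    by (auto elim!: wf_MetaE)
  have "values_agree \<Sigma> I I' (M, \<B>)" using Meta.prems(3) by simp
  then obtain e e' where e: "map_of I (M, \<B>) = Some e" "map_of I' (M, \<B>) = Some e'"
    "wf_expr \<Sigma> 0 (c, length ts) e" "wf_expr \<Sigma> 0 (c, length ts) e'" "erase e = erase e'"
    using c by (auto simp: values_agree_def)
  obtain f f' where f: "e = (Abs ^^ length ts) f" "e' = (Abs ^^ length ts) f'"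
    using wf_expr_Abs_funpow[OF e(3)] wf_expr_Abs_funpow[OF e(4)] by auto
  have "erase (inst t I) = erase (inst t I')" if "t \<in> set ts" for t
  proof -
    have "asm t |\<subseteq>| asm (Meta M \<B> ts)" using that by (auto simp: fset_of_list.rep_eq)
    then show ?thesis
      by (intro Meta.IH(1)[OF that, of k "(Tm, 0)"]) (use Meta.prems(2,3) that c(2) in blast)+
  qed
  then have ts: "map erase (map (\<lambda>t. inst t I) ts) = map erase (map (\<lambda>t. inst t I') ts)" by simp
  have "erase (apply_args e (map (\<lambda>t. inst t I) ts)) =
      apply_args (erase e) (map erase (map (\<lambda>t. inst t I) ts))"
    using erase_apply_args[of "map (\<lambda>t. inst t I) ts" f] unfolding length_map f(1)[symmetric] .
  also have "\<dots> = apply_args (erase e') (map erase (map (\<lambda>t. inst t I') ts))"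
    unfolding e(5) ts ..
  also have "\<dots> = erase (apply_args e' (map (\<lambda>t. inst t I') ts))"
    using erase_apply_args[of "map (\<lambda>t. inst t I') ts" f'] unfolding length_map f(2)[symmetric] by (rule sym)
  finally have "erase (apply_args e (map (\<lambda>t. inst t I) ts)) = erase (apply_args e' (map (\<lambda>t. inst t I') ts))" .
  then show ?case using e by simp
next
  case (Conv t \<alpha>)
  have "erase (inst t I) = erase (inst t I')"
    by (rule Conv.IH(1)[of k "(Tm, 0)"]) (use Conv.prems in \<open>auto elim!: wf_ConvE\<close>)
  then show ?case by simp
next
  case (Abs e)
  from Abs.prems(1) obtain c n where "wf_expr \<Sigma> (Suc k) (c, n) e" by (auto elim!: wf_Abs'E)
  then have "erase (inst e I) = erase (inst e I')"
    by (rule Abs.IH) (use Abs.prems(2,3) in \<open>auto simp: fmember_unbind\<close>)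
  then show ?case by simp
qed auto

lemma wf_args_of_arg_judgements:
  "\<forall>P \<in> set (arg_judgements \<B> ts). wf_jdg \<Sigma> 0 P \<Longrightarrow> snd (ar \<B>) = length ts \<Longrightarrow>
    \<forall>t \<in> set ts. wf_expr \<Sigma> 0 (Tm, 0) t"
  by (induction \<B> ts rule: arg_judgements.induct) auto

inductive_cases drv_BTmE: "derivable_bdry \<Sigma> T (BTm A)"
inductive_cases drv_BEqTyE: "derivable_bdry \<Sigma> T (BEqTy A B)"
inductive_cases drv_BEqTmE: "derivable_bdry \<Sigma> T (BEqTm s t A)"

lemma ar_thesis_cases:
  "ar \<B> = (Ty, 0) \<Longrightarrow> \<B> = BTy"
  "ar \<B> = (Tm, 0) \<Longrightarrow> \<exists>A. \<B> = BTm A"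
  by (cases \<B>; auto)+

text \<open>On such sets \<open>asm_set\<close> adds nothing, so that assumption sets can be
  compared by inclusion alone.\<close>

definition asm_closed_set :: "'s assm fset \<Rightarrow> bool" where
  "asm_closed_set \<alpha> \<longleftrightarrow> (\<forall>x. x |\<in>| \<alpha> \<longrightarrow> asm_assm x |\<subseteq>| \<alpha>)"

lemma asm_closed_set_funion: "asm_closed_set \<alpha> \<Longrightarrow> asm_closed_set \<beta> \<Longrightarrow> asm_closed_set (\<alpha> |\<union>| \<beta>)"
  unfolding asm_closed_set_def by blast

lemma asm_set_mono: "asm_closed_set \<alpha> \<Longrightarrow> \<beta> |\<subseteq>| \<alpha> \<Longrightarrow> asm_set \<beta> |\<subseteq>| \<alpha>"
  unfolding asm_closed_set_def by fastforce

lemma asm_closed_set_wf: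
  "wf_expr \<Sigma> k r e \<Longrightarrow> asm_closed_set (asm e)"
  "\<forall>x \<in> fset \<alpha>. wf_assm \<Sigma> k x \<Longrightarrow> asm_closed_set (asm_set \<alpha>)"
  using asm_closed(1) asm_closed(2) unfolding asm_closed_set_def by fastforce+

section \<open>Inversion and presuppositions in standard theories\<close>

text \<open>The family of rules is replaced by its set, on which derivability depends; accordingly
  uniqueness is an equality of rules and not of indices.\<close>

locale standard_rules =
  fixes \<Sigma> :: "'s signature" and T :: "'s rule set"
  assumes signature: "raw_signature \<Sigma>"
    and raw: "r \<in> T \<Longrightarrow> raw_rule \<Sigma> r"
    and symbol: "r \<in> T \<Longrightarrow> object_rule r \<Longrightarrow> \<exists>S. symbol_rule \<Sigma> S r"
    and unique: "r \<in> T \<Longrightarrow> r' \<in> T \<Longrightarrow> symbol_rule \<Sigma> S r \<Longrightarrow> symbol_rule \<Sigma> S r' \<Longrightarrow> r = r'"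
begin

lemma type_rule:
  assumes "(ms, JTy A) \<in> T"
  obtains S where "A = Sym S (map generic_arg ms)" "\<Sigma> S = Some (Ty, map (\<lambda>m. ar (snd m)) ms)"
    "symbol_rule \<Sigma> S (ms, JTy A)"
proof -
  obtain S where S: "symbol_rule \<Sigma> S (ms, JTy A)" using symbol[OF assms] by auto
  then obtain \<beta> c where \<beta>: "ar \<beta> = (c, 0)" "is_object_class c" "\<Sigma> S = Some (c, map (\<lambda>m. ar (snd m)) ms)"
    "JTy A = fill \<beta> (Sym S (map generic_arg ms))"
    unfolding symbol_rule_def by auto
  then show ?thesis using that S by (cases \<beta>) auto
qed

lemma term_rule:
  assumes "(ms, JTm t A) \<in> T"
  obtains S where "t = Sym S (map generic_arg ms)" "\<Sigma> S = Some (Tm, map (\<lambda>m. ar (snd m)) ms)"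
    "symbol_rule \<Sigma> S (ms, JTm t A)"
proof -
  obtain S where S: "symbol_rule \<Sigma> S (ms, JTm t A)" using symbol[OF assms] by auto
  then obtain \<beta> c where \<beta>: "ar \<beta> = (c, 0)" "is_object_class c" "\<Sigma> S = Some (c, map (\<lambda>m. ar (snd m)) ms)"
    "JTm t A = fill \<beta> (Sym S (map generic_arg ms))"
    unfolding symbol_rule_def by auto
  then show ?thesis using that S by (cases \<beta>) auto
qed

lemma inst_value:
  assumes "(ms, J) \<in> T" "inst_values \<Sigma> ms es" "i < length ms"
  shows "map_of (zip ms es) (ms ! i) = Some (es ! i)" "wf_expr \<Sigma> 0 (ar (snd (ms ! i))) (es ! i)"
proof -
  have "distinct ms" using raw[OF assms(1)] by simp
  then show "map_of (zip ms es) (ms ! i) = Some (es ! i)"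
    using assms by (intro map_of_zip_nth) (auto simp: inst_values_def)
  show "wf_expr \<Sigma> 0 (ar (snd (ms ! i))) (es ! i)"
    using assms by (auto simp: inst_values_def)
qed

lemma wf_inst_head:
  assumes "(ms, J) \<in> T" "inst_values \<Sigma> ms es" "\<Sigma> S = Some (c, map (\<lambda>m. ar (snd m)) ms)"
  shows "wf_expr \<Sigma> 0 (c, 0) (inst (Sym S (map generic_arg ms)) (zip ms es))"
proof -
  have "wf_expr \<Sigma> 0 (ar (snd (ms ! i))) (inst (generic_arg (ms ! i)) (zip ms es))" if "i < length ms" for i
    using inst_value[OF assms(1,2) that] wf_inst_generic_arg[of "zip ms es" "fst (ms ! i)" "snd (ms ! i)"]
    by simp
  then show ?thesis using assms(3) by (auto intro!: wf_intros)
qed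

text \<open>The conclusion of a rule is closed, so only its metavariables contribute, and they are
  sent to the assumptions of well-formed values.\<close>

lemma wf_inst_set:
  assumes "(ms, J) \<in> T" "inst_values \<Sigma> ms es" "\<alpha> |\<subseteq>| asm_jdg J" "\<forall>x \<in> fset \<alpha>. wf_assm \<Sigma> 0 x"
  shows "\<forall>x \<in> fset (ffUnion ((\<lambda>x. inst_assm x (zip ms es)) |`| \<alpha>)). wf_assm \<Sigma> 0 x"
proof
  fix x assume "x \<in> fset (ffUnion ((\<lambda>x. inst_assm x (zip ms es)) |`| \<alpha>))"
  then obtain y where y: "y |\<in>| \<alpha>" "x |\<in>| inst_assm y (zip ms es)" by auto
  show "wf_assm \<Sigma> 0 x"
  proof (cases y)
    case (AFree a A)
    have "AFree a A |\<notin>| asm_jdg J"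
      using raw[OF assms(1)] by (auto simp: frees_def fset_eq_iff)
    then show ?thesis using y AFree assms(3) by auto
  next
    case (ABound i)
    then show ?thesis using y assms(4) by (auto elim: wf_ABoundE)
  next
    case (AMeta M \<B>)
    then obtain e where e: "map_of (zip ms es) (M, \<B>) = Some e" "x |\<in>| asm e"
      using y by (auto split: option.splits)
    then have "((M, \<B>), e) \<in> set (zip ms es)" by (auto dest: map_of_SomeD)
    then obtain i where "i < length ms" "ms ! i = (M, \<B>)" "es ! i = e"
      by (auto simp: set_zip)
    then have "wf_expr \<Sigma> 0 (ar \<B>) e" using inst_value(2)[OF assms(1,2)] by fastforce
    then show ?thesis using wf_asm(1) e(2) by blast
  qed
qed

text \<open>Well-formedness is what later makes \<open>asm\<close> of derived syntax closed under
  annotations and its codes independent of how symbols outside the signature are numbered.\<close>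

lemma derivable_wf:
  shows "derivable \<Sigma> T J \<Longrightarrow> wf_jdg \<Sigma> 0 J"
    and "derivable_bdry \<Sigma> T \<B> \<Longrightarrow> wf_bdry \<Sigma> 0 \<B>"
proof (induction rule: derivable_derivable_bdry.inducts)
  case (Abstr A J a)
  then show ?case using wf_subst_jdg_FVarD by fastforce
next
  case (Meta \<B> ts M)
  have ts: "\<forall>t \<in> set ts. wf_expr \<Sigma> 0 (Tm, 0) t"
    by (rule wf_args_of_arg_judgements) (use Meta in auto)
  have ar: "snd (ar (apply_bdry \<B> ts)) = 0" "ar \<B> = (fst (ar (apply_bdry \<B> ts)), length ts)"
    using Meta by (auto simp: snd_ar_apply_bdry fst_ar_apply_bdry prod_eq_iff)
  have cl: "wf_bdry \<Sigma> 0 \<B>" "frees (asm_bdry \<B>) = {||}" using Meta by (auto simp: closed_bdry_def)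
  have asm: "wf_assm \<Sigma> 0 x" if "x |\<in>| asm (expr.Meta M \<B> ts)" for x
  proof -
    from that consider "x = AMeta M \<B>" | "x |\<in>| asm_bdry \<B>" | t where "t \<in> set ts" "x |\<in>| asm t"
      by (auto simp: fset_of_list.rep_eq)
    then show ?thesis
    proof cases
      case 1
      then show ?thesis using wf_intros(10)[OF cl] by simp
    next
      case 2
      then show ?thesis using wf_asm(3)[OF cl(1)] by blast
    next
      case (3 t)
      then show ?thesis using wf_asm(1) ts by blast
    qed
  qed
  have obj: "wf_expr \<Sigma> 0 (c, 0) (expr.Meta M \<B> ts)"
    if "is_object_class c" "fst (ar (apply_bdry \<B> ts)) = c" for c
    using that ts cl ar by (intro wf_intros(4)) auto
  have wf: "wf_bdry \<Sigma> 0 (apply_bdry \<B> ts)" using Meta by simp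
  show ?case
  proof (cases "apply_bdry \<B> ts")
    case BTy
    then show ?thesis using obj[of Ty] by simp
  next
    case (BTm A)
    then show ?thesis using obj[of Tm] wf by (auto elim: wf_BTmE)
  next
    case (BEqTy A B)
    then show ?thesis using wf asm by (auto elim!: wf_BEqTyE simp del: asm.simps)
  next
    case (BEqTm s t A)
    then show ?thesis using wf asm by (auto elim!: wf_BEqTmE simp del: asm.simps)
  next
    case (BAbs A \<B>')
    then show ?thesis using ar by simp
  qed
next
  case (Meta_Congr_Ty \<B> m ss ts ts' \<alpha>s Ps M \<gamma>)
  have "\<forall>t \<in> set ss. wf_expr \<Sigma> 0 (Tm, 0) t" "\<forall>t \<in> set ts. wf_expr \<Sigma> 0 (Tm, 0) t"
    by (rule wf_args_of_arg_judgements[of \<B>]; use Meta_Congr_Ty in auto)+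
  moreover have "wf_assm \<Sigma> 0 x" if "x |\<in>| \<gamma>" for x
    using wf_asm_jdgs[of Ps \<Sigma> 0 x] Meta_Congr_Ty fsubset_asm_set[OF that] by auto
  ultimately show ?case using Meta_Congr_Ty by (auto simp: closed_bdry_def intro!: wf_intros)
next
  case (Meta_Congr_Tm \<B> m ss ts ts' \<alpha>s B Ps v M \<gamma>)
  have "\<forall>t \<in> set ss. wf_expr \<Sigma> 0 (Tm, 0) t"
    by (rule wf_args_of_arg_judgements[of \<B>]; use Meta_Congr_Tm in auto)
  moreover have "wf_assm \<Sigma> 0 x" if "x |\<in>| \<gamma>" for x
    using wf_asm_jdgs[of Ps \<Sigma> 0 x] Meta_Congr_Tm fsubset_asm_set[OF that] by auto
  moreover have "wf_jdg \<Sigma> 0 (JTm v B)" using Meta_Congr_Tm by auto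
  ultimately show ?case using Meta_Congr_Tm by (auto simp: closed_bdry_def intro!: wf_intros)
next
  case (EqTy_Trans A B \<alpha> B' C \<beta> \<gamma>)
  have "wf_assm \<Sigma> 0 x" if "x |\<in>| \<gamma>" for x
    using wf_asm_jdgs[of "[JEqTy A B \<alpha>, JEqTy B' C \<beta>]" \<Sigma> 0 x] EqTy_Trans fsubset_asm_set[OF that] by auto
  then show ?case using EqTy_Trans by auto
next
  case (EqTm_Trans s t A \<alpha> t' u \<beta> \<gamma>)
  have "wf_assm \<Sigma> 0 x" if "x |\<in>| \<gamma>" for x
    using wf_asm_jdgs[of "[JEqTm s t A \<alpha>, JEqTm t' u A \<beta>]" \<Sigma> 0 x] EqTm_Trans fsubset_asm_set[OF that] by auto
  then show ?case using EqTm_Trans by auto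
next
  case (Conv_Tm t A B \<alpha> \<beta>)
  have "wf_assm \<Sigma> 0 x" if "x |\<in>| \<beta>" for x
  proof -
    have "x |\<in>| asm_jdg (JTm t A) |\<union>| asm_jdg (JEqTy A B \<alpha>)"
      using fsubset_asm_set[OF that] Conv_Tm.hyps by (auto simp del: asm.simps)
    then show ?thesis using wf_asm_jdg Conv_Tm.IH by blast
  qed
  then show ?case using Conv_Tm by (auto intro: wf_intros)
next
  case (Conv_EqTm s t A \<alpha> B \<beta> \<gamma> \<delta>)
  have "wf_assm \<Sigma> 0 x" if "x |\<in>| \<gamma> |\<union>| \<delta>" for x
  proof -
    have "x |\<in>| asm_set \<gamma> \<or> x |\<in>| asm_set \<delta>" using that fsubset_asm_set by blast
    then have "x |\<in>| asm_jdg (JEqTm s t A \<alpha>) |\<union>| asm_jdg (JEqTy A B \<beta>)"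
      using Conv_EqTm.hyps by (auto simp del: asm.simps)
    then show ?thesis using wf_asm_jdg Conv_EqTm.IH by blast
  qed
  then show ?case using Conv_EqTm by (auto intro: wf_intros)
next
  case (Bdry_Abstr A \<B> a)
  then show ?case using wf_subst_bdry_FVarD by (fastforce intro: wf_intros)
next
  case (Specific ms J es)
  have wf: "wf_thesis \<Sigma> J" using raw[OF Specific(1)] by simp
  show ?case
  proof (cases J)
    case (JTy A)
    then obtain S where "A = Sym S (map generic_arg ms)" "\<Sigma> S = Some (Ty, map (\<lambda>m. ar (snd m)) ms)"
      using Specific(1) type_rule by blast
    then have "wf_expr \<Sigma> 0 (Ty, 0) (inst A (zip ms es))" using wf_inst_head[OF Specific(1,2)] by simp
    then show ?thesis using JTy by simp
  next
    case (JTm t A)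
    then obtain S where "t = Sym S (map generic_arg ms)" "\<Sigma> S = Some (Tm, map (\<lambda>m. ar (snd m)) ms)"
      using Specific(1) term_rule by blast
    then have "wf_expr \<Sigma> 0 (Tm, 0) (inst t (zip ms es))" using wf_inst_head[OF Specific(1,2)] by simp
    then show ?thesis using Specific JTm by (auto elim: wf_BTmE)
  next
    case (JEqTy A B \<alpha>)
    have "\<forall>x \<in> fset (ffUnion ((\<lambda>x. inst_assm x (zip ms es)) |`| \<alpha>)). wf_assm \<Sigma> 0 x"
      by (rule wf_inst_set[OF Specific(1,2)]) (use wf JEqTy fsubset_asm_set in \<open>auto simp del: asm.simps\<close>)
    then show ?thesis using Specific JEqTy by (auto elim!: wf_BEqTyE)
  next
    case (JEqTm s t A \<alpha>)
    have "\<forall>x \<in> fset (ffUnion ((\<lambda>x. inst_assm x (zip ms es)) |`| \<alpha>)). wf_assm \<Sigma> 0 x"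
      by (rule wf_inst_set[OF Specific(1,2)]) (use wf JEqTm fsubset_asm_set in \<open>auto simp del: asm.simps\<close>)
    then show ?thesis using Specific JEqTm by (auto elim!: wf_BEqTmE)
  next
    case (JAbs A J')
    then show ?thesis using wf by simp
  qed
next
  case (Congr_Ty ms A fs gs gs' \<alpha>s Ps \<gamma>)
  have "wf_assm \<Sigma> 0 x" if "x |\<in>| \<gamma>" for x
    using wf_asm_jdgs[of Ps \<Sigma> 0 x] Congr_Ty fsubset_asm_set[OF that] by auto
  moreover obtain S where "A = Sym S (map generic_arg ms)" "\<Sigma> S = Some (Ty, map (\<lambda>m. ar (snd m)) ms)"
    using type_rule[OF Congr_Ty(1)] by blast
  ultimately show ?case using wf_inst_head[OF Congr_Ty(1)] Congr_Ty(2,3) by auto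
next
  case (Congr_Tm ms t A fs gs gs' \<alpha>s Ps t' \<gamma>)
  have "wf_assm \<Sigma> 0 x" if "x |\<in>| \<gamma>" for x
    using wf_asm_jdgs[of Ps \<Sigma> 0 x] Congr_Tm fsubset_asm_set[OF that] by auto
  moreover obtain S where "t = Sym S (map generic_arg ms)" "\<Sigma> S = Some (Tm, map (\<lambda>m. ar (snd m)) ms)"
    using term_rule[OF Congr_Tm(1)] by blast
  moreover have "wf_jdg \<Sigma> 0 (JTm t' (inst A (zip ms fs)))" using Congr_Tm by auto
  ultimately show ?case using wf_inst_head[OF Congr_Tm(1)] Congr_Tm(2,3) by auto
qed (auto intro: wf_intros)

lemma derivable_Meta:
  assumes "closed_bdry \<Sigma> \<B>" "ar \<B> = (c, length ts)" "\<forall>P \<in> set (arg_judgements \<B> ts). derivable \<Sigma> T P"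
    "derivable_bdry \<Sigma> T (apply_bdry \<B> ts)"
  shows "c = Ty \<Longrightarrow> derivable \<Sigma> T (JTy (expr.Meta M \<B> ts))"
    and "apply_bdry \<B> ts = BTm A \<Longrightarrow> derivable \<Sigma> T (JTm (expr.Meta M \<B> ts) A)"
proof -
  have d: "derivable \<Sigma> T (fill (apply_bdry \<B> ts) (expr.Meta M \<B> ts))"
    by (rule derivable_derivable_bdry.Meta) (use assms in auto)
  show "derivable \<Sigma> T (JTy (expr.Meta M \<B> ts))" if "c = Ty"
  proof -
    have "ar (apply_bdry \<B> ts) = (Ty, 0)"
      using assms(2) that by (simp add: prod_eq_iff snd_ar_apply_bdry fst_ar_apply_bdry)
    then show ?thesis using ar_thesis_cases(1) d by fastforce
  qed
  show "derivable \<Sigma> T (JTm (expr.Meta M \<B> ts) A)" if "apply_bdry \<B> ts = BTm A" using d that by simp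
qed

lemma apply_bdry_thesis: "snd (ar \<B>) = length ts \<Longrightarrow> apply_bdry \<B> ts \<noteq> BAbs A \<B>'"
  using snd_ar_apply_bdry[of \<B> ts] by auto

text \<open>A congruence rule has among its premises those from which \<open>Meta\<close> and
  \<open>Specific\<close> derive both of its sides, and a specific equation has its boundary as a
  premise.\<close>

lemma EqTy_presup:
  "derivable \<Sigma> T (JEqTy A B \<alpha>) \<Longrightarrow> derivable \<Sigma> T (JTy A) \<and> derivable \<Sigma> T (JTy B)"
proof (induction "JEqTy A B \<alpha>" arbitrary: A B \<alpha> rule: derivable_derivable_bdry.inducts(1)[where ?P2.0 = "\<lambda>_. True"])
  case (Meta \<B> ts M)
  then show ?case
    using apply_bdry_thesis[of \<B> ts] by (cases "apply_bdry \<B> ts") (auto elim!: drv_BEqTyE)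
next
  case (Meta_Congr_Ty \<B> m ss ts ts' \<alpha>s Ps M \<gamma>)
  have bdry: "apply_bdry \<B> us = BTy" if "length us = m" for us
    using Meta_Congr_Ty(2) that
    by (intro ar_thesis_cases) (simp add: prod_eq_iff snd_ar_apply_bdry fst_ar_apply_bdry)
  show ?case
    by (intro conjI derivable_Meta[of \<B> Ty])
      (use Meta_Congr_Ty bdry in \<open>auto intro: derivable_derivable_bdry.Bdry_Ty\<close>)
next
  case (Specific ms J es)
  then show ?case by (cases J) (auto elim!: drv_BEqTyE)
next
  case (Congr_Ty ms A fs gs gs' \<alpha>s Ps \<gamma>)
  have "derivable \<Sigma> T (inst_jdg (JTy A) (zip ms hs))" if "hs = fs \<or> hs = gs" for hs
    by (rule derivable_derivable_bdry.Specific)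
      (use Congr_Ty that in \<open>auto simp: congruence_premises_def intro: derivable_derivable_bdry.Bdry_Ty\<close>)
  then show ?case by force
qed auto

text \<open>Only the variable case does not make the type of the term derivable. The conversion case
  keeps the side condition, which later bounds the assumptions used.\<close>

lemma term_inversion:
  assumes "derivable \<Sigma> T (JTm t A)"
  obtains (Var) a where "t = FVar a A"
  | (Meta) M \<B> ts where "t = expr.Meta M \<B> ts" "apply_bdry \<B> ts = BTm A" "derivable \<Sigma> T (JTy A)"
  | (Sym) S ms A' es where "(ms, JTm (Sym S (map generic_arg ms)) A') \<in> T"
      "symbol_rule \<Sigma> S (ms, JTm (Sym S (map generic_arg ms)) A')"
      "inst_values \<Sigma> ms es" "t = inst (Sym S (map generic_arg ms)) (zip ms es)" "A = inst A' (zip ms es)"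
      "derivable \<Sigma> T (JTy A)"
  | (Conv) t' B \<alpha> \<beta> where "t = Conv t' \<beta>" "derivable \<Sigma> T (JTm t' B)" "derivable \<Sigma> T (JEqTy B A \<alpha>)"
      "asm t' |\<union>| asm B |\<union>| asm A |\<union>| asm_set \<alpha> = asm t' |\<union>| asm A |\<union>| asm_set \<beta>"
  using assms
proof cases
  case (Var a)
  then show ?thesis using that(1) by simp
next
  case (Meta \<B> ts M)
  then show ?thesis
    using apply_bdry_thesis[of \<B> ts] that(2) by (cases "apply_bdry \<B> ts") (auto elim!: drv_BTmE)
next
  case (Conv_Tm t' B \<alpha> \<beta>)
  then show ?thesis using that(4) by metis
next
  case (Specific ms J es)
  then obtain t0 A0 where J: "J = JTm t0 A0" "t = inst t0 (zip ms es)" "A = inst A0 (zip ms es)"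
    by (cases J) auto
  with Specific obtain S where "t0 = Sym S (map generic_arg ms)" "symbol_rule \<Sigma> S (ms, JTm t0 A0)"
    using term_rule by blast
  then show ?thesis using that(3)[of ms S A0 es] J Specific by (auto elim: drv_BTmE)
qed

lemma type_of_term:
  "derivable \<Sigma> T (JTm t A) \<Longrightarrow> \<forall>a. t \<noteq> FVar a A \<Longrightarrow> derivable \<Sigma> T (JTy A)"
  by (erule term_inversion) (auto dest: EqTy_presup)

lemma EqTm_presup:
  "derivable \<Sigma> T (JEqTm s t A \<alpha>) \<Longrightarrow> derivable \<Sigma> T (JTm s A) \<and> derivable \<Sigma> T (JTm t A)"
proof (induction "JEqTm s t A \<alpha>" arbitrary: s t A \<alpha> rule: derivable_derivable_bdry.inducts(1)[where ?P2.0 = "\<lambda>_. True"])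
  case (Meta \<B> ts M)
  then show ?case
    using apply_bdry_thesis[of \<B> ts] by (cases "apply_bdry \<B> ts") (auto elim!: drv_BEqTmE)
next
  case (Meta_Congr_Tm \<B> m ss ts ts' \<alpha>s B Ps v M \<gamma>)
  have v: "derivable \<Sigma> T (JTm v B)" using Meta_Congr_Tm by auto
  \<comment> \<open>\<open>v\<close> erases to an application of a metavariable and is thus no
    variable, so its type is derivable. The rule itself does not state that \<open>B\<close> is a
    type.\<close>
  have "derivable \<Sigma> T (JTy B)"
    by (rule type_of_term[OF v]) (use Meta_Congr_Tm in auto)
  then have "derivable \<Sigma> T (JTm (expr.Meta M \<B> ss) B)"
    by (intro derivable_Meta[of \<B> Tm])
      (use Meta_Congr_Tm in \<open>auto intro: derivable_derivable_bdry.Bdry_Tm\<close>)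
  then show ?case using v by simp
next
  case (Conv_EqTm s t A \<alpha> B \<beta> \<gamma> \<delta>)
  then show ?case using derivable_derivable_bdry.Conv_Tm by blast
next
  case (Specific ms J es)
  then show ?case by (cases J) (auto elim!: drv_BEqTmE)
next
  case (Congr_Tm ms t A fs gs gs' \<alpha>s Ps t' \<gamma>)
  have t': "derivable \<Sigma> T (JTm t' (inst A (zip ms fs)))" using Congr_Tm by auto
  obtain S where S: "t = Sym S (map generic_arg ms)" using term_rule[OF Congr_Tm(1)] by blast
  have "derivable \<Sigma> T (JTy (inst A (zip ms fs)))"
    by (rule type_of_term[OF t']) (use Congr_Tm S in auto)
  then have "derivable \<Sigma> T (inst_jdg (JTm t A) (zip ms fs))"
    by (intro derivable_derivable_bdry.Specific)
      (use Congr_Tm in \<open>auto simp: congruence_premises_def intro: derivable_derivable_bdry.Bdry_Tm\<close>)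
  then show ?case using t' by simp
qed auto

text \<open>
  Where the argument is an assumption set, the instance of the generic argument only determines the
  assumptions occurring in it, but the erasures agree anyway.
\<close>

lemma erase_arg_eq:
  assumes "(ms, J) \<in> T" "inst_values \<Sigma> ms es" "inst_values \<Sigma> ms es'" "i < length ms"
    "inst (generic_arg (ms ! i)) (zip ms es) = inst (generic_arg (ms ! i)) (zip ms es')"
  shows "erase (es ! i) = erase (es' ! i)"
proof -
  obtain M \<B> where m: "ms ! i = (M, \<B>)" by fastforce
  note v = inst_value[OF assms(1,2,4), unfolded m] inst_value[OF assms(1,3,4), unfolded m]
  show ?thesis
  proof (cases "is_object_class (fst (ar \<B>))")
    case True
    then show ?thesis
      using assms(5) v inst_generic_arg_object[of "zip ms es" M \<B> "es ! i" \<Sigma>]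
        inst_generic_arg_object[of "zip ms es'" M \<B> "es' ! i" \<Sigma>] m by simp
  next
    case False
    obtain c k where ar: "ar \<B> = (c, k)" by fastforce
    have erased: "erase e = (Abs ^^ k) (Asms {||})" if wf: "wf_expr \<Sigma> 0 (ar \<B>) e" for e
    proof -
      obtain f where f: "e = (Abs ^^ k) f" "wf_expr \<Sigma> k (c, 0) f"
        using wf_expr_Abs_funpow wf ar by fastforce
      from f(2) have "erase f = Asms {||}"
      proof cases
        \<comment> \<open>A symbol has class \<open>Ty\<close> or \<open>Tm\<close>, so it cannot
          occur as an argument of an equation class; only an assumption set remains.\<close>
        case (3 S ars es)
        then show ?thesis using signature False ar by (auto simp: raw_signature_def)
      qed (use False ar in auto)
      then show ?thesis by (simp add: f(1) erase_Abs_funpow)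
    qed
    show ?thesis using erased v by simp
  qed
qed

text \<open>The metavariables of the type \<open>A\<close> all belong to the rule, and equality of
  the two symbol terms makes the corresponding arguments equal, which fixes the erasures of the
  values.\<close>

lemma erase_rule_type:
  assumes rule: "(ms, JTm (Sym S (map generic_arg ms)) A) \<in> T"
    and es: "inst_values \<Sigma> ms es" "inst_values \<Sigma> ms es'"
    and eq: "inst (Sym S (map generic_arg ms)) (zip ms es) = inst (Sym S (map generic_arg ms)) (zip ms es')"
  shows "erase (inst A (zip ms es)) = erase (inst A (zip ms es'))"
proof (rule erase_inst_cong)
  note raw = raw[OF rule]
  show "wf_expr \<Sigma> 0 (Ty, 0) A" using raw by simp
  show "\<forall>a C. AFree a C |\<notin>| asm A" using raw by (auto simp: frees_def fset_eq_iff)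
  have "values_agree \<Sigma> (zip ms es) (zip ms es') (M, \<B>)" if M: "AMeta M \<B> |\<in>| asm A" for M \<B>
  proof -
    have "AMeta M \<B> |\<in>| metas (asm_jdg (JTm (Sym S (map generic_arg ms)) A))"
      using M by (auto simp: metas_def)
    then have "AMeta M \<B> |\<in>| mvars ms" using raw by (simp del: asm_jdg.simps)
    then have "(M, \<B>) \<in> set ms" by (auto simp: mvars_def fset_of_list.rep_eq)
    then obtain i where i: "i < length ms" "ms ! i = (M, \<B>)" by (auto simp: in_set_conv_nth)
    have "inst (generic_arg (ms ! i)) (zip ms es) = inst (generic_arg (ms ! i)) (zip ms es')"
      using eq i(1) by (auto simp: list_eq_iff_nth_eq)
    then show ?thesis
      using erase_arg_eq[OF rule es i(1)] inst_value[OF rule es(1) i(1)] inst_value[OF rule es(2) i(1)] i(2)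
      by (simp add: values_agree_def)
  qed
  then show "\<forall>M \<B>. AMeta M \<B> |\<in>| asm A \<longrightarrow> values_agree \<Sigma> (zip ms es) (zip ms es') (M, \<B>)" by blast
qed

section \<open>Chaining type equations with few assumptions\<close>

lemma asm_closed_set_EqTy:
  assumes "derivable \<Sigma> T (JEqTy A B \<alpha>)"
  shows "asm_closed_set (asm A)" "asm_closed_set (asm B)" "asm_closed_set (asm_set \<alpha>)"
  using derivable_wf(1)[OF assms] asm_closed_set_wf by (auto simp del: asm.simps)

text \<open>Suitability prescribes \<open>asm\<close> of the conclusion as a whole, and the two
  outer types are part of it. Their assumptions may thus be left out of \<gamma>, while those of the
  middle type must be recorded.\<close>

lemma EqTy_trans_minimal:
  assumes "derivable \<Sigma> T (JEqTy A B \<alpha>)" "derivable \<Sigma> T (JEqTy B C \<beta>)"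
  defines "U \<equiv> asm A |\<union>| asm B |\<union>| asm_set \<alpha> |\<union>| asm C |\<union>| asm_set \<beta>"
  defines "\<gamma> \<equiv> U |-| (asm A |\<union>| asm C)"
  shows "derivable \<Sigma> T (JEqTy A C \<gamma>)" and "asm A |\<union>| asm C |\<union>| asm_set \<gamma> = U"
proof -
  \<comment> \<open>Otherwise the annotations of assumptions in \<gamma> could lead outside
    \<open>U\<close> and violate suitability.\<close>
  have "asm_closed_set U"
    unfolding U_def
    by (intro asm_closed_set_funion asm_closed_set_EqTy[OF assms(1)] asm_closed_set_EqTy[OF assms(2)])
  then have "asm_set \<gamma> |\<subseteq>| U" by (rule asm_set_mono) (auto simp: \<gamma>_def)
  moreover have "\<gamma> |\<subseteq>| asm_set \<gamma>" using fsubset_asm_set by blast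
  ultimately show U: "asm A |\<union>| asm C |\<union>| asm_set \<gamma> = U"
    unfolding \<gamma>_def U_def by blast
  show "derivable \<Sigma> T (JEqTy A C \<gamma>)"
    by (rule derivable_derivable_bdry.EqTy_Trans[OF assms(1,2) refl])
      (use U in \<open>auto simp: asm_jdgs_def U_def simp del: asm.simps\<close>)
qed

theorem unique_typing:
  assumes "derivable \<Sigma> T (JTm t A)" "derivable \<Sigma> T (JTm t B)"
    "\<forall>a C. t = FVar a C \<longrightarrow> derivable \<Sigma> T (JTy C)"
  shows "\<exists>\<alpha>. \<alpha> |\<subseteq>| asm t \<and> derivable \<Sigma> T (JEqTy A B \<alpha>)"
  using assms
proof (induction "size t" arbitrary: t A B rule: less_induct)
  case less
  have refl: ?case if "derivable \<Sigma> T (JTy A)" "derivable \<Sigma> T (JTy B)" "erase A = erase B"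
    using derivable_derivable_bdry.EqTy_Refl[OF that] by blast
  from less.prems(1) show ?case
  proof (cases rule: term_inversion)
    case (Var a)
    from less.prems(2) show ?thesis
      by (cases rule: term_inversion) (use Var less.prems(3) refl in auto)
  next
    case (Meta M \<B> ts)
    from less.prems(2) show ?thesis
      by (cases rule: term_inversion) (use Meta refl in auto)
  next
    case (Sym S ms A' es)
    note A = Sym
    from less.prems(2) show ?thesis
    proof (cases rule: term_inversion)
      case (Sym S' ms' B' es')
      then have "S' = S" using A(4) by simp
      then have "(ms', JTm (Sym S (map generic_arg ms')) B') = (ms, JTm (Sym S (map generic_arg ms)) A')"
        using unique[OF Sym(1) A(1)] Sym(2) A(2) by simp
      then have eq: "ms' = ms" "B' = A'" by auto
      have "erase A = erase B"
        unfolding A(5) Sym(5) eq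
        by (rule erase_rule_type[OF A(1,3)]) (use Sym A(4) \<open>S' = S\<close> eq in auto)
      then show ?thesis using refl A(6) Sym(6) by blast
    qed (use Sym in auto)
  next
    case (Conv t' A' \<alpha>1 \<beta>)
    note A = Conv
    from less.prems(2) show ?thesis
    proof (cases rule: term_inversion)
      case (Conv t'' B' \<alpha>2 \<beta>')
      then have [simp]: "t'' = t'" "\<beta>' = \<beta>" using A by auto
      note B = Conv
      \<comment> \<open>A variable below the conversion has its annotation \<open>A'\<close> as its
        type, and this is the left side of a derivable equation.\<close>
      have "\<forall>a C. t' = FVar a C \<longrightarrow> derivable \<Sigma> T (JTy C)"
        using A(2) EqTy_presup[OF A(3)] by (auto elim: term_inversion)
      then obtain \<delta> where \<delta>: "\<delta> |\<subseteq>| asm t'" "derivable \<Sigma> T (JEqTy A' B' \<delta>)"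
        using less.hyps[of t' A' B'] A B by auto
      have "asm_closed_set (asm t')"
        using derivable_wf(1)[OF A(2)] asm_closed_set_wf by auto
      then have set_\<delta>: "asm_set \<delta> |\<subseteq>| asm t'" using \<delta>(1) by (rule asm_set_mono)
      \<comment> \<open>The chain runs from \<open>A\<close> to \<open>A'\<close>, \<open>B'\<close>
        and \<open>B\<close>: back along one conversion, through the induction hypothesis, and
        forward along the other.\<close>
      note AB' = EqTy_trans_minimal[OF derivable_derivable_bdry.EqTy_Sym[OF A(3)] \<delta>(2)]
      note AB = EqTy_trans_minimal[OF AB'(1) B(3)]
      \<comment> \<open>The side condition of each conversion bounds its source type and its
        equation by \<open>t'\<close>, \<beta> and the target type. Subtracting the targets
        \<open>A\<close> and \<open>B\<close> leaves assumptions of \<open>t'\<close> and \<beta>,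
        which are those of \<open>t\<close>.\<close>
      have "asm A' |\<union>| asm_set \<alpha>1 |\<subseteq>| asm t' |\<union>| asm A |\<union>| asm_set \<beta>"
        unfolding A(4)[symmetric] by blast
      moreover have "asm B' |\<union>| asm_set \<alpha>2 |\<subseteq>| asm t' |\<union>| asm B |\<union>| asm_set \<beta>"
        using B(4) by (auto simp del: asm.simps)
      ultimately have "asm A |\<union>| asm A' |\<union>| asm_set \<alpha>1 |\<union>| asm B' |\<union>| asm_set \<delta> |\<union>| asm B |\<union>| asm_set \<alpha>2 |-|
          (asm A |\<union>| asm B) |\<subseteq>| asm t' |\<union>| asm_set \<beta>"
        using set_\<delta> by blast
      moreover have "asm t = asm t' |\<union>| asm_set \<beta>" using A(1) by simp
      ultimately show ?thesis using AB(1) unfolding AB'(2) by metis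
    qed (use Conv in auto)
  qed
qed

text \<open>The right-hand term has both types by the presuppositions; well-typed annotations supply
  the hypothesis on bare variables.\<close>

theorem unique_equation_type:
  assumes "derivable \<Sigma> T (JEqTm s t A \<beta>1)" "derivable \<Sigma> T (JEqTm s t B \<beta>2)"
    "well_typed_annotations \<Sigma> T (asm_jdg (JEqTm s t A \<beta>1))"
  shows "\<exists>\<alpha>. \<alpha> |\<subseteq>| asm t \<and> derivable \<Sigma> T (JEqTy A B \<alpha>)"
proof (rule unique_typing)
  show "derivable \<Sigma> T (JTm t A)" "derivable \<Sigma> T (JTm t B)"
    using EqTm_presup[OF assms(1)] EqTm_presup[OF assms(2)] by simp_all
  show "\<forall>a C. t = FVar a C \<longrightarrow> derivable \<Sigma> T (JTy C)"
    using assms(3) by (auto simp: well_typed_annotations_def)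
qed

end

section \<open>Computing the assumption set\<close>

lemma re_set_UNIV: "re_set X UNIV"
  using re_set_eq[OF total_rec_id total_rec_id, of X] by simp

lemma re_set_finite: "finite S \<Longrightarrow> re_set X S"
proof (induction rule: finite_induct)
  case empty
  show ?case using re_set_eq[OF total_rec_const[of X 0] total_rec_const[of X 1]] by simp
next
  case (insert n S)
  have "{m. m = n} \<union> S = insert n S" by auto
  then show ?case using re_set_Un[OF re_set_eq[OF total_rec_id total_rec_const[of X n]] insert(3)] by simp
qed

text \<open>
  The range of \<open>\<nu>\<close> need not be recursively enumerable, but the symbols outside the signature can be
  renumbered so that it becomes so: if there are infinitely many of them, they can fill up the
  natural numbers that are not numbers of symbols of the signature.
\<close>

lemma ex_enumerable_numbering:
  assumes \<nu>: "inj \<nu>" and D: "re_set X (\<nu> ` D)"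
  obtains \<mu> where "inj \<mu>" "\<forall>S \<in> D. \<mu> S = \<nu> S" "re_set X (range \<mu>)"
proof (cases "finite (- D)")
  case True
  have "range \<nu> = \<nu> ` D \<union> \<nu> ` (- D)" by auto
  then show ?thesis using that[of \<nu>] \<nu> re_set_Un[OF D re_set_finite[OF finite_imageI[OF True]]] by simp
next
  case False
  have "countable (- D)" using \<nu> by (meson countableI inj_on_subset subset_UNIV)
  then have f: "bij_betw (to_nat_on (- D)) (- D) UNIV" using False by (rule to_nat_on_infinite)
  have "infinite (\<nu> ` (- D))" using False finite_imageD[OF _ inj_on_subset[OF \<nu>]] by blast
  moreover have "\<nu> ` (- D) \<subseteq> - \<nu> ` D" using \<nu> by (auto simp: inj_eq)
  ultimately have "infinite (- \<nu> ` D)" using finite_subset by blast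
  then have "bij_betw (from_nat_into (- \<nu> ` D)) UNIV (- \<nu> ` D)"
    by (intro bij_betw_from_nat_into) auto
  from bij_betw_trans[OF f this] have g: "bij_betw (from_nat_into (- \<nu> ` D) \<circ> to_nat_on (- D)) (- D) (- \<nu> ` D)" .
  define \<mu> where "\<mu> S = (if S \<in> D then \<nu> S else (from_nat_into (- \<nu> ` D) \<circ> to_nat_on (- D)) S)" for S
  have "bij_betw \<mu> (- D) (- \<nu> ` D)"
    using g by (rule bij_betw_cong[THEN iffD1, rotated]) (auto simp: \<mu>_def)
  moreover have "bij_betw \<mu> D (\<nu> ` D)"
    using inj_on_imp_bij_betw[OF inj_on_subset[OF \<nu>]]
    by (rule bij_betw_cong[THEN iffD1, rotated]) (auto simp: \<mu>_def)
  ultimately have "bij_betw \<mu> (D \<union> - D) (\<nu> ` D \<union> - \<nu> ` D)" by (intro bij_betw_combine) auto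
  then have "bij \<mu>" by simp
  then show ?thesis using that[of \<mu>] re_set_UNIV by (auto simp: \<mu>_def bij_def)
qed

text \<open>Well-formed syntax mentions only symbols of the signature, so a renumbering of the
  others leaves its codes unchanged.\<close>

lemma code_cong:
  assumes "\<forall>S \<in> dom \<Sigma>. \<mu> S = \<nu> S"
  shows "wf_expr \<Sigma> k r e \<Longrightarrow> code e \<mu> = code e \<nu>"
    and "wf_assm \<Sigma> k x \<Longrightarrow> code_assm x \<mu> = code_assm x \<nu>"
    and "wf_bdry \<Sigma> k \<B> \<Longrightarrow> code_bdry \<B> \<mu> = code_bdry \<B> \<nu>"
proof (induction rule: wf_expr_wf_assm_wf_bdry.inducts)
  case (3 S c ars es k)
  have "map (\<lambda>e. code e \<mu>) es = map (\<lambda>e. code e \<nu>) es"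
    by (rule nth_equalityI) (use 3 in auto)
  then show ?case using bspec[OF assms, of S] 3(1) by (auto simp del: map_eq_conv)
next
  case (4 \<B> c ts k M)
  have "map (\<lambda>e. code e \<mu>) ts = map (\<lambda>e. code e \<nu>) ts" using 4 by auto
  then show ?case using 4 by (simp del: map_eq_conv)
next
  case (5 k t \<alpha>)
  have "(\<lambda>x. code_assm x \<mu>) ` fset \<alpha> = (\<lambda>x. code_assm x \<nu>) ` fset \<alpha>" using 5 by (intro image_cong) auto
  then show ?case using 5 by simp
next
  case (6 c \<alpha> k)
  have "(\<lambda>x. code_assm x \<mu>) ` fset \<alpha> = (\<lambda>x. code_assm x \<nu>) ` fset \<alpha>" using 6 by (intro image_cong) auto
  then show ?case by simp
qed auto

lemma code_set_cong:
  assumes "\<forall>S \<in> dom \<Sigma>. \<mu> S = \<nu> S" "\<forall>x \<in> fset \<alpha>. wf_assm \<Sigma> k x"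
  shows "code_set \<alpha> \<mu> = code_set \<alpha> \<nu>"
proof -
  have "(\<lambda>x. code_assm x \<mu>) ` fset \<alpha> = (\<lambda>x. code_assm x \<nu>) ` fset \<alpha>"
    using assms code_cong(2)[OF assms(1)] by (intro image_cong) auto
  then show ?thesis by (simp add: code_set_def)
qed

lemma code_jdg_cong:
  assumes "\<forall>S \<in> dom \<Sigma>. \<mu> S = \<nu> S"
  shows "wf_jdg \<Sigma> k J \<Longrightarrow> code_jdg J \<mu> = code_jdg J \<nu>"
  by (induction J arbitrary: k)
    (use code_cong(1)[OF assms] code_set_cong[OF assms] in fastforce)+

lemma wf_jdg_thesis: "wf_thesis \<Sigma> J \<Longrightarrow> wf_jdg \<Sigma> 0 J"
  by (cases J) auto

context relative_re begin

lemma re_select: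
  assumes "enumerable d" "re (c \<otimes> d) (\<lambda>p. Q (fst p) (snd p))"
  obtains F where "partial_recursive_in X F"
    "\<And>x. \<exists>y. Q x y \<Longrightarrow> \<exists>y. F (c x) = Some (d y) \<and> Q x y"
proof -
  obtain S where S: "re_set X S" "\<And>p. Q (fst p) (snd p) \<longleftrightarrow> (c \<otimes> d) p \<in> S"
    using assms(2) unfolding re_def by blast
  have "re_set X (S \<inter> {k. dec2 k \<in> range d})"
    using assms(1) unfolding enumerable_def by (intro re_set_Int S re_set_vimage total_rec_intros) auto
  then obtain F where F: "partial_recursive_in X F"
    "\<And>n. \<exists>m. prod_encode (n, m) \<in> S \<inter> {k. dec2 k \<in> range d} \<Longrightarrow>
       \<exists>m. F n = Some m \<and> prod_encode (n, m) \<in> S \<inter> {k. dec2 k \<in> range d}"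
    using re_set_select by blast
  show ?thesis
  proof (rule that[OF F(1)])
    fix x assume "\<exists>y. Q x y"
    then have "\<exists>m. prod_encode (c x, m) \<in> S \<inter> {k. dec2 k \<in> range d}"
      using S(2)[of "(x, y)" for y] by (fastforce simp: enc_pair_def)
    from F(2)[OF this] obtain y where "F (c x) = Some (d y)" "prod_encode (c x, d y) \<in> S" by auto
    then show "\<exists>y. F (c x) = Some (d y) \<and> Q x y"
      using S(2)[of "(x, y)"] by (auto simp: enc_pair_def)
  qed
qed

lemma computable_prod_encode:
  "computable c enc_nat f \<Longrightarrow> computable c enc_nat g \<Longrightarrow> computable c enc_nat (\<lambda>x. prod_encode (f x, g x))"
  using computable_encD[OF computable_Pair, of c enc_nat f enc_nat g] by (simp add: enc_pair_def enc_nat_def)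

end

text \<open>\<open>P\<close> reads a term and two types off the pair of input judgements, which lets
  one search serve both kinds of judgements.\<close>

lemma (in theory_coding) select_equation:
  assumes "re ((enc_jdg \<otimes> enc_jdg) \<otimes> enc_expr \<otimes> enc_expr \<otimes> enc_expr) (\<lambda>p. P (fst p) (snd p))"
  obtains F where "partial_recursive_in X F"
    "\<And>Js. \<exists>\<alpha> t A B. P Js (t, A, B) \<and> \<alpha> |\<subseteq>| asm t \<and> derivable \<Sigma> T (JEqTy A B \<alpha>) \<Longrightarrow>
       \<exists>\<alpha> t A B. F ((enc_jdg \<otimes> enc_jdg) Js) = Some (enc_fset enc_assm \<alpha>) \<and> P Js (t, A, B) \<and>
         \<alpha> |\<subseteq>| asm t \<and> derivable \<Sigma> T (JEqTy A B \<alpha>)"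
proof -
  define Q where "Q Js \<alpha> \<longleftrightarrow> (\<exists>t A B. P Js (t, A, B) \<and> \<alpha> |\<subseteq>| asm t \<and> derivable \<Sigma> T (JEqTy A B \<alpha>))"
    for Js \<alpha>
  have "re ((enc_jdg \<otimes> enc_jdg) \<otimes> enc_fset enc_assm) (\<lambda>p. Q (fst p) (snd p))"
    unfolding Q_def by (rule re_app2[OF assms] re_intros)+
  from re_select[OF enumerable_fset[OF enumerable_assm] this] obtain F where F: "partial_recursive_in X F"
    "\<And>x. \<exists>y. Q x y \<Longrightarrow> \<exists>y. F ((enc_jdg \<otimes> enc_jdg) x) = Some (enc_fset enc_assm y) \<and> Q x y" by blast
  show ?thesis
    by (rule that[OF F(1)]) (use F(2) in \<open>auto simp: Q_def\<close>)
qed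

section \<open>Recovering the theory from its oracle\<close>

context standard_rules begin

lemma code_rule_cong:
  assumes "\<forall>S \<in> dom \<Sigma>. \<mu> S = \<nu> S" "r \<in> T"
  shows "code_rule r \<mu> = code_rule r \<nu>"
proof -
  obtain ms J where r: "r = (ms, J)" by fastforce
  have wf: "wf_bdry \<Sigma> 0 (snd m)" if "m \<in> set ms" for m
    using raw[OF assms(2)] that by (auto simp: r closed_bdry_def in_set_conv_nth)
  have "wf_jdg \<Sigma> 0 J" using raw[OF assms(2)] by (auto simp: r intro: wf_jdg_thesis)
  then have "code_jdg J \<mu> = code_jdg J \<nu>" using code_jdg_cong[OF assms(1)] by blast
  moreover have "map (\<lambda>(M, \<B>). prod_encode (M, code_bdry \<B> \<mu>)) ms = map (\<lambda>(M, \<B>). prod_encode (M, code_bdry \<B> \<nu>)) ms"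
    using wf code_cong(3)[OF assms(1)] by (intro map_cong) fastforce+
  ultimately show ?thesis unfolding r code_rule.simps by metis
qed

lemma signature_iff:
  assumes total: "\<And>S. S \<in> dom \<Sigma> \<Longrightarrow> \<exists>r \<in> T. symbol_rule \<Sigma> S r"
  shows "\<Sigma> S = Some (k, ars) \<longleftrightarrow> (\<exists>ms es A. ars = map (\<lambda>m. ar (snd m)) ms \<and>
      (k = Ty \<and> (ms, JTy (Sym S es)) \<in> T \<or> k = Tm \<and> (ms, JTm (Sym S es) A) \<in> T))"
proof
  assume \<Sigma>: "\<Sigma> S = Some (k, ars)"
  then obtain r where "r \<in> T" "symbol_rule \<Sigma> S r" using total by blast
  then obtain ms \<beta> where "ar \<beta> = (k, 0)" "ars = map (\<lambda>m. ar (snd m)) ms"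
    "(ms, fill \<beta> (Sym S (map generic_arg ms))) \<in> T" "is_object_class k"
    using \<Sigma> unfolding symbol_rule_def by auto
  then show "\<exists>ms es A. ars = map (\<lambda>m. ar (snd m)) ms \<and>
      (k = Ty \<and> (ms, JTy (Sym S es)) \<in> T \<or> k = Tm \<and> (ms, JTm (Sym S es) A) \<in> T)"
    by (cases \<beta>) auto
next
  assume "\<exists>ms es A. ars = map (\<lambda>m. ar (snd m)) ms \<and>
      (k = Ty \<and> (ms, JTy (Sym S es)) \<in> T \<or> k = Tm \<and> (ms, JTm (Sym S es) A) \<in> T)"
  then show "\<Sigma> S = Some (k, ars)"
    by (elim exE conjE disjE) (auto elim: type_rule term_rule)
qed

text \<open>Object rules are symbol rules, so a symbol belongs to the signature exactly when it
  heads the conclusion of an object rule, and the oracle lists the codes of these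
  conclusions.\<close>

lemma re_set_signature:
  fixes \<nu> :: "'s \<Rightarrow> nat"
  assumes total: "\<And>S. S \<in> dom \<Sigma> \<Longrightarrow> \<exists>r \<in> T. symbol_rule \<Sigma> S r"
  defines "X \<equiv> (\<lambda>r. code_rule r \<nu>) ` T"
  shows "re_set X (\<nu> ` dom \<Sigma>)"
proof -
  interpret relative_re X .
  \<comment> \<open>The conclusion is the second component of the code of a rule. Tags 0 and 1 in
    front mark type and term judgements, and tag 2 marks an expression headed by the symbol with
    number \<open>n\<close>.\<close>
  have "re enc_nat (\<lambda>n. \<exists>l es A. prod_encode (l, list_encode [0, list_encode [2, n, es]]) \<in> X \<or>
      prod_encode (l, list_encode [1, list_encode [2, n, es], A]) \<in> X)" (is "re _ ?P")
    by (rule re_recf_reset[OF re_set_self] computable_prod_encode computable_list_encode re_intros)+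
  moreover have "?P n \<longleftrightarrow> n \<in> \<nu> ` dom \<Sigma>" for n
  proof
    assume "n \<in> \<nu> ` dom \<Sigma>"
    then obtain S k ars where "n = \<nu> S" "\<Sigma> S = Some (k, ars)" by auto
    then obtain ms es A where "(ms, JTy (Sym S es)) \<in> T \<or> (ms, JTm (Sym S es) A) \<in> T"
      using signature_iff[OF total] by blast
    then show "?P n"
    proof
      assume "(ms, JTy (Sym S es)) \<in> T"
      then have "code_rule (ms, JTy (Sym S es)) \<nu> \<in> X" unfolding X_def by blast
      then show "?P n" unfolding \<open>n = \<nu> S\<close> code_rule.simps code_jdg.simps code.simps by blast
    next
      assume "(ms, JTm (Sym S es) A) \<in> T"
      then have "code_rule (ms, JTm (Sym S es) A) \<nu> \<in> X" unfolding X_def by blast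
      then show "?P n" unfolding \<open>n = \<nu> S\<close> code_rule.simps code_jdg.simps code.simps by blast
    qed
  next
    assume "?P n"
    then obtain m l es A where m: "m \<in> X" "m = prod_encode (l, list_encode [0, list_encode [2, n, es]]) \<or>
        m = prod_encode (l, list_encode [1, list_encode [2, n, es], A])" by blast
    then obtain ms J where "(ms, J) \<in> T" "m = code_rule (ms, J) \<nu>" unfolding X_def by fastforce
    with m(2) have J: "(ms, J) \<in> T" "code_jdg J \<nu> = list_encode [0, list_encode [2, n, es]] \<or>
        code_jdg J \<nu> = list_encode [1, list_encode [2, n, es], A]"
      by (auto simp del: list_encode.simps)
    have sym: "\<exists>S es'. e = Sym S es' \<and> n = \<nu> S" if "code e \<nu> = list_encode [2, n, es]" for e
      using that by (cases e) (auto simp: list_encode_eq simp del: list_encode.simps)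
    from J(2) show "n \<in> \<nu> ` dom \<Sigma>"
      using J(1) by (cases J)
        (auto simp: list_encode_eq simp del: list_encode.simps dest!: sym elim!: type_rule term_rule)
  qed
  ultimately have "re_set X (Collect ?P)" by (intro re_enc_nat)
  then show ?thesis using \<open>\<And>n. ?P n \<longleftrightarrow> n \<in> \<nu> ` dom \<Sigma>\<close> by simp
qed

text \<open>The oracle is coded with \<nu> and the syntax with the renumbered \<mu>. Rules are
  well-formed, so both give them the same code, and injectivity of \<mu> turns membership in the
  oracle into membership in \<open>T\<close>.\<close>

lemma theory_coding_exists:
  fixes \<nu> :: "'s \<Rightarrow> nat"
  assumes total: "\<And>S. S \<in> dom \<Sigma> \<Longrightarrow> \<exists>r \<in> T. symbol_rule \<Sigma> S r" and \<nu>: "inj \<nu>"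
  obtains \<mu> where "theory_coding ((\<lambda>r. code_rule r \<nu>) ` T) \<mu> \<Sigma> T" "\<forall>S \<in> dom \<Sigma>. \<mu> S = \<nu> S"
proof -
  let ?X = "(\<lambda>r. code_rule r \<nu>) ` T"
  obtain \<mu> where \<mu>: "inj \<mu>" "\<forall>S \<in> dom \<Sigma>. \<mu> S = \<nu> S" "re_set ?X (range \<mu>)"
    using ex_enumerable_numbering[OF \<nu> re_set_signature[OF total]] by blast
  interpret syntax_coding ?X \<mu>
    by unfold_locales (simp add: relative_re.enumerable_def \<mu>(1,3))
  have enc: "(enc_list (enc_nat \<otimes> enc_bdry) \<otimes> enc_jdg) r = code_rule r \<mu>" for r
  proof -
    have "enc_nat \<otimes> enc_bdry = (\<lambda>(M, \<B>). prod_encode (M, code_bdry \<B> \<mu>))"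
      by (rule ext) (simp add: enc_pair_def enc_nat_def enc_bdry_def split_def)
    then show ?thesis by (cases r) (simp add: enc_pair_def[of _ enc_jdg] enc_list_def enc_jdg_def)
  qed
  have "r \<in> T \<longleftrightarrow> code_rule r \<mu> \<in> ?X" for r
  proof
    assume r: "r \<in> T"
    show "code_rule r \<mu> \<in> ?X" unfolding code_rule_cong[OF \<mu>(2) r] using r by (rule imageI)
  next
    assume "code_rule r \<mu> \<in> ?X"
    then obtain r' where r': "code_rule r \<mu> = code_rule r' \<nu>" "r' \<in> T" by (rule imageE)
    have "code_rule r \<mu> = code_rule r' \<mu>" unfolding r'(1) by (rule code_rule_cong[OF \<mu>(2) r'(2), symmetric])
    then show "r \<in> T" using r'(2) unfolding code_rule_inject[OF \<mu>(1)] by simp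
  qed
  then have "re (enc_list (enc_nat \<otimes> enc_bdry) \<otimes> enc_jdg) (\<lambda>r. r \<in> T)"
    unfolding re_def enc by (intro exI[of _ ?X] conjI re_set_self allI)
  then have "theory_coding ?X \<mu> \<Sigma> T"
    by unfold_locales (assumption, rule signature_iff[OF total])
  then show ?thesis by (rule that) (rule \<mu>(2))
qed

end

theorem mainTheorem14:
  fixes \<Sigma> :: "'s signature" and I :: "'i set" and R :: "'i \<Rightarrow> 's rule"
  assumes "standard_theory \<Sigma> I R"
  defines "T \<equiv> R ` I"
  defines "typing \<equiv> \<lambda>t A B.
      derivable \<Sigma> T (JTm t A) \<and> derivable \<Sigma> T (JTm t B) \<and>
      (\<forall>a C. t = FVar a C \<longrightarrow> derivable \<Sigma> T (JTy C))"
  defines "equations \<equiv> \<lambda>s t A B \<beta>1 \<beta>2.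
      derivable \<Sigma> T (JEqTm s t A \<beta>1) \<and> derivable \<Sigma> T (JEqTm s t B \<beta>2) \<and>
      well_typed_annotations \<Sigma> T (asm_jdg (JEqTm s t A \<beta>1)) \<and>
      well_typed_annotations \<Sigma> T (asm_jdg (JEqTm s t B \<beta>2))"
  shows
    "(\<forall>t A B. typing t A B \<longrightarrow> (\<exists>\<alpha>. \<alpha> |\<subseteq>| asm t \<and> derivable \<Sigma> T (JEqTy A B \<alpha>))) \<and>
     (\<forall>s t A B \<beta>1 \<beta>2. equations s t A B \<beta>1 \<beta>2 \<longrightarrow>
        (\<exists>\<alpha>. \<alpha> |\<subseteq>| asm t \<and> derivable \<Sigma> T (JEqTy A B \<alpha>))) \<and>
     (\<forall>\<nu> :: 's \<Rightarrow> nat. inj \<nu> \<longrightarrow>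
        (\<exists>F. partial_recursive_in ((\<lambda>r. code_rule r \<nu>) ` T) F \<and>
          (\<forall>t A B. typing t A B \<longrightarrow>
             (\<exists>\<alpha>. F (prod_encode (code_jdg (JTm t A) \<nu>, code_jdg (JTm t B) \<nu>)) = Some (code_set \<alpha> \<nu>)
                \<and> \<alpha> |\<subseteq>| asm t \<and> derivable \<Sigma> T (JEqTy A B \<alpha>)))) \<and>
        (\<exists>G. partial_recursive_in ((\<lambda>r. code_rule r \<nu>) ` T) G \<and>
          (\<forall>s t A B \<beta>1 \<beta>2. equations s t A B \<beta>1 \<beta>2 \<longrightarrow>
             (\<exists>\<alpha>. G (prod_encode (code_jdg (JEqTm s t A \<beta>1) \<nu>, code_jdg (JEqTm s t B \<beta>2) \<nu>))
                    = Some (code_set \<alpha> \<nu>)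
                \<and> \<alpha> |\<subseteq>| asm t \<and> derivable \<Sigma> T (JEqTy A B \<alpha>)))))"
proof -
  have fin: "raw_signature \<Sigma>" "\<And>i. i \<in> I \<Longrightarrow> raw_rule \<Sigma> (R i)"
    and obj: "\<And>i. i \<in> I \<Longrightarrow> object_rule (R i) \<Longrightarrow> \<exists>S. symbol_rule \<Sigma> S (R i)"
    and uni: "\<And>S. S \<in> dom \<Sigma> \<Longrightarrow> \<exists>!i. i \<in> I \<and> symbol_rule \<Sigma> S (R i)"
    using assms(1) unfolding standard_theory_def finitary_theory_def raw_theory_def by blast+
  have total: "\<exists>r \<in> T. symbol_rule \<Sigma> S r" if "S \<in> dom \<Sigma>" for S
    using uni[OF that] unfolding T_def by blast
  have dom: "S \<in> dom \<Sigma>" if "symbol_rule \<Sigma> S r" for S r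
    using that unfolding symbol_rule_def by auto
  interpret standard_rules \<Sigma> T
  proof
    \<comment> \<open>Two rules for the same symbol come from the same index, since the index of the
      rule of a symbol is unique.\<close>
    show "r = r'" if "r \<in> T" "r' \<in> T" "symbol_rule \<Sigma> S r" "symbol_rule \<Sigma> S r'" for r r' S
      using uni[OF dom[OF that(3)]] that unfolding T_def by blast
  qed (use fin obj in \<open>auto simp: T_def\<close>)
  have 1: "\<exists>\<alpha>. \<alpha> |\<subseteq>| asm t \<and> derivable \<Sigma> T (JEqTy A B \<alpha>)" if "typing t A B" for t A B
    using unique_typing that unfolding typing_def by blast
  have 2: "\<exists>\<alpha>. \<alpha> |\<subseteq>| asm t \<and> derivable \<Sigma> T (JEqTy A B \<alpha>)" if "equations s t A B \<beta>1 \<beta>2"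
    for s t A B \<beta>1 \<beta>2
    using unique_equation_type that unfolding equations_def by blast
  have 3: "(\<exists>F. partial_recursive_in ((\<lambda>r. code_rule r \<nu>) ` T) F \<and>
          (\<forall>t A B. typing t A B \<longrightarrow>
             (\<exists>\<alpha>. F (prod_encode (code_jdg (JTm t A) \<nu>, code_jdg (JTm t B) \<nu>)) = Some (code_set \<alpha> \<nu>)
                \<and> \<alpha> |\<subseteq>| asm t \<and> derivable \<Sigma> T (JEqTy A B \<alpha>)))) \<and>
        (\<exists>G. partial_recursive_in ((\<lambda>r. code_rule r \<nu>) ` T) G \<and>
          (\<forall>s t A B \<beta>1 \<beta>2. equations s t A B \<beta>1 \<beta>2 \<longrightarrow>
             (\<exists>\<alpha>. G (prod_encode (code_jdg (JEqTm s t A \<beta>1) \<nu>, code_jdg (JEqTm s t B \<beta>2) \<nu>))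
                    = Some (code_set \<alpha> \<nu>)
                \<and> \<alpha> |\<subseteq>| asm t \<and> derivable \<Sigma> T (JEqTy A B \<alpha>))))"
    if \<nu>: "inj \<nu>" for \<nu> :: "'s \<Rightarrow> nat"
  proof -
    obtain \<mu> where \<mu>: "theory_coding ((\<lambda>r. code_rule r \<nu>) ` T) \<mu> \<Sigma> T" "\<forall>S \<in> dom \<Sigma>. \<mu> S = \<nu> S"
      using theory_coding_exists[OF total \<nu>] by blast
    interpret theory_coding "(\<lambda>r. code_rule r \<nu>) ` T" \<mu> \<Sigma> T by (rule \<mu>(1))
    \<comment> \<open>The functions found below act on codes under \<mu>, whereas the claim is about
      \<nu>. On derivable judgements, and on the assumption sets in them, the two agree.\<close>
    have jdg: "enc_jdg J = code_jdg J \<nu>" if "derivable \<Sigma> T J" for J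
      unfolding enc_jdg_def using code_jdg_cong[OF \<mu>(2) derivable_wf(1)[OF that]] .
    have set: "enc_fset enc_assm \<alpha> = code_set \<alpha> \<nu>" if "derivable \<Sigma> T (JEqTy A B \<alpha>)" for A B \<alpha>
      using code_set_cong[OF \<mu>(2), of \<alpha> 0] derivable_wf(1)[OF that]
      by (simp add: enc_fset_def code_set_def enc_assm_def)
    have enc: "(enc_jdg \<otimes> enc_jdg) (J, J') = prod_encode (code_jdg J \<nu>, code_jdg J' \<nu>)"
      if "derivable \<Sigma> T J" "derivable \<Sigma> T J'" for J J'
      using jdg[OF that(1)] jdg[OF that(2)] by (simp add: enc_pair_def)
    \<comment> \<open>The input pair determines the term and both types, so the equation found by
      the search is the one wanted.\<close>
    define P where "P Js w \<longleftrightarrow> Js = (JTm (fst w) (fst (snd w)), JTm (fst w) (snd (snd w)))"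
      for Js and w :: "'s expr \<times> 's expr \<times> 's expr"
    have "re ((enc_jdg \<otimes> enc_jdg) \<otimes> enc_expr \<otimes> enc_expr \<otimes> enc_expr) (\<lambda>p. P (fst p) (snd p))"
      unfolding P_def by (rule re_intros)+
    from select_equation[OF this] obtain F where F: "partial_recursive_in ((\<lambda>r. code_rule r \<nu>) ` T) F"
      "\<And>Js. \<exists>\<alpha> t A B. P Js (t, A, B) \<and> \<alpha> |\<subseteq>| asm t \<and> derivable \<Sigma> T (JEqTy A B \<alpha>) \<Longrightarrow>
       \<exists>\<alpha> t A B. F ((enc_jdg \<otimes> enc_jdg) Js) = Some (enc_fset enc_assm \<alpha>) \<and> P Js (t, A, B) \<and>
         \<alpha> |\<subseteq>| asm t \<and> derivable \<Sigma> T (JEqTy A B \<alpha>)" by blast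
    \<comment> \<open>The left-hand term and the two assumption sets are projected away, because the
      bound is in terms of the right-hand term alone.\<close>
    define P' where "P' Js w \<longleftrightarrow> (\<exists>s \<beta>1 \<beta>2. Js = (JEqTm s (fst w) (fst (snd w)) \<beta>1, JEqTm s (fst w) (snd (snd w)) \<beta>2))"
      for Js and w :: "'s expr \<times> 's expr \<times> 's expr"
    have "re ((enc_jdg \<otimes> enc_jdg) \<otimes> enc_expr \<otimes> enc_expr \<otimes> enc_expr) (\<lambda>p. P' (fst p) (snd p))"
      unfolding P'_def by (rule re_intros)+
    from select_equation[OF this] obtain G where G: "partial_recursive_in ((\<lambda>r. code_rule r \<nu>) ` T) G"
      "\<And>Js. \<exists>\<alpha> t A B. P' Js (t, A, B) \<and> \<alpha> |\<subseteq>| asm t \<and> derivable \<Sigma> T (JEqTy A B \<alpha>) \<Longrightarrow>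
       \<exists>\<alpha> t A B. G ((enc_jdg \<otimes> enc_jdg) Js) = Some (enc_fset enc_assm \<alpha>) \<and> P' Js (t, A, B) \<and>
         \<alpha> |\<subseteq>| asm t \<and> derivable \<Sigma> T (JEqTy A B \<alpha>)" by blast
    have "\<exists>\<alpha>. F (prod_encode (code_jdg (JTm t A) \<nu>, code_jdg (JTm t B) \<nu>)) = Some (code_set \<alpha> \<nu>)
        \<and> \<alpha> |\<subseteq>| asm t \<and> derivable \<Sigma> T (JEqTy A B \<alpha>)" if ty: "typing t A B" for t A B
    proof -
      have "\<exists>\<alpha> t' A' B'. P (JTm t A, JTm t B) (t', A', B') \<and> \<alpha> |\<subseteq>| asm t' \<and> derivable \<Sigma> T (JEqTy A' B' \<alpha>)"
        using 1[OF ty] by (auto simp: P_def)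
      from F(2)[OF this] obtain \<alpha> t' A' B' where
        \<alpha>: "F ((enc_jdg \<otimes> enc_jdg) (JTm t A, JTm t B)) = Some (enc_fset enc_assm \<alpha>)"
        "P (JTm t A, JTm t B) (t', A', B')" "\<alpha> |\<subseteq>| asm t'" "derivable \<Sigma> T (JEqTy A' B' \<alpha>)" by blast
      from \<alpha>(2) have "t' = t" "A' = A" "B' = B" by (simp_all add: P_def)
      moreover have d: "derivable \<Sigma> T (JTm t A)" "derivable \<Sigma> T (JTm t B)"
        using ty by (simp_all add: typing_def)
      ultimately show ?thesis using \<alpha>(1,3,4) unfolding enc[OF d] set[OF \<alpha>(4)] by blast
    qed
    moreover have "\<exists>\<alpha>. G (prod_encode (code_jdg (JEqTm s t A \<beta>1) \<nu>, code_jdg (JEqTm s t B \<beta>2) \<nu>))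
          = Some (code_set \<alpha> \<nu>) \<and> \<alpha> |\<subseteq>| asm t \<and> derivable \<Sigma> T (JEqTy A B \<alpha>)"
      if eq: "equations s t A B \<beta>1 \<beta>2" for s t A B \<beta>1 \<beta>2
    proof -
      have "\<exists>\<alpha> t' A' B'. P' (JEqTm s t A \<beta>1, JEqTm s t B \<beta>2) (t', A', B') \<and> \<alpha> |\<subseteq>| asm t' \<and>
          derivable \<Sigma> T (JEqTy A' B' \<alpha>)"
        using 2[OF eq] by (auto simp: P'_def)
      from G(2)[OF this] obtain \<alpha> t' A' B' where
        \<alpha>: "G ((enc_jdg \<otimes> enc_jdg) (JEqTm s t A \<beta>1, JEqTm s t B \<beta>2)) = Some (enc_fset enc_assm \<alpha>)"
        "P' (JEqTm s t A \<beta>1, JEqTm s t B \<beta>2) (t', A', B')" "\<alpha> |\<subseteq>| asm t'"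
        "derivable \<Sigma> T (JEqTy A' B' \<alpha>)" by blast
      from \<alpha>(2) have "t' = t" "A' = A" "B' = B" by (auto simp: P'_def)
      moreover have d: "derivable \<Sigma> T (JEqTm s t A \<beta>1)" "derivable \<Sigma> T (JEqTm s t B \<beta>2)"
        using eq by (simp_all add: equations_def)
      ultimately show ?thesis using \<alpha>(1,3,4) unfolding enc[OF d] set[OF \<alpha>(4)] by blast
    qed
    ultimately show ?thesis
      by (intro conjI exI[of _ F] exI[of _ G] F(1) G(1) allI impI)
  qed
  show ?thesis by (intro conjI allI impI) (fact 1, fact 2, (use 3 in blast)+)
qed

end
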